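(* Let $(S,\Omega)$ be a relative Sierpiński carpet such that $\Omega$ is bounded and $\partial\Omega$ consists of finitely many, non-trivial, and disjoint Jordan curves. Let $u,v:S\to\mathbb R$ be the solutions to the Dirichlet problem in $\Omega$ with boundary data $\alpha,\beta$, respectively. Assume that $\alpha(x)\ge\beta(x)$ for all points $x\in\partial\Omega$ that are accessible by paths $\gamma\in\mathcal G_0$, where $\mathcal G_0$ is a path family in $\Omega$ that contains almost every path. Then $u\ge v$ in $S$.
   Context: Relative Sierpiński carpets. Let $\Omega\subset\mathbb C$ be a connected open set and $\{Q_i\}_{i\in\mathbb N}$ open Jordan regions compactly contained in $\Omega$, with pairwise disjoint closures, such that $S:=\Omega\setminus\bigcup_iQ_i$ has empty interior and is locally connected. Then $(S,\Omega)$ is a relative Sierpiński carpet with peripheral disks $Q_i$. Standing assumptions on every relative Sierpiński carpet: (i) $\mathcal H^2(S)=0$; (ii) there is $K_0\ge1$ such that for each $i$ there are concentric balls $B(x,r)\subset Q_i\subset B(x,R)$ with $R/r\le K_0$; (iii) there is $K_1>0$ such that $\mathcal H^2(B(x,r)\cap Q_i)\ge K_1r^2$ for all $i$, $x\in Q_i$, $0<r<\operatorname{diam}(Q_i)$. $\mathcal H^m$ is Hausdorff measure normalized to agree with Lebesgue measure. Notation. $\widehat{\mathbb R}=\mathbb R\cup\{\pm\infty\}$. $V\subset\subset\Omega$: $\overline V$ is compact and contained in $\Omega$. $I_V=\{i:Q_i\cap V\ne\emptyset\}$. $S^\circ$: points of $S$ on no $\partial Q_i$. A path is a continuous map from a bounded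 interval to $\mathbb C$ with a continuous extension to the closed interval (also its image); it is open if the interval is open; subpaths are restrictions to subintervals. For $g:S\to\widehat{\mathbb R}$: $M_{Q_i}(g)=\sup_{\partial Q_i}g$, $m_{Q_i}(g)=\inf_{\partial Q_i}g$, $\operatorname{osc}_{Q_i}(g)=M_{Q_i}(g)-m_{Q_i}(g)$. Moduli of a path family $\Gamma$ in $\Omega$. $\mathrm{mod}_2(\Gamma)=\inf\int\lambda^2d\mathcal H^2$ over Borel $\lambda\ge0$ with $\int_\gamma\lambda\,ds\ge1$ for all $\gamma\in\Gamma$ (with $\int_\gamma\lambda\,ds:=\infty$ if $\gamma$ is not locally rectifiable). Weak modulus $\mathrm{mod}_w(\Gamma)=\inf\sum_i\rho(Q_i)^2$ over non-negative sequences for which there is $\Gamma_0\subset\Gamma$ with $\mathrm{mod}_2(\Gamma_0)=0$ and $\sum_{i:Q_i\cap\gamma\ne\emptyset}\rho(Q_i)\ge1$ for $\gamma\in\Gamma\setminus\Gamma_0$. Strong modulus $\mathrm{mod}_s(\Gamma)$: the same infimum over sequences satisfying this inequality for all $\gamma\in\Gamma$ with $\mathcal H^1(\gamma\cap S)=0$. Sobolev spaces. $\{\rho(Q_i)\}$ is a weak (strong) upper gradient of $g:S\to\widehat{\mathbb R}$ if there is $\Gamma_0$ with $\mathrm{mod}_w(\Gamma_0)=0$ ($\mathrm{mod}_s(\Gamma_0)=0$) such that for all paths $\gamma\subset\Omega$, $\gamma\notin\Gamma_0$, and $x,y\in\gamma\cap S$: $g(x),g(y)\neq\pm\infty$ and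 $|g(x)-g(y)|\le\sum_{i:Q_i\cap\gamma\ne\emptyset}\rho(Q_i)$. $g\in\mathcal W^{1,2}_{\mathrm{loc}}(S)$ if $M_{Q_i}(g),m_{Q_i}(g)$ are finite for all $i$, $\sum_{i\in I_B}M_{Q_i}(g)^2\operatorname{diam}(Q_i)^2<\infty$ and $\sum_{i\in I_B}\operatorname{osc}_{Q_i}(g)^2<\infty$ for every ball $B\subset\subset\Omega$, and $\{\operatorname{osc}_{Q_i}(g)\}$ is an upper gradient of $g$; $g\in\mathcal W^{1,2}(S)$ if moreover the sums over all $i\in\mathbb N$ are finite. There is a weak and a strong version; the statement holds for each, with one version fixed throughout. "Almost every path": the complement of the family (in the set of all paths in $\Omega$) has weak (strong) modulus zero. Dirichlet energy: $D_V(g)=\sum_{i\in I_V}\operatorname{osc}_{Q_i}(g)^2$. Normalized functions. For $g\in\mathcal W^{1,2}_{\mathrm{loc}}(S)$ let $\hat g(Q_i)=M_{Q_i}(g)$. Let $\mathcal G_{\hat g}$ be the family of non-constant paths $\gamma\subset\Omega$ with: $\mathcal H^1(\gamma\cap S)=0$; for every subpath $\gamma'$ of $\gamma$ and $Q_{i_1},Q_{i_2}$ meeting $\gamma'$, $|\hat g(Q_{i_1})-\hat g(Q_{i_2})|\le\sum_{i:Q_i\cap\gamma'\neq\emptyset}\operatorname{osc}_{Q_i}(g)$; $\sum_{i:Q_i\cap\gamma'\ne\emptyset}\operatorname{osc}_{Q_i}(g)<\infty$ for subpaths $\gamma'\subset\subset\Omega$; and, if $\sum_{i\in\mathbb N}\operatorname{osc}_{Q_i}(g)^2<\infty$,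 also $\sum_{i:Q_i\cap\gamma\ne\emptyset}\operatorname{osc}_{Q_i}(g)<\infty$. A point $x\in S$ is accessible by $\gamma_0$ if $x\in\gamma_0\cap S^\circ$ (put $\gamma=\gamma_0$), or there is an open subpath $\gamma$ of $\gamma_0$ with $x\in\overline\gamma\setminus\gamma$ and $\gamma\cap Q_{i_0}=\emptyset$ whenever $x\in\partial Q_{i_0}$. The normalized version $\tilde g$ of $g$ is: $\tilde g(x)=\liminf_{Q_i\to x,\,Q_i\cap\gamma\ne\emptyset}\hat g(Q_i)$ if $x$ is accessible by a path $\gamma_0\in\mathcal G_{\hat g}$, where $\gamma=\gamma_0$ if $x\in\gamma_0\cap S^\circ$, and otherwise $\gamma$ is an open subpath of $\gamma_0$ with $x\in\overline\gamma\setminus\gamma$ and $\gamma\cap Q_{i_0}=\emptyset$ whenever $x\in\partial Q_{i_0}$ (the value is independent of $\gamma$); for non-accessible $x\in\partial Q_{i_0}$, $\tilde g(x)=\liminf\tilde g(y)$ as $y\to x$ through accessible $y\in\partial Q_{i_0}$; for all other $x$, $\tilde g(x)=\liminf\tilde g(y)$ as $y\to x$ through accessible $y$. A function is normalized if it equals the normalized version of some function in the Sobolev space. Boundary values. Let $\mathcal G_f$ be the family of non-constant paths $\gamma\subset\Omega$ satisfying the conditions defining $\mathcal G_{\hat f}$, but with the second condition replaced by $|f(x)-f(y)|\le\sum_{i:Q_i\cap\gamma'\ne\emptyset}\operatorname{osc}_{Q_i}(f)$ for all subpaths $\gamma'$ of $\gamma$ and $x,y\in\gamma'\cap S$. For $f\in\mathcal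 W^{1,2}(S)$ and $x\in\partial\Omega$ accessible by an open path $\gamma\in\mathcal G_f$ (i.e. $x\in\overline\gamma$), set $f(x)=\liminf_{Q_i\to x,\,Q_i\cap\gamma\ne\emptyset}M_{Q_i}(f)$ (independent of $\gamma$); for other $x\in\partial\Omega$ set $f(x)=\liminf f(y)$ as $y\to x$ through accessible $y\in\partial\Omega$. A function $g\in\mathcal W^{1,2}(S)$ has boundary values equal to $f$ if there is a path family $\mathcal G_0$ containing almost every path in $\Omega$ such that $g(x)=f(x)$ for all $x\in\partial\Omega$ accessible by paths of $\mathcal G_0$. Dirichlet problem. Boundary data are the boundary values on $\partial\Omega$ of a function $f\in\mathcal W^{1,2}(S)$ whose boundary values are bounded. The solution to the Dirichlet problem with these boundary data is the unique normalized function minimizing $D_\Omega(g)$ over all $g\in\mathcal W^{1,2}(S)$ with boundary values equal to $f$ (existence and uniqueness hold). *)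

theory Defs
  imports "HOL-Analysis.Analysis"
begin

section \<open>Relative Sierpinski carpets\<close>

definition jordan_curve :: "complex set \<Rightarrow> bool" where
  "jordan_curve C \<longleftrightarrow> (\<exists>c. simple_path c \<and> pathfinish c = pathstart c \<and> path_image c = C)"

definition jordan_region :: "complex set \<Rightarrow> bool" where
  "jordan_region V \<longleftrightarrow> (\<exists>C. jordan_curve C \<and> V = inside C)"

definition compactly_in :: "complex set \<Rightarrow> complex set \<Rightarrow> bool" where
  "compactly_in V W \<longleftrightarrow> compact (closure V) \<and> closure V \<subseteq> W"

definition carpet :: "complex set \<Rightarrow> (nat \<Rightarrow> complex set) \<Rightarrow> complex set" where
  "carpet \<Omega> Q = \<Omega> - (\<Union>i. Q i)"

definition carpet_interior :: "complex set \<Rightarrow> (nat \<Rightarrow> complex set) \<Rightarrow> complex set" where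
  "carpet_interior \<Omega> Q = carpet \<Omega> Q - (\<Union>i. frontier (Q i))"

text \<open>
  Two-dimensional Hausdorff measure on the plane, normalized to agree with Lebesgue measure, is
  \<open>lborel\<close>; every set measured here is Borel. The last three conjuncts are the standing
  assumptions: zero area, uniform quasi-roundness and uniform fatness of the peripheral disks.
\<close>

definition relative_carpet :: "complex set \<Rightarrow> (nat \<Rightarrow> complex set) \<Rightarrow> bool" where
  "relative_carpet \<Omega> Q \<longleftrightarrow>
     open \<Omega> \<and> connected \<Omega> \<and>
     (\<forall>i. jordan_region (Q i) \<and> compactly_in (Q i) \<Omega>) \<and>
     (\<forall>i j. i \<noteq> j \<longrightarrow> closure (Q i) \<inter> closure (Q j) = {}) \<and>
     interior (carpet \<Omega> Q) = {} \<and>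
     locally connected (carpet \<Omega> Q) \<and>
     emeasure lborel (carpet \<Omega> Q) = 0 \<and>
     (\<exists>K0\<ge>1. \<forall>i. \<exists>x r R. 0 < r \<and> R / r \<le> K0 \<and> ball x r \<subseteq> Q i \<and> Q i \<subseteq> ball x R) \<and>
     (\<exists>K1>0. \<forall>i. \<forall>x\<in>Q i. \<forall>r. 0 < r \<and> r < diameter (Q i) \<longrightarrow>
        emeasure lborel (ball x r \<inter> Q i) \<ge> ennreal (K1 * r\<^sup>2))"


section \<open>Paths and line integrals\<close>

text \<open>
  A path is a bounded interval together with a map. The map is required to be continuous on the
  closure of the interval, so its values at the endpoints are those of the continuous extension;
  they do not belong to the image unless the endpoints belong to the interval. Values off the
  closure of the interval are irrelevant to every notion below.
\<close>

type_synonym cpath = "real set \<times> (real \<Rightarrow> complex)"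

definition is_cpath :: "cpath \<Rightarrow> bool" where
  "is_cpath \<gamma> \<longleftrightarrow> fst \<gamma> \<noteq> {} \<and> is_interval (fst \<gamma>) \<and> bounded (fst \<gamma>) \<and>
     continuous_on (closure (fst \<gamma>)) (snd \<gamma>)"

definition im :: "cpath \<Rightarrow> complex set" where
  "im \<gamma> = snd \<gamma> ` fst \<gamma>"

definition open_cpath :: "cpath \<Rightarrow> bool" where
  "open_cpath \<gamma> \<longleftrightarrow> open (fst \<gamma>)"

definition subcpath :: "cpath \<Rightarrow> cpath \<Rightarrow> bool" where
  "subcpath \<gamma>' \<gamma> \<longleftrightarrow>
     fst \<gamma>' \<noteq> {} \<and> is_interval (fst \<gamma>') \<and> fst \<gamma>' \<subseteq> fst \<gamma> \<and> snd \<gamma>' = snd \<gamma>"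

definition paths_in :: "complex set \<Rightarrow> cpath set" where
  "paths_in \<Omega> = {\<gamma>. is_cpath \<gamma> \<and> im \<gamma> \<subseteq> \<Omega>}"

definition nonconst_paths_in :: "complex set \<Rightarrow> cpath set" where
  "nonconst_paths_in \<Omega> = {\<gamma> \<in> paths_in \<Omega>. \<not> snd \<gamma> constant_on fst \<gamma>}"

definition arc_length :: "(real \<Rightarrow> complex) \<Rightarrow> real \<Rightarrow> real \<Rightarrow> ennreal" where
  "arc_length g a b =
     (SUP (n, t) \<in> {(n::nat, t::nat \<Rightarrow> real). mono_on {..n} t \<and> t ` {..n} \<subseteq> {a..b}}.
        \<Sum>k<n. ennreal (dist (g (t k)) (g (t (Suc k)))))"

definition locally_rectifiable :: "cpath \<Rightarrow> bool" where
  "locally_rectifiable \<gamma> \<longleftrightarrow>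
     (\<forall>a\<in>fst \<gamma>. \<forall>b\<in>fst \<gamma>. a \<le> b \<longrightarrow> arc_length (snd \<gamma>) a b < \<infinity>)"

text \<open>
  The point at distance \<open>l\<close> from the start along \<open>g\<close> restricted to \<open>{a..b}\<close>, i.e. the arc length
  parametrization. It does not depend on the choice of \<open>t\<close>, since \<open>g\<close> is constant on intervals
  where the arc length is.
\<close>

definition arc_length_param :: "(real \<Rightarrow> complex) \<Rightarrow> real \<Rightarrow> real \<Rightarrow> real \<Rightarrow> complex" where
  "arc_length_param g a b l = g (SOME t. t \<in> {a..b} \<and> arc_length g a t = ennreal l)"

definition line_integral :: "cpath \<Rightarrow> (complex \<Rightarrow> ennreal) \<Rightarrow> ennreal" where
  "line_integral \<gamma> \<phi> =
     (if locally_rectifiable \<gamma> then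
        (SUP (a, b) \<in> {(a, b). a \<in> fst \<gamma> \<and> b \<in> fst \<gamma> \<and> a \<le> b}.
           \<integral>\<^sup>+ l \<in> {0..enn2real (arc_length (snd \<gamma>) a b)}.
              \<phi> (arc_length_param (snd \<gamma>) a b l) \<partial>lborel)
      else \<infinity>)"

definition hausdorff1 :: "complex set \<Rightarrow> ennreal" where
  "hausdorff1 A =
     (SUP \<delta> \<in> {0<..}.
        INF C \<in> {C :: nat \<Rightarrow> complex set.
                  A \<subseteq> (\<Union>i. C i) \<and> (\<forall>i. bounded (C i) \<and> diameter (C i) \<le> \<delta>)}.
          \<Sum>i. ennreal (diameter (C i)))"


section \<open>Moduli\<close>

definition mod2 :: "cpath set \<Rightarrow> ennreal" where
  "mod2 \<Gamma> =
     (INF \<phi> \<in> {\<phi> \<in> borel_measurable borel. \<forall>\<gamma>\<in>\<Gamma>. 1 \<le> line_integral \<gamma> \<phi>}.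
        \<integral>\<^sup>+ z. (\<phi> z)\<^sup>2 \<partial>lborel)"

definition meet_sum :: "(nat \<Rightarrow> complex set) \<Rightarrow> (nat \<Rightarrow> ennreal) \<Rightarrow> complex set \<Rightarrow> ennreal" where
  "meet_sum Q \<rho> A = (\<Sum>i. if Q i \<inter> A \<noteq> {} then \<rho> i else 0)"

definition mod_weak :: "(nat \<Rightarrow> complex set) \<Rightarrow> cpath set \<Rightarrow> ennreal" where
  "mod_weak Q \<Gamma> =
     (INF \<rho> \<in> {\<rho>. \<exists>\<Gamma>0\<subseteq>\<Gamma>. mod2 \<Gamma>0 = 0 \<and> (\<forall>\<gamma>\<in>\<Gamma> - \<Gamma>0. 1 \<le> meet_sum Q \<rho> (im \<gamma>))}.
        \<Sum>i. (\<rho> i)\<^sup>2)"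

definition mod_strong :: "complex set \<Rightarrow> (nat \<Rightarrow> complex set) \<Rightarrow> cpath set \<Rightarrow> ennreal" where
  "mod_strong \<Omega> Q \<Gamma> =
     (INF \<rho> \<in> {\<rho>. \<forall>\<gamma>\<in>\<Gamma>. hausdorff1 (im \<gamma> \<inter> carpet \<Omega> Q) = 0 \<longrightarrow> 1 \<le> meet_sum Q \<rho> (im \<gamma>)}.
        \<Sum>i. (\<rho> i)\<^sup>2)"

datatype carpet_version = Weak | Strong

fun carpet_mod ::
  "carpet_version \<Rightarrow> complex set \<Rightarrow> (nat \<Rightarrow> complex set) \<Rightarrow> cpath set \<Rightarrow> ennreal" where
  "carpet_mod Weak \<Omega> Q \<Gamma> = mod_weak Q \<Gamma>"
| "carpet_mod Strong \<Omega> Q \<Gamma> = mod_strong \<Omega> Q \<Gamma>"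

text \<open>
  Constant paths are disregarded in ``almost every path'' and in the definition of upper gradients:
  no family containing a constant path has carpet modulus zero, so otherwise no family of
  non-constant paths (such as those used for normalization and boundary values) could contain
  almost every path.
\<close>

definition almost_every_path ::
  "carpet_version \<Rightarrow> complex set \<Rightarrow> (nat \<Rightarrow> complex set) \<Rightarrow> cpath set \<Rightarrow> bool" where
  "almost_every_path ver \<Omega> Q G \<longleftrightarrow> carpet_mod ver \<Omega> Q (nonconst_paths_in \<Omega> - G) = 0"


section \<open>Sobolev spaces and Dirichlet energy\<close>

text \<open>
  Functions on the carpet are represented by functions on the plane; only their values on the
  carpet are ever used.
\<close>

definition Msup :: "(nat \<Rightarrow> complex set) \<Rightarrow> (complex \<Rightarrow> ereal) \<Rightarrow> nat \<Rightarrow> ereal" where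
  "Msup Q g i = (SUP x\<in>frontier (Q i). g x)"

definition minf :: "(nat \<Rightarrow> complex set) \<Rightarrow> (complex \<Rightarrow> ereal) \<Rightarrow> nat \<Rightarrow> ereal" where
  "minf Q g i = (INF x\<in>frontier (Q i). g x)"

definition osc :: "(nat \<Rightarrow> complex set) \<Rightarrow> (complex \<Rightarrow> ereal) \<Rightarrow> nat \<Rightarrow> ennreal" where
  "osc Q g i = e2ennreal (Msup Q g i - minf Q g i)"

definition upper_gradient ::
  "carpet_version \<Rightarrow> complex set \<Rightarrow> (nat \<Rightarrow> complex set) \<Rightarrow> (nat \<Rightarrow> ennreal)
     \<Rightarrow> (complex \<Rightarrow> ereal) \<Rightarrow> bool" where
  "upper_gradient ver \<Omega> Q \<rho> g \<longleftrightarrow>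
     (\<exists>\<Gamma>0\<subseteq>paths_in \<Omega>. carpet_mod ver \<Omega> Q \<Gamma>0 = 0 \<and>
        (\<forall>\<gamma>\<in>nonconst_paths_in \<Omega> - \<Gamma>0. \<forall>x\<in>im \<gamma> \<inter> carpet \<Omega> Q. \<forall>y\<in>im \<gamma> \<inter> carpet \<Omega> Q.
           \<bar>g x\<bar> \<noteq> \<infinity> \<and> \<bar>g y\<bar> \<noteq> \<infinity> \<and>
           \<bar>g x - g y\<bar> \<le> enn2ereal (meet_sum Q \<rho> (im \<gamma>))))"

definition sobolev_loc ::
  "carpet_version \<Rightarrow> complex set \<Rightarrow> (nat \<Rightarrow> complex set) \<Rightarrow> (complex \<Rightarrow> ereal) \<Rightarrow> bool" where
  "sobolev_loc ver \<Omega> Q g \<longleftrightarrow>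
     (\<forall>i. \<bar>Msup Q g i\<bar> \<noteq> \<infinity> \<and> \<bar>minf Q g i\<bar> \<noteq> \<infinity>) \<and>
     (\<forall>z r. 0 < r \<and> compactly_in (ball z r) \<Omega> \<longrightarrow>
        meet_sum Q (\<lambda>i. (e2ennreal \<bar>Msup Q g i\<bar>)\<^sup>2 * ennreal ((diameter (Q i))\<^sup>2)) (ball z r) < \<infinity> \<and>
        meet_sum Q (\<lambda>i. (osc Q g i)\<^sup>2) (ball z r) < \<infinity>) \<and>
     upper_gradient ver \<Omega> Q (osc Q g) g"

definition sobolev ::
  "carpet_version \<Rightarrow> complex set \<Rightarrow> (nat \<Rightarrow> complex set) \<Rightarrow> (complex \<Rightarrow> ereal) \<Rightarrow> bool" where
  "sobolev ver \<Omega> Q g \<longleftrightarrow>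
     sobolev_loc ver \<Omega> Q g \<and>
     (\<Sum>i. (e2ennreal \<bar>Msup Q g i\<bar>)\<^sup>2 * ennreal ((diameter (Q i))\<^sup>2)) < \<infinity> \<and>
     (\<Sum>i. (osc Q g i)\<^sup>2) < \<infinity>"

definition dirichlet_energy ::
  "(nat \<Rightarrow> complex set) \<Rightarrow> complex set \<Rightarrow> (complex \<Rightarrow> ereal) \<Rightarrow> ennreal" where
  "dirichlet_energy Q V g = meet_sum Q (\<lambda>i. (osc Q g i)\<^sup>2) V"


section \<open>Normalized functions\<close>

text \<open>The conditions shared by the two families of good paths of \<open>g\<close>.\<close>

definition tame_path ::
  "complex set \<Rightarrow> (nat \<Rightarrow> complex set) \<Rightarrow> (complex \<Rightarrow> ereal) \<Rightarrow> cpath \<Rightarrow> bool" where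
  "tame_path \<Omega> Q g \<gamma> \<longleftrightarrow>
     \<gamma> \<in> nonconst_paths_in \<Omega> \<and>
     hausdorff1 (im \<gamma> \<inter> carpet \<Omega> Q) = 0 \<and>
     (\<forall>\<gamma>'. subcpath \<gamma>' \<gamma> \<and> compactly_in (im \<gamma>') \<Omega> \<longrightarrow> meet_sum Q (osc Q g) (im \<gamma>') < \<infinity>) \<and>
     ((\<Sum>i. (osc Q g i)\<^sup>2) < \<infinity> \<longrightarrow> meet_sum Q (osc Q g) (im \<gamma>) < \<infinity>)"

definition good_paths_hat ::
  "complex set \<Rightarrow> (nat \<Rightarrow> complex set) \<Rightarrow> (complex \<Rightarrow> ereal) \<Rightarrow> cpath set" where
  "good_paths_hat \<Omega> Q g =
     {\<gamma>. tame_path \<Omega> Q g \<gamma> \<and>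
        (\<forall>\<gamma>' i1 i2. subcpath \<gamma>' \<gamma> \<and> Q i1 \<inter> im \<gamma>' \<noteq> {} \<and> Q i2 \<inter> im \<gamma>' \<noteq> {} \<longrightarrow>
           \<bar>Msup Q g i1 - Msup Q g i2\<bar> \<le> enn2ereal (meet_sum Q (osc Q g) (im \<gamma>')))}"

definition good_paths ::
  "complex set \<Rightarrow> (nat \<Rightarrow> complex set) \<Rightarrow> (complex \<Rightarrow> ereal) \<Rightarrow> cpath set" where
  "good_paths \<Omega> Q f =
     {\<gamma>. tame_path \<Omega> Q f \<gamma> \<and>
        (\<forall>\<gamma>'. subcpath \<gamma>' \<gamma> \<longrightarrow>
           (\<forall>x\<in>im \<gamma>' \<inter> carpet \<Omega> Q. \<forall>y\<in>im \<gamma>' \<inter> carpet \<Omega> Q.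
              \<bar>f x - f y\<bar> \<le> enn2ereal (meet_sum Q (osc Q f) (im \<gamma>'))))}"

text \<open>The filter of disks meeting \<open>A\<close> and shrinking to the point \<open>x\<close>.\<close>

definition disks_to :: "(nat \<Rightarrow> complex set) \<Rightarrow> complex set \<Rightarrow> complex \<Rightarrow> nat filter" where
  "disks_to Q A x = (INF e\<in>{0<..}. principal {i. Q i \<inter> A \<noteq> {} \<and> Q i \<subseteq> ball x e})"

definition accesses ::
  "complex set \<Rightarrow> (nat \<Rightarrow> complex set) \<Rightarrow> cpath \<Rightarrow> cpath \<Rightarrow> complex \<Rightarrow> bool" where
  "accesses \<Omega> Q \<gamma>0 \<gamma> x \<longleftrightarrow>
     (if x \<in> im \<gamma>0 \<inter> carpet_interior \<Omega> Q then \<gamma> = \<gamma>0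
      else subcpath \<gamma> \<gamma>0 \<and> open_cpath \<gamma> \<and> x \<in> closure (im \<gamma>) - im \<gamma> \<and>
           (\<forall>i. x \<in> frontier (Q i) \<longrightarrow> im \<gamma> \<inter> Q i = {}))"

definition accessible_points ::
  "complex set \<Rightarrow> (nat \<Rightarrow> complex set) \<Rightarrow> cpath set \<Rightarrow> complex set" where
  "accessible_points \<Omega> Q G = {x \<in> carpet \<Omega> Q. \<exists>\<gamma>0\<in>G. \<exists>\<gamma>. accesses \<Omega> Q \<gamma>0 \<gamma> x}"

text \<open>
  In \<open>access_value\<close> and \<open>boundary_value\<close> below, \<open>THE\<close> is justified by the independence of the value
  of the accessing path, for functions in the Sobolev spaces.
\<close>

definition access_value ::
  "complex set \<Rightarrow> (nat \<Rightarrow> complex set) \<Rightarrow> (complex \<Rightarrow> ereal) \<Rightarrow> complex \<Rightarrow> ereal" where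
  "access_value \<Omega> Q g x =
     (THE l. \<exists>\<gamma>0\<in>good_paths_hat \<Omega> Q g. \<exists>\<gamma>. accesses \<Omega> Q \<gamma>0 \<gamma> x \<and>
        l = Liminf (disks_to Q (im \<gamma>) x) (Msup Q g))"

definition normalized_version ::
  "complex set \<Rightarrow> (nat \<Rightarrow> complex set) \<Rightarrow> (complex \<Rightarrow> ereal) \<Rightarrow> complex \<Rightarrow> ereal" where
  "normalized_version \<Omega> Q g x =
     (let A = accessible_points \<Omega> Q (good_paths_hat \<Omega> Q g) in
      if x \<in> A then access_value \<Omega> Q g x
      else if \<exists>i. x \<in> frontier (Q i) then
        Liminf (at x within (A \<inter> frontier (Q (THE i. x \<in> frontier (Q i))))) (access_value \<Omega> Q g)
      else Liminf (at x within A) (access_value \<Omega> Q g))"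

definition normalized ::
  "carpet_version \<Rightarrow> complex set \<Rightarrow> (nat \<Rightarrow> complex set) \<Rightarrow> (complex \<Rightarrow> ereal) \<Rightarrow> bool" where
  "normalized ver \<Omega> Q u \<longleftrightarrow>
     (\<exists>g. sobolev_loc ver \<Omega> Q g \<and> (\<forall>x\<in>carpet \<Omega> Q. u x = normalized_version \<Omega> Q g x))"


section \<open>Boundary values and the Dirichlet problem\<close>

definition boundary_accessible :: "complex set \<Rightarrow> cpath set \<Rightarrow> complex set" where
  "boundary_accessible \<Omega> G = {x \<in> frontier \<Omega>. \<exists>\<gamma>\<in>G. open_cpath \<gamma> \<and> x \<in> closure (im \<gamma>)}"

definition boundary_access_value ::
  "complex set \<Rightarrow> (nat \<Rightarrow> complex set) \<Rightarrow> (complex \<Rightarrow> ereal) \<Rightarrow> complex \<Rightarrow> ereal" where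
  "boundary_access_value \<Omega> Q f x =
     (THE l. \<exists>\<gamma>\<in>good_paths \<Omega> Q f. open_cpath \<gamma> \<and> x \<in> closure (im \<gamma>) \<and>
        l = Liminf (disks_to Q (im \<gamma>) x) (Msup Q f))"

definition boundary_value ::
  "complex set \<Rightarrow> (nat \<Rightarrow> complex set) \<Rightarrow> (complex \<Rightarrow> ereal) \<Rightarrow> complex \<Rightarrow> ereal" where
  "boundary_value \<Omega> Q f x =
     (let A = boundary_accessible \<Omega> (good_paths \<Omega> Q f) in
      if x \<in> A then boundary_access_value \<Omega> Q f x
      else Liminf (at x within A) (boundary_access_value \<Omega> Q f))"

definition has_boundary_values_of ::
  "carpet_version \<Rightarrow> complex set \<Rightarrow> (nat \<Rightarrow> complex set) \<Rightarrow> (complex \<Rightarrow> ereal)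
     \<Rightarrow> (complex \<Rightarrow> ereal) \<Rightarrow> bool" where
  "has_boundary_values_of ver \<Omega> Q g f \<longleftrightarrow>
     (\<exists>G0\<subseteq>paths_in \<Omega>. almost_every_path ver \<Omega> Q G0 \<and>
        (\<forall>x\<in>boundary_accessible \<Omega> G0. boundary_value \<Omega> Q g x = boundary_value \<Omega> Q f x))"

definition boundary_data_of ::
  "carpet_version \<Rightarrow> complex set \<Rightarrow> (nat \<Rightarrow> complex set) \<Rightarrow> (complex \<Rightarrow> ereal)
     \<Rightarrow> (complex \<Rightarrow> real) \<Rightarrow> bool" where
  "boundary_data_of ver \<Omega> Q f \<alpha> \<longleftrightarrow>
     sobolev ver \<Omega> Q f \<and> (\<forall>x\<in>frontier \<Omega>. boundary_value \<Omega> Q f x = ereal (\<alpha> x)) \<and>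
     bounded (\<alpha> ` frontier \<Omega>)"

text \<open>\<open>u\<close> solves the Dirichlet problem in \<open>\<Omega>\<close> with boundary data \<open>\<alpha>\<close>.\<close>

definition dirichlet_solution ::
  "carpet_version \<Rightarrow> complex set \<Rightarrow> (nat \<Rightarrow> complex set) \<Rightarrow> (complex \<Rightarrow> real)
     \<Rightarrow> (complex \<Rightarrow> ereal) \<Rightarrow> bool" where
  "dirichlet_solution ver \<Omega> Q \<alpha> u \<longleftrightarrow>
     (\<exists>f. boundary_data_of ver \<Omega> Q f \<alpha> \<and>
        normalized ver \<Omega> Q u \<and> sobolev ver \<Omega> Q u \<and> has_boundary_values_of ver \<Omega> Q u f \<and>
        (\<forall>g. sobolev ver \<Omega> Q g \<and> has_boundary_values_of ver \<Omega> Q g f \<longrightarrow>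
           dirichlet_energy Q \<Omega> u \<le> dirichlet_energy Q \<Omega> g))"

end

theory Submission
 imports Defs
begin

text \<open>
 The comparison is made between the suprema and infima of \<open>u\<close> and \<open>v\<close> over the peripheral circles.
 Submodularity of the energy gives that \<open>w = max u v\<close> has the same energy as \<open>u\<close>, and strict convexity
 that \<open>u\<close> and \<open>w\<close> have the same oscillation on every disk, so there both extrema are shifted by
 the same amount. Lifting \<open>u\<close> towards \<open>w\<close> below a level lowers the energy unless shift times oscillation
 vanishes; a nonzero shift therefore forces \<open>u\<close> to be locally constant, which propagates along generic
 axis-parallel lines to the boundary, where \<open>u\<close> and \<open>w\<close> agree. Hence there is no shift.
 Truncating a minimizer inside a small crosscut gives another minimizer, so the disk values of a minimizer
 converge at every point of the carpet, and the limit is the value of the normalized function.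
\<close>

section \<open>Sums over the disks met by a set\<close>

text \<open>The energy sees only oscillations, so moving both extrema of a disk by the same amount
  is invisible to it. Strict convexity therefore leaves open that \<open>u\<close> and
  \<open>w\<close> differ by constants, possibly by different ones in different places, and a
  competitor that reacts to absolute levels is needed to exclude this. Two obstacles shape the rest.
  A competitor built from \<open>u\<close> and \<open>w\<close> has an evident gradient, but the
  Sobolev space demands that its own oscillation be a gradient; a measure argument on the values
  taken along a path turns any square summable gradient into the oscillation. And all inequalities
  hold only along almost every path. Fubini's theorem makes this usable on axis-parallel lines,
  which is why squares take the place of round discs and crosscuts are arcs of squares. The weak and
  the strong version differ in the passage from exceptional families to lines and in the closure
  properties of exceptional families; everything else treats them alike.\<close>

lemma meet_sum_mono_set: "A \<subseteq> B ==> meet_sum Q \<rho> A \<le> meet_sum Q \<rho> B"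
 unfolding meet_sum_def by (intro suminf_le summableI) auto

lemma meet_sum_mono: "(\<And>i. \<rho> i \<le> \<rho>' i) ==> meet_sum Q \<rho> A \<le> meet_sum Q \<rho>' A"
 unfolding meet_sum_def by (intro suminf_le summableI) auto

lemma meet_sum_le_suminf: "meet_sum Q \<rho> A \<le> (\<Sum>i. \<rho> i)" unfolding meet_sum_def by (intro suminf_le summableI) auto

lemma meet_sum_add: "meet_sum Q (\<lambda>i. \<rho> i + \<rho>' i) A = meet_sum Q \<rho> A + meet_sum Q \<rho>' A"
proof -
 have "meet_sum Q (\<lambda>i. \<rho> i + \<rho>' i) A
   = (\<Sum>i. (if Q i \<inter> A \<noteq> {} then \<rho> i else 0) + (if Q i \<inter> A \<noteq> {} then \<rho>' i else 0))"
  unfolding meet_sum_def by (intro suminf_cong) auto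
 also have "\<dots> = meet_sum Q \<rho> A + meet_sum Q \<rho>' A" unfolding meet_sum_def by (intro suminf_add[symmetric] summableI)
 finally show ?thesis .
qed

lemma meet_sum_cmult: "meet_sum Q (\<lambda>i. c * \<rho> i) A = c * meet_sum Q \<rho> A"
proof -
 have "meet_sum Q (\<lambda>i. c * \<rho> i) A = (\<Sum>i. c * (if Q i \<inter> A \<noteq> {} then \<rho> i else 0))"
  unfolding meet_sum_def by (intro suminf_cong) auto
 also have "\<dots> = c * meet_sum Q \<rho> A" unfolding meet_sum_def by (rule ennreal_suminf_cmult)
 finally show ?thesis .
qed

lemma meet_sum_ge_term:
 assumes "Q i \<inter> A \<noteq> {}" shows "\<rho> i \<le> meet_sum Q \<rho> A"
proof -
 have "(\<Sum>j\<in>{i}. if Q j \<inter> A \<noteq> {} then \<rho> j else 0) \<le> meet_sum Q \<rho> A"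
  unfolding meet_sum_def by (intro sum_le_suminf summableI) auto
 then show ?thesis using assms by simp
qed

text \<open>Lets the disks at the two ends of a path be charged beside a part of the path that
  avoids them.\<close>

lemma meet_sum_split:
 assumes "finite F" "\<And>i. i \<in> F ==> Q i \<inter> A \<noteq> {}" "\<And>i. i \<in> F ==> Q i \<inter> B = {}" "B \<subseteq> A"
 shows "(\<Sum>i\<in>F. \<rho> i) + meet_sum Q \<rho> B \<le> meet_sum Q \<rho> A"
proof -
 have "(\<Sum>i\<in>F. \<rho> i) = (\<Sum>i. if i \<in> F then \<rho> i else 0)" using assms(1) by (simp add: suminf_finite[of F])
 then have "(\<Sum>i\<in>F. \<rho> i) + meet_sum Q \<rho> B
   = (\<Sum>i. (if i \<in> F then \<rho> i else 0) + (if Q i \<inter> B \<noteq> {} then \<rho> i else 0))"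
  unfolding meet_sum_def by (simp add: suminf_add summableI)
 also have "\<dots> \<le> meet_sum Q \<rho> A" unfolding meet_sum_def using assms by (intro suminf_le summableI) auto
 finally show ?thesis .
qed

text \<open>Finitely many disks carry almost the whole sum. The limit arguments below combine this
  with topology: a point off the closures of those few disks has a neighbourhood missing them, and
  there the remaining sum is small.\<close>

lemma meet_sum_tail:
 assumes "meet_sum Q \<rho> A < \<infinity>" "0 < (e::real)"
 shows "\<exists>n. meet_sum Q (\<lambda>i. if i < n then 0 else \<rho> i) A < ennreal e"
proof -
 define f where "f i = (if Q i \<inter> A \<noteq> {} then \<rho> i else 0)" for i
 have fin: "(\<Sum>i. f i) < \<infinity>" using assms(1) unfolding meet_sum_def f_def by simp
 have fi: "f i < \<infinity>" for i using sum_le_suminf[OF summableI, of "{i}" f] fin by (auto simp: le_less_trans)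
 have ef: "ennreal (enn2real (f i)) = f i" for i using fi[of i] by (simp add: less_top)
 have sm: "summable (\<lambda>i. enn2real (f i))" using fin by (intro summable_suminf_not_top) (simp_all add: ef less_top)
 obtain n where n: "norm (\<Sum>i. enn2real (f (i + n))) < e" using suminf_exist_split[OF assms(2) sm] by blast
 have "meet_sum Q (\<lambda>i. if i < n then 0 else \<rho> i) A = (\<Sum>i. if i < n then 0 else f i)"
  unfolding meet_sum_def f_def by (intro suminf_cong) auto
 also have "\<dots> = (\<Sum>i. f (i + n))" by (subst suminf_offset[of _ n]) (auto simp: summableI)
 also have "\<dots> = (\<Sum>i. ennreal (enn2real (f (i + n))))" by (simp add: ef)
 also have "\<dots> = ennreal (\<Sum>i. enn2real (f (i + n)))"
  using sm by (intro suminf_ennreal2) (simp_all add: summable_iff_shift[of "\<lambda>i. enn2real (f i)"])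
 also have "\<dots> < ennreal e" using n assms(2) by (intro ennreal_lessI) auto
 finally show ?thesis by blast
qed

section \<open>Oscillation along a path\<close>

lemma exit_point:
 fixes g :: "real => complex"
 assumes "continuous_on {t..b} g" "t \<le> b" "g t \<in> U" "open U" "g b \<notin> U"
 obtains e where "t < e" "e \<le> b" "g e \<in> frontier U"
proof -
 have "connected (g ` {t..b})" using assms(1) by (intro connected_continuous_image) auto
 moreover have "g t \<in> g ` {t..b}" "g b \<in> g ` {t..b}" using assms by auto
 ultimately have "g ` {t..b} \<inter> frontier U \<noteq> {}" using connected_Int_frontier[of "g ` {t..b}" U] assms(3,5) by blast
 then obtain e where e: "e \<in> {t..b}" "g e \<in> frontier U" by blast
 moreover have "e \<noteq> t" using e assms by (auto simp: frontier_def interior_open)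
 ultimately show ?thesis using that[of e] by auto
qed

text \<open>The function \<open>z\<close> need not be continuous along the path, so a last low time
  may fail to exist. For finitely many disks a low time close enough to the supremum serves as well.
  After it no disk with \<open>M i < y\<close> is met: the path would have to leave that disk
  through a point of its boundary, where \<open>z\<close> is again below \<open>y\<close>, and this
  would be a later low time.\<close>

lemma last_low_time:
 fixes g :: "real => complex" and z :: "complex => real"
 assumes cont: "continuous_on {a..b} g" and ab: "a \<le> b"
  and op: "\<And>i. open (Q i)"
  and dis: "\<And>i j. i \<noteq> j ==> closure (Q i) \<inter> closure (Q j) = {}"
  and up: "\<And>i t. t \<in> {a..b} ==> g t \<in> frontier (Q i) ==> z (g t) \<le> M i"
  and Ka: "\<And>i. g a \<notin> Q i" and Kb: "\<And>i. g b \<notin> Q i"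
  and low: "z (g a) < y" and F: "finite F"
 shows "\<exists>t\<in>{a..b}. (\<forall>i. g t \<notin> Q i) \<and> z (g t) < y \<and>
      (\<forall>i\<in>F. M i < y --> (\<forall>s\<in>{t..b}. g s \<notin> Q i))"
proof -
 define T where "T = {t\<in>{a..b}. (\<forall>i. g t \<notin> Q i) \<and> z (g t) < y}"
 define t1 where "t1 = Sup T"
 have aT: "a \<in> T" using assms by (auto simp: T_def)
 have bT: "bdd_above T" unfolding T_def by (auto intro!: bdd_aboveI[of _ b])
 have t1: "a \<le> t1" "t1 \<le> b" unfolding t1_def using aT bT by (auto intro!: cSup_upper cSup_least simp: T_def)
 have Tle: "t \<in> T ==> t \<le> t1" for t unfolding t1_def using bT by (auto intro!: cSup_upper)
 have front: "g e \<notin> Q j" if "g e \<in> frontier (Q i)" for e i j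
 proof (cases "i = j")
  case True then show ?thesis using that op by (auto simp: frontier_def interior_open)
 next
  case False then show ?thesis using that dis[of i j] closure_subset[of "Q j"] by (auto simp: frontier_def)
 qed
 have after: "g s \<notin> Q i" if hyp: "M i < y" "t1 \<le> s" "s \<le> b" for i s
 proof
  assume "g s \<in> Q i"
  moreover have "continuous_on {s..b} g" using hyp t1 by (intro continuous_on_subset[OF cont]) auto
  ultimately obtain e where e: "s < e" "e \<le> b" "g e \<in> frontier (Q i)" using exit_point[of s b g "Q i"] hyp op Kb by blast
  have "e \<in> T" using e hyp t1 front[OF e(3)] up[of e i] by (auto simp: T_def)
  then show False using Tle[of e] e hyp by auto
 qed
 show ?thesis
 proof (cases "t1 \<in> T")
  case True
  then show ?thesis using after t1 by (intro bexI[of _ t1]) (auto simp: T_def)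
 next
  case False
  \<comment> \<open>Were \<open>g t1\<close> in a disk, low times just before \<open>t1\<close>
    would lie in the same open disk, but low times avoid all disks.\<close>
  have Kt1: "g t1 \<notin> Q i" for i
  proof
   assume q: "g t1 \<in> Q i"
   have "open (Q i)" by (rule op)
   then obtain A where A: "open A" "A \<inter> {a..b} = g -` Q i \<inter> {a..b}" using cont unfolding continuous_on_open_invariant by metis
   then have "t1 \<in> A" using q t1 by auto
   then obtain d where d: "d > 0" "ball t1 d \<subseteq> A" using A openE by blast
   obtain t where t: "t \<in> T" "t1 - d < t" using less_cSup_iff[of T "t1 - d"] aT bT d unfolding t1_def by auto
   have "t \<le> t1" using Tle t by auto
   then have "t \<in> A" using d t by (auto simp: dist_real_def subset_iff)
   then have "g t \<in> Q i" using A t by (auto simp: T_def)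
   then show False using t by (auto simp: T_def)
  qed
  \<comment> \<open>A disk with \<open>M i < y\<close> cannot have \<open>g t1\<close> in its
    closure, since \<open>t1\<close> would then be a low time itself; hence the disk is missed
    shortly before \<open>t1\<close> as well.\<close>
  have "eventually (\<lambda>t. M i < y --> (\<forall>s\<in>{t..b}. g s \<notin> Q i)) (at_left t1)" for i
  proof (cases "M i < y")
   case True
   have ncl: "g t1 \<notin> closure (Q i)"
   proof
    assume "g t1 \<in> closure (Q i)"
    then have "g t1 \<in> frontier (Q i)" using Kt1 op by (simp add: frontier_def interior_open)
    then have "z (g t1) < y" using up[of t1 i] t1 True by auto
    then show False using False t1 Kt1 by (auto simp: T_def)
   qed
   have "open (- closure (Q i))" by auto
   then obtain A where A: "open A" "A \<inter> {a..b} = g -` (- closure (Q i)) \<inter> {a..b}"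
    using cont unfolding continuous_on_open_invariant by metis
   have "t1 \<in> A \<inter> {a..b}" unfolding A(2) using ncl t1 by simp
   then have "t1 \<in> A" by simp
   then obtain d where d: "d > 0" "ball t1 d \<subseteq> A" using A openE by blast
   have *: "t1 \<noteq> a" using False aT by auto
   have "\<forall>t. max (t1 - d) a < t \<and> t < t1 --> (\<forall>s\<in>{t..b}. g s \<notin> Q i)"
   proof (intro allI impI ballI)
    fix t s assume ts: "max (t1 - d) a < t \<and> t < t1" "s \<in> {t..b}"
    show "g s \<notin> Q i"
    proof (cases "t1 \<le> s")
     case ge: True
     show ?thesis using ts by (intro after[OF True ge]) simp
    next
     case False
     then have "s \<in> A" using ts d by (auto simp: dist_real_def subset_iff)
     then have "g s \<notin> closure (Q i)" using A ts by auto
     then show ?thesis using closure_subset by blast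
    qed
   qed
   moreover have "max (t1 - d) a < t1" using d * t1 by auto
   ultimately show ?thesis unfolding eventually_at_left_field using True by blast
  qed simp
  then have "eventually (\<lambda>t. \<forall>i\<in>F. M i < y --> (\<forall>s\<in>{t..b}. g s \<notin> Q i)) (at_left t1)"
   using F by (intro eventually_ball_finite) auto
  then obtain c where c: "c < t1" "\<And>t. c < t ==> t < t1 ==> \<forall>i\<in>F. M i < y --> (\<forall>s\<in>{t..b}. g s \<notin> Q i)"
   unfolding eventually_at_left_field by blast
  obtain t where t: "t \<in> T" "c < t" using less_cSup_iff[of T c] aT bT c unfolding t1_def by auto
  have "t < t1" using Tle[OF t(1)] False t by (cases "t = t1") auto
  then show ?thesis using c(2)[of t] t by (intro bexI[of _ t]) (auto simp: T_def)
 qed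
qed

text \<open>Cut the path at a last low time for \<open>y\<close>, then cut the rest at a first high
  time for \<open>y'\<close>, which is a last low time after reversing time and the sign of
  \<open>z\<close>. A disk of \<open>F\<close> met in between has its range neither below
  \<open>y\<close> nor above \<open>y'\<close>; as both levels avoid the range, it lies strictly
  between them.\<close>

lemma rising_piece:
 fixes g :: "real => complex" and z :: "complex => real"
 assumes cont: "continuous_on {a..b} g" and ab: "a \<le> b"
  and op: "\<And>i. open (Q i)"
  and dis: "\<And>i j. i \<noteq> j ==> closure (Q i) \<inter> closure (Q j) = {}"
  and bd: "\<And>i t. t \<in> {a..b} ==> g t \<in> frontier (Q i) ==> m i \<le> z (g t) \<and> z (g t) \<le> M i"
  and Ka: "\<And>i. g a \<notin> Q i" and Kb: "\<And>i. g b \<notin> Q i"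
  and low: "z (g a) < y" and high: "y' < z (g b)" and F: "finite F"
  and gap: "\<And>i t. t \<in> {a..b} ==> g t \<in> Q i ==> y \<notin> {m i..M i} \<and> y' \<notin> {m i..M i}"
 shows "\<exists>t s. a \<le> t \<and> t \<le> s \<and> s \<le> b \<and> (\<forall>i. g t \<notin> Q i) \<and> (\<forall>i. g s \<notin> Q i) \<and>
      z (g t) < y \<and> y' < z (g s) \<and>
      (\<forall>i\<in>F. (\<exists>r\<in>{t..s}. g r \<in> Q i) --> y < m i \<and> M i < y')"
proof -
 obtain t where t: "t \<in> {a..b}" "\<And>i. g t \<notin> Q i" "z (g t) < y"
   "\<And>i s. i \<in> F ==> M i < y ==> s \<in> {t..b} ==> g s \<notin> Q i"
 proof -
  have "\<exists>t\<in>{a..b}. (\<forall>i. g t \<notin> Q i) \<and> z (g t) < y \<and>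
      (\<forall>i\<in>F. M i < y --> (\<forall>s\<in>{t..b}. g s \<notin> Q i))"
   by (rule last_low_time) (fact cont ab op dis Ka Kb low F | simp add: bd)+
  then show ?thesis using that by blast
 qed
 define h where "h = (\<lambda>r. g (- r))"
 have "continuous_on {-b..-t} h" unfolding h_def by (intro continuous_on_compose2[OF cont] continuous_intros) (use t in auto)
 moreover have "-b \<le> -t" using t by auto
 ultimately have "\<exists>r\<in>{-b..-t}. (\<forall>i. h r \<notin> Q i) \<and> - z (h r) < - y' \<and>
      (\<forall>i\<in>F. - m i < - y' --> (\<forall>s\<in>{r..-t}. h s \<notin> Q i))" using op dis F high t(1) t(2) Kb bd
  by (intro last_low_time) (auto simp: h_def)
 then obtain r where r: "r \<in> {-b..-t}" "\<And>i. h r \<notin> Q i" "y' < z (h r)"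
   "\<And>i s. i \<in> F ==> y' < m i ==> s \<in> {r..-t} ==> h s \<notin> Q i" by auto
 have "y < m i \<and> M i < y'" if i: "i \<in> F" "q \<in> {t..-r}" "g q \<in> Q i" for i q
 proof -
  have "\<not> M i < y" using t(4)[OF i(1), of q] i r(1) by auto
  moreover have "\<not> y' < m i" using r(4)[OF i(1), of "-q"] i t(1) by (auto simp: h_def)
  moreover have "y \<notin> {m i..M i} \<and> y' \<notin> {m i..M i}" using gap[of q i] i t r by auto
  ultimately show ?thesis by auto
 qed
 then show ?thesis using t r by (intro exI[of _ t] exI[of _ "-r"]) (auto simp: h_def)
qed

text \<open>Induction over the removed intervals. The interval of a disk \<open>j\<close> inside the
  window leaves one window on each side, and no disk contributes to both, so the two bounds add up
  to one without the term of \<open>j\<close>. With nothing removed, \<open>grow\<close> bounds the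
  diameter of the uncovered set.\<close>

lemma emeasure_uncovered_values_le:
 fixes m M \<rho> :: "nat => real"
 assumes F: "finite F" "F \<subseteq> J" and Y: "Y \<in> sets borel"
  and le: "\<And>i. i \<in> J ==> m i \<le> M i"
  and nn: "\<And>i. i \<in> J ==> 0 \<le> \<rho> i" and sm: "summable (\<lambda>i. if i \<in> J then \<rho> i else 0)"
  and dis: "\<And>i. i \<in> J ==> Y \<inter> {m i..M i} = {}"
  and grow: "\<And>y y'. y \<in> Y ==> y' \<in> Y ==> y < y' ==>
    y' - y \<le> (\<Sum>i. if i \<in> J \<and> y < m i \<and> M i < y' then \<rho> i else 0)"
 shows "emeasure lborel (Y \<inter> {c<..<d}) \<le> ennreal (\<Sum>i. if i \<in> J - F \<and> c < m i \<and> M i < d then \<rho> i else 0)" using F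
proof (induction F arbitrary: c d rule: finite_induct)
 case empty
 have sm': "summable (\<lambda>i. if i \<in> J \<and> P i then \<rho> i else 0)" for P
  by (rule summable_comparison_test_ev[OF _ sm]) (use nn in auto)
 define R where "R = (\<Sum>i. if i \<in> J \<and> c < m i \<and> M i < d then \<rho> i else 0)"
 have dif: "y' - y \<le> R" if "y \<in> Y \<inter> {c<..<d}" "y' \<in> Y \<inter> {c<..<d}" "y < y'" for y y'
 proof -
  have "y' - y \<le> (\<Sum>i. if i \<in> J \<and> y < m i \<and> M i < y' then \<rho> i else 0)" using grow that by auto
  also have "\<dots> \<le> R" unfolding R_def using that nn by (intro suminf_le sm') auto
  finally show ?thesis .
 qed
 have R0: "0 \<le> R" unfolding R_def using nn by (intro suminf_nonneg sm') auto
 show ?case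
 proof (cases "Y \<inter> {c<..<d} = {}")
  case True then show ?thesis by simp
 next
  case False
  define l u where "l = Inf (Y \<inter> {c<..<d})" and "u = Sup (Y \<inter> {c<..<d})"
  have bb: "bdd_below (Y \<inter> {c<..<d})" "bdd_above (Y \<inter> {c<..<d})" by (auto intro!: bdd_belowI[of _ c] bdd_aboveI[of _ d])
  have sub: "Y \<inter> {c<..<d} \<subseteq> {l..u}" unfolding l_def u_def using bb by (auto intro!: cInf_lower cSup_upper simp del: Int_iff)
  have dif': "y' - y \<le> R" if "y \<in> Y \<inter> {c<..<d}" "y' \<in> Y \<inter> {c<..<d}" for y y'
   using dif[OF that] R0 by (cases "y < y'") auto
  have "u \<le> R + y" if y: "y \<in> Y \<inter> {c<..<d}" for y unfolding u_def
  proof (intro cSup_least)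
   fix x assume "x \<in> Y \<inter> {c<..<d}" then show "x \<le> R + y" using dif'[OF y] by (simp add: algebra_simps)
  qed (use False in auto)
  then have "u - R \<le> l" unfolding l_def using False by (intro cInf_greatest) (auto simp: algebra_simps)
  moreover have "l \<le> u" using sub False by auto
  ultimately have "emeasure lborel {l..u} \<le> ennreal R" by (simp add: ennreal_leI)
  moreover have "emeasure lborel (Y \<inter> {c<..<d}) \<le> emeasure lborel {l..u}" using sub by (intro emeasure_mono) auto
  ultimately show ?thesis unfolding R_def by simp
 qed
next
 case (insert j F)
 have sm': "summable (\<lambda>i. if i \<in> J - G \<and> P i then \<rho> i else 0)" for P G
  by (rule summable_comparison_test_ev[OF _ sm]) (use nn in auto)
 have jJ: "j \<in> J" using insert by auto
 show ?case
 proof (cases "c < m j \<and> M j < d")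
  case False
  then have "(\<Sum>i. if i \<in> J - insert j F \<and> c < m i \<and> M i < d then \<rho> i else 0)
    = (\<Sum>i. if i \<in> J - F \<and> c < m i \<and> M i < d then \<rho> i else 0)" by (intro suminf_cong) auto
  then show ?thesis using insert by auto
 next
  case True
  let ?f = "\<lambda>c d i. if i \<in> J - F \<and> c < m i \<and> M i < d then \<rho> i else 0"
  \<comment> \<open>Uncovered values miss the interval of \<open>j\<close>, so each lies on one side
    of it.\<close>
  have "Y \<inter> {c<..<d} \<subseteq> (Y \<inter> {c<..<m j}) \<union> (Y \<inter> {M j<..<d})" using dis[OF jJ] by (force simp: disjoint_iff)
  then have "emeasure lborel (Y \<inter> {c<..<d}) \<le> emeasure lborel ((Y \<inter> {c<..<m j}) \<union> (Y \<inter> {M j<..<d}))"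
   using Y by (intro emeasure_mono) auto
  also have "\<dots> \<le> emeasure lborel (Y \<inter> {c<..<m j}) + emeasure lborel (Y \<inter> {M j<..<d})"
   using Y by (intro emeasure_subadditive) auto
  also have "\<dots> \<le> ennreal (suminf (?f c (m j))) + ennreal (suminf (?f (M j) d))" using insert by (intro add_mono) auto
  also have "\<dots> = ennreal (suminf (?f c (m j)) + suminf (?f (M j) d))"
  proof -
   have "0 \<le> suminf (?f c d)" for c d using nn by (intro suminf_nonneg sm') simp
   then show ?thesis by (simp only: ennreal_plus)
  qed
  also have "suminf (?f c (m j)) + suminf (?f (M j) d) = (\<Sum>i. ?f c (m j) i + ?f (M j) d i)" by (intro suminf_add sm')
  also have "\<dots> \<le> (\<Sum>i. if i \<in> J - insert j F \<and> c < m i \<and> M i < d then \<rho> i else 0)"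
  proof (intro suminf_le summable_add sm')
   fix i
   show "?f c (m j) i + ?f (M j) d i \<le> (if i \<in> J - insert j F \<and> c < m i \<and> M i < d then \<rho> i else 0)"
    using le[OF jJ] le[of i] nn[of i] True jJ by (cases "i \<in> J - insert j F"; cases "M i < m j"; cases "M j < m i"; cases "i = j") auto
  qed
  finally show ?thesis by (simp add: ennreal_leI)
 qed
qed

text \<open>A covering argument on the line of values. The values between \<open>z (g a)\<close> and
  \<open>z (g b)\<close> that are in no range \<open>{m i..M i}\<close> of a disk met by the path
  form a null set, because their measure is bounded by arbitrarily late tails of \<rho>. The ranges
  thus cover the interval up to measure zero, and the sum of their lengths is at least its
  length.\<close>

lemma oscillation_along_path_aux:
 fixes g :: "real => complex" and z :: "complex => real" and m M :: "nat => real"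
 assumes cont: "continuous_on {a..b} g" and ab: "a \<le> b"
  and op: "\<And>i. open (Q i)"
  and dis: "\<And>i j. i \<noteq> j ==> closure (Q i) \<inter> closure (Q j) = {}"
  and bd: "\<And>i t. t \<in> {a..b} ==> g t \<in> frontier (Q i) ==> m i \<le> z (g t) \<and> z (g t) \<le> M i"
  and mM: "\<And>i. m i \<le> M i"
  and Ka: "\<And>i. g a \<notin> Q i" and Kb: "\<And>i. g b \<notin> Q i"
  and grad: "\<And>s t. a \<le> s ==> s \<le> t ==> t \<le> b ==> (\<And>i. g s \<notin> Q i) ==> (\<And>i. g t \<notin> Q i) ==>
    ennreal \<bar>z (g s) - z (g t)\<bar> \<le> meet_sum Q \<rho> (g ` {s..t})"
  and fin: "meet_sum Q \<rho> (g ` {a..b}) < \<infinity>"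
  and less: "z (g a) < z (g b)"
 shows "ennreal \<bar>z (g a) - z (g b)\<bar> \<le> meet_sum Q (\<lambda>i. ennreal (M i - m i)) (g ` {a..b})"
proof -
 define J where "J = {i. Q i \<inter> g ` {a..b} \<noteq> {}}"
 define r where "r i = enn2real (\<rho> i)" for i
 have rJ: "ennreal (r i) = \<rho> i" if "i \<in> J" for i using meet_sum_ge_term[of Q i "g ` {a..b}" \<rho>] that fin unfolding r_def J_def
  by (auto intro!: ennreal_enn2real simp: order_le_less_trans)
 have r0: "0 \<le> r i" for i by (simp add: r_def)
 have eqJ: "ennreal (if i \<in> J then r i else 0) = (if Q i \<inter> g ` {a..b} \<noteq> {} then \<rho> i else 0)" for i
  using rJ[of i] by (auto simp: J_def)
 have sm: "summable (\<lambda>i. if i \<in> J then r i else 0)"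
 proof (rule summable_suminf_not_top)
  show "(\<Sum>i. ennreal (if i \<in> J then r i else 0)) \<noteq> top" using fin unfolding eqJ meet_sum_def by simp
 qed (simp add: r0)
 have sm': "summable (\<lambda>i. if i \<in> J \<and> P i then r i else 0)" for P by (rule summable_comparison_test_ev[OF _ sm]) (use r0 in auto)
 define Y where "Y = {z (g a)<..<z (g b)} - (\<Union>i\<in>J. {m i..M i})"
 have Yb: "Y \<in> sets borel" unfolding Y_def by (intro sets.Diff sets.countable_UN'') auto
 have grow: "y' - y \<le> (\<Sum>i. if i \<in> J \<and> y < m i \<and> M i < y' then r i else 0)"
  if y: "y \<in> Y" "y' \<in> Y" "y < y'" for y y'
 proof -
  define R where "R = (\<Sum>i. if i \<in> J \<and> y < m i \<and> M i < y' then r i else 0)"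
  have "y' - y \<le> R + e" if e: "e > 0" for e
  proof -
   \<comment> \<open>The first \<open>n\<close> disks are localized between the two levels by
     \<open>rising_piece\<close>; all others together cost less than \<open>e\<close>.\<close>
   obtain n where n: "meet_sum Q (\<lambda>i. if i < n then 0 else \<rho> i) (g ` {a..b}) < ennreal e" using meet_sum_tail[OF fin e] by blast
   have "\<exists>t s. a \<le> t \<and> t \<le> s \<and> s \<le> b \<and> (\<forall>i. g t \<notin> Q i) \<and> (\<forall>i. g s \<notin> Q i) \<and>
      z (g t) < y \<and> y' < z (g s) \<and>
      (\<forall>i\<in>{..<n}. (\<exists>r\<in>{t..s}. g r \<in> Q i) --> y < m i \<and> M i < y')"
   proof (rule rising_piece)
    show "z (g a) < y" "y' < z (g b)" using y by (auto simp: Y_def)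
    show "y \<notin> {m i..M i} \<and> y' \<notin> {m i..M i}" if t: "t \<in> {a..b}" "g t \<in> Q i" for i t
    proof -
     have "i \<in> J" using t by (auto simp: J_def)
     then show ?thesis using y by (auto simp: Y_def)
    qed
   qed (fact cont ab op dis Ka Kb | simp add: bd)+
   then obtain t s where ts: "a \<le> t" "t \<le> s" "s \<le> b" "\<And>i. g t \<notin> Q i" "\<And>i. g s \<notin> Q i"
      "z (g t) < y" "y' < z (g s)"
      "\<And>i q. i < n ==> q \<in> {t..s} ==> g q \<in> Q i ==> y < m i \<and> M i < y'"
    by (metis lessThan_iff)
   have "ennreal (y' - y) \<le> ennreal \<bar>z (g t) - z (g s)\<bar>" using ts by (intro ennreal_leI) auto
   also have "\<dots> \<le> meet_sum Q \<rho> (g ` {t..s})" using ts by (intro grad) auto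
   also have "\<dots> \<le> (\<Sum>i. ennreal (if i \<in> J \<and> y < m i \<and> M i < y' then r i else 0)
     + (if Q i \<inter> g ` {a..b} \<noteq> {} then if i < n then 0 else \<rho> i else 0))" unfolding meet_sum_def
   proof (intro suminf_le summableI)
    fix i
    show "(if Q i \<inter> g ` {t..s} \<noteq> {} then \<rho> i else 0)
     \<le> ennreal (if i \<in> J \<and> y < m i \<and> M i < y' then r i else 0)
     + (if Q i \<inter> g ` {a..b} \<noteq> {} then if i < n then 0 else \<rho> i else 0)"
    proof (cases "Q i \<inter> g ` {t..s} = {}")
     case False
     then obtain q where q: "q \<in> {t..s}" "g q \<in> Q i" by blast
     then have iJ: "i \<in> J" using ts by (auto simp: J_def)
     show ?thesis
     proof (cases "i < n")
      case True
      then show ?thesis using ts(8)[OF True q] rJ[OF iJ] iJ by simp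
     next
      case False
      then show ?thesis using iJ by (simp add: J_def)
     qed
    qed simp
   qed
   also have "\<dots> = (\<Sum>i. ennreal (if i \<in> J \<and> y < m i \<and> M i < y' then r i else 0))
     + meet_sum Q (\<lambda>i. if i < n then 0 else \<rho> i) (g ` {a..b})" unfolding meet_sum_def by (intro suminf_add[symmetric] summableI)
   also have "(\<Sum>i. ennreal (if i \<in> J \<and> y < m i \<and> M i < y' then r i else 0)) = ennreal R"
    unfolding R_def using r0 by (intro suminf_ennreal2 sm') auto
   also have "ennreal R + meet_sum Q (\<lambda>i. if i < n then 0 else \<rho> i) (g ` {a..b}) \<le> ennreal R + ennreal e"
    using n by (intro add_left_mono) simp
   also have "\<dots> = ennreal (R + e)" using e r0 unfolding R_def by (subst ennreal_plus) (auto intro!: suminf_nonneg sm')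
   finally show ?thesis using e r0 suminf_nonneg[OF sm'] unfolding R_def
    by (subst (asm) ennreal_le_iff) (auto intro!: add_nonneg_nonneg suminf_nonneg sm')
  qed
  then show ?thesis unfolding R_def[symmetric] by (rule field_le_epsilon)
 qed
 \<comment> \<open>Removing the intervals of the first \<open>n\<close> disks leaves only a tail of
   the summable sequence as a bound for the measure.\<close>
 have bound: "emeasure lborel Y \<le> ennreal e" if e: "e > 0" for e
 proof -
  obtain n where n: "norm (\<Sum>i. (\<lambda>i. if i \<in> J then r i else 0) (i + n)) < e" using suminf_exist_split[OF e sm] by blast
  have YY: "Y \<inter> {z (g a)<..<z (g b)} = Y" by (auto simp: Y_def)
  have "emeasure lborel (Y \<inter> {z (g a)<..<z (g b)})
    \<le> ennreal (\<Sum>i. if i \<in> J - ({..<n} \<inter> J) \<and> z (g a) < m i \<and> M i < z (g b) then r i else 0)"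
  proof (rule emeasure_uncovered_values_le)
   show "Y \<inter> {m i..M i} = {}" if "i \<in> J" for i using that by (auto simp: Y_def)
  qed (use Yb mM r0 sm grow in auto)
  also have "\<dots> \<le> ennreal (\<Sum>i. if i \<in> J \<and> n \<le> i then r i else 0)"
   using r0 sm'[of "\<lambda>i. n \<le> i"] sm'[of "\<lambda>i. i \<notin> {..<n} \<inter> J \<and> z (g a) < m i \<and> M i < z (g b)"]
   by (intro ennreal_leI suminf_le) (auto simp: conj_assoc)
  also have "(\<Sum>i. if i \<in> J \<and> n \<le> i then r i else 0) = (\<Sum>i. (\<lambda>i. if i \<in> J then r i else 0) (i + n))"
   by (subst suminf_split_initial_segment[OF sm', of _ n]) auto
  also have "ennreal \<dots> \<le> ennreal e" using n by (intro ennreal_leI) auto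
  finally show ?thesis unfolding YY .
 qed
 have Y0: "emeasure lborel Y = 0"
 proof (rule ccontr)
  assume "emeasure lborel Y \<noteq> 0"
  moreover have "emeasure lborel Y \<le> 1" using bound[of 1] by simp
  ultimately obtain x where x: "emeasure lborel Y = ennreal x" "0 < x" by (cases "emeasure lborel Y") (auto simp: top_unique)
  then have "ennreal x \<le> ennreal (x/2)" using bound[of "x/2"] by simp
  then show False using x by simp
 qed
 have "{z (g a)<..<z (g b)} \<subseteq> Y \<union> (\<Union>i\<in>J. {m i..M i})" by (auto simp: Y_def)
 then have "emeasure lborel {z (g a)<..<z (g b)} \<le> emeasure lborel (Y \<union> (\<Union>i\<in>J. {m i..M i}))"
  using Yb by (intro emeasure_mono) (auto intro!: sets.countable_UN'')
 also have "\<dots> \<le> emeasure lborel Y + emeasure lborel (\<Union>i\<in>J. {m i..M i})"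
  using Yb by (intro emeasure_subadditive) (auto intro!: sets.countable_UN'')
 also have "\<dots> = emeasure lborel (\<Union>i. if i \<in> J then {m i..M i} else {})"
 proof -
  have "(\<Union>i\<in>J. {m i..M i}) = (\<Union>i. if i \<in> J then {m i..M i} else {})" by auto
  then show ?thesis using Y0 by simp
 qed
 also have "\<dots> \<le> (\<Sum>i. emeasure lborel (if i \<in> J then {m i..M i} else {}))" by (intro emeasure_subadditive_countably) auto
 also have "\<dots> = meet_sum Q (\<lambda>i. ennreal (M i - m i)) (g ` {a..b})" unfolding meet_sum_def J_def using mM by (intro suminf_cong) auto
 finally show ?thesis using less by (simp add: ennreal_leI)
qed

text \<open>The falling case is the rising one for the negative of \<open>z\<close>, with the roles
  of \<open>m\<close> and \<open>M\<close> exchanged.\<close>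

lemma oscillation_along_path:
 fixes g :: "real => complex" and z :: "complex => real" and m M :: "nat => real"
 assumes cont: "continuous_on {a..b} g" and ab: "a \<le> b"
  and op: "\<And>i. open (Q i)"
  and dis: "\<And>i j. i \<noteq> j ==> closure (Q i) \<inter> closure (Q j) = {}"
  and bd: "\<And>i t. t \<in> {a..b} ==> g t \<in> frontier (Q i) ==> m i \<le> z (g t) \<and> z (g t) \<le> M i"
  and mM: "\<And>i. m i \<le> M i"
  and Ka: "\<And>i. g a \<notin> Q i" and Kb: "\<And>i. g b \<notin> Q i"
  and grad: "\<And>s t. a \<le> s ==> s \<le> t ==> t \<le> b ==> (\<And>i. g s \<notin> Q i) ==> (\<And>i. g t \<notin> Q i) ==>
    ennreal \<bar>z (g s) - z (g t)\<bar> \<le> meet_sum Q \<rho> (g ` {s..t})"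
  and fin: "meet_sum Q \<rho> (g ` {a..b}) < \<infinity>"
 shows "ennreal \<bar>z (g a) - z (g b)\<bar> \<le> meet_sum Q (\<lambda>i. ennreal (M i - m i)) (g ` {a..b})"
proof -
 consider "z (g a) < z (g b)" | "- z (g a) < - z (g b)" | "z (g a) = z (g b)" by linarith
 then show ?thesis
 proof cases
  case 1
  show ?thesis by (rule oscillation_along_path_aux[where z = z and \<rho> = \<rho>])
    (fact cont ab op dis mM Ka Kb fin 1 grad | simp add: bd)+
 next
  case 2
  have "ennreal \<bar>- z (g a) - - z (g b)\<bar> \<le> meet_sum Q (\<lambda>i. ennreal (- m i - - M i)) (g ` {a..b})"
  proof (rule oscillation_along_path_aux[where z = "\<lambda>x. - z x" and \<rho> = \<rho>])
   show "ennreal \<bar>- z (g s) - - z (g t)\<bar> \<le> meet_sum Q \<rho> (g ` {s..t})"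
    if "a \<le> s" "s \<le> t" "t \<le> b" "\<And>i. g s \<notin> Q i" "\<And>i. g t \<notin> Q i" for s t
    using grad[OF that] by (simp add: abs_minus_commute)
  qed (fact cont ab op dis Ka Kb fin 2 | simp add: bd mM)+
  then show ?thesis by (simp add: abs_minus_commute)
 qed simp
qed

section \<open>Squares and crosscuts of Jordan curves\<close>

text \<open>Squares replace round discs because their sides lie on axis-parallel lines, where
  Fubini's theorem controls almost every position.\<close>

definition sup_norm :: "complex => real" where "sup_norm z = max \<bar>Re z\<bar> \<bar>Im z\<bar>"

definition square :: "complex => real => complex set" where "square c r = {z. sup_norm (z - c) < r}"

definition csquare :: "complex => real => complex set" where "csquare c r = {z. sup_norm (z - c) \<le> r}"

text \<open>The parameter \<open>t\<close> is the polar angle about the centre.\<close>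

definition square_path :: "complex => real => real => complex" where
 "square_path c r t = c + of_real (r / sup_norm (cis t)) * cis t"

lemma sup_norm_nonneg [simp]: "0 \<le> sup_norm z" by (simp add: sup_norm_def)

lemma sup_norm_0 [simp]: "sup_norm 0 = 0" by (simp add: sup_norm_def)

lemma sup_norm_eq_0 [simp]: "sup_norm z = 0 \<longleftrightarrow> z = 0" by (auto simp: sup_norm_def complex_eq_iff max_def)

lemma sup_norm_scale: "sup_norm (of_real a * z) = \<bar>a\<bar> * sup_norm z" by (simp add: sup_norm_def abs_mult max_mult_distrib_left)

lemma sup_norm_commute: "sup_norm (a - b) = sup_norm (b - a)" by (simp add: sup_norm_def abs_minus_commute)

lemma sup_norm_triangle: "sup_norm (a + b) \<le> sup_norm a + sup_norm b" unfolding sup_norm_def by (simp add: max_def) linarith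

lemma sup_norm_le_norm: "sup_norm z \<le> norm z" using abs_Re_le_cmod abs_Im_le_cmod by (simp add: sup_norm_def)

lemma norm_le_sup_norm: "norm z \<le> 2 * sup_norm z" using cmod_le[of z] by (simp add: sup_norm_def max_def split: if_splits)

lemma sup_norm_diff_le: "\<bar>sup_norm a - sup_norm b\<bar> \<le> norm (a - b)"
 using sup_norm_triangle[of "a - b" b] sup_norm_triangle[of "b - a" a] sup_norm_le_norm[of "a - b"]
  sup_norm_commute[of a b] by simp

lemma continuous_on_sup_norm [continuous_intros]:
 "continuous_on A f ==> continuous_on A (\<lambda>x. sup_norm (f x))" unfolding sup_norm_def by (intro continuous_intros)

lemma sup_norm_cis_pos: "0 < sup_norm (cis t)" using sup_norm_nonneg[of "cis t"] sup_norm_eq_0[of "cis t"] by (simp add: less_le)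

lemma square_eq_box: "square c r = box (c - Complex r r) (c + Complex r r)"
 by (auto simp: square_def sup_norm_def box_Complex_eq complex_eq_iff in_box_complex_iff abs_less_iff)

lemma csquare_eq_cbox: "csquare c r = cbox (c - Complex r r) (c + Complex r r)"
 by (auto simp: csquare_def sup_norm_def in_cbox_complex_iff abs_le_iff)

lemma open_square [simp]: "open (square c r)" by (simp add: square_eq_box open_box)
lemma convex_square [simp]: "convex (square c r)" by (simp add: square_eq_box convex_box)
lemma bounded_square [simp]: "bounded (square c r)" by (simp add: square_eq_box bounded_box)
lemma compact_csquare [simp]: "compact (csquare c r)" by (simp add: csquare_eq_cbox compact_cbox)

lemma centre_in_square: "0 < r ==> c \<in> square c r" by (simp add: square_def)

lemma square_mono: "r \<le> r' ==> square c r \<subseteq> square c r'" by (auto simp: square_def)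

lemma ball_subset_square: "ball c r \<subseteq> square c r"
 using sup_norm_le_norm by (auto simp: square_def dist_norm norm_minus_commute) (meson order_le_less_trans)

lemma square_subset_ball: "square c r \<subseteq> ball c (2 * r)" using norm_le_sup_norm by (auto simp: square_def dist_norm norm_minus_commute)
  (smt (verit, best) norm_minus_commute)

lemma open_contains_square: "open A ==> x \<in> A ==> \<exists>r>0. square x r \<subseteq> A"
proof -
 assume "open A" "x \<in> A"
 then obtain e where "e > 0" "ball x e \<subseteq> A" using openE by blast
 then show ?thesis using square_subset_ball[of x "e/2"] by (intro exI[of _ "e/2"]) auto
qed

lemma square_path_norm: "0 \<le> r ==> sup_norm (square_path c r t - c) = r"
 using sup_norm_cis_pos[of t] by (simp add: square_path_def sup_norm_scale del: of_real_divide)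

lemma continuous_on_square_path: "continuous_on A (square_path c r)" unfolding square_path_def using sup_norm_cis_pos
 by (intro continuous_intros) (auto simp: less_le)

lemma square_path_inj:
 assumes "0 < r" "square_path c r s = square_path c r t" shows "cis s = cis t"
proof -
 let ?a = "r / sup_norm (cis s)" and ?b = "r / sup_norm (cis t)"
 have pos: "0 < ?a" "0 < ?b" using assms sup_norm_cis_pos by auto
 have e: "of_real ?a * cis s = of_real ?b * cis t" using assms(2) by (simp add: square_path_def del: of_real_divide)
 then have "norm (of_real ?a * cis s) = norm (of_real ?b * cis t)" by simp
 then have ab: "?a = ?b" using pos by (simp only: norm_mult norm_of_real norm_cis)
 have "of_real ?b * cis s = of_real ?b * cis t" using e unfolding ab .
 then show ?thesis using pos(2) by (simp only: mult_cancel_left of_real_eq_0_iff less_irrefl) (metis less_irrefl)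
qed

lemma square_path_periodic: "square_path c r (t + 2 * pi) = square_path c r t" by (simp add: square_path_def cis.code)

text \<open>Both ends of a period name the same point, so one of the parameters has to be
  interior.\<close>

lemma square_path_inj_interval:
 assumes "0 < r" "square_path c r s = square_path c r t" "t0 < s" "s < t0 + 2 * pi" "t0 \<le> t" "t \<le> t0 + 2 * pi"
 shows "s = t"
proof -
 have "cis s = cis t" using square_path_inj assms by blast
 then have "exp (\<i> * of_real s) = exp (\<i> * of_real t)" by (simp add: cis_conv_exp)
 then obtain n :: int where n: "\<i> * of_real s = \<i> * of_real t + of_int (2 * n) * of_real pi * \<i>" unfolding exp_eq by auto
 then have "s = t + 2 * of_int n * pi" by (auto simp: complex_eq_iff)
 moreover have "n = 0"
 proof (rule ccontr)
  assume "n \<noteq> 0"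
  then have "1 \<le> \<bar>real_of_int n\<bar>" by linarith
  then have "2 * pi \<le> 2 * \<bar>real_of_int n\<bar> * pi" using pi_gt_zero by simp
  then have "2 * pi \<le> \<bar>s - t\<bar>" using calculation by (simp add: abs_mult)
  then show False using assms by linarith
 qed
 ultimately show ?thesis by simp
qed

lemma square_path_surj:
 assumes "0 < r" "sup_norm (z - c) = r"
 shows "\<exists>t\<in>{t0..<t0 + 2 * pi}. square_path c r t = z"
proof -
 have zc: "z \<noteq> c" using assms by auto
 obtain t where t: "t \<in> {t0..<t0 + 2 * pi}" "cis t = sgn (z - c)"
 proof -
  define n where "n = \<lceil>(t0 - Arg (z - c)) / (2 * pi)\<rceil>"
  have "t0 - Arg (z - c) \<le> 2 * pi * n" "2 * pi * n < t0 - Arg (z - c) + 2 * pi"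
  proof -
   have "(t0 - Arg (z - c)) / (2 * pi) \<le> n" "n < (t0 - Arg (z - c)) / (2 * pi) + 1" unfolding n_def by linarith+
   then show "t0 - Arg (z - c) \<le> 2 * pi * n" "2 * pi * n < t0 - Arg (z - c) + 2 * pi" using pi_gt_zero by (simp_all add: field_simps)
  qed
  moreover have "cis (Arg (z - c) + 2 * pi * n) = sgn (z - c)" using zc by (simp add: cis_mult[symmetric] cis_Arg)
  ultimately show ?thesis by (intro that[of "Arg (z - c) + 2 * pi * n"]) auto
 qed
 have s: "sgn (z - c) = of_real (1 / norm (z - c)) * (z - c)" by (simp add: sgn_div_norm scaleR_conv_of_real divide_inverse)
 have "sup_norm (cis t) = r / norm (z - c)" unfolding t(2) s using assms by (simp only: sup_norm_scale) (simp add: divide_inverse)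
 then have "square_path c r t = c + of_real (norm (z - c)) * sgn (z - c)" unfolding square_path_def t(2) using assms zc by simp
 also have "\<dots> = z" using zc by (simp add: s)
 finally show ?thesis using t by auto
qed

lemma connected_meets_square:
 assumes X: "connected X" and "a \<in> X" "sup_norm (a - c) < r" "b \<in> X" "r < sup_norm (b - c)"
 shows "\<exists>z\<in>X. sup_norm (z - c) = r"
proof -
 have "connected ((\<lambda>z. sup_norm (z - c)) ` X)" using X by (intro connected_continuous_image continuous_intros)
 then have "r \<in> (\<lambda>z. sup_norm (z - c)) ` X"
  using assms connectedD_interval[of "(\<lambda>z. sup_norm (z - c)) ` X" "sup_norm (a - c)" "sup_norm (b - c)" r] by auto
 then show ?thesis by auto
qed

text \<open>Induction by Janiszewski's theorem: the next compact set is disjoint from the complement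
  of the region obtained so far, and the empty intersection is connected.\<close>

lemma connected_complement_finite_Union:
 fixes K :: "nat => complex set"
 assumes F: "finite F" and op: "open V" and con: "connected V"
  and K: "\<And>k. k \<in> F ==> compact (K k) \<and> connected (- K k) \<and> K k \<subseteq> V"
  and dis: "\<And>i j. i \<in> F ==> j \<in> F ==> i \<noteq> j ==> K i \<inter> K j = {}"
 shows "connected (V - (\<Union>k\<in>F. K k))" using F K dis
proof (induction F rule: finite_induct)
 case empty then show ?case using con by simp
next
 case (insert k F)
 let ?T = "- (V - (\<Union>k\<in>F. K k))"
 have cl: "closed ?T"
 proof -
  have "closed (\<Union>k\<in>F. K k)" using insert by (intro closed_UN) (auto intro: compact_imp_closed)
  then show ?thesis using op by (auto simp: open_Diff)
 qed
 have 1: "compact (K k)" "K k \<inter> ?T = {}" using insert.prems insert.hyps(2) by (auto, blast)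
 have "connected (V - (\<Union>k\<in>F. K k))" using insert by auto
 then have "connected (- ?T)" by (simp only: double_compl)
 then have "connected (- (K k \<union> ?T))" using insert.prems(1)[of k] 1 cl by (intro Janiszewski_connected) simp_all
 moreover have "- (K k \<union> ?T) = V - (\<Union>k\<in>insert k F. K k)" by auto
 ultimately show ?case by metis
qed

text \<open>Rotate the parametrization so that it starts and ends at \<open>x\<close>. Continuity
  keeps the two short end arcs, which join at \<open>x\<close>, inside the square; injectivity keeps
  the middle arc away from \<open>x\<close>.\<close>

lemma jordan_curve_local_split:
 assumes J: "jordan_curve G" and x: "x \<in> G" and e: "0 < e"
 obtains s T where "compact s" "connected s" "compact T" "connected T" "s \<union> T = G"
  "s \<subseteq> square x e" "x \<notin> T"
proof -
 obtain c where c: "simple_path c" "pathfinish c = pathstart c" "path_image c = G" using J by (auto simp: jordan_curve_def)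
 obtain t0 where t0: "t0 \<in> {0..1}" "c t0 = x" using x c by (auto simp: path_image_def)
 define g where "g = shiftpath t0 c"
 have g: "simple_path g" "pathstart g = x" "pathfinish g = x" "path_image g = G"
  using simple_path_shiftpath[OF c(1,2)] t0 c pathstart_shiftpath[of t0 c] pathfinish_shiftpath[of t0 c]
   path_image_shiftpath[of t0 c] by (auto simp: g_def)
 have cont: "continuous_on {0..1} g" using g simple_path_imp_path path_def by blast
 have g01: "g 0 = x" "g 1 = x" using g by (auto simp: pathstart_def pathfinish_def)
 have "open (square x e)" by simp
 then obtain A where A: "open A" "A \<inter> {0..1} = g -` square x e \<inter> {0..1}" using cont unfolding continuous_on_open_invariant by metis
 have "0 \<in> A \<inter> {0..1}" "1 \<in> A \<inter> {0..1}" unfolding A(2) using g01 e by (auto simp: centre_in_square)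
 then obtain d0 d1 where d: "d0 > 0" "ball 0 d0 \<subseteq> A" "d1 > 0" "ball 1 d1 \<subseteq> A" using A(1) openE by (metis IntD1)
 \<comment> \<open>Below one half, so that the middle arc is not empty, and small enough for both
   end arcs to stay in the square.\<close>
 define h where "h = min (1/3) (min (d0/2) (d1/2))"
 have h: "0 < h" "h < 1/2" "h < d0" "h < d1" using d by (auto simp: h_def)
 define s T where "s = g ` {0..h} \<union> g ` {1-h..1}" and "T = g ` {h..1-h}"
 have co: "continuous_on {0..h} g" "continuous_on {1-h..1} g" "continuous_on {h..1-h} g" using h by (auto intro: continuous_on_subset[OF cont])
 show ?thesis
 proof (rule that[of s T])
  show "compact s" "compact T" unfolding s_def T_def using co by (auto intro!: compact_Un compact_continuous_image)
  have "connected (g ` {0..h})" "connected (g ` {1-h..1})" "connected (g ` {h..1-h})" using co by (auto intro!: connected_continuous_image)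
  moreover have "x \<in> g ` {0..h}" "x \<in> g ` {1-h..1}" using h g01 by (auto intro: image_eqI[of _ _ 0] image_eqI[of _ _ 1])
  ultimately show "connected s" "connected T" unfolding s_def T_def by (auto intro!: connected_Un)
  have "{0..h} \<union> {1-h..1} \<union> {h..1-h} = {0..1}" using h by auto
  then show "s \<union> T = G" unfolding s_def T_def image_Un[symmetric] using g(4) by (simp add: path_image_def)
  have "t \<in> {0..h} \<union> {1-h..1} ==> t \<in> A \<inter> {0..1}" for t using h d by (auto simp: dist_real_def subset_iff)
  then have "t \<in> {0..h} \<union> {1-h..1} ==> g t \<in> square x e" for t unfolding A(2) by blast
  then show "s \<subseteq> square x e" unfolding s_def by blast
  show "x \<notin> T"
  proof
   assume "x \<in> T"
   then obtain t where t: "t \<in> {h..1-h}" "g t = g 0" using g01 by (auto simp: T_def)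
   then have "t = 0 \<or> t = 1" using g(1) h unfolding simple_path_def loop_free_def by fastforce
   then show False using t h by auto
  qed
 qed
qed

text \<open>Both sides are treated at once: a peripheral disk is approached from outside its
  boundary curve, while the domain may lie inside or outside a curve of its boundary.\<close>

definition jordan_side :: "complex set => complex set => bool" where
 "jordan_side G U \<longleftrightarrow> jordan_curve G \<and> (U = inside G \<or> U = outside G)"

lemma jordan_sideD:
 assumes "jordan_side G U"
 shows "compact G" "connected G" "open U" "connected U" "U \<inter> G = {}" "closure U = U \<union> G"
  "\<And>a b. a \<in> U ==> b \<in> U ==> connected_component (- G) a b"
  "\<And>a X. connected X ==> X \<inter> G = {} ==> a \<in> X ==> a \<in> U ==> X \<subseteq> U"
proof -
 obtain c where c: "simple_path c" "pathfinish c = pathstart c" "path_image c = G" using assms by (auto simp: jordan_curve_def jordan_side_def)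
 have J: "inside G \<noteq> {}" "open (inside G)" "connected (inside G)"
   "outside G \<noteq> {}" "open (outside G)" "connected (outside G)"
   "inside G \<inter> outside G = {}" "inside G \<union> outside G = - G"
   "frontier (inside G) = G" "frontier (outside G) = G" using Jordan_inside_outside[OF c(1,2)] c(3) by auto
 show "compact G" "connected G" using c simple_path_imp_path by (auto intro: compact_path_image connected_path_image)
 show op: "open U" and con: "connected U" using J assms by (auto simp: jordan_side_def)
 show dis: "U \<inter> G = {}" using assms J(8) unfolding jordan_side_def by (metis Compl_disjoint inf_commute inf_sup_absorb sup_ge1 sup_ge2 disjoint_eq_subset_Compl)
 have "frontier U = G" using J assms by (auto simp: jordan_side_def)
 then show "closure U = U \<union> G" using closure_Un_frontier by metis
 show "connected_component (- G) a b" if "a \<in> U" "b \<in> U" for a b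
  unfolding connected_component_def using con dis that by (intro exI[of _ U]) auto
 show "X \<subseteq> U" if "connected X" "X \<inter> G = {}" "a \<in> X" "a \<in> U" for a X
 proof (rule ccontr)
  assume "\<not> X \<subseteq> U"
  then have "X \<inter> frontier U \<noteq> {}" using that by (intro connected_Int_frontier) auto
  then show False using that \<open>frontier U = G\<close> by auto
 qed
qed

text \<open>Janiszewski's theorem for \<open>G\<close> and the compact set made of the far arc
  \<open>T\<close> and the boundary of the large square, which meets \<open>G\<close> exactly in the
  connected arc \<open>T\<close>. Two points of \<open>U\<close> near \<open>x\<close> are joined
  off the compact set by a small square and off \<open>G\<close> inside \<open>U\<close>, hence by a
  connected set that avoids both.\<close>

lemma jordan_side_locally_connected:
 assumes JS: "jordan_side G U" and x: "x \<in> G" and e: "0 < e"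
 shows "\<exists>d>0. d \<le> e \<and> (\<forall>a\<in>U \<inter> square x d. \<forall>b\<in>U \<inter> square x d.
      \<exists>X. connected X \<and> a \<in> X \<and> b \<in> X \<and> X \<subseteq> U \<inter> square x e)"
proof -
 note J = jordan_sideD[OF JS]
 obtain s T where st: "compact s" "connected s" "compact T" "connected T" "s \<union> T = G"
  "s \<subseteq> square x e" "x \<notin> T" using jordan_curve_local_split[of G x e] JS x e by (auto simp: jordan_side_def)
 have "open (- T)" using st by (auto intro: compact_imp_closed)
 then obtain d0 where d0: "d0 > 0" "square x d0 \<subseteq> - T" using open_contains_square st(7) by blast
 define d where "d = min d0 e"
 have d: "0 < d" "d \<le> e" "square x d \<subseteq> - T" using d0 e square_mono[of d d0 x] by (auto simp: d_def)
 have "\<exists>X. connected X \<and> a \<in> X \<and> b \<in> X \<and> X \<subseteq> U \<inter> square x e"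
  if ab: "a \<in> U \<inter> square x d" "b \<in> U \<inter> square x d" for a b
 proof -
  define S where "S = T \<union> frontier (square x e)"
  have fr: "frontier (square x e) \<inter> square x e = {}" by (auto simp: frontier_def interior_open)
  have cS: "compact S" unfolding S_def using st by (auto intro!: compact_Un compact_frontier_bounded)
  have "S \<inter> G = T" using st fr by (auto simp: S_def)
  moreover have "connected_component (- S) a b"
  proof -
   have "square x d \<subseteq> - S" using d fr square_mono[of d e x] by (auto simp: S_def)
   then show ?thesis unfolding connected_component_def using ab convex_connected[OF convex_square] by (intro exI[of _ "square x d"]) auto
  qed
  ultimately have "connected_component (- (S \<union> G)) a b"
   using cS J(1) J(7)[of a b] ab st by (intro Janiszewski) (auto intro: compact_imp_closed)
  then obtain X where X: "connected X" "X \<subseteq> - (S \<union> G)" "a \<in> X" "b \<in> X" by (auto simp: connected_component_def)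
  have "X \<subseteq> square x e"
  proof (rule ccontr)
   assume "\<not> X \<subseteq> square x e"
   then have "X \<inter> frontier (square x e) \<noteq> {}" using X ab square_mono[OF d(2), of x] by (intro connected_Int_frontier) auto
   then show False using X by (auto simp: S_def)
  qed
  moreover have "X \<subseteq> U" using J(8)[OF X(1) _ X(3)] X ab by auto
  ultimately show ?thesis using X by auto
 qed
 then show ?thesis using d by auto
qed

lemma connected_compl_square: "connected (- square x r)" using connected_complement_bounded_convex[OF bounded_square convex_square] by simp

text \<open>The same argument with the arcs exchanged: the near arc \<open>s\<close> together with a
  small closed square meets \<open>G\<close> in \<open>s\<close> only, and far points are joined off
  this set through the complement of the larger square.\<close>

lemma jordan_side_far_connected:
 assumes JS: "jordan_side G U" and x: "x \<in> G" and r1: "0 < r1"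
 shows "\<exists>r0>0. r0 \<le> r1 \<and> (\<forall>r<r0. \<forall>a\<in>U - square x r1. \<forall>b\<in>U - square x r1.
      \<exists>X. connected X \<and> a \<in> X \<and> b \<in> X \<and> X \<subseteq> U - csquare x r)"
proof -
 note J = jordan_sideD[OF JS]
 obtain s T where st: "compact s" "connected s" "compact T" "connected T" "s \<union> T = G"
  "s \<subseteq> square x r1" "x \<notin> T" using jordan_curve_local_split[of G x r1] JS x r1 by (auto simp: jordan_side_def)
 have "open (- T)" using st by (auto intro: compact_imp_closed)
 then obtain d0 where d0: "d0 > 0" "square x d0 \<subseteq> - T" using open_contains_square st(7) by blast
 have "\<exists>X. connected X \<and> a \<in> X \<and> b \<in> X \<and> X \<subseteq> U - csquare x r"
  if r: "r < min d0 r1" and ab: "a \<in> U - square x r1" "b \<in> U - square x r1" for r a b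
 proof -
  define S where "S = s \<union> csquare x r"
  have cs: "csquare x r \<subseteq> square x d0" "csquare x r \<subseteq> square x r1" using r by (auto simp: square_def csquare_def)
  have cS: "compact S" unfolding S_def using st by (auto intro!: compact_Un)
  have "S \<inter> G = s" using st d0 cs by (auto simp: S_def)
  moreover have "connected_component (- S) a b" unfolding connected_component_def
   using ab st cs connected_compl_square[of x r1] by (intro exI[of _ "- square x r1"]) (auto simp: S_def)
  ultimately have "connected_component (- (S \<union> G)) a b"
   using cS J(1) J(7)[of a b] ab st by (intro Janiszewski) (auto intro: compact_imp_closed)
  then obtain X where X: "connected X" "X \<subseteq> - (S \<union> G)" "a \<in> X" "b \<in> X" by (auto simp: connected_component_def)
  moreover have "X \<subseteq> U" using J(8)[OF X(1) _ X(3)] X ab by auto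
  ultimately show ?thesis by (intro exI[of _ X]) (auto simp: S_def)
 qed
 then show ?thesis using d0 r1 by (intro exI[of _ "min d0 r1"]) auto
qed

lemma open_connected_real:
 fixes J :: "real set"
 assumes "open J" "connected J" "bounded J" "J \<noteq> {}"
 obtains s s' where "s < s'" "J = {s<..<s'}"
proof -
 have bb: "bdd_below J" "bdd_above J" using assms(3) bounded_imp_bdd_below bounded_imp_bdd_above by auto
 have "J = {Inf J<..<Sup J}"
 proof (intro subset_antisym subsetI)
  fix t assume t: "t \<in> J"
  obtain e where e: "e > 0" "ball t e \<subseteq> J" using assms(1) t openE by blast
  have "t - e/2 \<in> J" "t + e/2 \<in> J" using e by (auto simp: dist_real_def subset_iff)
  then have "Inf J \<le> t - e/2" "t + e/2 \<le> Sup J" using bb by (auto intro: cInf_lower cSup_upper)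
  then show "t \<in> {Inf J<..<Sup J}" using e by auto
 next
  fix t assume t: "t \<in> {Inf J<..<Sup J}"
  obtain a b where "a \<in> J" "a < t" "b \<in> J" "t < b" using t bb assms(4) by (auto simp: cInf_less_iff less_cSup_iff)
  then show "t \<in> J" using connectedD_interval[OF assms(2), of a b t] by auto
 qed
 moreover have "Inf J < Sup J" using calculation assms(4) by auto
 ultimately show ?thesis using that by blast
qed

text \<open>Some arc of the small square separates the points of \<open>U\<close> close to
  \<open>x\<close> from a far point. A path in \<open>U\<close> from a near point \<open>a0\<close>
  to a far point \<open>b\<close> is met by finitely many arcs of the square inside
  \<open>U\<close>. If none of them separated \<open>a0\<close> from \<open>b\<close>, Janiszewski's
  theorem would allow adding them one by one, and after them the rest of the square, which the path
  avoids. The resulting connected set would join \<open>a0\<close> to \<open>b\<close> without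
  meeting the square, although it has to pass its level. The bound \<open>4 * pi\<close> arises
  because the period starts at an angle below \<open>2 * pi\<close>.\<close>

lemma square_crosscut:
 assumes JS: "jordan_side H U" and x: "x \<in> H" and r1: "0 < r1" and far: "U - square x r1 \<noteq> {}"
 shows "\<exists>r0>0. \<forall>r. 0 < r --> r < r0 --> (\<exists>s s' N d. 0 \<le> s \<and> s < s' \<and> s' \<le> 4 * pi \<and>
   square_path x r ` {s<..<s'} \<subseteq> U \<and> square_path x r s \<in> H \<and> square_path x r s' \<in> H \<and>
   0 < d \<and> (U \<union> H) \<inter> square x d \<subseteq> N \<and> N \<subseteq> (U \<union> H) \<inter> csquare x r1 \<and>
   (\<forall>X. connected X --> X \<subseteq> U \<union> H --> X \<inter> square_path x r ` {s..s'} = {} --> X \<inter> N \<noteq> {} --> X \<subseteq> N))"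
proof -
 note J = jordan_sideD[OF JS]
 obtain r0 where r0: "r0 > 0" "r0 \<le> r1"
  and farc: "\<And>r a b. r < r0 ==> a \<in> U - square x r1 ==> b \<in> U - square x r1 ==>
   \<exists>X. connected X \<and> a \<in> X \<and> b \<in> X \<and> X \<subseteq> U - csquare x r"
  using jordan_side_far_connected[OF JS x r1] by metis
 obtain b where b: "b \<in> U" "b \<notin> square x r1" using far by auto
 \<comment> \<open>A second point of \<open>H\<close> forces the connected curve to meet every small
   enough square.\<close>
 obtain q where q: "q \<in> H" "q \<noteq> x"
 proof -
  obtain c where c: "simple_path c" "path_image c = H" using JS by (auto simp: jordan_curve_def jordan_side_def)
  have "c 0 \<noteq> c (1/2)" using c(1) unfolding simple_path_def loop_free_def by fastforce
  moreover have "c 0 \<in> H" "c (1/2) \<in> H" using c(2) by (auto simp: path_image_def)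
  ultimately show ?thesis using that by metis
 qed
 define r2 where "r2 = min r0 (sup_norm (q - x))"
 have r2: "0 < r2"
 proof -
  have "sup_norm (q - x) \<noteq> 0" using q by simp
  then show ?thesis using r0 sup_norm_nonneg[of "q - x"] unfolding r2_def by linarith
 qed
 have "\<exists>s s' N d. 0 \<le> s \<and> s < s' \<and> s' \<le> 4 * pi \<and>
   square_path x r ` {s<..<s'} \<subseteq> U \<and> square_path x r s \<in> H \<and> square_path x r s' \<in> H \<and>
   0 < d \<and> (U \<union> H) \<inter> square x d \<subseteq> N \<and> N \<subseteq> (U \<union> H) \<inter> csquare x r1 \<and>
   (\<forall>X. connected X --> X \<subseteq> U \<union> H --> X \<inter> square_path x r ` {s..s'} = {} --> X \<inter> N \<noteq> {} --> X \<subseteq> N)"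
  if r: "0 < r" "r < r2" for r
 proof -
  define p where "p = square_path x r"
  have pn: "sup_norm (p t - x) = r" for t using square_path_norm[of r x t] r by (simp add: p_def)
  have pc: "continuous_on B p" for B by (simp add: p_def continuous_on_square_path)
  obtain z where z: "z \<in> H" "sup_norm (z - x) = r" using connected_meets_square[OF J(2), of x x r q] x q r by (auto simp: r2_def)
  obtain t0 where t0: "t0 \<in> {0..<2*pi}" "p t0 = z" using square_path_surj[OF r(1) z(2), of 0] by (auto simp: p_def)
  \<comment> \<open>Starting the period at a point of \<open>H\<close> keeps components of
    \<open>G\<close> from running over the ends of the parameter interval.\<close>
  have pt0: "p t0 \<in> H" "p (t0 + 2 * pi) \<in> H" using t0 z square_path_periodic[of x r t0] by (auto simp: p_def)
  have inj: "s = t" if "p s = p t" "t0 < s" "s < t0 + 2 * pi" "t0 \<le> t" "t \<le> t0 + 2 * pi" for s t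
   using square_path_inj_interval[OF r(1)] that by (auto simp: p_def)
  define G where "G = p -` U \<inter> {t0<..<t0 + 2 * pi}"
  have Gop: "open G" unfolding G_def using continuous_on_open_vimage[of "{t0<..<t0 + 2 * pi}" p] pc J(3) by (auto simp: Int_commute)
  \<comment> \<open>Points of \<open>U\<close> in the square of radius \<open>d\<close> can be
    joined inside the square of radius \<open>r\<close>, so all of them end up on the side of
    \<open>a0\<close>.\<close>
  obtain d where d: "0 < d" "d \<le> r" and dX: "\<And>a b. a \<in> U \<inter> square x d ==> b \<in> U \<inter> square x d ==>
    \<exists>X. connected X \<and> a \<in> X \<and> b \<in> X \<and> X \<subseteq> U \<inter> square x r"
   using jordan_side_locally_connected[OF JS x r(1)] by metis
  have near: "\<exists>a\<in>U. a \<in> B" if "y \<in> H" "open B" "y \<in> B" for y B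
   using that J(6) closure_iff_nhds_not_empty[of y U] by (metis UnI2 disjoint_iff open_Int_closure_eq_empty)
  obtain a0 where a0: "a0 \<in> U" "a0 \<in> square x d" using near[OF x, of "square x d"] d centre_in_square by auto
  have a0r: "sup_norm (a0 - x) < r" using a0 d by (simp add: square_def)
  have br: "r < sup_norm (b - x)" using b r r0 by (simp add: square_def r2_def)
  have "path_connected U" using J(3,4) connected_open_path_connected by blast
  then obtain w where w: "path w" "path_image w \<subseteq> U" "pathstart w = a0" "pathfinish w = b"
   using a0 b unfolding path_connected_def by blast
  \<comment> \<open>The parameters at which the square meets the path; compactness leaves finitely
    many components to consider.\<close>
  define T where "T = {t0..t0 + 2 * pi} \<inter> p -` path_image w"
  have "compact T"
  proof -
   have "closed T" unfolding T_def using w(1) by (intro continuous_closed_preimage pc closed_path_image) auto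
   then show ?thesis unfolding T_def by (metis compact_Icc compact_Int_closed closed_Int compact_eq_bounded_closed bounded_Int)
  qed
  have TG: "T \<subseteq> G"
  proof
   fix t assume t: "t \<in> T"
   then have "p t \<in> U" using w by (auto simp: T_def)
   then have "t \<noteq> t0" "t \<noteq> t0 + 2 * pi" using pt0 J(5) by auto
   then show "t \<in> G" using t \<open>p t \<in> U\<close> by (auto simp: T_def G_def)
  qed
  then have "T \<subseteq> \<Union>(components G)" by (simp add: Union_components)
  then obtain \<J> where \<J>: "\<J> \<subseteq> components G" "finite \<J>" "T \<subseteq> \<Union>\<J>"
   using compactE[OF \<open>compact T\<close>, of "components G"] Gop open_components by metis
  \<comment> \<open>The end points of a component lie in the closure of \<open>U\<close>. They are
    not in \<open>U\<close>, since otherwise the component could be enlarged; so they lie on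
    \<open>H\<close>.\<close>
  have comp: "\<exists>s s'. s < s' \<and> J = {s<..<s'} \<and> t0 \<le> s \<and> s' \<le> t0 + 2 * pi \<and> p s \<in> H \<and> p s' \<in> H"
   if JG: "J \<in> components G" for J
  proof -
   have JGs: "J \<subseteq> G" "connected J" "open J" "J \<noteq> {}"
    using in_components_subset[OF JG] in_components_connected[OF JG] open_components[OF Gop JG]
     in_components_nonempty[OF JG] by blast+
   have "bounded G" unfolding G_def by (rule bounded_subset[of "{t0<..<t0 + 2 * pi}"]) auto
   then have "bounded J" using JGs bounded_subset by blast
   then obtain s s' where s: "s < s'" "J = {s<..<s'}" using open_connected_real[of J] JGs by metis
   have lim: "t0 \<le> s" "s' \<le> t0 + 2 * pi"
   proof -
    have sub: "{s<..<s'} \<subseteq> {t0<..<t0 + 2 * pi}" using JGs s by (auto simp: G_def)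
    then show "t0 \<le> s" "s' \<le> t0 + 2 * pi" using s(1) by (auto simp: greaterThanLessThan_subseteq_greaterThanLessThan)
   qed
   have clU: "p t \<in> U \<union> H" if "t \<in> {s..s'}" for t
   proof -
    have "{s..s'} = closure J" using s by simp
    then have "p ` {s..s'} \<subseteq> closure (p ` J)" using image_closure_subset[OF pc closed_closure closure_subset, of J] by metis
    also have "\<dots> \<subseteq> closure U" using JGs by (intro closure_mono) (auto simp: G_def)
    finally show ?thesis using that J(6) by blast
   qed
   have "p s \<in> H"
   proof (rule ccontr)
    assume "p s \<notin> H"
    then have "p s \<in> U" using clU[of s] s(1) by auto
    then have "s \<in> G" using \<open>p s \<notin> H\<close> pt0 lim s by (auto simp: G_def less_le)
    then have "{s..<s'} \<subseteq> G" using JGs s by (auto simp: less_le)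
    moreover have "J \<inter> {s..<s'} \<noteq> {}"
    proof -
     have "J \<subseteq> {s..<s'}" using s by auto
     then show ?thesis using JGs(4) by blast
    qed
    ultimately have "{s..<s'} \<subseteq> J" using components_maximal[OF JG, of "{s..<s'}"] by simp
    then show False using s by auto
   qed
   moreover have "p s' \<in> H"
   proof (rule ccontr)
    assume "p s' \<notin> H"
    then have "p s' \<in> U" using clU[of s'] s(1) by auto
    then have "s' \<in> G" using \<open>p s' \<notin> H\<close> pt0 lim s by (auto simp: G_def less_le)
    then have "{s<..s'} \<subseteq> G" using JGs s by (auto simp: less_le)
    moreover have "J \<inter> {s<..s'} \<noteq> {}"
    proof -
     have "J \<subseteq> {s<..s'}" using s by auto
     then show ?thesis using JGs(4) by blast
    qed
    ultimately have "{s<..s'} \<subseteq> J" using components_maximal[OF JG, of "{s<..s'}"] by simp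
    then show False using s by auto
   qed
   ultimately show ?thesis using s lim by blast
  qed
  have comp_cpt: "compact (H \<union> p ` J)" if JG: "J \<in> components G" for J
  proof -
   obtain s s' where s: "s < s'" "J = {s<..<s'}" "p s \<in> H" "p s' \<in> H" using comp[OF JG] by blast
   have "{s..s'} = {s<..<s'} \<union> {s, s'}" using s(1) by auto
   then have "H \<union> p ` J = H \<union> p ` {s..s'}" using s by auto
   then show ?thesis using J(1) pc by (auto intro!: compact_Un compact_continuous_image)
  qed
  have compU: "p ` J \<subseteq> U" "J \<subseteq> {t0<..<t0 + 2 * pi}" if "J \<in> components G" for J
   using in_components_subset[OF that] by (auto simp: G_def)
  have "\<exists>J\<in>\<J>. \<not> connected_component (- (H \<union> p ` J)) a0 b"
  proof (rule ccontr)
   assume "\<not> ?thesis"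
   then have all: "connected_component (- (H \<union> p ` J)) a0 b" if "J \<in> \<J>" for J using that by blast
   \<comment> \<open>The arcs are added one at a time: together with \<open>H\<close>, a new arc
     meets the old ones exactly in \<open>H\<close>, which is connected.\<close>
   have fin: "connected_component (- (H \<union> p ` \<Union>\<K>)) a0 b \<and> compact (H \<union> p ` \<Union>\<K>)" if "finite \<K>" "\<K> \<subseteq> \<J>" for \<K>
    using that
   proof (induction \<K> rule: finite_induct)
    case empty then show ?case using J(1) J(7)[OF a0(1) b(1)] by simp
   next
    case (insert C \<K>)
    have C: "C \<in> components G" "\<K> \<subseteq> components G" using insert \<J> by auto
    have eq: "H \<union> p ` \<Union>(insert C \<K>) = (H \<union> p ` C) \<union> (H \<union> p ` \<Union>\<K>)" by auto
    have "p ` C \<inter> p ` \<Union>\<K> = {}"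
    proof (rule ccontr)
     assume "p ` C \<inter> p ` \<Union>\<K> \<noteq> {}"
     then obtain s t D where st: "s \<in> C" "D \<in> \<K>" "t \<in> D" "p s = p t" by auto
     then have "s = t" using inj[of s t] compU(2)[OF C(1)] compU(2)[of D] C by fastforce
     then have "C = D" using components_nonoverlap[of C G D] st C by auto
     then show False using st insert by auto
    qed
    then have "(H \<union> p ` C) \<inter> (H \<union> p ` \<Union>\<K>) = H" by auto
    then have conn: "connected ((H \<union> p ` C) \<inter> (H \<union> p ` \<Union>\<K>))" using J(2) by simp
    have IH: "connected_component (- (H \<union> p ` \<Union>\<K>)) a0 b" "compact (H \<union> p ` \<Union>\<K>)" and CJ: "C \<in> \<J>"
     using insert by blast+
    have "connected_component (- ((H \<union> p ` C) \<union> (H \<union> p ` \<Union>\<K>))) a0 b"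
     by (rule Janiszewski[OF comp_cpt[OF C(1)] compact_imp_closed[OF IH(2)] conn all[OF CJ] IH(1)])
    moreover have "compact ((H \<union> p ` C) \<union> (H \<union> p ` \<Union>\<K>))" by (rule compact_Un[OF comp_cpt[OF C(1)] IH(2)])
    ultimately show ?case unfolding eq by blast
   qed
   \<comment> \<open>\<open>?S\<close> collects the finitely many arcs and \<open>?T\<close> the
     rest of the square; injectivity of the parametrization makes them meet in \<open>H\<close>
     only.\<close>
   let ?S = "H \<union> p ` \<Union>\<J>" and ?T = "H \<union> p ` ({t0..t0 + 2 * pi} - \<Union>\<J>)"
   have "open (\<Union>\<J>)" using \<J> Gop open_components by (intro open_Union) auto
   then have cT: "compact ?T" using J(1) pc by (intro compact_Un compact_continuous_image compact_diff) auto
   have ST: "?S \<inter> ?T = H"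
   proof -
    have "p ` \<Union>\<J> \<inter> p ` ({t0..t0 + 2 * pi} - \<Union>\<J>) = {}"
    proof (rule ccontr)
     assume "\<not> ?thesis"
     then obtain s t C where st: "s \<in> C" "C \<in> \<J>" "t \<in> {t0..t0 + 2 * pi}" "t \<notin> \<Union>\<J>" "p s = p t" by blast
     then have "s = t" using inj[of s t] compU(2)[of C] \<J> by fastforce
     then show False using st by auto
    qed
    then show ?thesis by auto
   qed
   \<comment> \<open>By the choice of the components the path avoids the rest of the square, so it
     joins \<open>a0\<close> to \<open>b\<close> there.\<close>
   have ccT: "connected_component (- ?T) a0 b"
   proof -
    have "path_image w \<inter> ?T = {}" using w J(5) \<J>(3) by (auto simp: T_def)
    moreover have "a0 \<in> path_image w" "b \<in> path_image w" using w pathstart_in_path_image pathfinish_in_path_image by metis+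
    ultimately show ?thesis unfolding connected_component_def using w connected_path_image[OF w(1)] by (intro exI[of _ "path_image w"]) auto
   qed
   have SJ: "compact ?S" "connected_component (- ?S) a0 b" using fin[OF \<J>(2)] by blast+
   have conn: "connected (?S \<inter> ?T)" using ST J(2) by (simp only:)
   have "connected_component (- (?S \<union> ?T)) a0 b" by (rule Janiszewski[OF SJ(1) compact_imp_closed[OF cT] conn SJ(2) ccT])
   then obtain X where X: "connected X" "X \<subseteq> - (?S \<union> ?T)" "a0 \<in> X" "b \<in> X" by (auto simp: connected_component_def)
   obtain y where y: "y \<in> X" "sup_norm (y - x) = r" using connected_meets_square[OF X(1,3) a0r X(4) br] by auto
   obtain t where t: "t \<in> {t0..<t0 + 2*pi}" "p t = y" using square_path_surj[OF r(1) y(2), of t0] by (auto simp: p_def)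
   have "y \<in> p ` {t0..t0 + 2 * pi}" using t by (intro image_eqI[of _ _ t]) auto
   then have "y \<in> ?S \<union> ?T" by blast
   then show False using X y by blast
  qed
  then obtain C where C: "C \<in> components G" "\<not> connected_component (- (H \<union> p ` C)) a0 b" using \<J> by auto
  obtain s s' where s: "s < s'" "C = {s<..<s'}" "t0 \<le> s" "s' \<le> t0 + 2 * pi" "p s \<in> H" "p s' \<in> H" using comp[OF C(1)] by blast
  define A where "A = p ` {s..s'}"
  have "{s..s'} = {s<..<s'} \<union> {s, s'}" using s(1) by auto
  then have GA: "H \<union> p ` C = H \<union> A" unfolding A_def using s by auto
  have cA: "compact A" unfolding A_def using pc by (intro compact_continuous_image) auto
  have An: "sup_norm (y - x) = r" if "y \<in> A" for y using that pn by (auto simp: A_def)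
  define R where "R = connected_component_set (- (H \<union> A)) a0"
  have bR: "b \<notin> R" using C(2) unfolding GA R_def by simp
  have a0A: "a0 \<notin> H \<union> A" using a0 J(5) An a0r by fastforce
  have a0R: "a0 \<in> R" using a0A by (simp add: R_def)
  have Rsub: "R \<subseteq> - (H \<union> A)" "connected R" unfolding R_def by (rule connected_component_subset, rule connected_connected_component)
  have Rmax: "X \<subseteq> R" if "connected X" "X \<inter> (H \<union> A) = {}" "a \<in> X" "a \<in> R" for X a
  proof -
   have "connected_component_set (- (H \<union> A)) a = R" using that(4) unfolding R_def by (metis connected_component_eq)
   then show ?thesis using connected_component_maximal[of a X "- (H \<union> A)"] that by auto
  qed
  have Rop: "open R" unfolding R_def using J(1) cA by (intro open_connected_component) (auto intro: compact_imp_closed)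
  have RU: "R \<subseteq> U" using J(8)[OF Rsub(2) _ a0R a0(1)] Rsub(1) by auto
  \<comment> \<open>A point of \<open>R\<close> outside the larger square could be joined to
    \<open>b\<close> off the closed small square, hence off the arc, contrary to the choice of the
    arc.\<close>
  have Rr1: "R \<subseteq> square x r1"
  proof
   fix y assume y: "y \<in> R"
   show "y \<in> square x r1"
   proof (rule ccontr)
    assume "y \<notin> square x r1"
    then obtain X where X: "connected X" "y \<in> X" "b \<in> X" "X \<subseteq> U - csquare x r"
     using farc[of r y b] y RU b r by (auto simp: r2_def)
    have "u \<notin> H \<union> A" if "u \<in> X" for u using that X(4) J(5) An[of u] by (auto simp: csquare_def)
    then have "X \<inter> (H \<union> A) = {}" by blast
    then show False using Rmax[OF X(1) _ X(2) y] X(3) bR by auto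
   qed
  qed
  have clR: "y \<in> R" if yc: "y \<in> closure R" "y \<in> U" "y \<notin> A" for y
  proof -
   have "open (U - A)" using J(3) cA by (auto intro: compact_imp_closed)
   then obtain e where e: "e > 0" "square y e \<subseteq> U - A" using open_contains_square yc by blast
   have "square y e \<inter> R \<noteq> {}" using yc(1) e centre_in_square[of e y] by (metis disjoint_iff open_Int_closure_eq_empty open_square)
   then obtain v where v: "v \<in> square y e" "v \<in> R" by auto
   have "square y e \<inter> (H \<union> A) = {}" using e J(5) by auto
   then have "square y e \<subseteq> R" using v convex_connected[OF convex_square] by (intro Rmax) auto
   then show ?thesis using e centre_in_square by auto
  qed
  \<comment> \<open>The points of \<open>H\<close> reached by \<open>R\<close> are included, so that
    connected sets running along the curve are caught too.\<close>
  define N where "N = ((U \<union> H) - A) \<inter> closure R"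
  have N1: "(U \<union> H) \<inter> square x d \<subseteq> N"
  proof
   fix y assume y: "y \<in> (U \<union> H) \<inter> square x d"
   have yA: "y \<notin> A" using y An[of y] d by (auto simp: square_def)
   have inR: "v \<in> R" if "v \<in> U \<inter> square x d" for v
   proof -
    obtain X where X: "connected X" "a0 \<in> X" "v \<in> X" "X \<subseteq> U \<inter> square x r" using dX[of a0 v] a0 \<open>v \<in> U \<inter> square x d\<close> by auto
    have "u \<notin> H \<union> A" if "u \<in> X" for u using that X(4) J(5) An[of u] by (auto simp: square_def)
    then have "X \<inter> (H \<union> A) = {}" by blast
    then show ?thesis using Rmax[OF X(1) _ X(2) a0R] X(3) by blast
   qed
   have "y \<in> closure R"
   proof (cases "y \<in> U")
    case True then show ?thesis using inR y closure_subset by blast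
   next
    case False
    then have yG: "y \<in> H" using y by auto
    show ?thesis unfolding closure_iff_nhds_not_empty
    proof (intro allI impI)
     fix B V assume "V \<subseteq> B" "open V" "y \<in> V"
     then obtain v where "v \<in> U" "v \<in> V \<inter> square x d" using near[OF yG, of "V \<inter> square x d"] y by (auto simp: open_Int)
     then show "R \<inter> B \<noteq> {}" using inR \<open>V \<subseteq> B\<close> by blast
    qed
   qed
   then show "y \<in> N" using y yA by (auto simp: N_def)
  qed
  have N2: "N \<subseteq> (U \<union> H) \<inter> csquare x r1"
  proof -
   have "R \<subseteq> csquare x r1" using Rr1 by (auto simp: square_def csquare_def)
   then have "closure R \<subseteq> csquare x r1" by (intro closure_minimal) (auto intro: compact_imp_closed)
   then show ?thesis by (auto simp: N_def)
  qed
  have N3: "X \<subseteq> N" if X: "connected X" "X \<subseteq> U \<union> H" "X \<inter> A = {}" "X \<inter> N \<noteq> {}" for X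
  proof -
   \<comment> \<open>The trace of this open set on the union of \<open>U\<close> and
     \<open>H\<close> lies in the closure of \<open>R\<close>, and every point of \<open>X\<close>
     in that closure belongs to it. So \<open>X\<close> is split into two relatively open parts, one
     of which is empty. At points of \<open>H\<close> this rests on local connectedness of the
     side.\<close>
   define W where "W = \<Union>{B. open B \<and> (U \<union> H) \<inter> B \<subseteq> closure R}"
   have Wop: "open W" unfolding W_def by auto
   have Wsub: "X \<inter> W \<subseteq> closure R" using X unfolding W_def by blast
   have inW: "y \<in> W" if y: "y \<in> X" "y \<in> closure R" for y
   proof (cases "y \<in> U")
    case True
    then have "y \<in> R" using clR[of y] y X by auto
    then show ?thesis unfolding W_def using Rop closure_subset[of R] by blast
   next
    case False
    then have yG: "y \<in> H" using y X by auto
    have "open (- A)" using cA by (auto intro: compact_imp_closed)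
    then obtain e where e: "e > 0" "square y e \<subseteq> - A" using open_contains_square[of "- A" y] y X by blast
    obtain d' where d': "0 < d'" and dX': "\<And>a b. a \<in> U \<inter> square y d' ==> b \<in> U \<inter> square y d' ==>
      \<exists>X. connected X \<and> a \<in> X \<and> b \<in> X \<and> X \<subseteq> U \<inter> square y e"
     using jordan_side_locally_connected[OF JS yG e(1)] by metis
    have "square y d' \<inter> R \<noteq> {}" using y(2) d' centre_in_square[of d' y]
     by (metis disjoint_iff open_Int_closure_eq_empty open_square)
    then obtain v where v: "v \<in> square y d'" "v \<in> R" by auto
    have inR: "u \<in> R" if "u \<in> U \<inter> square y d'" for u
    proof -
     obtain Z where Z: "connected Z" "v \<in> Z" "u \<in> Z" "Z \<subseteq> U \<inter> square y e" using dX'[of v u] v RU \<open>u \<in> U \<inter> square y d'\<close> by auto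
     then have "Z \<inter> (H \<union> A) = {}" using J(5) e by auto
     then show ?thesis using Rmax[OF Z(1) _ Z(2) v(2)] Z by auto
    qed
    have "(U \<union> H) \<inter> square y d' \<subseteq> closure R"
    proof
     fix u assume u: "u \<in> (U \<union> H) \<inter> square y d'"
     show "u \<in> closure R"
     proof (cases "u \<in> U")
      case True then show ?thesis using inR u closure_subset by blast
     next
      case False
      then have uG: "u \<in> H" using u by auto
      show ?thesis unfolding closure_iff_nhds_not_empty
      proof (intro allI impI)
       fix B V assume "V \<subseteq> B" "open V" "u \<in> V"
       then obtain v where "v \<in> U" "v \<in> V \<inter> square y d'" using near[OF uG, of "V \<inter> square y d'"] u by (auto simp: open_Int)
       then show "R \<inter> B \<noteq> {}" using inR \<open>V \<subseteq> B\<close> by blast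
      qed
     qed
    qed
    moreover have "y \<in> square y d'" using d' by (rule centre_in_square)
    ultimately show ?thesis unfolding W_def by (intro UnionI[of "square y d'"] CollectI conjI open_square)
   qed
   have "X \<subseteq> W \<union> - closure R" using inW by blast
   moreover have "W \<inter> - closure R \<inter> X = {}" using Wsub by auto
   ultimately have "W \<inter> X = {} \<or> - closure R \<inter> X = {}" using connectedD[OF X(1) Wop, of "- closure R"] by auto
   moreover have "W \<inter> X \<noteq> {}" using X(4) inW by (auto simp: N_def)
   ultimately show ?thesis using X by (auto simp: N_def)
  qed
  have 1: "0 \<le> s" "s' \<le> 4 * pi" using s t0 by auto
  have 2: "p ` {s<..<s'} \<subseteq> U" using compU(1)[OF C(1)] s by simp
  have 3: "\<forall>X. connected X --> X \<subseteq> U \<union> H --> X \<inter> p ` {s..s'} = {} --> X \<inter> N \<noteq> {} --> X \<subseteq> N"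
   using N3 unfolding A_def by blast
  show ?thesis unfolding p_def[symmetric] by (intro exI[of _ s] exI[of _ s'] exI[of _ N] exI[of _ d] conjI) (fact s 1 2 3 d N1 N2)+
 qed
 then show ?thesis using r2 by blast
qed

section \<open>Null sets and axis-parallel lines\<close>

text \<open>Measurability of \<open>B\<close> is not assumed: \<open>B\<close> lies in the
  measurable set where all majorants are at least one, and that set is null by Markov's
  inequality.\<close>

lemma AE_notin_of_small_integrals:
 fixes B :: "real set"
 assumes "\<And>e::real. e > 0 ==> \<exists>h\<in>borel_measurable borel. (\<integral>\<^sup>+x. h x \<partial>lborel) \<le> ennreal e \<and> (\<forall>x\<in>B. 1 \<le> h x)"
 shows "AE x in lborel. x \<notin> B"
proof -
 have "\<forall>n::nat. \<exists>h\<in>borel_measurable borel. (\<integral>\<^sup>+x. h x \<partial>lborel) \<le> ennreal (1 / Suc n) \<and> (\<forall>x\<in>B. 1 \<le> h x)"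
  using assms by simp
 then obtain h where h: "\<And>n::nat. h n \<in> borel_measurable borel" "\<And>n. (\<integral>\<^sup>+x. h n x \<partial>lborel) \<le> ennreal (1 / Suc n)"
  "\<And>n x. x \<in> B ==> 1 \<le> h n x" by metis
 have [measurable]: "h n \<in> borel_measurable lborel" for n using h(1) by simp
 have le: "emeasure lborel {x\<in>space lborel. \<forall>n. 1 \<le> h n x} \<le> ennreal (1 / Suc n)" for n
 proof -
  have "emeasure lborel {x\<in>space lborel. \<forall>n. 1 \<le> h n x} \<le> emeasure lborel {x\<in>space lborel. 1 \<le> 1 * h n x}"
   by (intro emeasure_mono) auto
  also have "\<dots> \<le> 1 * (\<integral>\<^sup>+x. h n x * indicator (space lborel) x \<partial>lborel)"
   by (rule nn_integral_Markov_inequality) auto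
  also have "\<dots> \<le> ennreal (1 / Suc n)" using h(2)[of n] by simp
  finally show ?thesis .
 qed
 have "emeasure lborel {x\<in>space lborel. \<forall>n. 1 \<le> h n x} = 0"
 proof (rule ccontr)
  assume ne: "emeasure lborel {x\<in>space lborel. \<forall>n. 1 \<le> h n x} \<noteq> 0"
  have "emeasure lborel {x\<in>space lborel. \<forall>n. 1 \<le> h n x} \<le> 1" using le[of 0] by simp
  then obtain c where c: "emeasure lborel {x\<in>space lborel. \<forall>n. 1 \<le> h n x} = ennreal c" "0 < c"
   using ne by (cases "emeasure lborel {x\<in>space lborel. \<forall>n. 1 \<le> h n x}") (auto simp: top_unique)
  obtain n where "inverse (real (Suc n)) < c" using reals_Archimedean c by blast
  then show False using le[of n] c by (simp add: inverse_eq_divide)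
 qed
 then have "AE x in lborel. \<not> (\<forall>n. 1 \<le> h n x)" by (intro AE_I[of _ _ "{x\<in>space lborel. \<forall>n. 1 \<le> h n x}"]) auto
 then show ?thesis using h(3) by (auto elim!: eventually_mono)
qed

text \<open>The weighted inequality between arithmetic and geometric mean. It does the work of
  Cauchy-Schwarz without square roots of extended values; the weight \<open>t\<close> is tuned at
  each use.\<close>

lemma ennreal_le_square_plus: "(a::ennreal) * ennreal d \<le> ennreal t * a^2 + ennreal (d^2 / t)" if "0 < t" "0 \<le> d"
proof (cases a)
 case (real r)
 have "0 \<le> (t * r - d)^2 + t * r * d" using real that by (intro add_nonneg_nonneg) auto
 then have "r * d * t \<le> t * r^2 * t + d^2" by (simp add: power2_eq_square algebra_simps)
 then have "r * d \<le> t * r^2 + d^2 / t" using that by (simp add: field_simps)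
 then show ?thesis using real that by (simp add: ennreal_mult[symmetric] ennreal_power ennreal_plus[symmetric] ennreal_leI del: ennreal_plus)
next
 case top
 then show ?thesis using that by (simp add: ennreal_mult_top power2_eq_square ennreal_top_mult)
qed

lemma lborel_complex: "lborel = distr (lborel \<Otimes>\<^sub>M lborel) borel (\<lambda>(x, y). Complex x y)"
proof (rule lborel_eqI)
 have m: "(\<lambda>(x, y). Complex x y) \<in> borel_measurable (lborel \<Otimes>\<^sub>M lborel)"
  by (auto simp: borel_measurable_complex_iff case_prod_beta)
 fix l u :: complex assume "\<And>b. b \<in> Basis ==> l \<bullet> b \<le> u \<bullet> b"
 from this[of 1] this[of \<i>] have lu: "Re l \<le> Re u" "Im l \<le> Im u" by (auto simp: Basis_complex_def)
 have "emeasure (distr (lborel \<Otimes>\<^sub>M lborel) borel (\<lambda>(x, y). Complex x y)) (box l u)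
   = emeasure (lborel \<Otimes>\<^sub>M lborel) ((\<lambda>(x, y). Complex x y) -` box l u \<inter> space (lborel \<Otimes>\<^sub>M lborel))"
  using m by (intro emeasure_distr) auto
 also have "(\<lambda>(x, y). Complex x y) -` box l u \<inter> space (lborel \<Otimes>\<^sub>M lborel) = {Re l<..<Re u} \<times> {Im l<..<Im u}"
  by (auto simp: in_box_complex_iff space_pair_measure)
 also have "emeasure (lborel \<Otimes>\<^sub>M lborel) \<dots> = emeasure lborel {Re l<..<Re u} * emeasure lborel {Im l<..<Im u}"
  by (intro lborel.emeasure_pair_measure_Times) auto
 also have "\<dots> = (\<Prod>b\<in>Basis. (u - l) \<bullet> b)" using lu by (simp add: Basis_complex_def ennreal_mult'')
 finally show "emeasure (distr (lborel \<Otimes>\<^sub>M lborel) borel (\<lambda>(x, y). Complex x y)) (box l u) = (\<Prod>b\<in>Basis. (u - l) \<bullet> b)" .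
qed simp

text \<open>The Boolean is the direction, \<open>True\<close> for vertical, so that both directions
  share one proof.\<close>

definition line :: "bool => real => real => complex" where
 "line b X t = (if b then Complex X t else Complex t X)"

lemma dist_line: "dist (line b X s) (line b X t) = \<bar>s - t\<bar>" by (cases b) (simp_all add: line_def dist_complex_def complex_diff cmod_def)

lemma continuous_on_line [continuous_intros]: "continuous_on A (line b X)"
proof -
 have "line b X = (\<lambda>t. if b then of_real X + \<i> * of_real t else of_real t + \<i> * of_real X)" by (auto simp: line_def Complex_eq)
 then show ?thesis by (cases b) (auto intro!: continuous_intros)
qed

lemma nn_integral_lines:
 assumes [measurable]: "f \<in> borel_measurable borel"
 shows "(\<integral>\<^sup>+z. f z \<partial>lborel) = (\<integral>\<^sup>+X. \<integral>\<^sup>+t. f (line b X t) \<partial>lborel \<partial>lborel)"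
proof -
 have m [measurable]: "(\<lambda>(x, y). Complex x y) \<in> borel_measurable (borel \<Otimes>\<^sub>M borel)"
  by (auto simp: borel_measurable_complex_iff case_prod_beta)
 have m' [measurable]: "(\<lambda>(x, y). Complex x y) \<in> borel_measurable (lborel \<Otimes>\<^sub>M lborel)"
  by (auto simp: borel_measurable_complex_iff case_prod_beta)
 have "(\<integral>\<^sup>+z. f z \<partial>lborel) = (\<integral>\<^sup>+p. f (case p of (x, y) => Complex x y) \<partial>(lborel \<Otimes>\<^sub>M lborel))"
  by (subst lborel_complex, subst nn_integral_distr) auto
 also have "\<dots> = (\<integral>\<^sup>+x. \<integral>\<^sup>+y. f (Complex x y) \<partial>lborel \<partial>lborel)"
  by (subst lborel.nn_integral_fst[symmetric]) auto
 finally have 1: "(\<integral>\<^sup>+z. f z \<partial>lborel) = (\<integral>\<^sup>+x. \<integral>\<^sup>+y. f (Complex x y) \<partial>lborel \<partial>lborel)" .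
 have "(\<lambda>(x, y). f (Complex x y)) \<in> borel_measurable (lborel \<Otimes>\<^sub>M lborel)"
  using measurable_compose[OF m' assms] by (simp add: case_prod_beta)
 then have "(\<integral>\<^sup>+x. \<integral>\<^sup>+y. f (Complex x y) \<partial>lborel \<partial>lborel) = (\<integral>\<^sup>+y. \<integral>\<^sup>+x. f (Complex x y) \<partial>lborel \<partial>lborel)"
  by (rule lborel_pair.Fubini'[symmetric])
 then show ?thesis using 1 by (cases b) (auto simp: line_def)
qed

lemma measurable_line_integral [measurable]:
 assumes [measurable]: "f \<in> borel_measurable borel"
 shows "(\<lambda>X. \<integral>\<^sup>+t. f (line b X t) \<partial>lborel) \<in> borel_measurable borel"
proof -
 have "(\<lambda>(X, t). line b X t) \<in> borel_measurable (borel \<Otimes>\<^sub>M lborel)"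
  unfolding line_def by (cases b) (auto simp: borel_measurable_complex_iff case_prod_beta)
 from measurable_compose[OF this assms]
 have "(\<lambda>(X, t). f (line b X t)) \<in> borel_measurable (borel \<Otimes>\<^sub>M lborel)" by (simp add: case_prod_beta)
 then show ?thesis by (rule lborel.borel_measurable_nn_integral)
qed

lemma arc_length_line:
 assumes "a \<le> c" shows "arc_length (line b X) a c = ennreal (c - a)"
proof (rule antisym)
 show "arc_length (line b X) a c \<le> ennreal (c - a)" unfolding arc_length_def
 proof (rule SUP_least, clarify)
  fix n :: nat and t :: "nat => real"
  assume t: "mono_on {..n} t" "t ` {..n} \<subseteq> {a..c}"
  have "(\<Sum>k<n. ennreal (dist (line b X (t k)) (line b X (t (Suc k))))) = (\<Sum>k<n. ennreal (t (Suc k) - t k))"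
  proof (intro sum.cong refl)
   fix k assume "k \<in> {..<n}"
   then have "t k \<le> t (Suc k)" using t(1) by (auto simp: mono_on_def)
   then show "ennreal (dist (line b X (t k)) (line b X (t (Suc k)))) = ennreal (t (Suc k) - t k)" by (simp add: dist_line)
  qed
  also have "\<dots> = ennreal (\<Sum>k<n. t (Suc k) - t k)" using t(1) by (intro sum_ennreal) (auto simp: mono_on_def)
  also have "(\<Sum>k<n. t (Suc k) - t k) = t n - t 0" by (rule sum_lessThan_telescope)
  also have "ennreal (t n - t 0) \<le> ennreal (c - a)"
  proof -
   have "t n \<in> {a..c}" "t 0 \<in> {a..c}" using t(2) by blast+
   then show ?thesis by (intro ennreal_leI) auto
  qed
  finally show "(\<Sum>k<n. ennreal (dist (line b X (t k)) (line b X (t (Suc k))))) \<le> ennreal (c - a)" .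
 qed
 have "(1::nat, (\<lambda>k. if k = 0 then a else c)) \<in> {(n, t). mono_on {..n} t \<and> t ` {..n} \<subseteq> {a..c}}"
  using assms by (auto simp: mono_on_def)
 from SUP_upper[OF this, of "\<lambda>(n, t). \<Sum>k<n. ennreal (dist (line b X (t k)) (line b X (t (Suc k))))"]
 show "ennreal (c - a) \<le> arc_length (line b X) a c" unfolding arc_length_def using assms by (simp add: dist_line)
qed

text \<open>On a line the arc length parametrization is a translation, since the choice operator in
  its definition has only one candidate.\<close>

lemma line_integral_line_le:
 assumes I: "is_interval I" and sub: "I \<subseteq> {-R..R}" and [measurable]: "F \<in> borel_measurable borel"
 shows "line_integral (I, line b X) F \<le> (\<integral>\<^sup>+t. F (line b X t) * indicator {-R..R} t \<partial>lborel)"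
proof -
 have lr: "locally_rectifiable (I, line b X)" unfolding locally_rectifiable_def by (auto simp: arc_length_line)
 have [measurable]: "line b X \<in> borel_measurable borel" by (intro borel_measurable_continuous_onI continuous_on_line)
 show ?thesis unfolding line_integral_def using lr
 proof (simp, intro SUP_least, clarify)
  fix a c assume ac: "a \<in> I" "c \<in> I" "a \<le> c"
  have par: "arc_length_param (line b X) a c l = line b X (a + l)" if "l \<in> {0..c - a}" for l
  proof -
   have "(SOME t. t \<in> {a..c} \<and> arc_length (line b X) a t = ennreal l) = a + l"
    using that by (intro some_equality) (auto simp: arc_length_line)
   then show ?thesis by (simp add: arc_length_param_def)
  qed
  have "(\<integral>\<^sup>+ l \<in> {0..enn2real (arc_length (line b X) a c)}. F (arc_length_param (line b X) a c l) \<partial>lborel)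
    = (\<integral>\<^sup>+ l. F (line b X (a + l)) * indicator {a..c} (a + l) \<partial>lborel)"
   using ac by (intro nn_integral_cong) (auto simp: arc_length_line par indicator_def)
  also have "\<dots> = (\<integral>\<^sup>+ t. F (line b X t) * indicator {a..c} t \<partial>lborel)"
   using nn_integral_real_affine[of "\<lambda>t. F (line b X t) * indicator {a..c} t" 1 a] by simp
  also have "\<dots> \<le> (\<integral>\<^sup>+t. F (line b X t) * indicator {-R..R} t \<partial>lborel)"
   using sub ac by (intro nn_integral_mono) (auto simp: indicator_def subset_iff)
  finally show "(\<integral>\<^sup>+ l \<in> {0..enn2real (arc_length (line b X) a c)}. F (arc_length_param (line b X) a c l) \<partial>lborel)
    \<le> (\<integral>\<^sup>+t. F (line b X t) * indicator {-R..R} t \<partial>lborel)" .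
 qed
qed

lemma mod2_null_obtain:
 assumes "mod2 G = 0" "0 < (e::real)"
 obtains F where "F \<in> borel_measurable borel" "\<And>p. p \<in> G ==> 1 \<le> line_integral p F"
  "(\<integral>\<^sup>+ z. (F z)^2 \<partial>lborel) < ennreal e"
proof -
 have "mod2 G < ennreal e" using assms by simp
 then show ?thesis unfolding mod2_def INF_less_iff using that by auto
qed

text \<open>Fubini turns a function with small square integral into one whose integrals along lines
  are small on average. The majorant depends on the line only, so one null set of lines takes care
  of all subintervals at once.\<close>

lemma mod2_null_lines:
 assumes "mod2 G = 0" "0 < (e::real)" "0 < R"
 shows "\<exists>h\<in>borel_measurable borel. (\<integral>\<^sup>+x. h x \<partial>lborel) \<le> ennreal e \<and>
   (\<forall>X I. (I, line b X) \<in> G --> is_interval I --> I \<subseteq> {-R..R} --> \<bar>X\<bar> \<le> R --> 1 \<le> h X)"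
proof -
 define B where "B = cbox (Complex (-R) (-R)) (Complex R R)"
 define V where "V = 4 * R^2"
 have V: "emeasure lborel B = ennreal V" "V > 0"
 proof -
  have "emeasure lborel B = (\<Prod>b\<in>Basis. (Complex R R - Complex (-R) (-R)) \<bullet> b)"
   unfolding B_def using assms by (intro emeasure_lborel_cbox) (auto simp: Basis_complex_def)
  then show "emeasure lborel B = ennreal V" using assms by (simp add: Basis_complex_def V_def power2_eq_square algebra_simps)
 qed (use assms in \<open>simp add: V_def\<close>)
 \<comment> \<open>With this weight the area of the box contributes \<open>V / t = e / 2\<close>,
   and a square integral below \<open>e / (2 * t)\<close> contributes at most the other
   half.\<close>
 define t where "t = 2 * V / e"
 have t: "t > 0" using V assms by (simp add: t_def)
 have "0 < e / (2 * t)" using t assms by simp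
 then obtain F where F: "F \<in> borel_measurable borel" "\<And>p. p \<in> G ==> 1 \<le> line_integral p F"
  "(\<integral>\<^sup>+ z. (F z)^2 \<partial>lborel) < ennreal (e / (2 * t))" using mod2_null_obtain[OF assms(1)] by metis
 note [measurable] = F(1)
 have Bb[measurable]: "B \<in> sets borel" by (simp add: B_def)
 define h where "h X = (\<integral>\<^sup>+s. F (line b X s) * indicator B (line b X s) \<partial>lborel)" for X
 have "h \<in> borel_measurable borel" unfolding h_def by (rule measurable_line_integral) simp
 moreover have "(\<integral>\<^sup>+x. h x \<partial>lborel) \<le> ennreal e"
 proof -
  have "(\<integral>\<^sup>+x. h x \<partial>lborel) = (\<integral>\<^sup>+z. F z * indicator B z \<partial>lborel)"
   unfolding h_def by (rule nn_integral_lines[symmetric]) simp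
  also have "\<dots> \<le> (\<integral>\<^sup>+z. ennreal t * (F z)^2 + ennreal (1 / t) * indicator B z \<partial>lborel)"
  proof (intro nn_integral_mono)
   fix z show "F z * indicator B z \<le> ennreal t * (F z)^2 + ennreal (1 / t) * indicator B z"
    using ennreal_le_square_plus[of t 1 "F z"] t by (auto simp: indicator_def)
  qed
  also have "\<dots> = ennreal t * (\<integral>\<^sup>+z. (F z)^2 \<partial>lborel) + ennreal (1 / t) * emeasure lborel B"
   by (subst nn_integral_add) (auto simp: nn_integral_cmult)
  also have "\<dots> \<le> ennreal t * ennreal (e / (2 * t)) + ennreal (1 / t) * ennreal V" using F(3) V by (intro add_mono mult_left_mono) auto
  also have "\<dots> = ennreal (t * (e / (2 * t)) + 1 / t * V)"
   using t V assms by (simp add: ennreal_mult[symmetric] ennreal_plus[symmetric] del: ennreal_plus)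
  also have "t * (e / (2 * t)) + 1 / t * V = e" using t V assms by (simp add: t_def field_simps)
  finally show ?thesis .
 qed
 moreover have "1 \<le> h X" if "(I, line b X) \<in> G" "is_interval I" "I \<subseteq> {-R..R}" "\<bar>X\<bar> \<le> R" for X I
 proof -
  have "1 \<le> line_integral (I, line b X) F" using F(2) that by blast
  also have "\<dots> \<le> (\<integral>\<^sup>+t. F (line b X t) * indicator {-R..R} t \<partial>lborel)"
   using that F(1) by (intro line_integral_line_le) auto
  also have "\<dots> = h X" unfolding h_def using that(4) by (intro nn_integral_cong) (auto simp: indicator_def B_def line_def in_cbox_complex_iff)
  finally show ?thesis .
 qed
 ultimately show ?thesis by blast
qed

section \<open>Sets of vanishing one-dimensional Hausdorff measure\<close>

text \<open>A sum of diameters below the mesh size bounds every single diameter, so the mesh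
  condition follows from a small enough sum.\<close>

lemma hausdorff1_eq_0_iff:
 "hausdorff1 A = 0 \<longleftrightarrow>
   (\<forall>e>0. \<exists>C. A \<subseteq> (\<Union>i::nat. C i) \<and> (\<forall>i. bounded (C i)) \<and> (\<Sum>i. ennreal (diameter (C i))) \<le> ennreal e)"
proof
 assume h: "hausdorff1 A = 0"
 show "\<forall>e>0. \<exists>C. A \<subseteq> (\<Union>i::nat. C i) \<and> (\<forall>i. bounded (C i)) \<and> (\<Sum>i. ennreal (diameter (C i))) \<le> ennreal e"
 proof (intro allI impI)
  fix e :: real assume e: "e > 0"
  have "(INF C \<in> {C :: nat => complex set. A \<subseteq> (\<Union>i. C i) \<and> (\<forall>i. bounded (C i) \<and> diameter (C i) \<le> 1)}.
     \<Sum>i. ennreal (diameter (C i))) \<le> hausdorff1 A" unfolding hausdorff1_def by (rule SUP_upper2[of 1]) auto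
  then have "(INF C \<in> {C :: nat => complex set. A \<subseteq> (\<Union>i. C i) \<and> (\<forall>i. bounded (C i) \<and> diameter (C i) \<le> 1)}.
     \<Sum>i. ennreal (diameter (C i))) < ennreal e" using h e by (simp add: order_le_less_trans)
  then show "\<exists>C. A \<subseteq> (\<Union>i::nat. C i) \<and> (\<forall>i. bounded (C i)) \<and> (\<Sum>i. ennreal (diameter (C i))) \<le> ennreal e"
   unfolding INF_less_iff using less_imp_le by blast
 qed
next
 assume r: "\<forall>e>0. \<exists>C. A \<subseteq> (\<Union>i::nat. C i) \<and> (\<forall>i. bounded (C i)) \<and> (\<Sum>i. ennreal (diameter (C i))) \<le> ennreal e"
 have le: "(INF C \<in> {C :: nat => complex set. A \<subseteq> (\<Union>i. C i) \<and> (\<forall>i. bounded (C i) \<and> diameter (C i) \<le> k)}.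
     \<Sum>i. ennreal (diameter (C i))) \<le> 0 + ennreal e" if hyp: "k > 0" "e > 0" for k e :: real
 proof -
  obtain C where C: "A \<subseteq> (\<Union>i::nat. C i)" "\<And>i. bounded (C i)" "(\<Sum>i. ennreal (diameter (C i))) \<le> ennreal (min e k)"
   using r[rule_format, of "min e k"] hyp by auto
  have "diameter (C i) \<le> k" for i
  proof -
   have "ennreal (diameter (C i)) \<le> (\<Sum>i. ennreal (diameter (C i)))"
   proof -
    have "(\<Sum>i\<in>{i}. ennreal (diameter (C i))) \<le> (\<Sum>i. ennreal (diameter (C i)))" by (rule sum_le_suminf[OF summableI]) auto
    then show ?thesis by simp
   qed
   also have "\<dots> \<le> ennreal k" using C(3) by (rule order_trans) (simp add: ennreal_leI)
   finally show ?thesis using that by (simp add: ennreal_le_iff)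
  qed
  then have "C \<in> {C :: nat => complex set. A \<subseteq> (\<Union>i. C i) \<and> (\<forall>i. bounded (C i) \<and> diameter (C i) \<le> k)}"
   using C by auto
  then have "(INF C \<in> {C :: nat => complex set. A \<subseteq> (\<Union>i. C i) \<and> (\<forall>i. bounded (C i) \<and> diameter (C i) \<le> k)}.
     \<Sum>i. ennreal (diameter (C i))) \<le> (\<Sum>i. ennreal (diameter (C i)))" by (rule INF_lower)
  also have "\<dots> \<le> ennreal e" using C(3) by (rule order_trans) (simp add: ennreal_leI)
  finally show ?thesis by simp
 qed
 have "(INF C \<in> {C :: nat => complex set. A \<subseteq> (\<Union>i. C i) \<and> (\<forall>i. bounded (C i) \<and> diameter (C i) \<le> k)}.
     \<Sum>i. ennreal (diameter (C i))) \<le> 0" if d: "k > 0" for k :: real by (rule ennreal_le_epsilon, rule le[OF d])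
 then show "hausdorff1 A = 0" unfolding hausdorff1_def by (intro antisym SUP_least) auto
qed

lemma hausdorff1_null_mono: assumes "hausdorff1 B = 0" "A \<subseteq> B" shows "hausdorff1 A = 0" using assms unfolding hausdorff1_eq_0_iff
proof (intro allI impI)
 fix e :: real
 assume "\<forall>e>0. \<exists>C. B \<subseteq> (\<Union>i::nat. C i) \<and> (\<forall>i. bounded (C i)) \<and> (\<Sum>i. ennreal (diameter (C i))) \<le> ennreal e"
  and AB: "A \<subseteq> B" and "0 < e"
 then obtain C where "B \<subseteq> (\<Union>i::nat. C i)" "\<forall>i. bounded (C i)" "(\<Sum>i. ennreal (diameter (C i))) \<le> ennreal e" by blast
 then show "\<exists>C. A \<subseteq> (\<Union>i::nat. C i) \<and> (\<forall>i. bounded (C i)) \<and> (\<Sum>i. ennreal (diameter (C i))) \<le> ennreal e"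
  using AB by (intro exI[of _ C]) simp
qed

lemma hausdorff1_null_UN:
 assumes "\<And>n::nat. hausdorff1 (A n) = 0" shows "hausdorff1 (\<Union>n. A n) = 0" unfolding hausdorff1_eq_0_iff
proof (intro allI impI)
 fix e :: real assume e: "e > 0"
 have "\<forall>n. \<exists>C. A n \<subseteq> (\<Union>i::nat. C i) \<and> (\<forall>i. bounded (C i)) \<and> (\<Sum>i. ennreal (diameter (C i))) \<le> ennreal (e / 2 * (1/2)^n)"
  using assms e unfolding hausdorff1_eq_0_iff by simp
 then obtain C where C: "\<And>n. A n \<subseteq> (\<Union>i::nat. C n i)" "\<And>n i. bounded (C n i)"
   "\<And>n. (\<Sum>i. ennreal (diameter (C n i))) \<le> ennreal (e / 2 * (1/2)^n)" by metis
 define D where "D k = (case prod_decode k of (n, i) => C n i)" for k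
 have "(\<Sum>k. ennreal (diameter (D k))) = (\<Sum>n. \<Sum>i. ennreal (diameter (C n i)))"
  using suminf_ennreal_2dimen[of "\<lambda>n. \<Sum>i. ennreal (diameter (C n i))" "\<lambda>p. ennreal (diameter (C (fst p) (snd p)))"]
  unfolding D_def by (simp add: case_prod_beta)
 also have "\<dots> \<le> (\<Sum>n. ennreal (e / 2 * (1/2)^n))" using C(3) by (intro suminf_le summableI)
 also have "\<dots> = ennreal (\<Sum>n. e / 2 * (1/2)^n)" using e by (intro suminf_ennreal2 summable_mult) (auto intro!: summable_geometric)
 also have "(\<Sum>n. e / 2 * (1/2)^n) = e" by (subst suminf_mult) (auto simp: suminf_geometric intro!: summable_geometric)
 finally have "(\<Sum>k. ennreal (diameter (D k))) \<le> ennreal e" .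
 moreover have "(\<Union>n. A n) \<subseteq> (\<Union>k. D k)"
 proof clarify
  fix x n assume "x \<in> A n"
  then obtain i where "x \<in> C n i" using C(1) by blast
  then show "x \<in> (\<Union>k. D k)" unfolding D_def by (auto intro!: exI[of _ "prod_encode (n, i)"])
 qed
 moreover have "bounded (D k)" for k unfolding D_def using C(2) by (auto split: prod.splits)
 ultimately show "\<exists>C. (\<Union>n. A n) \<subseteq> (\<Union>i::nat. C i) \<and> (\<forall>i. bounded (C i)) \<and> (\<Sum>i. ennreal (diameter (C i))) \<le> ennreal e"
  by blast
qed

text \<open>A set of diameter \<open>d\<close> has its image in an interval of length
  \<open>2 * d\<close>, so covers with small sum project to covers with small sum.\<close>

lemma AE_notin_lipschitz_image:
 fixes f :: "complex => real"
 assumes A: "hausdorff1 A = 0" and f: "\<And>x y. \<bar>f x - f y\<bar> \<le> dist x y"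
 shows "AE x in lborel. x \<notin> f ` A"
proof (rule AE_notin_of_small_integrals)
 fix e :: real assume e: "e > 0"
 obtain C where C: "A \<subseteq> (\<Union>i::nat. C i)" "\<And>i. bounded (C i)" "(\<Sum>i. ennreal (diameter (C i))) \<le> ennreal (e/2)"
  using A e unfolding hausdorff1_eq_0_iff by (metis half_gt_zero)
 define c where "c i = (SOME y. y \<in> C i)" for i
 define T where "T i = (if C i = {} then {} else {f (c i) - diameter (C i)..f (c i) + diameter (C i)})" for i
 have sub: "f x \<in> T i" if "x \<in> C i" for x i
 proof -
  have "c i \<in> C i" unfolding c_def using that by (rule someI)
  then have "dist x (c i) \<le> diameter (C i)" using diameter_bounded_bound[OF C(2)] that by blast
  then show ?thesis using f[of x "c i"] that by (auto simp: T_def)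
 qed
 have "(\<integral>\<^sup>+x. indicator (\<Union>i. T i) x \<partial>lborel) = emeasure lborel (\<Union>i. T i)"
  by (intro nn_integral_indicator) (auto simp: T_def)
 also have "\<dots> \<le> (\<Sum>i. emeasure lborel (T i))" by (intro emeasure_subadditive_countably) (auto simp: T_def)
 also have "\<dots> \<le> (\<Sum>i. 2 * ennreal (diameter (C i)))"
 proof (intro suminf_le summableI)
  fix i
  have "emeasure lborel (T i) \<le> ennreal (2 * diameter (C i))" using diameter_ge_0[OF C(2)] by (auto simp: T_def)
  then show "emeasure lborel (T i) \<le> 2 * ennreal (diameter (C i))" using diameter_ge_0[OF C(2)] by (simp add: ennreal_mult)
 qed
 also have "\<dots> = 2 * (\<Sum>i. ennreal (diameter (C i)))" by (rule ennreal_suminf_cmult)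
 also have "\<dots> \<le> 2 * ennreal (e/2)" using C(3) by (intro mult_left_mono) auto
 also have "\<dots> = ennreal e" using e by (simp add: ennreal_mult[symmetric] flip: ennreal_numeral)
 finally have "(\<integral>\<^sup>+x. indicator (\<Union>i. T i) x \<partial>lborel) \<le> ennreal e" .
 moreover have "\<forall>x\<in>f ` A. 1 \<le> (indicator (\<Union>i. T i) x :: ennreal)" using C(1) sub by (auto simp: indicator_def) blast
 ultimately show "\<exists>h\<in>borel_measurable borel. (\<integral>\<^sup>+x. h x \<partial>lborel) \<le> ennreal e \<and> (\<forall>x\<in>f ` A. 1 \<le> h x)"
  by (intro bexI[of _ "indicator (\<Union>i. T i)"]) (auto simp: T_def)
qed

text \<open>The components of an open neighbourhood of small measure give the cover. The Lipschitz
  bound is asked on \<open>N\<close> only, because one application is to an arc length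
  parametrization on the set of lengths at which a path visits a closed set.\<close>

lemma hausdorff1_lipschitz_image:
 fixes f :: "real => complex"
 assumes N: "N \<in> null_sets lborel" and b: "N \<subseteq> {-R<..<R}"
  and f: "\<And>s t. s \<in> N ==> t \<in> N ==> dist (f s) (f t) \<le> \<bar>s - t\<bar>"
 shows "hausdorff1 (f ` N) = 0" unfolding hausdorff1_eq_0_iff
proof (intro allI impI)
 fix e :: real assume e: "e > 0"
 have Nb: "N \<in> sets borel" using N by auto
 obtain U0 where U0: "open U0" "N \<subseteq> U0" "emeasure lborel (U0 - N) < ennreal e"
 proof -
  have "negligible N" using N by (simp add: negligible_iff_null_sets null_sets_completionI)
  obtain U where "open U" "N \<subseteq> U" "U - N \<in> lmeasurable" "emeasure lebesgue (U - N) < ennreal e"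
   using sets_lebesgue_outer_open[of N e] Nb e by (auto simp: sets_completionI_sets)
  moreover have "emeasure lebesgue (U - N) = emeasure lborel (U - N)" using Nb \<open>open U\<close> by simp
  ultimately show ?thesis using that by metis
 qed
 define U where "U = U0 \<inter> {-R<..<R}"
 have U: "open U" "N \<subseteq> U" "bounded U" using U0 b by (auto simp: U_def intro: bounded_subset[of "{-R<..<R}"])
 have Ue: "emeasure lborel U \<le> ennreal e"
 proof -
  have "emeasure lborel U = emeasure lborel (U - N)" using N U by (intro emeasure_Diff_null_set[symmetric]) auto
  also have "\<dots> \<le> emeasure lborel (U0 - N)" using U0 Nb by (intro emeasure_mono) (auto simp: U_def)
  finally show ?thesis using U0 by simp
 qed
 let ?D = "components U"
 have cD: "countable ?D"
 proof (rule countable_disjoint_open_subsets)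
  show "open S" if "S \<in> ?D" for S using that U open_components by blast
  show "disjoint ?D" unfolding pairwise_def disjnt_def using components_nonoverlap by blast
 qed
 \<comment> \<open>The empty set fills the indices that enumerate no component, which keeps the
   sequence disjoint.\<close>
 define J where "J n = (if n \<in> to_nat_on ?D ` ?D then from_nat_into ?D n else {})" for n
 have JD: "J n = {} \<or> J n \<in> ?D" for n using cD by (auto simp: J_def)
 have int: "\<exists>s s'. s < s' \<and> J n = {s<..<s'}" if "J n \<noteq> {}" for n
  using JD[of n] that U open_components[OF U(1)] in_components_connected in_components_subset bounded_subset
   open_connected_real by metis
 have UJ: "(\<Union>n. J n) = U"
 proof -
  have "(\<Union>n. J n) = \<Union> ?D"
  proof (intro subset_antisym subsetI)
   fix x assume "x \<in> (\<Union>n. J n)"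
   then obtain n where "x \<in> J n" by blast
   then show "x \<in> \<Union> ?D" using JD[of n] by blast
  next
   fix x assume "x \<in> \<Union> ?D"
   then obtain K where "K \<in> ?D" "x \<in> K" by blast
   then have "x \<in> J (to_nat_on ?D K)" using cD by (simp add: J_def)
   then show "x \<in> (\<Union>n. J n)" by blast
  qed
  then show ?thesis by (simp add: Union_components)
 qed
 have disj: "disjoint_family J" unfolding disjoint_family_on_def
 proof (intro ballI impI)
  fix m n :: nat assume mn: "m \<noteq> n"
  show "J m \<inter> J n = {}"
  proof (rule ccontr)
   assume "J m \<inter> J n \<noteq> {}"
   then have ne: "J m \<noteq> {}" "J n \<noteq> {}" "J m \<in> ?D" "J n \<in> ?D" using JD[of m] JD[of n] by blast+
   then have "J m = J n" using components_nonoverlap \<open>J m \<inter> J n \<noteq> {}\<close> by metis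
   moreover obtain K L where "K \<in> ?D" "m = to_nat_on ?D K" "L \<in> ?D" "n = to_nat_on ?D L" using ne by (auto simp: J_def split: if_splits)
   ultimately have "K = L" using cD by (auto simp: J_def)
   then show False using mn \<open>m = _\<close> \<open>n = _\<close> by simp
  qed
 qed
 have Jb: "J n \<in> sets lborel" for n using int[of n] by (cases "J n = {}") auto
 have diam: "ennreal (diameter (f ` (N \<inter> J n))) \<le> emeasure lborel (J n)" for n
 proof (cases "N \<inter> J n = {}")
  case True then show ?thesis by simp
 next
  case False
  then obtain s s' where s: "s < s'" "J n = {s<..<s'}" using int[of n] by auto
  have "diameter (f ` (N \<inter> J n)) \<le> s' - s"
  proof (rule diameter_le)
   fix x y assume "x \<in> f ` (N \<inter> J n)" "y \<in> f ` (N \<inter> J n)"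
   then obtain a b where ab: "a \<in> N" "b \<in> N" "a \<in> J n" "b \<in> J n" "x = f a" "y = f b" by blast
   then have "dist x y \<le> \<bar>a - b\<bar>" using f by blast
   then show "norm (x - y) \<le> s' - s" using ab s by (auto simp: dist_norm)
  qed (use False in simp)
  then show ?thesis using s by (simp add: ennreal_leI)
 qed
 have "(\<Sum>i. ennreal (diameter (f ` (N \<inter> J i)))) \<le> (\<Sum>i. emeasure lborel (J i))" using diam by (intro suminf_le summableI)
 also have "\<dots> = emeasure lborel (\<Union>n. J n)" using Jb disj by (intro suminf_emeasure) auto
 also have "\<dots> \<le> ennreal e" using UJ Ue by simp
 finally have "(\<Sum>i. ennreal (diameter (f ` (N \<inter> J i)))) \<le> ennreal e" .
 moreover have "f ` N \<subseteq> (\<Union>i. f ` (N \<inter> J i))"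
 proof
  fix y assume "y \<in> f ` N"
  then obtain a where a: "a \<in> N" "y = f a" by blast
  then obtain i where "a \<in> J i" using U(2) UJ by blast
  then show "y \<in> (\<Union>i. f ` (N \<inter> J i))" using a by blast
 qed
 moreover have "bounded (f ` (N \<inter> J i))" for i
 proof (cases "N \<inter> J i = {}")
  case False
  then obtain s s' where s: "s < s'" "J i = {s<..<s'}" using int[of i] by auto
  obtain t where t: "t \<in> N \<inter> J i" using False by auto
  show ?thesis unfolding bounded_def
  proof (intro exI[of _ "f t"] exI[of _ "s' - s"] ballI)
   fix y assume "y \<in> f ` (N \<inter> J i)"
   then obtain a where a: "a \<in> N" "a \<in> J i" "y = f a" by blast
   then have "dist (f t) y \<le> \<bar>t - a\<bar>" using f t by blast
   then show "dist (f t) y \<le> s' - s" using a t s by auto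
  qed
 qed simp
 ultimately show "\<exists>C. f ` N \<subseteq> (\<Union>i::nat. C i) \<and> (\<forall>i. bounded (C i)) \<and> (\<Sum>i. ennreal (diameter (C i))) \<le> ennreal e"
  by (intro exI[of _ "\<lambda>i. f ` (N \<inter> J i)"]) blast
qed

section \<open>Carpets in bounded domains\<close>

locale bounded_carpet =
 fixes \<Omega> :: "complex set" and Q :: "nat => complex set" and ver :: carpet_version
 assumes carpet: "relative_carpet \<Omega> Q" and bounded_domain: "bounded \<Omega>"
begin

abbreviation S where "S \<equiv> carpet \<Omega> Q"

lemma open_domain: "open \<Omega>" and connected_domain: "connected \<Omega>" using carpet by (auto simp: relative_carpet_def)

lemma disk_jordan: "jordan_region (Q i)" and disk_compactly: "compactly_in (Q i) \<Omega>" using carpet by (auto simp: relative_carpet_def)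

lemma disk_closures_disjoint: "i \<noteq> j ==> closure (Q i) \<inter> closure (Q j) = {}"
 using carpet unfolding relative_carpet_def by blast

lemma interior_carpet: "interior S = {}" and carpet_null: "emeasure lborel S = 0" using carpet by (auto simp: relative_carpet_def)

lemma disk_fat: "\<exists>K1>0. \<forall>i. \<forall>x\<in>Q i. \<forall>r. 0 < r \<and> r < diameter (Q i) -->
    emeasure lborel (ball x r \<inter> Q i) \<ge> ennreal (K1 * r^2)" using carpet unfolding relative_carpet_def by blast

lemma disk_facts:
 shows open_disk: "open (Q i)" and connected_disk: "connected (Q i)" and disk_nonempty: "Q i \<noteq> {}"
  and disk_sides: "jordan_side (frontier (Q i)) (Q i)" "jordan_side (frontier (Q i)) (- closure (Q i))"
  and bounded_disk: "bounded (Q i)"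
proof -
 obtain C where C: "jordan_curve C" "Q i = inside C" using disk_jordan[of i] by (auto simp: jordan_region_def)
 obtain c where c: "simple_path c" "pathfinish c = pathstart c" "path_image c = C" using C by (auto simp: jordan_curve_def)
 note J = Jordan_inside_outside[OF c(1,2), unfolded c(3)]
 have f: "frontier (Q i) = C" using J C by simp
 show "open (Q i)" "connected (Q i)" "Q i \<noteq> {}" "bounded (Q i)" using J C by auto
 show "jordan_side (frontier (Q i)) (Q i)" using C f by (simp add: jordan_side_def)
 have "closure (Q i) = inside C \<union> C" using C f by (simp add: closure_Un_frontier)
 moreover have "inside C \<inter> outside C = {}" "inside C \<union> outside C = - C" using J by auto
 ultimately have "- closure (Q i) = outside C" by blast
 then show "jordan_side (frontier (Q i)) (- closure (Q i))" using C f by (simp add: jordan_side_def)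
qed

lemma closure_disk: "closure (Q i) = Q i \<union> frontier (Q i)" by (rule closure_Un_frontier)

lemma compact_closure_disk: "compact (closure (Q i))" and closure_disk_subset: "closure (Q i) \<subseteq> \<Omega>"
 using disk_compactly[of i] by (auto simp: compactly_in_def)

lemma disk_subset: "Q i \<subseteq> \<Omega>" using closure_disk_subset closure_subset by blast

lemma frontier_disk_nonempty: "frontier (Q i) \<noteq> {}" using jordan_sideD(6)[OF disk_sides(1), of i] disk_nonempty[of i] disk_sides(1)[of i]
 unfolding jordan_side_def jordan_curve_def by (metis path_image_nonempty)

lemma disk_disjoint: "i \<noteq> j ==> Q i \<inter> Q j = {}"
 using disk_closures_disjoint[of i j] closure_subset[of "Q i"] closure_subset[of "Q j"] by blast

lemma disk_unique: "z \<in> Q i ==> z \<in> Q j ==> i = j" using disk_disjoint by blast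

lemma closure_disk_unique: "z \<in> closure (Q i) ==> z \<in> closure (Q j) ==> i = j"
 using disk_closures_disjoint by blast

lemma frontier_not_in_disk: "z \<in> frontier (Q i) ==> z \<notin> Q j"
proof (cases "i = j")
 case True then show "z \<in> frontier (Q i) ==> z \<notin> Q j" using open_disk by (auto simp: frontier_def interior_open)
next
 case False then show "z \<in> frontier (Q i) ==> z \<notin> Q j"
  using disk_closures_disjoint[of i j] closure_subset[of "Q j"] by (auto simp: frontier_def)
qed

lemma frontier_disk_subset: "frontier (Q i) \<subseteq> S"
proof
 fix x assume x: "x \<in> frontier (Q i)"
 then have "x \<in> \<Omega>" using closure_disk_subset[of i] by (auto simp: frontier_def)
 then show "x \<in> S" using frontier_not_in_disk[OF x] by (auto simp: carpet_def)
qed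

lemma frontier_disk_unique: "z \<in> frontier (Q i) ==> z \<in> frontier (Q j) ==> i = j"
 using closure_disk_unique by (auto simp: frontier_def)

lemma not_in_carpet: "z \<in> \<Omega> ==> z \<notin> S ==> \<exists>i. z \<in> Q i" by (auto simp: carpet_def)

lemma carpet_subset: "S \<subseteq> \<Omega>" and disk_not_carpet: "z \<in> Q i ==> z \<notin> S" by (auto simp: carpet_def)

lemma carpet_sets: "S \<in> sets borel" using open_domain open_disk by (auto simp: carpet_def intro!: sets.Diff)

lemma disk_dense: "open W ==> W \<subseteq> \<Omega> ==> W \<noteq> {} ==> \<exists>i. Q i \<inter> W \<noteq> {}"
proof (rule ccontr)
 assume W: "open W" "W \<subseteq> \<Omega>" "W \<noteq> {}" "\<not> (\<exists>i. Q i \<inter> W \<noteq> {})"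
 then have "W \<subseteq> S" by (auto simp: carpet_def)
 then have "W \<subseteq> interior S" using W(1) by (rule interior_maximal)
 then show False using interior_carpet W by auto
qed

lemma diameter_disk_pos: "0 < diameter (Q i)"
proof -
 obtain x where "x \<in> Q i" using disk_nonempty by blast
 then obtain e where e: "e > 0" "ball x e \<subseteq> Q i" using open_disk openE by blast
 have "x + of_real (e/2) \<in> Q i" using e by (auto simp: dist_norm)
 then have "dist x (x + of_real (e/2)) \<le> diameter (Q i)" using diameter_bounded_bound[OF bounded_disk \<open>x \<in> Q i\<close>] by blast
 then show ?thesis using e by (simp add: dist_norm)
qed

section \<open>Packing of the peripheral disks\<close>

lemma csquare_borel [measurable, simp]: "csquare x r \<in> sets borel" by (simp add: csquare_eq_cbox)

lemma disk_borel [measurable, simp]: "Q i \<in> sets borel" by (rule borel_open[OF open_disk])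

text \<open>Around one of its points in the square, each disk has, inside the doubled square, a
  piece of area comparable to the square of \<open>min (diameter (Q i)) h\<close>. These pieces are
  disjoint, and the doubled square has area \<open>16 * h^2\<close>. Disks larger than the square
  count with its size.\<close>

lemma packing:
 "\<exists>C>0. \<forall>x h. 0 < h -->
   (\<Sum>i. if Q i \<inter> csquare x h \<noteq> {} then ennreal ((min (diameter (Q i)) h)^2) else 0) \<le> ennreal (C * h^2)"
proof -
 obtain K where K: "K > 0" "\<And>i x r. x \<in> Q i ==> 0 < r ==> r < diameter (Q i) ==>
    emeasure lborel (ball x r \<inter> Q i) \<ge> ennreal (K * r^2)" using disk_fat by blast
 have "(\<Sum>i. if Q i \<inter> csquare x h \<noteq> {} then ennreal ((min (diameter (Q i)) h)^2) else 0)
   \<le> ennreal (64 / K * h^2)" if h: "0 < h" for x h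
 proof -
  let ?B = "csquare x (2 * h)"
  have le: "(if Q i \<inter> csquare x h \<noteq> {} then ennreal ((min (diameter (Q i)) h)^2) else 0)
    \<le> ennreal (4 / K) * emeasure lborel (Q i \<inter> ?B)" for i
  proof (cases "Q i \<inter> csquare x h = {}")
   case False
   then obtain y where y: "y \<in> Q i" "y \<in> csquare x h" by blast
   \<comment> \<open>Half of the minimum is strictly below the diameter, as fatness requires, and
     keeps the ball in the doubled square.\<close>
   define s where "s = min (diameter (Q i)) h / 2"
   have s: "0 < s" "s < diameter (Q i)" "s \<le> h / 2" using diameter_disk_pos[of i] h by (auto simp: s_def)
   have "ball y s \<subseteq> ?B"
   proof
    fix z assume "z \<in> ball y s"
    then have "norm (z - y) < s" by (simp add: dist_norm norm_minus_commute)
    then have "sup_norm (z - y) < s" using sup_norm_le_norm[of "z - y"] by simp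
    then show "z \<in> ?B" using sup_norm_triangle[of "z - y" "y - x"] y s h by (simp add: csquare_def)
   qed
   have "ennreal (K * s^2) \<le> emeasure lborel (ball y s \<inter> Q i)" using K(2)[OF y(1) s(1,2)] .
   also have "\<dots> \<le> emeasure lborel (Q i \<inter> ?B)" using \<open>ball y s \<subseteq> ?B\<close> by (intro emeasure_mono) auto
   finally have "ennreal (4 / K) * ennreal (K * s^2) \<le> ennreal (4 / K) * emeasure lborel (Q i \<inter> ?B)" by (intro mult_left_mono) auto
   moreover have "ennreal (4 / K) * ennreal (K * s^2) = ennreal ((min (diameter (Q i)) h)^2)"
    using K(1) by (simp add: ennreal_mult[symmetric] s_def power_divide)
   ultimately show ?thesis using False by simp
  qed simp
  have "(\<Sum>i. if Q i \<inter> csquare x h \<noteq> {} then ennreal ((min (diameter (Q i)) h)^2) else 0)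
    \<le> (\<Sum>i. ennreal (4 / K) * emeasure lborel (Q i \<inter> ?B))" using le by (intro suminf_le summableI)
  also have "\<dots> = ennreal (4 / K) * (\<Sum>i. emeasure lborel (Q i \<inter> ?B))" by (rule ennreal_suminf_cmult)
  also have "(\<Sum>i. emeasure lborel (Q i \<inter> ?B)) = emeasure lborel (\<Union>i. Q i \<inter> ?B)" using open_disk disk_disjoint
   by (intro suminf_emeasure) (auto simp: disjoint_family_on_def)
  also have "\<dots> \<le> emeasure lborel ?B" by (intro emeasure_mono) auto
  also have "emeasure lborel ?B = ennreal (16 * h^2)"
  proof -
   have "emeasure lborel ?B = (\<Prod>b\<in>Basis. ((x + Complex (2*h) (2*h)) - (x - Complex (2*h) (2*h))) \<bullet> b)"
    unfolding csquare_eq_cbox using h by (intro emeasure_lborel_cbox) (auto simp: Basis_complex_def inner_diff_left inner_add_left)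
   then show ?thesis using h by (simp add: Basis_complex_def power2_eq_square algebra_simps)
  qed
  also have "ennreal (4 / K) * ennreal (16 * h^2) = ennreal (64 / K * h^2)" using K(1) by (simp add: ennreal_mult[symmetric])
  finally show ?thesis by (simp add: mult_left_mono)
 qed
 then show ?thesis using K(1) by (intro exI[of _ "64 / K"]) auto
qed

lemma domain_bound: "\<exists>R>0. \<Omega> \<subseteq> square 0 R"
proof -
 obtain R where R: "R > 0" "\<And>x. x \<in> \<Omega> ==> norm x \<le> R" using bounded_domain by (auto simp: bounded_pos)
 have "\<Omega> \<subseteq> square 0 (R + 1)"
 proof
  fix x assume "x \<in> \<Omega>"
  then show "x \<in> square 0 (R + 1)" using R(2)[of x] sup_norm_le_norm[of x] by (simp add: square_def)
 qed
 then show ?thesis using R by (intro exI[of _ "R + 1"]) auto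
qed

text \<open>Packing in one square of size \<open>4 * R\<close>, which is at least every diameter, so
  that the minimum is always the diameter.\<close>

lemma sum_diameter_finite: "\<exists>D\<ge>0. (\<Sum>i. ennreal ((diameter (Q i))^2)) \<le> ennreal D"
proof -
 obtain C where C: "C > 0" "\<And>x h. 0 < h ==>
   (\<Sum>i. if Q i \<inter> csquare x h \<noteq> {} then ennreal ((min (diameter (Q i)) h)^2) else 0) \<le> ennreal (C * h^2)"
  using packing by blast
 obtain R where R: "R > 0" "\<Omega> \<subseteq> square 0 R" using domain_bound by blast
 have "ennreal ((diameter (Q i))^2)
   = (if Q i \<inter> csquare 0 (4*R) \<noteq> {} then ennreal ((min (diameter (Q i)) (4*R))^2) else 0)" for i
 proof -
  have "Q i \<subseteq> ball 0 (2*R)" using disk_subset R square_subset_ball by blast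
  then have "diameter (Q i) \<le> diameter (ball (0::complex) (2*R))" by (intro diameter_subset) auto
  also have "\<dots> \<le> 4 * R" using R by (simp add: diameter_ball)
  finally have "diameter (Q i) \<le> 4 * R" .
  moreover have "Q i \<subseteq> csquare 0 (4*R)" using disk_subset[of i] R by (force simp: square_def csquare_def)
  ultimately show ?thesis using disk_nonempty[of i] by (auto simp: min_def)
 qed
 then have "(\<Sum>i. ennreal ((diameter (Q i))^2))
   = (\<Sum>i. if Q i \<inter> csquare 0 (4*R) \<noteq> {} then ennreal ((min (diameter (Q i)) (4*R))^2) else 0)" by (rule suminf_cong)
 also have "\<dots> \<le> ennreal (C * (4*R)^2)" using C(2)[of "4*R"] R by simp
 finally show ?thesis using C(1) by (intro exI[of _ "C * (4*R)^2"]) auto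
qed

lemma finite_large_disks: "0 < e ==> finite {i. e \<le> diameter (Q i)}"
proof -
 assume e: "0 < e"
 obtain D where D: "D \<ge> 0" "(\<Sum>i. ennreal ((diameter (Q i))^2)) \<le> ennreal D" using sum_diameter_finite by blast
 have "summable (\<lambda>i. (diameter (Q i))^2)" using D(2) by (intro summable_suminf_not_top) (auto simp: top_unique)
 then have "(\<lambda>i. (diameter (Q i))^2) \<longlonglongrightarrow> 0" by (rule summable_LIMSEQ_zero)
 then have "eventually (\<lambda>i. (diameter (Q i))^2 < e^2) sequentially" by (rule order_tendstoD(2)) (use e in simp)
 then obtain n where n: "\<And>i. i \<ge> n ==> (diameter (Q i))^2 < e^2" by (auto simp: eventually_sequentially)
 have "{i. e \<le> diameter (Q i)} \<subseteq> {..<n}"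
 proof
  fix i assume "i \<in> {i. e \<le> diameter (Q i)}"
  then have "e^2 \<le> (diameter (Q i))^2" using e by (intro power_mono) auto
  then show "i \<in> {..<n}" using n[of i] by force
 qed
 then show ?thesis using finite_subset by blast
qed

section \<open>Generic axis-parallel lines\<close>

lemma disk_projection_integral:
 fixes P :: "complex => real"
 assumes P: "\<And>x y. \<bar>P x - P y\<bar> \<le> dist x y"
 shows "\<exists>T. (\<forall>i. T i \<in> sets borel \<and> P ` Q i \<subseteq> T i \<and> emeasure lborel (T i) \<le> ennreal (2 * diameter (Q i)))"
proof -
 have "\<exists>T. T \<in> sets borel \<and> P ` Q i \<subseteq> T \<and> emeasure lborel T \<le> ennreal (2 * diameter (Q i))" for i
 proof -
  obtain y where y: "y \<in> Q i" using disk_nonempty by blast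
  define T where "T = {P y - diameter (Q i)..P y + diameter (Q i)}"
  have "P z \<in> T" if "z \<in> Q i" for z using P[of z y] diameter_bounded_bound[OF bounded_disk that y] by (auto simp: T_def)
  moreover have "emeasure lborel T \<le> ennreal (2 * diameter (Q i))" using diameter_disk_pos[of i] by (simp add: T_def)
  ultimately show ?thesis by (intro exI[of _ T]) (auto simp: T_def)
 qed
 then show ?thesis by metis
qed

text \<open>Averaged over all parallel lines, the sum over the disks met is controlled by the sum of
  \<open>\<rho> i\<close> times the diameter of the disk, and the squared diameters are summable in
  a bounded domain. Small energy of \<rho> thus makes a typical line meet little of it.\<close>

lemma line_meets_small:
 assumes "0 < (e::real)"
 shows "\<exists>d>0. \<forall>\<rho>. (\<Sum>i. (\<rho> i)^2) < ennreal d -->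
  (\<exists>h\<in>borel_measurable borel. (\<integral>\<^sup>+x. h x \<partial>lborel) \<le> ennreal e \<and>
    (\<forall>X. meet_sum Q \<rho> (range (line b X)) \<le> h X))"
proof -
 define P where "P z = (if b then Re z else Im z)" for z
 have PL: "\<bar>P x - P y\<bar> \<le> dist x y" for x y using abs_Re_le_cmod[of "x - y"] abs_Im_le_cmod[of "x - y"] by (auto simp: P_def dist_norm)
 obtain T where T: "\<And>i. T i \<in> sets borel" "\<And>i. P ` Q i \<subseteq> T i"
   "\<And>i. emeasure lborel (T i) \<le> ennreal (2 * diameter (Q i))" using disk_projection_integral[of P] PL by blast
 obtain D where D: "D \<ge> 0" "(\<Sum>i. ennreal ((diameter (Q i))^2)) \<le> ennreal D" using sum_diameter_finite by blast
 \<comment> \<open>Balances the two terms: \<open>4 / t * D\<close> is at most \<open>e / 2\<close>,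
   and \<open>t\<close> times the energy bound \<open>e / (2 * t)\<close> equals
   \<open>e / 2\<close>.\<close>
 define t where "t = 8 * (D + 1) / e"
 have t: "t > 0" using D assms by (simp add: t_def)
 have "\<exists>h\<in>borel_measurable borel. (\<integral>\<^sup>+x. h x \<partial>lborel) \<le> ennreal e \<and>
    (\<forall>X. meet_sum Q \<rho> (range (line b X)) \<le> h X)" if \<rho>: "(\<Sum>i. (\<rho> i)^2) < ennreal (e / (2 * t))" for \<rho> :: "nat => ennreal"
 proof -
  define h where "h X = (\<Sum>i. \<rho> i * indicator (T i) X)" for X
  have [measurable]: "T i \<in> sets borel" for i by (rule T)
  have hm: "h \<in> borel_measurable borel" unfolding h_def by measurable
  have "(\<integral>\<^sup>+x. h x \<partial>lborel) = (\<Sum>i. \<integral>\<^sup>+x. \<rho> i * indicator (T i) x \<partial>lborel)"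
   unfolding h_def by (intro nn_integral_suminf) simp
  also have "\<dots> = (\<Sum>i. \<rho> i * emeasure lborel (T i))" by (intro suminf_cong nn_integral_cmult_indicator) simp
  also have "\<dots> \<le> (\<Sum>i. ennreal t * (\<rho> i)^2 + ennreal (4 / t) * ennreal ((diameter (Q i))^2))"
  proof (intro suminf_le summableI)
   fix i
   have "\<rho> i * emeasure lborel (T i) \<le> \<rho> i * ennreal (2 * diameter (Q i))" using T(3) by (rule mult_left_mono) simp
   also have "\<dots> \<le> ennreal t * (\<rho> i)^2 + ennreal ((2 * diameter (Q i))^2 / t)"
    using t diameter_disk_pos[of i] by (intro ennreal_le_square_plus) auto
   also have "ennreal ((2 * diameter (Q i))^2 / t) = ennreal (4 / t) * ennreal ((diameter (Q i))^2)"
    using t by (simp add: ennreal_mult[symmetric] power_mult_distrib)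
   finally show "\<rho> i * emeasure lborel (T i) \<le> ennreal t * (\<rho> i)^2 + ennreal (4 / t) * ennreal ((diameter (Q i))^2)" .
  qed
  also have "\<dots> = (\<Sum>i. ennreal t * (\<rho> i)^2) + (\<Sum>i. ennreal (4 / t) * ennreal ((diameter (Q i))^2))"
   by (intro suminf_add[symmetric] summableI)
  also have "\<dots> = ennreal t * (\<Sum>i. (\<rho> i)^2) + ennreal (4 / t) * (\<Sum>i. ennreal ((diameter (Q i))^2))"
   by (simp only: ennreal_suminf_cmult)
  also have "\<dots> \<le> ennreal t * ennreal (e / (2 * t)) + ennreal (4 / t) * ennreal D" using \<rho> D by (intro add_mono mult_left_mono) auto
  also have "\<dots> = ennreal (t * (e / (2 * t)) + 4 / t * D)"
   using t D assms by (simp add: ennreal_mult[symmetric] ennreal_plus[symmetric] del: ennreal_plus)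
  also have "\<dots> \<le> ennreal e"
  proof (rule ennreal_leI)
   have "e * t = 8 * (D + 1)" using assms by (simp add: t_def)
   then have "4 * D \<le> e / 2 * t" using D by simp
   then have "4 / t * D \<le> e / 2" using t by (simp add: pos_divide_le_eq)
   moreover have "t * (e / (2 * t)) = e / 2" using t by simp
   ultimately show "t * (e / (2 * t)) + 4 / t * D \<le> e" by linarith
  qed
  finally have "(\<integral>\<^sup>+x. h x \<partial>lborel) \<le> ennreal e" .
  moreover have "meet_sum Q \<rho> (range (line b X)) \<le> h X" for X unfolding meet_sum_def h_def
  proof (intro suminf_le summableI)
   fix i
   have "X \<in> T i" if ne: "Q i \<inter> range (line b X) \<noteq> {}"
   proof -
    obtain s where "line b X s \<in> Q i" using ne by auto
    then have "P (line b X s) \<in> T i" using T(2) by blast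
    then show ?thesis by (simp add: P_def line_def split: if_splits)
   qed
   then show "(if Q i \<inter> range (line b X) \<noteq> {} then \<rho> i else 0) \<le> \<rho> i * indicator (T i) X" by (auto simp: indicator_def)
  qed
  ultimately show ?thesis using hm by blast
 qed
 then show ?thesis using t assms by (intro exI[of _ "e / (2 * t)"]) auto
qed

text \<open>The carpet has area zero, so by Fubini almost every line spends a null set of parameters
  in it; a line is an isometry, which carries null sets to sets of vanishing Hausdorff
  measure.\<close>

lemma AE_line_carpet_null: "AE X in lborel. hausdorff1 (range (line b X) \<inter> S) = 0"
proof -
 have [measurable]: "S \<in> sets borel" by (rule carpet_sets)
 obtain R where R: "R > 0" "\<Omega> \<subseteq> square 0 R" using domain_bound by blast
 have "(\<integral>\<^sup>+X. \<integral>\<^sup>+t. indicator S (line b X t) \<partial>lborel \<partial>lborel) = (\<integral>\<^sup>+z. indicator S z \<partial>lborel)"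
  by (rule nn_integral_lines[symmetric]) simp
 also have "\<dots> = 0" using carpet_null by simp
 finally have "(\<integral>\<^sup>+X. \<integral>\<^sup>+t. indicator S (line b X t) \<partial>lborel \<partial>lborel) = 0" .
 moreover have m: "(\<lambda>X. \<integral>\<^sup>+t. indicator S (line b X t) \<partial>lborel) \<in> borel_measurable borel"
  by (rule measurable_line_integral) simp
 ultimately have "AE X in lborel. (\<integral>\<^sup>+t. indicator S (line b X t) \<partial>lborel) = 0"
  by (subst (asm) nn_integral_0_iff_AE) simp_all
 then show ?thesis
 proof eventually_elim
  case (elim X)
  have lm [measurable]: "line b X \<in> borel_measurable borel" by (intro borel_measurable_continuous_onI continuous_on_line)
  define N where "N = line b X -` S"
  have Ns: "N \<in> sets borel" unfolding N_def using measurable_sets[OF lm carpet_sets] by simp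
  have "(\<integral>\<^sup>+t. indicator S (line b X t) \<partial>lborel) = (\<integral>\<^sup>+t. indicator N t \<partial>lborel)"
   by (intro nn_integral_cong) (simp add: N_def indicator_def)
  then have "emeasure lborel N = 0" using elim Ns by simp
  then have "N \<in> null_sets lborel" using Ns by (simp add: null_setsI)
  moreover have "N \<subseteq> {-R<..<R}"
  proof
   fix t assume "t \<in> N"
   then have "line b X t \<in> square 0 R" using carpet_subset R by (auto simp: N_def)
   then show "t \<in> {-R<..<R}" by (auto simp: square_def sup_norm_def line_def split: if_splits)
  qed
  ultimately have "hausdorff1 (line b X ` N) = 0" by (rule hausdorff1_lipschitz_image) (simp add: dist_line)
  moreover have "range (line b X) \<inter> S = line b X ` N" by (auto simp: N_def)
  ultimately show ?case by simp
 qed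
qed

text \<open>The bridge from modulus to measure: a family of carpet modulus zero contains no path
  running on a generic line. The set \<open>B\<close> also asks for a null trace on the carpet,
  because the strong modulus tests only such paths; almost every line has one.\<close>

lemma AE_line_not_exceptional:
 assumes null: "carpet_mod ver \<Omega> Q G = 0"
 shows "AE X in lborel. \<forall>I. (I, line b X) \<in> paths_in \<Omega> --> (I, line b X) \<notin> G"
proof -
 obtain R where R: "R > 0" "\<Omega> \<subseteq> square 0 R" using domain_bound by blast
 have lim: "is_interval I \<and> I \<subseteq> {-R..R} \<and> \<bar>X\<bar> \<le> R" if I: "(I, line b X) \<in> paths_in \<Omega>" for I X
 proof -
  have *: "line b X t \<in> square 0 R" if "t \<in> I" for t using I R that by (auto simp: paths_in_def im_def)
  have ne: "I \<noteq> {}" "is_interval I" using I by (auto simp: paths_in_def is_cpath_def)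
  then obtain t where "t \<in> I" by blast
  have "I \<subseteq> {-R..R}"
  proof
   fix s assume "s \<in> I"
   from *[OF this] show "s \<in> {-R..R}" by (cases b) (auto simp: square_def sup_norm_def line_def)
  qed
  moreover have "\<bar>X\<bar> \<le> R" using *[OF \<open>t \<in> I\<close>] by (auto simp: square_def sup_norm_def line_def split: if_splits)
  ultimately show ?thesis using ne by blast
 qed
 define B where "B = {X. \<exists>I. (I, line b X) \<in> paths_in \<Omega> \<and> (I, line b X) \<in> G \<and> hausdorff1 (range (line b X) \<inter> S) = 0}"
 have "AE X in lborel. X \<notin> B"
 proof (rule AE_notin_of_small_integrals)
  fix e :: real assume e: "e > 0"
  have "0 < e/2" using e by simp
  from line_meets_small[OF this, of b] obtain d where d: "d > 0" "\<And>\<rho>. (\<Sum>i. (\<rho> i)^2) < ennreal d ==>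
   (\<exists>h\<in>borel_measurable borel. (\<integral>\<^sup>+x. h x \<partial>lborel) \<le> ennreal (e/2) \<and>
    (\<forall>X. meet_sum Q \<rho> (range (line b X)) \<le> h X))" by blast
  have imr: "im (I, line b X) \<subseteq> range (line b X)" for I X by (auto simp: im_def)
  show "\<exists>h\<in>borel_measurable borel. (\<integral>\<^sup>+x. h x \<partial>lborel) \<le> ennreal e \<and> (\<forall>x\<in>B. 1 \<le> h x)"
  proof (cases ver)
   case Strong
   then have "mod_strong \<Omega> Q G < ennreal d" using null d(1) by simp
   then obtain \<rho> where \<rho>: "\<And>p. p \<in> G ==> hausdorff1 (im p \<inter> S) = 0 ==> 1 \<le> meet_sum Q \<rho> (im p)"
     "(\<Sum>i. (\<rho> i)^2) < ennreal d" unfolding mod_strong_def INF_less_iff by auto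
   obtain h where h: "h \<in> borel_measurable borel" "(\<integral>\<^sup>+x. h x \<partial>lborel) \<le> ennreal (e/2)"
     "\<And>X. meet_sum Q \<rho> (range (line b X)) \<le> h X" using d(2)[OF \<rho>(2)] by blast
   have "1 \<le> h X" if XB: "X \<in> B" for X
   proof -
    obtain I where I: "(I, line b X) \<in> G" "hausdorff1 (range (line b X) \<inter> S) = 0" using XB by (auto simp: B_def)
    have "hausdorff1 (im (I, line b X) \<inter> S) = 0" using imr by (intro hausdorff1_null_mono[OF I(2)]) auto
    then have "1 \<le> meet_sum Q \<rho> (im (I, line b X))" using \<rho>(1) I by blast
    also have "\<dots> \<le> meet_sum Q \<rho> (range (line b X))" using imr by (rule meet_sum_mono_set)
    also have "\<dots> \<le> h X" by (rule h)
    finally show ?thesis .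
   qed
   moreover have "(\<integral>\<^sup>+x. h x \<partial>lborel) \<le> ennreal e"
    by (rule order_trans[OF h(2)]) (use e in \<open>simp add: ennreal_leI\<close>)
   ultimately show ?thesis using h(1) by blast
  next
   case Weak
   then have "mod_weak Q G < ennreal d" using null d(1) by simp
   then obtain \<rho> G0 where \<rho>: "G0 \<subseteq> G" "mod2 G0 = 0" "\<And>p. p \<in> G - G0 ==> 1 \<le> meet_sum Q \<rho> (im p)"
     "(\<Sum>i. (\<rho> i)^2) < ennreal d" unfolding mod_weak_def INF_less_iff by auto
   obtain h where h: "h \<in> borel_measurable borel" "(\<integral>\<^sup>+x. h x \<partial>lborel) \<le> ennreal (e/2)"
     "\<And>X. meet_sum Q \<rho> (range (line b X)) \<le> h X" using d(2)[OF \<rho>(4)] by blast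
   obtain k where k: "k \<in> borel_measurable borel" "(\<integral>\<^sup>+x. k x \<partial>lborel) \<le> ennreal (e/2)"
     "\<And>X I. (I, line b X) \<in> G0 ==> is_interval I ==> I \<subseteq> {-R..R} ==> \<bar>X\<bar> \<le> R ==> 1 \<le> k X"
    using mod2_null_lines[OF \<rho>(2), of "e/2" R b] e R by auto
   \<comment> \<open>Paths in the subfamily of classical modulus zero are charged to
     \<open>k\<close>, all others to \<open>h\<close>.\<close>
   have "1 \<le> h X + k X" if XB: "X \<in> B" for X
   proof -
    obtain I where I: "(I, line b X) \<in> G" "(I, line b X) \<in> paths_in \<Omega>" using XB by (auto simp: B_def)
    show ?thesis
    proof (cases "(I, line b X) \<in> G0")
     case True
     then have "1 \<le> k X" using k(3) lim[OF I(2)] by blast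
     then show ?thesis by (rule order_trans) simp
    next
     case False
     then have "1 \<le> meet_sum Q \<rho> (im (I, line b X))" using \<rho>(3) I by blast
     also have "\<dots> \<le> meet_sum Q \<rho> (range (line b X))" using imr by (rule meet_sum_mono_set)
     also have "\<dots> \<le> h X" by (rule h)
     also have "\<dots> \<le> h X + k X" by simp
     finally show ?thesis .
    qed
   qed
   moreover have "(\<integral>\<^sup>+x. h x + k x \<partial>lborel) \<le> ennreal e"
   proof -
    have "(\<integral>\<^sup>+x. h x + k x \<partial>lborel) = (\<integral>\<^sup>+x. h x \<partial>lborel) + (\<integral>\<^sup>+x. k x \<partial>lborel)"
     using h(1) k(1) by (intro nn_integral_add) auto
    also have "\<dots> \<le> ennreal (e/2) + ennreal (e/2)" using h(2) k(2) by (rule add_mono)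
    also have "\<dots> = ennreal e" using e by (simp add: ennreal_plus[symmetric] del: ennreal_plus)
    finally show ?thesis .
   qed
   moreover have "(\<lambda>x. h x + k x) \<in> borel_measurable borel" using h(1) k(1) by (intro borel_measurable_add) auto
   ultimately show ?thesis by blast
  qed
 qed
 with AE_line_carpet_null[of b] show ?thesis by eventually_elim (auto simp: B_def)
qed

text \<open>
 Averaging over \<open>r \<in> (0, \<eta>)\<close> and fatness of the disks give a sum of order \<open>\<eta>\<close>; this
 replaces the usual logarithmic estimate for the modulus of curves around a point.
\<close>

lemma square_with_small_sum:
 fixes \<rho> :: "nat => real"
 assumes nn: "\<And>i. 0 \<le> \<rho> i" and sm: "(\<Sum>i. if i \<in> I then ennreal ((\<rho> i)^2) else 0) < \<infinity>"
  and I: "\<And>i. i \<in> I ==> x \<notin> closure (Q i)"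
  and ae: "AE r in lborel. P r" and pos: "0 < (e::real)" "0 < d0"
 shows "\<exists>r. 0 < r \<and> r < d0 \<and> P r \<and>
   (\<Sum>i. if i \<in> I \<and> Q i \<inter> {z. sup_norm (z - x) = r} \<noteq> {} then ennreal (\<rho> i) else 0) < ennreal e"
proof -
 obtain C where C: "C > 0" "\<And>x d. 0 < d ==>
   (\<Sum>i. if Q i \<inter> csquare x d \<noteq> {} then ennreal ((min (diameter (Q i)) d)^2) else 0) \<le> ennreal (C * d^2)"
  using packing by blast
 \<comment> \<open>Chosen so that the final bound \<open>k * d * (1 + 4 * C)\<close> is half of
   \<open>e * d\<close>, which contradicts a sum of at least \<open>e\<close> for almost all
   \<open>r\<close> below \<open>d\<close>.\<close>
 define k where "k = e / (2 * (1 + 4 * C))"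
 have k: "k > 0" using pos C by (simp add: k_def)
 have fs: "meet_sum (\<lambda>i. if i \<in> I then UNIV else {}) (\<lambda>i. ennreal ((\<rho> i)^2)) (UNIV :: complex set) < \<infinity>"
 proof -
  have "(\<Sum>i. if (if i \<in> I then UNIV else {}) \<inter> (UNIV :: complex set) \<noteq> {} then ennreal ((\<rho> i)^2) else 0)
    = (\<Sum>i. if i \<in> I then ennreal ((\<rho> i)^2) else 0)" by (intro suminf_cong) simp
  then show ?thesis using sm by (simp add: meet_sum_def)
 qed
 obtain n where
  n: "(\<Sum>i. if i \<in> I then if i < n then 0 else ennreal ((\<rho> i)^2) else 0) < ennreal (k^2)"
 proof -
  obtain n where n: "meet_sum (\<lambda>i. if i \<in> I then UNIV else {}) (\<lambda>i. if i < n then 0 else ennreal ((\<rho> i)^2)) (UNIV :: complex set) < ennreal (k^2)"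
   using meet_sum_tail[OF fs, of "k^2"] k by auto
  have "(\<Sum>i. if (if i \<in> I then UNIV else {}) \<inter> (UNIV :: complex set) \<noteq> {} then if i < n then 0 else ennreal ((\<rho> i)^2) else 0)
    = (\<Sum>i. if i \<in> I then if i < n then 0 else ennreal ((\<rho> i)^2) else 0)" by (intro suminf_cong) simp
  then show ?thesis using n that unfolding meet_sum_def by metis
 qed
 \<comment> \<open>Squares below the size \<open>d1\<close> avoid those of the first
   \<open>n\<close> disks that count, since \<open>x\<close> is off their closures; only the tail of
   the energy is left.\<close>
 have "open (- (\<Union>i\<in>I \<inter> {..<n}. closure (Q i)))" by (auto intro!: closed_UN)
 moreover have "x \<in> - (\<Union>i\<in>I \<inter> {..<n}. closure (Q i))" using I by auto
 ultimately obtain d1 where d1: "d1 > 0" "square x d1 \<subseteq> - (\<Union>i\<in>I \<inter> {..<n}. closure (Q i))"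
  using open_contains_square by blast
 define d where "d = min d0 d1"
 have d: "0 < d" "d \<le> d0" "d \<le> d1" using pos d1 by (auto simp: d_def)
 define f where "f r = (\<Sum>i. if i \<in> I \<and> Q i \<inter> {z. sup_norm (z - x) = r} \<noteq> {} then ennreal (\<rho> i) else 0)" for r
 obtain T where T: "\<And>i. T i \<in> sets borel" "\<And>i. (\<lambda>z. sup_norm (z - x)) ` Q i \<subseteq> T i"
   "\<And>i. emeasure lborel (T i) \<le> ennreal (2 * diameter (Q i))"
 proof -
  have "\<bar>sup_norm (y - x) - sup_norm (z - x)\<bar> \<le> dist y z" for y z using sup_norm_diff_le[of "y - x" "z - x"] by (simp add: dist_norm)
  from disk_projection_integral[of "\<lambda>z. sup_norm (z - x)", OF this] show ?thesis using that by blast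
 qed
 define J where "J = {i\<in>I. n \<le> i \<and> Q i \<inter> csquare x d \<noteq> {}}"
 define h where "h r = (\<Sum>i. (if i \<in> J then ennreal (\<rho> i) else 0) * indicator (T i \<inter> {0<..<d}) r)" for r
 have [measurable]: "T i \<in> sets borel" for i by (rule T)
 have hm: "h \<in> borel_measurable borel" unfolding h_def by measurable
 have fh: "f r \<le> h r" if r: "0 < r" "r < d" for r unfolding f_def h_def
 proof (intro suminf_le summableI)
  fix i
  show "(if i \<in> I \<and> Q i \<inter> {z. sup_norm (z - x) = r} \<noteq> {} then ennreal (\<rho> i) else 0)
    \<le> (if i \<in> J then ennreal (\<rho> i) else 0) * indicator (T i \<inter> {0<..<d}) r"
  proof (cases "i \<in> I \<and> Q i \<inter> {z. sup_norm (z - x) = r} \<noteq> {}")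
   case True
   then obtain z where z: "z \<in> Q i" "sup_norm (z - x) = r" by blast
   have "r \<in> T i" using T(2)[of i] z by blast
   moreover have "z \<in> square x d1" using z r d by (simp add: square_def)
   then have "\<not> i < n" using d1(2) True z closure_subset[of "Q i"] by blast
   moreover have "z \<in> csquare x d" using z r by (simp add: csquare_def)
   ultimately show ?thesis using True z r by (auto simp: J_def indicator_def)
  qed auto
 qed
 have int: "(\<integral>\<^sup>+r. h r \<partial>lborel) \<le> ennreal (k * d * (1 + 4 * C))"
 proof -
  have "(\<integral>\<^sup>+r. h r \<partial>lborel) = (\<Sum>i. \<integral>\<^sup>+r. (if i \<in> J then ennreal (\<rho> i) else 0) * indicator (T i \<inter> {0<..<d}) r \<partial>lborel)"
   unfolding h_def by (intro nn_integral_suminf) simp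
  also have "\<dots> = (\<Sum>i. (if i \<in> J then ennreal (\<rho> i) else 0) * emeasure lborel (T i \<inter> {0<..<d}))"
   by (intro suminf_cong nn_integral_cmult_indicator) simp
  \<comment> \<open>The weight \<open>d / k\<close> balances both parts: the tail then contributes
    at most \<open>k * d\<close>, and packing at most \<open>4 * C * k * d\<close>.\<close>
  also have "\<dots> \<le> (\<Sum>i. ennreal (d / k) * (if i \<in> I then if i < n then 0 else ennreal ((\<rho> i)^2) else 0)
    + ennreal (4 * k / d) * (if Q i \<inter> csquare x d \<noteq> {} then ennreal ((min (diameter (Q i)) d)^2) else 0))"
  proof (intro suminf_le summableI)
   fix i
   let ?m = "min (diameter (Q i)) d"
   show "(if i \<in> J then ennreal (\<rho> i) else 0) * emeasure lborel (T i \<inter> {0<..<d})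
    \<le> ennreal (d / k) * (if i \<in> I then if i < n then 0 else ennreal ((\<rho> i)^2) else 0)
    + ennreal (4 * k / d) * (if Q i \<inter> csquare x d \<noteq> {} then ennreal (?m^2) else 0)"
   proof (cases "i \<in> J")
    case True
    have m0: "0 < ?m" using diameter_disk_pos[of i] d by simp
    \<comment> \<open>The radii at which a disk is met have measure at most twice its diameter, and
      inside the window at most \<open>d\<close>; twice the minimum of both sizes is what packing
      can sum.\<close>
    have "emeasure lborel (T i \<inter> {0<..<d}) \<le> ennreal (2 * ?m)"
    proof (cases "diameter (Q i) \<le> d")
     case True
     have "emeasure lborel (T i \<inter> {0<..<d}) \<le> emeasure lborel (T i)" by (intro emeasure_mono) auto
     then show ?thesis using T(3)[of i] True by (simp add: min_def)
    next
     case False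
     have "emeasure lborel (T i \<inter> {0<..<d}) \<le> emeasure lborel {0<..<d}" by (intro emeasure_mono) auto
     also have "\<dots> \<le> ennreal (2 * d)" using d by (simp add: ennreal_leI)
     finally show ?thesis using False by (simp add: min_def)
    qed
    then have "ennreal (\<rho> i) * emeasure lborel (T i \<inter> {0<..<d}) \<le> ennreal (\<rho> i) * ennreal (2 * ?m)"
     by (rule mult_left_mono) simp
    also have "\<dots> \<le> ennreal (d / k) * (ennreal (\<rho> i))^2 + ennreal ((2 * ?m)^2 / (d / k))"
     using m0 d k by (intro ennreal_le_square_plus) auto
    also have "ennreal ((2 * ?m)^2 / (d / k)) = ennreal (4 * k / d) * ennreal (?m^2)"
     using d k by (simp add: ennreal_mult[symmetric] power_mult_distrib mult_ac)
    finally show ?thesis using True nn by (simp add: J_def ennreal_power)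
   qed simp
  qed
  also have "\<dots> = (\<Sum>i. ennreal (d / k) * (if i \<in> I then if i < n then 0 else ennreal ((\<rho> i)^2) else 0))
    + (\<Sum>i. ennreal (4 * k / d) * (if Q i \<inter> csquare x d \<noteq> {} then ennreal ((min (diameter (Q i)) d)^2) else 0))"
   by (intro suminf_add[symmetric] summableI)
  also have "\<dots> = ennreal (d / k) * (\<Sum>i. if i \<in> I then if i < n then 0 else ennreal ((\<rho> i)^2) else 0)
    + ennreal (4 * k / d) * (\<Sum>i. if Q i \<inter> csquare x d \<noteq> {} then ennreal ((min (diameter (Q i)) d)^2) else 0)"
   by (simp only: ennreal_suminf_cmult)
  also have "\<dots> \<le> ennreal (d / k) * ennreal (k^2) + ennreal (4 * k / d) * ennreal (C * d^2)"
   using n C(2)[OF d(1), of x] by (intro add_mono mult_left_mono) auto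
  also have "\<dots> = ennreal (d / k * k^2 + 4 * k / d * (C * d^2))"
   using d k C(1) by (simp add: ennreal_mult[symmetric] ennreal_plus[symmetric] del: ennreal_plus)
  also have "d / k * k^2 + 4 * k / d * (C * d^2) = k * d * (1 + 4 * C)" using d k by (simp add: power2_eq_square field_simps)
  finally show ?thesis .
 qed
 show ?thesis
 proof (rule ccontr)
  assume "\<not> ?thesis"
  then have no: "\<And>r. 0 < r ==> r < d0 ==> P r ==> ennreal e \<le> f r" unfolding f_def by (meson not_le)
  have "ennreal (e * d) = (\<integral>\<^sup>+r. ennreal e * indicator {0<..<d} r \<partial>lborel)"
   using d pos by (simp add: nn_integral_cmult_indicator ennreal_mult)
  also have "\<dots> \<le> (\<integral>\<^sup>+r. h r \<partial>lborel)"
  proof (rule nn_integral_mono_AE)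
   show "AE r in lborel. ennreal e * indicator {0<..<d} r \<le> h r" using ae
   proof eventually_elim
    case (elim r)
    show ?case
    proof (cases "0 < r \<and> r < d")
     case True
     then have "ennreal e \<le> f r" using no elim d by auto
     also have "\<dots> \<le> h r" using fh True by blast
     finally show ?thesis using True by simp
    qed auto
   qed
  qed
  also have "\<dots> \<le> ennreal (k * d * (1 + 4 * C))" by (rule int)
  finally have "e * d \<le> k * d * (1 + 4 * C)" using d k C(1) by (simp add: ennreal_le_iff)
  also have "\<dots> = e * d / 2" using C(1) by (simp add: k_def field_simps)
  finally show False using d pos by simp
 qed
qed

end

section \<open>Squares as chains of segments\<close>

lemma AE_lborel_affine:
 fixes c :: real
 assumes "AE x in lborel. P x" "c \<noteq> 0" shows "AE r in lborel. P (t + c * r)"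
proof -
 obtain N where N: "{x \<in> space lborel. \<not> P x} \<subseteq> N" "emeasure lborel N = 0" "N \<in> sets lborel" using AE_E[OF assms(1)] by metis
 have "AE x in lborel. x \<notin> N" using N by (intro AE_not_in) (auto simp: null_setsI)
 then have "AE r in lborel. t + c * r \<notin> N" using N(3) assms(2) by (intro AE_borel_affine) auto
 then show ?thesis by (rule eventually_mono) (use N(1) in auto)
qed

text \<open>Undoing \<open>k\<close> quarter turns brings the side to the right one. There the angle
  is at most \<open>pi/4\<close> in absolute value, so the cosine dominates the sine and the
  supremum norm of the direction is its real part.\<close>

lemma corner_angles_side:
 fixes k :: nat
 assumes k: "real k * (pi/2) - pi/4 \<le> t" "t \<le> real (Suc k) * (pi/2) - pi/4" and r: "0 < r"
 shows "\<exists>w. square_path c r t = c + \<i> ^ k * w \<and> Re w = r"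
proof -
 define G where "G = t - real k * (pi/2)"
 have G: "\<bar>G\<bar> \<le> pi/4"
 proof -
  have "real (Suc k) * (pi/2) = real k * (pi/2) + pi/2" by (simp add: algebra_simps)
  then show ?thesis using k unfolding G_def abs_le_iff by linarith
 qed
 have "cos (pi/4) \<le> cos \<bar>G\<bar>" using G pi_gt_zero by (intro cos_monotone_0_pi_le) auto
 moreover have "sin \<bar>G\<bar> \<le> sin (pi/4)" using G pi_gt_zero by (intro sin_monotone_2pi_le) auto
 moreover have "\<bar>sin G\<bar> = sin \<bar>G\<bar>" using G pi_gt_zero sin_ge_zero[of "\<bar>G\<bar>"] by (cases "G \<ge> 0") auto
 ultimately have sc: "\<bar>sin G\<bar> \<le> cos G" by (simp add: cos_45 sin_45)
 have c0: "0 < cos G" using \<open>cos (pi/4) \<le> cos \<bar>G\<bar>\<close> by (simp add: cos_45) (smt (verit) real_sqrt_gt_0_iff half_gt_zero)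
 have ik: "cis (real k * (pi/2)) = \<i> ^ k"
 proof (induction k)
  case (Suc k)
  have "cis (real (Suc k) * (pi/2)) = cis (pi/2) * cis (real k * (pi/2))" unfolding cis_mult by (rule arg_cong[of _ _ cis]) (simp add: field_simps)
  then show ?case using Suc by simp
 qed simp
 have t: "cis t = \<i> ^ k * cis G" unfolding ik[symmetric] cis_mult by (simp add: G_def)
 have ni: "sup_norm (\<i> ^ k * z) = sup_norm z" for z
 proof (induction k)
  case (Suc k)
  have "sup_norm (\<i> ^ Suc k * z) = sup_norm (\<i> * (\<i> ^ k * z))" by (simp only: power_Suc mult.assoc)
  also have "\<dots> = sup_norm (\<i> ^ k * z)" by (simp add: sup_norm_def max.commute)
  finally show ?case using Suc by simp
 qed simp
 have n: "sup_norm (cis t) = cos G" unfolding t ni using sc c0 by (simp add: sup_norm_def)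
 have "square_path c r t = c + \<i> ^ k * (of_real (r / cos G) * cis G)" unfolding square_path_def n unfolding t by (simp add: mult_ac)
 moreover have "Re (of_real (r / cos G) * cis G) = r" using c0 by simp
 ultimately show ?thesis by blast
qed

lemma square_path_on_line:
 fixes k :: nat and c :: complex
 assumes r: "0 < r"
 shows "\<exists>b X. (if b then X = Re c + r \<or> X = Re c - r else X = Im c + r \<or> X = Im c - r) \<and>
   (\<forall>t. real k * (pi/2) - pi/4 \<le> t --> t \<le> real (Suc k) * (pi/2) - pi/4 -->
    square_path c r t = line b X (if b then Im (square_path c r t) else Re (square_path c r t)))"
proof -
 have ik: "\<i> ^ k = 1 \<or> \<i> ^ k = \<i> \<or> \<i> ^ k = -1 \<or> \<i> ^ k = - \<i>" by (induction k) auto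
 consider "\<i> ^ k = 1" | "\<i> ^ k = \<i>" | "\<i> ^ k = -1" | "\<i> ^ k = - \<i>" using ik by blast
 then show ?thesis
 proof cases
  case 1
  show ?thesis using corner_angles_side[of k _ r c] r 1 by (intro exI[of _ True] exI[of _ "Re c + r"]) (fastforce simp: line_def complex_eq_iff)
 next
  case 2
  show ?thesis using corner_angles_side[of k _ r c] r 2 by (intro exI[of _ False] exI[of _ "Im c + r"]) (fastforce simp: line_def complex_eq_iff)
 next
  case 3
  show ?thesis using corner_angles_side[of k _ r c] r 3 by (intro exI[of _ True] exI[of _ "Re c - r"]) (fastforce simp: line_def complex_eq_iff)
 next
  case 4
  show ?thesis using corner_angles_side[of k _ r c] r 4 by (intro exI[of _ False] exI[of _ "Im c - r"]) (fastforce simp: line_def complex_eq_iff)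
 qed
qed

lemma abs_ereal_diff_le_iff: "\<bar>ereal a - ereal b\<bar> \<le> enn2ereal x \<longleftrightarrow> ennreal \<bar>a - b\<bar> \<le> x"
proof -
 have "\<bar>ereal a - ereal b\<bar> = enn2ereal (ennreal \<bar>a - b\<bar>)" by (simp add: enn2ereal_ennreal)
 then show ?thesis by (simp add: less_eq_ennreal.rep_eq)
qed

section \<open>Real functions on the carpet\<close>

context bounded_carpet
begin

definition upper :: "(complex => real) => nat => real" where "upper f i = (SUP x\<in>frontier (Q i). f x)"
definition lower :: "(complex => real) => nat => real" where "lower f i = (INF x\<in>frontier (Q i). f x)"
definition rosc :: "(complex => real) => nat => ennreal" where "rosc f i = ennreal (upper f i - lower f i)"
definition disk_bounded :: "(complex => real) => bool" where
 "disk_bounded f \<longleftrightarrow> (\<forall>i. bounded (f ` frontier (Q i)))"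

lemma disk_boundedD:
 assumes "disk_bounded f"
 shows "bdd_above (f ` frontier (Q i))" "bdd_below (f ` frontier (Q i))"
  "x \<in> frontier (Q i) ==> f x \<le> upper f i" "x \<in> frontier (Q i) ==> lower f i \<le> f x"
  "lower f i \<le> upper f i"
proof -
 show b: "bdd_above (f ` frontier (Q i))" "bdd_below (f ` frontier (Q i))"
  using assms by (auto simp: disk_bounded_def bounded_imp_bdd_above bounded_imp_bdd_below)
 show u: "f x \<le> upper f i" if "x \<in> frontier (Q i)" for x unfolding upper_def using b(1) that by (rule cSUP_upper[rotated])
 show l: "lower f i \<le> f x" if "x \<in> frontier (Q i)" for x unfolding lower_def using b(2) that by (rule cINF_lower)
 obtain y where "y \<in> frontier (Q i)" using frontier_disk_nonempty by blast
 then show "lower f i \<le> upper f i" using u[of y] l[of y] by linarith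
qed

lemma upper_least: "(\<And>x. x \<in> frontier (Q i) ==> f x \<le> c) ==> upper f i \<le> c"
 unfolding upper_def using frontier_disk_nonempty by (intro cSUP_least) auto

lemma lower_greatest: "(\<And>x. x \<in> frontier (Q i) ==> c \<le> f x) ==> c \<le> lower f i"
 unfolding lower_def using frontier_disk_nonempty by (intro cINF_greatest) auto

lemma disk_boundedI: "(\<And>i x. x \<in> frontier (Q i) ==> l i \<le> f x \<and> f x \<le> u i) ==> disk_bounded f"
 unfolding disk_bounded_def bounded_iff by (intro allI, rule_tac x = "max \<bar>l i\<bar> \<bar>u i\<bar>" in exI) (force simp: abs_le_iff)

lemma Msup_real: "disk_bounded f ==> Msup Q (\<lambda>x. ereal (f x)) i = ereal (upper f i)"
proof -
 assume f: "disk_bounded f"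
 show ?thesis unfolding Msup_def
 proof (intro antisym SUP_least)
  show "ereal (f x) \<le> ereal (upper f i)" if "x \<in> frontier (Q i)" for x using disk_boundedD(3)[OF f that] by simp
  show "ereal (upper f i) \<le> (SUP x\<in>frontier (Q i). ereal (f x))"
  proof (cases "SUP x\<in>frontier (Q i). ereal (f x)")
   case (real c)
   have "f x \<le> c" if "x \<in> frontier (Q i)" for x using SUP_upper[OF that, of "\<lambda>x. ereal (f x)"] real by simp
   then show ?thesis using upper_least[of i f c] real by simp
  next
   case MInf
   obtain y where "y \<in> frontier (Q i)" using frontier_disk_nonempty by blast
   then show ?thesis using SUP_upper[of y "frontier (Q i)" "\<lambda>x. ereal (f x)"] MInf by simp
  qed simp
 qed
qed

lemma minf_real: "disk_bounded f ==> minf Q (\<lambda>x. ereal (f x)) i = ereal (lower f i)"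
proof -
 assume f: "disk_bounded f"
 show ?thesis unfolding minf_def
 proof (intro antisym INF_greatest)
  show "ereal (lower f i) \<le> ereal (f x)" if "x \<in> frontier (Q i)" for x using disk_boundedD(4)[OF f that] by simp
  show "(INF x\<in>frontier (Q i). ereal (f x)) \<le> ereal (lower f i)"
  proof (cases "INF x\<in>frontier (Q i). ereal (f x)")
   case (real c)
   have "c \<le> f x" if "x \<in> frontier (Q i)" for x using INF_lower[OF that, of "\<lambda>x. ereal (f x)"] real by simp
   then show ?thesis using lower_greatest[of i c f] real by simp
  next
   case PInf
   obtain y where "y \<in> frontier (Q i)" using frontier_disk_nonempty by blast
   then show ?thesis using INF_lower[of y "frontier (Q i)" "\<lambda>x. ereal (f x)"] PInf by simp
  qed simp
 qed
qed

lemma osc_real: "disk_bounded f ==> osc Q (\<lambda>x. ereal (f x)) = rosc f"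
 by (rule ext) (simp add: osc_def Msup_real minf_real rosc_def e2ennreal_ereal)

lemma disk_bounded_of_finite:
 assumes "\<And>i. \<bar>Msup Q (\<lambda>x. ereal (f x)) i\<bar> \<noteq> \<infinity>" "\<And>i. \<bar>minf Q (\<lambda>x. ereal (f x)) i\<bar> \<noteq> \<infinity>"
 shows "disk_bounded f"
proof (rule disk_boundedI)
 fix i x assume x: "x \<in> frontier (Q i)"
 obtain u l where ul: "Msup Q (\<lambda>x. ereal (f x)) i = ereal u" "minf Q (\<lambda>x. ereal (f x)) i = ereal l"
 proof -
  have "\<exists>u. Msup Q (\<lambda>x. ereal (f x)) i = ereal u" using assms(1)[of i] by (cases "Msup Q (\<lambda>x. ereal (f x)) i") auto
  moreover have "\<exists>l. minf Q (\<lambda>x. ereal (f x)) i = ereal l" using assms(2)[of i] by (cases "minf Q (\<lambda>x. ereal (f x)) i") auto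
  ultimately show ?thesis using that by blast
 qed
 have "ereal (f x) \<le> ereal u" "ereal l \<le> ereal (f x)"
  using SUP_upper[OF x, of "\<lambda>x. ereal (f x)"] INF_lower[OF x, of "\<lambda>x. ereal (f x)"] ul by (auto simp: Msup_def minf_def)
 then show "real_of_ereal (minf Q (\<lambda>x. ereal (f x)) i) \<le> f x \<and> f x \<le> real_of_ereal (Msup Q (\<lambda>x. ereal (f x)) i)"
  using ul by simp
qed

definition real_gradient :: "(nat => ennreal) => (complex => real) => bool" where
 "real_gradient \<rho> f \<longleftrightarrow> (\<exists>G0\<subseteq>paths_in \<Omega>. carpet_mod ver \<Omega> Q G0 = 0 \<and>
   (\<forall>p\<in>nonconst_paths_in \<Omega> - G0. \<forall>x\<in>im p \<inter> S. \<forall>y\<in>im p \<inter> S.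
    ennreal \<bar>f x - f y\<bar> \<le> meet_sum Q \<rho> (im p)))"

lemma upper_gradient_real: "upper_gradient ver \<Omega> Q \<rho> (\<lambda>x. ereal (f x)) \<longleftrightarrow> real_gradient \<rho> f"
 unfolding upper_gradient_def real_gradient_def by (simp only: abs_ereal_diff_le_iff) simp

text \<open>One null set of lines has to serve all compact segments, so the condition quantifies
  over them.\<close>

definition good_line :: "(complex => real) => bool => real => bool" where
 "good_line f b X \<longleftrightarrow> (\<forall>s t. s \<le> t --> line b X ` {s..t} \<subseteq> \<Omega> -->
   (\<forall>x\<in>line b X ` {s..t} \<inter> S. \<forall>y\<in>line b X ` {s..t} \<inter> S.
    ennreal \<bar>f x - f y\<bar> \<le> meet_sum Q (rosc f) (line b X ` {s..t})))"

lemma line_path: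
 assumes "s < t" "line b X ` {s..t} \<subseteq> \<Omega>" shows "({s..t}, line b X) \<in> nonconst_paths_in \<Omega>"
proof -
 have "line b X s \<noteq> line b X t" using assms(1) dist_line[of b X s t] by auto
 then have "\<not> line b X constant_on {s..t}" using assms(1) unfolding constant_on_def by (metis atLeastAtMost_iff less_eq_real_def order_refl)
 then show ?thesis using assms by (auto simp: nonconst_paths_in_def paths_in_def is_cpath_def im_def continuous_on_line is_interval_cc)
qed

lemma AE_good_line:
 assumes "real_gradient (rosc f) f" shows "AE X in lborel. good_line f b X"
proof -
 obtain H0 where G: "carpet_mod ver \<Omega> Q H0 = 0"
  "\<And>c x y. c \<in> nonconst_paths_in \<Omega> - H0 ==> x \<in> im c \<inter> S ==> y \<in> im c \<inter> S ==>
    ennreal \<bar>f x - f y\<bar> \<le> meet_sum Q (rosc f) (im c)" using assms unfolding real_gradient_def by blast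
 from AE_line_not_exceptional[OF G(1), of b] show ?thesis
 proof eventually_elim
  case (elim X)
  show ?case unfolding good_line_def
  proof (intro allI impI ballI)
   fix s t x y assume a: "s \<le> t" "line b X ` {s..t} \<subseteq> \<Omega>" "x \<in> line b X ` {s..t} \<inter> S" "y \<in> line b X ` {s..t} \<inter> S"
   show "ennreal \<bar>f x - f y\<bar> \<le> meet_sum Q (rosc f) (line b X ` {s..t})"
   proof (cases "s = t")
    case True then show ?thesis using a by auto
   next
    case False
    then have p: "({s..t}, line b X) \<in> nonconst_paths_in \<Omega>" using a by (intro line_path) auto
    then have "({s..t}, line b X) \<notin> H0" using elim by (auto simp: nonconst_paths_in_def)
    then show ?thesis using G(2)[of "({s..t}, line b X)" x y] p a by (simp add: im_def)
   qed
  qed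
 qed
qed

text \<open>Extends a function from the carpet to the domain, so that values along a line or a
  square can be compared even where it runs inside a disk. The supremum is used because limits along
  accessing paths are formed with suprema.\<close>

definition disk_value :: "(complex => real) => complex => real" where
 "disk_value f z = (if \<exists>i. z \<in> Q i then upper f (THE i. z \<in> Q i) else f z)"

lemma disk_value_disk: "z \<in> Q i ==> disk_value f z = upper f i"
proof -
 assume z: "z \<in> Q i"
 then have "(THE i. z \<in> Q i) = i" using disk_unique by blast
 then show ?thesis using z by (auto simp: disk_value_def)
qed

lemma disk_value_carpet: "z \<in> S ==> disk_value f z = f z" using disk_not_carpet by (auto simp: disk_value_def)

lemma rosc_bound:
 assumes "disk_bounded f" "x \<in> frontier (Q i)" shows "ennreal \<bar>upper f i - f x\<bar> \<le> rosc f i"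
 unfolding rosc_def using disk_boundedD(3,4)[OF assms] by (intro ennreal_leI) auto

lemma connected_meets_frontier:
 assumes "connected X" "X \<inter> Q i \<noteq> {}" "\<not> X \<subseteq> Q i" obtains e where "e \<in> X" "e \<in> frontier (Q i)"
 using connected_Int_frontier[OF assms(1), of "Q i"] assms by blast

text \<open>One sum for passing from each end to a carpet point of the segment, through the circle
  of the disk containing that end, and one for the gradient inequality between the two carpet
  points: hence the factor 3. A segment inside a single disk has no such points, but there both
  values agree.\<close>

lemma good_line_disk_value:
 assumes f: "disk_bounded f" and g: "good_line f b X" and st: "s \<le> t" "line b X ` {s..t} \<subseteq> \<Omega>"
  and ac: "a \<in> {s..t}" "c \<in> {s..t}"
 shows "ennreal \<bar>disk_value f (line b X a) - disk_value f (line b X c)\<bar> \<le> 3 * meet_sum Q (rosc f) (line b X ` {s..t})"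
proof -
 let ?L = "line b X ` {s..t}"
 have con: "connected ?L" by (intro connected_continuous_image continuous_on_line) auto
 show ?thesis
 proof (cases "\<exists>i. ?L \<subseteq> Q i")
  case True
  then obtain i where "?L \<subseteq> Q i" by blast
  then have "line b X a \<in> Q i" "line b X c \<in> Q i" using ac by auto
  then show ?thesis by (simp add: disk_value_disk)
 next
  case False
  have "\<exists>e\<in>?L \<inter> S. ennreal \<bar>disk_value f (line b X a) - f e\<bar> \<le> meet_sum Q (rosc f) ?L" if a: "a \<in> {s..t}" for a
  proof (cases "line b X a \<in> S")
   case True
   then show ?thesis using a by (intro bexI[of _ "line b X a"]) (auto simp: disk_value_carpet)
  next
   case False
   have aL: "line b X a \<in> ?L" using a by blast
   then obtain i where i: "line b X a \<in> Q i" using not_in_carpet False st by blast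
   then obtain e where e: "e \<in> ?L" "e \<in> frontier (Q i)"
    using connected_meets_frontier[OF con, of i] aL \<open>\<nexists>i. ?L \<subseteq> Q i\<close> by blast
   have "ennreal \<bar>disk_value f (line b X a) - f e\<bar> \<le> rosc f i" using rosc_bound[OF f e(2)] by (simp add: disk_value_disk[OF i])
   also have "\<dots> \<le> meet_sum Q (rosc f) ?L" using i aL by (intro meet_sum_ge_term) blast
   finally show ?thesis using e frontier_disk_subset by blast
  qed
  then obtain e1 e2 where e: "e1 \<in> ?L \<inter> S" "ennreal \<bar>disk_value f (line b X a) - f e1\<bar> \<le> meet_sum Q (rosc f) ?L"
    "e2 \<in> ?L \<inter> S" "ennreal \<bar>disk_value f (line b X c) - f e2\<bar> \<le> meet_sum Q (rosc f) ?L" using ac by blast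
  have 3: "ennreal \<bar>f e1 - f e2\<bar> \<le> meet_sum Q (rosc f) ?L" using g st e unfolding good_line_def by blast
  have "ennreal \<bar>disk_value f (line b X a) - disk_value f (line b X c)\<bar>
    \<le> ennreal (\<bar>disk_value f (line b X a) - f e1\<bar> + \<bar>f e1 - f e2\<bar> + \<bar>disk_value f (line b X c) - f e2\<bar>)"
   by (intro ennreal_leI) linarith
  also have "\<dots> = ennreal \<bar>disk_value f (line b X a) - f e1\<bar> + ennreal \<bar>f e1 - f e2\<bar> + ennreal \<bar>disk_value f (line b X c) - f e2\<bar>"
   by (simp add: ennreal_plus)
  also have "\<dots> \<le> meet_sum Q (rosc f) ?L + meet_sum Q (rosc f) ?L + meet_sum Q (rosc f) ?L" using e 3 by (intro add_mono) auto
  also have "\<dots> = (1 + 1 + 1) * meet_sum Q (rosc f) ?L" by (simp only: distrib_right mult_1_left)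
  also have "(1 + 1 + 1 :: ennreal) = 3" by simp
  finally show ?thesis .
 qed
qed

definition good_square :: "(complex => real) => complex => real => bool" where
 "good_square f c r \<longleftrightarrow> good_line f True (Re c + r) \<and> good_line f True (Re c - r) \<and>
   good_line f False (Im c + r) \<and> good_line f False (Im c - r)"

lemma AE_good_square:
 assumes "real_gradient (rosc f) f" shows "AE r in lborel. good_square f c r"
proof -
 note A = AE_lborel_affine[OF AE_good_line[OF assms]]
 have "AE r in lborel. good_line f True (Re c + 1 * r)" "AE r in lborel. good_line f True (Re c + (-1) * r)"
  "AE r in lborel. good_line f False (Im c + 1 * r)" "AE r in lborel. good_line f False (Im c + (-1) * r)" by (intro A; simp)+
 then show ?thesis by eventually_elim (simp add: good_square_def)
qed

text \<open>The corners cut the arc into straight pieces. Angles run from 0 to at most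
  \<open>4 * pi\<close>, and the corners sit at odd multiples of \<open>pi/4\<close>, so nine pieces
  suffice, each costing the factor 3.\<close>

lemma good_square_arc:
 assumes f: "disk_bounded f" and g: "good_square f c r" and r: "0 < r"
  and t: "0 \<le> t1" "t1 \<le> t2" "t2 \<le> 4 * pi" and sub: "square_path c r ` {t1..t2} \<subseteq> \<Omega>"
 shows "ennreal \<bar>disk_value f (square_path c r t1) - disk_value f (square_path c r t2)\<bar>
   \<le> 27 * meet_sum Q (rosc f) (square_path c r ` {t1..t2})"
proof -
 let ?p = "square_path c r"
 define M where "M = meet_sum Q (rosc f) (?p ` {t1..t2})"
 define a where "a k = real k * (pi/2) - pi/4" for k :: nat
 define T where "T k = max t1 (min t2 (a k))" for k
 have amono: "a k \<le> a (Suc k)" for k using pi_gt_zero by (simp add: a_def algebra_simps)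
 have T: "t1 \<le> T k" "T k \<le> T (Suc k)" "T k \<le> t2" for k using t amono[of k] by (auto simp: T_def)
 have T0: "T 0 = t1" using t pi_gt_zero by (auto simp: T_def a_def)
 have T9: "T 9 = t2" using t pi_gt_zero by (auto simp: T_def a_def)
 have step: "ennreal \<bar>disk_value f (?p (T k)) - disk_value f (?p (T (Suc k)))\<bar> \<le> 3 * M" for k
 proof (cases "T k = T (Suc k)")
  case False
  then have lim: "a k \<le> T k" "T (Suc k) \<le> a (Suc k)" "T k < T (Suc k)"
   using t amono[of k] T(2)[of k] by (auto simp: T_def max_def min_def split: if_splits)
  obtain b X where bX: "if b then X = Re c + r \<or> X = Re c - r else X = Im c + r \<or> X = Im c - r"
   "\<And>u. a k \<le> u ==> u \<le> a (Suc k) ==> ?p u = line b X (if b then Im (?p u) else Re (?p u))"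
   using square_path_on_line[OF r, of c k] unfolding a_def by blast
  define q where "q u = (if b then Im (?p u) else Re (?p u))" for u
  have gl: "good_line f b X" using g bX(1) unfolding good_square_def by (cases b) auto
  have pq: "?p u = line b X (q u)" if "u \<in> {T k..T (Suc k)}" for u using bX(2)[of u] that lim unfolding q_def by auto
  \<comment> \<open>By connectedness the moving coordinate takes all values between those at the two
    ends, so this segment is contained in the traced part of the side.\<close>
  define s where "s = min (q (T k)) (q (T (Suc k)))"
  define s' where "s' = max (q (T k)) (q (T (Suc k)))"
  have "continuous_on {T k..T (Suc k)} q" unfolding q_def using continuous_on_square_path[of _ c r] by (cases b) (auto intro!: continuous_intros)
  then have "connected (q ` {T k..T (Suc k)})" by (intro connected_continuous_image) auto
  moreover have "q (T k) \<in> q ` {T k..T (Suc k)}" "q (T (Suc k)) \<in> q ` {T k..T (Suc k)}" using lim by auto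
  ultimately have "{s..s'} \<subseteq> q ` {T k..T (Suc k)}" unfolding s_def s'_def by (intro connected_contains_Icc) (auto simp: min_def max_def)
  then have "line b X ` {s..s'} \<subseteq> line b X ` q ` {T k..T (Suc k)}" by (rule image_mono)
  also have "\<dots> = ?p ` {T k..T (Suc k)}" unfolding image_image using pq by (intro image_cong) auto
  also have "\<dots> \<subseteq> ?p ` {t1..t2}" using T(1)[of k] T(3)[of "Suc k"] by (intro image_mono) auto
  finally have sub': "line b X ` {s..s'} \<subseteq> ?p ` {t1..t2}" .
  have "ennreal \<bar>disk_value f (line b X (q (T k))) - disk_value f (line b X (q (T (Suc k))))\<bar>
    \<le> 3 * meet_sum Q (rosc f) (line b X ` {s..s'})" using sub sub' by (intro good_line_disk_value f gl) (auto simp: s_def s'_def)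
  also have "\<dots> \<le> 3 * M" unfolding M_def using sub' by (intro mult_left_mono meet_sum_mono_set) auto
  finally show ?thesis using pq[of "T k"] pq[of "T (Suc k)"] lim by simp
 qed simp
 have "disk_value f (?p (T 0)) - disk_value f (?p (T 9)) = (\<Sum>k<9. disk_value f (?p (T k)) - disk_value f (?p (T (Suc k))))"
  by (rule sum_lessThan_telescope'[symmetric])
 then have "ennreal \<bar>disk_value f (?p t1) - disk_value f (?p t2)\<bar>
   \<le> ennreal (\<Sum>k<9. \<bar>disk_value f (?p (T k)) - disk_value f (?p (T (Suc k)))\<bar>)"
  unfolding T0 T9 by (simp only:) (intro ennreal_leI sum_abs)
 also have "\<dots> = (\<Sum>k<9. ennreal \<bar>disk_value f (?p (T k)) - disk_value f (?p (T (Suc k)))\<bar>)"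
  by (intro sum_ennreal[symmetric]) simp
 also have "\<dots> \<le> (\<Sum>k<(9::nat). 3 * M)" using step by (intro sum_mono)
 also have "\<dots> = 27 * M" by (simp add: mult.assoc[symmetric])
 finally show ?thesis unfolding M_def .
qed

end

lemma eventually_disks_to:
 "eventually P (disks_to Q A x) \<longleftrightarrow> (\<exists>e>0. \<forall>i. Q i \<inter> A \<noteq> {} \<and> Q i \<subseteq> ball x e --> P i)"
proof -
 have "eventually P (disks_to Q A x)
  \<longleftrightarrow> (\<exists>e\<in>{0<..}. eventually P (principal {i. Q i \<inter> A \<noteq> {} \<and> Q i \<subseteq> ball x e}))"
  unfolding disks_to_def
 proof (rule eventually_INF_base)
  fix a b :: real assume ab: "a \<in> {0<..}" "b \<in> {0<..}"
  have "ball x (min a b) \<subseteq> ball x a" "ball x (min a b) \<subseteq> ball x b" by auto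
  then show "\<exists>e\<in>{0<..}. principal {i. Q i \<inter> A \<noteq> {} \<and> Q i \<subseteq> ball x e}
    \<le> inf (principal {i. Q i \<inter> A \<noteq> {} \<and> Q i \<subseteq> ball x a}) (principal {i. Q i \<inter> A \<noteq> {} \<and> Q i \<subseteq> ball x b})"
   using ab by (intro bexI[of _ "min a b"]) auto
 qed auto
 then show ?thesis by (auto simp: eventually_principal)
qed

section \<open>Limits along paths accessing a point\<close>

context bounded_carpet
begin

text \<open>The arc of the square of radius \<open>r\<close> with parameters from \<open>s\<close>
  to \<open>s'\<close> cuts off \<open>N\<close>, a relative neighbourhood of \<open>x\<close> in
  \<open>W\<close>. Points of the open domain and points of its boundary share this notion. At the
  boundary the ends of the arc may lie outside \<open>W\<close>, so only subarcs with ends in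
  \<open>W\<close> have to stay in it. For \<open>x\<close> in the domain the whole arc lies in
  \<open>W\<close>, and if a disk is left out of \<open>W\<close>, the arc starts on its
  circle.\<close>

definition crosscut_region ::
 "complex set => complex => real => real => real => real => complex set => bool" where
 "crosscut_region W x r r1 s s' N \<longleftrightarrow> 0 \<le> s \<and> s \<le> s' \<and> s' \<le> 4 * pi \<and> N \<subseteq> W \<inter> csquare x r1 \<and>
   (\<exists>d>0. W \<inter> square x d \<subseteq> N) \<and>
   (\<forall>X. connected X --> X \<subseteq> W --> X \<inter> square_path x r ` {s..s'} = {} --> X \<inter> N \<noteq> {} --> X \<subseteq> N) \<and>
   (\<forall>t t'. s \<le> t --> t \<le> t' --> t' \<le> s' --> square_path x r t \<in> W --> square_path x r t' \<in> W -->
    square_path x r ` {t..t'} \<subseteq> W) \<and>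
   (x \<in> \<Omega> --> square_path x r s \<in> W \<and> square_path x r s' \<in> W \<and>
    (\<forall>i. \<not> Q i \<subseteq> W --> square_path x r s \<in> frontier (Q i)))"

text \<open>
 The set \<open>W\<close> is the part of the plane in which \<open>x\<close> may be approached: the domain minus the disk
 having \<open>x\<close> on its boundary, if there is one.
\<close>

definition crosscut_point :: "complex => complex set => bool" where
 "crosscut_point x W \<longleftrightarrow> W \<subseteq> \<Omega> \<and> (\<forall>i. Q i \<inter> W \<noteq> {} --> x \<notin> closure (Q i)) \<and>
   (\<exists>R>0. \<forall>r1. 0 < r1 --> r1 < R --> (\<exists>r0>0. \<forall>r. 0 < r --> r < r0 -->
    (\<exists>s s' N. crosscut_region W x r r1 s s' N)))"

text \<open>Any small square inside the domain works, traversed once.\<close>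

lemma crosscut_point_interior:
 assumes "x \<in> S" "\<And>i. x \<notin> frontier (Q i)" shows "crosscut_point x \<Omega>"
proof -
 have "x \<in> \<Omega>" using assms carpet_subset by blast
 then obtain R where R: "R > 0" "square x R \<subseteq> \<Omega>" using open_contains_square open_domain by blast
 have cl: "x \<notin> closure (Q i)" for i using assms disk_not_carpet by (auto simp: closure_disk)
 have "\<exists>r0>0. \<forall>r. 0 < r --> r < r0 --> (\<exists>s s' N. crosscut_region \<Omega> x r r1 s s' N)" if r1: "0 < r1" "r1 < R" for r1
 proof (rule exI[of _ r1], intro conjI allI impI)
  fix r assume r: "0 < r" "r < r1"
  have n: "sup_norm (square_path x r t - x) = r" for t using square_path_norm[of r x t] r by simp
  have sub: "square_path x r ` T \<subseteq> \<Omega>" for T using R(2) n r r1 by (auto simp: square_def)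
  have "crosscut_region \<Omega> x r r1 0 (2 * pi) (square x r)" unfolding crosscut_region_def
  proof (intro conjI allI impI)
   show "square x r \<subseteq> \<Omega> \<inter> csquare x r1" using R r r1 by (auto simp: square_def csquare_def)
   show "\<exists>d>0. \<Omega> \<inter> square x d \<subseteq> square x r" using r by blast
   fix X assume X: "connected X" "X \<subseteq> \<Omega>" "X \<inter> square_path x r ` {0..2 * pi} = {}" "X \<inter> square x r \<noteq> {}"
   obtain a where a: "a \<in> X" "sup_norm (a - x) < r" using X(4) by (auto simp: square_def)
   have ne: "sup_norm (z - x) \<noteq> r" if "z \<in> X" for z
   proof
    assume "sup_norm (z - x) = r"
    then obtain t where "t \<in> {0..<0 + 2 * pi}" "square_path x r t = z" using square_path_surj[OF r(1)] by blast
    then show False using X(3) that by auto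
   qed
   show "X \<subseteq> square x r"
   proof
    fix z assume z: "z \<in> X"
    then show "z \<in> square x r" using connected_meets_square[OF X(1) a z] ne by (force simp: square_def)
   qed
  next
   show "square_path x r 0 \<in> frontier (Q i)" if "\<not> Q i \<subseteq> \<Omega>" for i using that disk_subset by blast
  qed (use pi_gt_zero sub R in \<open>auto simp: image_subset_iff\<close>)
  then show "\<exists>s s' N. crosscut_region \<Omega> x r r1 s s' N" by blast
 qed (use r1 in auto)
 then show ?thesis using R cl unfolding crosscut_point_def by blast
qed

text \<open>Crosscuts on the outer side of the boundary curve of \<open>Q i0\<close>; small squares
  around \<open>x\<close> stay in the domain.\<close>

lemma crosscut_point_disk:
 assumes "x \<in> frontier (Q i0)" shows "crosscut_point x (\<Omega> - Q i0)"
proof -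
 have xS: "x \<in> \<Omega>" using assms frontier_disk_subset carpet_subset by blast
 then obtain R where R: "R > 0" "square x R \<subseteq> \<Omega>" using open_contains_square open_domain by blast
 let ?G = "frontier (Q i0)" and ?U = "- closure (Q i0)" and ?W = "\<Omega> - Q i0"
 have UG: "?U \<union> ?G = - Q i0" using closure_disk[of i0] frontier_not_in_disk[of _ i0 i0] by auto
 have cl: "x \<notin> closure (Q i)" if "Q i \<inter> ?W \<noteq> {}" for i
 proof
  assume "x \<in> closure (Q i)"
  then have "i = i0" using assms closure_disk_unique by (auto simp: closure_disk)
  then show False using that by auto
 qed
 have far: "?U - square x r1 \<noteq> {}" for r1
 proof
  assume "?U - square x r1 = {}"
  then have "UNIV \<subseteq> closure (Q i0) \<union> square x r1" by auto
  moreover have "bounded (closure (Q i0) \<union> square x r1)" using bounded_disk by (simp add: bounded_closure)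
  ultimately show False using bounded_subset not_bounded_UNIV by blast
 qed
 have "\<exists>r0>0. \<forall>r. 0 < r --> r < r0 --> (\<exists>s s' N. crosscut_region ?W x r r1 s s' N)" if r1: "0 < r1" "r1 < R" for r1
 proof -
  obtain r0 where r0: "r0 > 0" and cc: "\<And>r. 0 < r ==> r < r0 ==> \<exists>s s' N d. 0 \<le> s \<and> s < s' \<and> s' \<le> 4 * pi \<and>
   square_path x r ` {s<..<s'} \<subseteq> ?U \<and> square_path x r s \<in> ?G \<and> square_path x r s' \<in> ?G \<and>
   0 < d \<and> (?U \<union> ?G) \<inter> square x d \<subseteq> N \<and> N \<subseteq> (?U \<union> ?G) \<inter> csquare x r1 \<and>
   (\<forall>X. connected X --> X \<subseteq> ?U \<union> ?G --> X \<inter> square_path x r ` {s..s'} = {} --> X \<inter> N \<noteq> {} --> X \<subseteq> N)"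
   using square_crosscut[OF disk_sides(2) assms r1(1) far] by metis
  have "\<exists>s s' N. crosscut_region ?W x r r1 s s' N" if r: "0 < r" "r < min r0 r1" for r
  proof -
   have n: "sup_norm (square_path x r t - x) = r" for t using square_path_norm[of r x t] r by simp
   have sub: "square_path x r t \<in> \<Omega>" for t using R(2) n r r1 by (auto simp: square_def)
   obtain s s' N d where c: "0 \<le> s" "s < s'" "s' \<le> 4 * pi"
    "square_path x r ` {s<..<s'} \<subseteq> ?U" "square_path x r s \<in> ?G" "square_path x r s' \<in> ?G"
    "0 < d" "- Q i0 \<inter> square x d \<subseteq> N" "N \<subseteq> - Q i0 \<inter> csquare x r1"
    "\<And>X. connected X ==> X \<subseteq> - Q i0 ==> X \<inter> square_path x r ` {s..s'} = {} ==> X \<inter> N \<noteq> {} ==> X \<subseteq> N"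
    using cc[of r, unfolded UG] r by auto
   have inW: "square_path x r t \<in> ?W" if "s \<le> t" "t \<le> s'" for t
   proof -
    have "square_path x r t \<in> ?U \<union> ?G"
    proof (cases "t = s \<or> t = s'")
     case True then show ?thesis using c(5,6) by blast
    next
     case False
     then have "t \<in> {s<..<s'}" using that by auto
     then show ?thesis using c(4) by blast
    qed
    then show ?thesis using sub[of t] unfolding UG by blast
   qed
   have "crosscut_region ?W x r r1 s s' N" unfolding crosscut_region_def
   proof (intro conjI allI impI)
    have "csquare x r1 \<subseteq> \<Omega>" using R(2) r1 by (auto simp: square_def csquare_def)
    then show "N \<subseteq> ?W \<inter> csquare x r1" using c(9) by auto
    show "\<exists>d>0. ?W \<inter> square x d \<subseteq> N" using c(7,8) by blast
    show "X \<subseteq> N" if "connected X" "X \<subseteq> ?W" "X \<inter> square_path x r ` {s..s'} = {}" "X \<inter> N \<noteq> {}" for X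
     using c(10)[of X] that by blast
    show "square_path x r ` {t..t'} \<subseteq> ?W" if "s \<le> t" "t' \<le> s'" for t t' using inW that by auto
    show "square_path x r s \<in> frontier (Q i)" if "\<not> Q i \<subseteq> ?W" for i
    proof -
     have "i = i0" using that disk_subset[of i] disk_disjoint[of i i0] by blast
     then show ?thesis using c(5) by simp
    qed
   qed (use c inW in auto)
   then show ?thesis by blast
  qed
  then show ?thesis using r0 r1 by (intro exI[of _ "min r0 r1"]) auto
 qed
 then show ?thesis using R cl unfolding crosscut_point_def by blast
qed

definition disk_controlled :: "(complex => real) => cpath => bool" where
 "disk_controlled f p \<longleftrightarrow> (\<forall>p' i j. subcpath p' p --> Q i \<inter> im p' \<noteq> {} --> Q j \<inter> im p' \<noteq> {} -->
   ennreal \<bar>upper f i - upper f j\<bar> \<le> meet_sum Q (rosc f) (im p'))"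

text \<open>Collects what paths accessing a carpet point and paths accessing a boundary point have
  in common, so that limits along them are studied once. Finiteness is asked only near
  \<open>x\<close>, because functions in the local Sobolev space offer no more.\<close>

definition approach :: "(complex => real) => complex => complex set => cpath => bool" where
 "approach f x W p \<longleftrightarrow> is_cpath p \<and> im p \<subseteq> W \<and> disk_controlled f p \<and>
   (\<exists>h>0. \<forall>p'. subcpath p' p --> im p' \<subseteq> square x h --> meet_sum Q (rosc f) (im p') < \<infinity>) \<and>
   hausdorff1 (im p \<inter> S) = 0 \<and> x \<in> closure (im p) \<and> (\<exists>y\<in>im p. y \<noteq> x)"

definition locally_square_summable :: "(complex => real) => complex => bool" where
 "locally_square_summable f x \<longleftrightarrow> (\<exists>h>0. meet_sum Q (\<lambda>i. (rosc f i)^2) (square x h) < \<infinity>)"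

lemma connected_im: "is_cpath p ==> connected (im p)" unfolding is_cpath_def im_def
 by (intro connected_continuous_image) (auto intro: continuous_on_subset[OF _ closure_subset] simp: is_interval_connected)

lemma is_cpath_sub: "is_cpath p ==> subcpath p' p ==> is_cpath p'" unfolding is_cpath_def subcpath_def
 by (auto intro: bounded_subset continuous_on_subset[OF _ closure_mono])

lemma im_sub: "subcpath p' p ==> im p' \<subseteq> im p" unfolding subcpath_def im_def by auto

lemma subcpath_trans: "subcpath p'' p' ==> subcpath p' p ==> subcpath p'' p" unfolding subcpath_def by auto

text \<open>The path may come near \<open>x\<close> at many times, so its part in a small square
  need not be connected. If bad disks existed at every scale, times spent in them would accumulate
  at some \<open>l\<close> with \<open>g l = x\<close>. The path on a short interval around
  \<open>l\<close> is connected, misses the finitely many heavy disks and has a sum below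
  \<open>e\<close>, which bounds the variation of the disk values on it.\<close>

lemma approach_piece:
 assumes ap: "approach f x W p" and cl: "\<And>i. Q i \<inter> W \<noteq> {} ==> x \<notin> closure (Q i)" and e: "0 < (e::real)"
 shows "\<exists>h>0. \<forall>i. Q i \<inter> im p \<inter> square x h \<noteq> {} -->
  (\<exists>X. connected X \<and> X \<subseteq> im p \<and> Q i \<inter> X \<noteq> {} \<and> x \<in> closure X \<and>
   (\<forall>j. Q j \<inter> X \<noteq> {} --> \<bar>upper f i - upper f j\<bar> \<le> e))"
proof (rule ccontr)
 assume neg: "\<not> ?thesis"
 obtain I g where p: "p = (I, g)" by (cases p)
 have I: "I \<noteq> {}" "is_interval I" "bounded I" "continuous_on (closure I) g" "g ` I \<subseteq> W"
  using ap by (auto simp: approach_def is_cpath_def p im_def)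
 obtain h0 where h0: "h0 > 0" "\<And>p'. subcpath p' p ==> im p' \<subseteq> square x h0 ==> meet_sum Q (rosc f) (im p') < \<infinity>"
  using ap by (auto simp: approach_def)
 have "\<forall>n::nat. \<exists>i. Q i \<inter> im p \<inter> square x (1 / Suc n) \<noteq> {} \<and>
  \<not> (\<exists>X. connected X \<and> X \<subseteq> im p \<and> Q i \<inter> X \<noteq> {} \<and> x \<in> closure X \<and>
   (\<forall>j. Q j \<inter> X \<noteq> {} --> \<bar>upper f i - upper f j\<bar> \<le> e))"
 proof
  fix n :: nat
  have "0 < 1 / real (Suc n)" by simp
  then show "\<exists>i. Q i \<inter> im p \<inter> square x (1 / Suc n) \<noteq> {} \<and>
  \<not> (\<exists>X. connected X \<and> X \<subseteq> im p \<and> Q i \<inter> X \<noteq> {} \<and> x \<in> closure X \<and>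
   (\<forall>j. Q j \<inter> X \<noteq> {} --> \<bar>upper f i - upper f j\<bar> \<le> e))" using neg by blast
 qed
 then obtain i where i: "\<And>n. Q (i n) \<inter> im p \<inter> square x (1 / Suc n) \<noteq> {}"
  "\<And>n X. connected X ==> X \<subseteq> im p ==> Q (i n) \<inter> X \<noteq> {} ==> x \<in> closure X ==>
   \<exists>j. Q j \<inter> X \<noteq> {} \<and> \<not> \<bar>upper f (i n) - upper f j\<bar> \<le> e" by metis
 have "\<forall>n. \<exists>t\<in>I. g t \<in> Q (i n) \<and> g t \<in> square x (1 / Suc n)" using i(1) by (fastforce simp: im_def p)
 then obtain t where t: "\<And>n. t n \<in> I" "\<And>n. g (t n) \<in> Q (i n)" "\<And>n. g (t n) \<in> square x (1 / Suc n)" by metis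
 have gx: "(\<lambda>n. g (t n)) \<longlonglongrightarrow> x"
 proof (rule metric_LIMSEQ_I)
  fix d :: real assume d: "0 < d"
  obtain m where m: "inverse (real (Suc m)) < d / 2" using reals_Archimedean[of "d/2"] d by auto
  have "dist (g (t n)) x < d" if "n \<ge> m" for n
  proof -
   have "1 / real (Suc n) \<le> 1 / real (Suc m)" using that by (intro divide_left_mono) auto
   moreover have "dist (g (t n)) x \<le> 2 * sup_norm (g (t n) - x)" using norm_le_sup_norm by (simp add: dist_norm)
   ultimately show ?thesis using t(3)[of n] m by (simp add: square_def inverse_eq_divide)
  qed
  then show "\<exists>m. \<forall>n\<ge>m. dist (g (t n)) x < d" by blast
 qed
 have "compact (closure I)" using I(3) by (simp add: compact_closure)
 moreover have "\<forall>n. t n \<in> closure I" using t(1) closure_subset by blast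
 ultimately obtain l q where lq: "l \<in> closure I" "strict_mono q" "(t \<circ> q) \<longlonglongrightarrow> l" unfolding compact_def by metis
 have gl: "g l = x"
 proof -
  have "(\<lambda>n. g ((t \<circ> q) n)) \<longlonglongrightarrow> g l"
   using I(4) lq \<open>\<forall>n. t n \<in> closure I\<close> by (intro continuous_on_tendsto_compose[of "closure I" g]) (auto simp: o_def)
  moreover have "(\<lambda>n. g ((t \<circ> q) n)) \<longlonglongrightarrow> x" using LIMSEQ_subseq_LIMSEQ[OF gx lq(2)] by (simp add: o_def)
  ultimately show ?thesis using LIMSEQ_unique by blast
 qed
 have nbhd: "\<exists>k>0. \<forall>s\<in>closure I. \<bar>s - l\<bar> < k --> g s \<in> V" if "open V" "x \<in> V" for V
 proof -
  obtain A where A: "open A" "A \<inter> closure I = g -` V \<inter> closure I"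
   using I(4) \<open>open V\<close> unfolding continuous_on_open_invariant by metis
  have "l \<in> A \<inter> closure I" unfolding A(2) using lq(1) gl \<open>x \<in> V\<close> by simp
  then have "l \<in> A" by simp
  then obtain k where "k > 0" "ball l k \<subseteq> A" using A(1) openE by blast
  have "\<forall>s\<in>closure I. \<bar>s - l\<bar> < k --> g s \<in> V"
  proof (intro ballI impI)
   fix u assume u: "u \<in> closure I" "\<bar>u - l\<bar> < k"
   then have "u \<in> A \<inter> closure I" using \<open>ball l k \<subseteq> A\<close> by (auto simp: dist_real_def abs_minus_commute)
   then show "g u \<in> V" unfolding A(2) by simp
  qed
  then show ?thesis using \<open>k > 0\<close> by blast
 qed
 define P where "P k = (I \<inter> {l - k<..<l + k}, g)" for k
 have sub: "subcpath (P k) p" if "k > 0" for k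
 proof -
  have "eventually (\<lambda>n. (t \<circ> q) n \<in> {l - k<..<l + k}) sequentially" by (rule topological_tendstoD[OF lq(3)]) (use that in auto)
  then obtain n where "t (q n) \<in> {l - k<..<l + k}" by (auto simp: eventually_sequentially)
  then have "I \<inter> {l - k<..<l + k} \<noteq> {}" using t(1)[of "q n"] by blast
  moreover have "is_interval (I \<inter> {l - k<..<l + k})" using I(2) by (intro is_interval_Int) (auto simp: is_interval_oo)
  ultimately show ?thesis by (auto simp: subcpath_def P_def p)
 qed
 have imP: "im (P k) \<subseteq> V" if "\<forall>s\<in>closure I. \<bar>s - l\<bar> < k --> g s \<in> V" for k V
 proof
  fix y assume "y \<in> im (P k)"
  then obtain u where "u \<in> I" "l - k < u" "u < l + k" "y = g u" by (auto simp: im_def P_def)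
  then show "y \<in> V" using that closure_subset[of I] by auto
 qed
 obtain k0 where k0: "k0 > 0" "im (P k0) \<subseteq> square x h0" using nbhd[of "square x h0"] h0(1) centre_in_square imP by (metis open_square)
 have fin: "meet_sum Q (rosc f) (im (P k0)) < \<infinity>" using h0(2)[OF sub[OF k0(1)] k0(2)] .
 obtain m where m: "meet_sum Q (\<lambda>i. if i < m then 0 else rosc f i) (im (P k0)) < ennreal e" using meet_sum_tail[OF fin e] by blast
 let ?V = "- (\<Union>i\<in>{i. i < m \<and> Q i \<inter> W \<noteq> {}}. closure (Q i))"
 have "open ?V" by (intro open_Compl closed_UN) auto
 moreover have "x \<in> ?V" using cl by auto
 ultimately obtain k1 where k1': "k1 > 0" "\<forall>s\<in>closure I. \<bar>s - l\<bar> < k1 --> g s \<in> ?V" using nbhd[of ?V] by blast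
 have k1: "k1 > 0" "im (P k1) \<subseteq> ?V" using k1'(1) imP[OF k1'(2)] by simp_all
 define k where "k = min k0 k1"
 have k: "k > 0" "im (P k) \<subseteq> im (P k0)" "im (P k) \<subseteq> im (P k1)"
 proof -
  have "im (P a) \<subseteq> im (P b)" if "a \<le> b" for a b using that unfolding P_def im_def fst_conv snd_conv by (intro image_mono) auto
  then show "k > 0" "im (P k) \<subseteq> im (P k0)" "im (P k) \<subseteq> im (P k1)" using k0(1) k1(1) by (simp_all add: k_def)
 qed
 \<comment> \<open>The piece lies in \<open>W\<close> and off the closures removed in
   \<open>?V\<close>, so it meets only disks of the tail.\<close>
 have small: "meet_sum Q (rosc f) (im (P k)) < ennreal e"
 proof -
  have "meet_sum Q (rosc f) (im (P k)) \<le> meet_sum Q (\<lambda>i. if i < m then 0 else rosc f i) (im (P k0))" unfolding meet_sum_def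
  proof (intro suminf_le summableI)
   fix i
   have "im (P k) \<subseteq> W" using I(5) by (auto simp: im_def P_def)
   then have "\<not> i < m" if "Q i \<inter> im (P k) \<noteq> {}" using that k(3) k1(2) closure_subset[of "Q i"] by fast
   then show "(if Q i \<inter> im (P k) \<noteq> {} then rosc f i else 0)
     \<le> (if Q i \<inter> im (P k0) \<noteq> {} then if i < m then 0 else rosc f i else 0)" using k(2) by auto
  qed
  then show ?thesis using m by (rule order_le_less_trans)
 qed
 have "eventually (\<lambda>n. (t \<circ> q) n \<in> {l - k<..<l + k}) sequentially" by (rule topological_tendstoD[OF lq(3)]) (use k(1) in auto)
 then obtain n0 where n0: "\<And>n. n \<ge> n0 ==> t (q n) \<in> {l - k<..<l + k}" by (auto simp: eventually_sequentially)
 then have inX: "g (t (q n)) \<in> im (P k)" if "n \<ge> n0" for n using that t(1) by (auto simp: im_def P_def)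
 have cx: "x \<in> closure (im (P k))" unfolding closure_sequential
 proof (intro exI conjI allI)
  show "g (t (q (n + n0))) \<in> im (P k)" for n using inX by simp
  have "(\<lambda>n. g (t (q n))) \<longlonglongrightarrow> x" using LIMSEQ_subseq_LIMSEQ[OF gx lq(2)] by (simp add: o_def)
  then show "(\<lambda>n. g (t (q (n + n0)))) \<longlonglongrightarrow> x" by (rule LIMSEQ_ignore_initial_segment)
 qed
 have con: "connected (im (P k))"
 proof -
  have "is_cpath p" using ap unfolding approach_def by blast
  then show ?thesis using is_cpath_sub[OF _ sub[OF k(1)]] connected_im by blast
 qed
 have meets: "Q (i (q n0)) \<inter> im (P k) \<noteq> {}" using inX[of n0] t(2) by blast
 obtain j where j: "Q j \<inter> im (P k) \<noteq> {}" "\<not> \<bar>upper f (i (q n0)) - upper f j\<bar> \<le> e"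
  using i(2)[OF con _ meets cx] im_sub[OF sub[OF k(1)]] by blast
 have "ennreal \<bar>upper f (i (q n0)) - upper f j\<bar> \<le> meet_sum Q (rosc f) (im (P k))"
  using ap sub[OF k(1)] meets j(1) unfolding approach_def disk_controlled_def by blast
 also have "\<dots> \<le> ennreal e" using small by simp
 finally show False using j(2) e by (simp add: ennreal_le_iff)
qed

lemma AE_avoids_carpet_on_square:
 assumes "hausdorff1 (X \<inter> S) = 0" shows "AE r in lborel. \<forall>z\<in>X \<inter> S. sup_norm (z - x) \<noteq> r"
proof -
 have "\<bar>sup_norm (y - x) - sup_norm (z - x)\<bar> \<le> dist y z" for y z using sup_norm_diff_le[of "y - x" "z - x"] by (simp add: dist_norm)
 from AE_notin_lipschitz_image[OF assms, of "\<lambda>z. sup_norm (z - x)", OF this]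
 show ?thesis by eventually_elim auto
qed

text \<open>Both sets run from \<open>x\<close> to points beyond the region cut off, so both cross
  the same crosscut. For generic \<open>r\<close> they cross it inside disks, and the disk values
  along the crosscut vary by at most \<open>e'\<close>.\<close>

lemma approach_values_agree:
 assumes cp: "crosscut_point x W" and f: "disk_bounded f" "real_gradient (rosc f) f" "locally_square_summable f x"
  and X1: "connected X1" "X1 \<subseteq> W" "x \<in> closure X1" "y1 \<in> X1" "y1 \<noteq> x" "hausdorff1 (X1 \<inter> S) = 0"
    "\<And>j. Q j \<inter> X1 \<noteq> {} ==> \<bar>l1 - upper f j\<bar> \<le> e"
  and X2: "connected X2" "X2 \<subseteq> W" "x \<in> closure X2" "y2 \<in> X2" "y2 \<noteq> x" "hausdorff1 (X2 \<inter> S) = 0"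
    "\<And>j. Q j \<inter> X2 \<noteq> {} ==> \<bar>l2 - upper f j\<bar> \<le> e"
 shows "\<bar>l1 - l2\<bar> \<le> 2 * e"
proof (rule field_le_epsilon)
 fix e' :: real assume e': "0 < e'"
 obtain R where WO: "W \<subseteq> \<Omega>" and cl: "\<And>i. Q i \<inter> W \<noteq> {} ==> x \<notin> closure (Q i)" and R: "R > 0"
  "\<And>r1. 0 < r1 ==> r1 < R ==> (\<exists>r0>0. \<forall>r. 0 < r --> r < r0 --> (\<exists>s s' N. crosscut_region W x r r1 s s' N))"
  using cp unfolding crosscut_point_def by metis
 obtain h where h: "h > 0" "meet_sum Q (\<lambda>i. (rosc f i)^2) (square x h) < \<infinity>" using f(3) by (auto simp: locally_square_summable_def)
 have yn: "0 < sup_norm (y1 - x)" "0 < sup_norm (y2 - x)"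
  using X1(5) X2(5) sup_norm_nonneg[of "y1 - x"] sup_norm_nonneg[of "y2 - x"] by (auto simp: less_le simp del: sup_norm_nonneg)
 \<comment> \<open>Below both distances, so that \<open>y1\<close> and \<open>y2\<close> are outside
   the region cut off.\<close>
 define r1 where "r1 = min (R/2) (min (sup_norm (y1 - x) / 2) (sup_norm (y2 - x) / 2))"
 have r1: "0 < r1" "r1 < R" "r1 < sup_norm (y1 - x)" "r1 < sup_norm (y2 - x)" using R(1) yn by (auto simp: r1_def)
 obtain r0 where r0: "r0 > 0" "\<And>r. 0 < r ==> r < r0 ==> (\<exists>s s' N. crosscut_region W x r r1 s s' N)" using R(2)[OF r1(1,2)] by blast
 define I where "I = {i. Q i \<inter> W \<noteq> {} \<and> Q i \<inter> square x h \<noteq> {}}"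
 define \<rho> where "\<rho> i = upper f i - lower f i" for i
 have \<rho>0: "0 \<le> \<rho> i" for i using disk_boundedD(5)[OF f(1)] by (simp add: \<rho>_def)
 have \<rho>r: "rosc f i = ennreal (\<rho> i)" for i by (simp add: rosc_def \<rho>_def)
 have "(\<Sum>i. if i \<in> I then ennreal ((\<rho> i)^2) else 0) \<le> meet_sum Q (\<lambda>i. (rosc f i)^2) (square x h)"
  unfolding meet_sum_def \<rho>r using \<rho>0 by (intro suminf_le summableI) (auto simp: I_def ennreal_power)
 then have sm: "(\<Sum>i. if i \<in> I then ennreal ((\<rho> i)^2) else 0) < \<infinity>" using h(2) by (rule order_le_less_trans)
 have ae: "AE r in lborel. good_square f x r \<and> (\<forall>z\<in>X1 \<inter> S. sup_norm (z - x) \<noteq> r) \<and> (\<forall>z\<in>X2 \<inter> S. sup_norm (z - x) \<noteq> r)"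
  using AE_good_square[OF f(2)] AE_avoids_carpet_on_square[OF X1(6)] AE_avoids_carpet_on_square[OF X2(6)] by eventually_elim blast
 have clI: "x \<notin> closure (Q i)" if "i \<in> I" for i using that cl by (auto simp: I_def)
 \<comment> \<open>The 27 undoes the factor of \<open>good_square_arc\<close>.\<close>
 have "0 < e' / 27" "0 < min r0 h" using e' r0 h by auto
 from square_with_small_sum[OF \<rho>0 sm clI ae this] obtain r where
  rr: "0 < r \<and> r < min r0 h \<and> (good_square f x r \<and> (\<forall>z\<in>X1 \<inter> S. sup_norm (z - x) \<noteq> r) \<and> (\<forall>z\<in>X2 \<inter> S. sup_norm (z - x) \<noteq> r)) \<and>
  (\<Sum>i. if i \<in> I \<and> Q i \<inter> {z. sup_norm (z - x) = r} \<noteq> {} then ennreal (\<rho> i) else 0) < ennreal (e' / 27)" by blast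
 have r: "0 < r" "r < min r0 h" "good_square f x r" "\<And>z. z \<in> X1 \<inter> S ==> sup_norm (z - x) \<noteq> r" "\<And>z. z \<in> X2 \<inter> S ==> sup_norm (z - x) \<noteq> r"
  "(\<Sum>i. if i \<in> I \<and> Q i \<inter> {z. sup_norm (z - x) = r} \<noteq> {} then ennreal (\<rho> i) else 0) < ennreal (e' / 27)" using rr by blast+
 have "r < r0" using r(2) by simp
 then obtain s s' N where "crosscut_region W x r r1 s s' N" using r0(2)[OF r(1)] by blast
 then obtain d where c: "0 \<le> s" "s' \<le> 4 * pi" "N \<subseteq> csquare x r1" "d > 0" "W \<inter> square x d \<subseteq> N"
  "\<And>X. connected X ==> X \<subseteq> W ==> X \<inter> square_path x r ` {s..s'} = {} ==> X \<inter> N \<noteq> {} ==> X \<subseteq> N"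
  "\<And>t t'. s \<le> t ==> t \<le> t' ==> t' \<le> s' ==> square_path x r t \<in> W ==> square_path x r t' \<in> W ==>
    square_path x r ` {t..t'} \<subseteq> W" unfolding crosscut_region_def by auto
 have n: "sup_norm (square_path x r t - x) = r" for t using square_path_norm[of r x t] r by simp
 \<comment> \<open>A set accumulating at \<open>x\<close> meets \<open>N\<close>, while its far
   point is not in \<open>N\<close>. By the separation property it meets the arc, and by genericity
   of \<open>r\<close> it does so off the carpet.\<close>
 have cross: "\<exists>t j. s \<le> t \<and> t \<le> s' \<and> square_path x r t \<in> X \<and> square_path x r t \<in> Q j"
  if X: "connected X" "X \<subseteq> W" "x \<in> closure X" "y \<in> X" "r1 < sup_norm (y - x)"
   and av: "\<And>z. z \<in> X \<inter> S ==> sup_norm (z - x) \<noteq> r" for X y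
 proof -
  have "X \<inter> square x d \<noteq> {}" using X(3) centre_in_square[OF c(4), of x] open_Int_closure_eq_empty[OF open_square, of x d X] by blast
  then have "X \<inter> N \<noteq> {}" using X(2) c(5) by blast
  moreover have "\<not> X \<subseteq> N" using X(4,5) c(3) by (auto simp: csquare_def)
  ultimately have "X \<inter> square_path x r ` {s..s'} \<noteq> {}" using c(6) X by blast
  then obtain t where t: "s \<le> t" "t \<le> s'" "square_path x r t \<in> X" by auto
  then have "square_path x r t \<notin> S" using av n by blast
  then show ?thesis using not_in_carpet t X(2) WO by blast
 qed
 obtain t1 j1 where t1: "s \<le> t1" "t1 \<le> s'" "square_path x r t1 \<in> X1" "square_path x r t1 \<in> Q j1"
  using cross[OF X1(1,2,3,4) r1(3) r(4)] by blast
 obtain t2 j2 where t2: "s \<le> t2" "t2 \<le> s'" "square_path x r t2 \<in> X2" "square_path x r t2 \<in> Q j2"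
  using cross[OF X2(1,2,3,4) r1(4) r(5)] by blast
 have arc: "\<bar>disk_value f (square_path x r t) - disk_value f (square_path x r t')\<bar> \<le> e'"
  if t: "s \<le> t" "t \<le> t'" "t' \<le> s'" "square_path x r t \<in> W" "square_path x r t' \<in> W" for t t'
 proof -
  have sub: "square_path x r ` {t..t'} \<subseteq> W" using c(7)[OF t] .
  have "ennreal \<bar>disk_value f (square_path x r t) - disk_value f (square_path x r t')\<bar>
    \<le> 27 * meet_sum Q (rosc f) (square_path x r ` {t..t'})"
  proof (rule good_square_arc[OF f(1) r(3,1)])
   show "0 \<le> t" "t' \<le> 4 * pi" using t c(1,2) by linarith+
   show "square_path x r ` {t..t'} \<subseteq> \<Omega>" using sub WO by (rule subset_trans)
  qed (rule t)
  also have "meet_sum Q (rosc f) (square_path x r ` {t..t'})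
    \<le> (\<Sum>i. if i \<in> I \<and> Q i \<inter> {z. sup_norm (z - x) = r} \<noteq> {} then ennreal (\<rho> i) else 0)"
   unfolding meet_sum_def \<rho>r
  proof (intro suminf_le summableI)
   fix i
   have "i \<in> I \<and> Q i \<inter> {z. sup_norm (z - x) = r} \<noteq> {}" if qi: "Q i \<inter> square_path x r ` {t..t'} \<noteq> {}"
   proof -
    obtain u where u: "u \<in> {t..t'}" "square_path x r u \<in> Q i" using qi by blast
    have "square_path x r u \<in> W" using sub u by blast
    moreover have "square_path x r u \<in> square x h" using n r by (simp add: square_def)
    ultimately show ?thesis using u n[of u] by (auto simp: I_def)
   qed
   then show "(if Q i \<inter> square_path x r ` {t..t'} \<noteq> {} then ennreal (\<rho> i) else 0)
    \<le> (if i \<in> I \<and> Q i \<inter> {z. sup_norm (z - x) = r} \<noteq> {} then ennreal (\<rho> i) else 0)" by auto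
  qed
  also have "\<dots> \<le> ennreal (e' / 27)" using r(6) by simp
  finally have "ennreal \<bar>disk_value f (square_path x r t) - disk_value f (square_path x r t')\<bar> \<le> 27 * ennreal (e' / 27)"
   by (simp add: mult_left_mono)
  also have "\<dots> = ennreal e'" using e' by (simp add: ennreal_mult[symmetric] flip: ennreal_numeral)
  finally show ?thesis using e' by (simp add: ennreal_le_iff)
 qed
 have W12: "square_path x r t1 \<in> W" "square_path x r t2 \<in> W" using t1 t2 X1(2) X2(2) by auto
 have "\<bar>upper f j1 - upper f j2\<bar> \<le> e'"
 proof (cases "t1 \<le> t2")
  case True
  then show ?thesis using arc[of t1 t2] t1 t2 W12 by (simp add: disk_value_disk)
 next
  case False
  then show ?thesis using arc[of t2 t1] t1 t2 W12 by (simp add: disk_value_disk abs_minus_commute)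
 qed
 moreover have "\<bar>l1 - upper f j1\<bar> \<le> e" using X1(7)[of j1] t1 by blast
 moreover have "\<bar>l2 - upper f j2\<bar> \<le> e" using X2(7)[of j2] t2 by blast
 ultimately show "\<bar>l1 - l2\<bar> \<le> 2 * e + e'" by linarith
qed

lemma approach_uniform:
 assumes cp: "crosscut_point x W" and f: "disk_bounded f" "real_gradient (rosc f) f" "locally_square_summable f x"
  and ap: "approach f x W p1" "approach f x W p2" and e: "0 < (e::real)"
 shows "\<exists>h>0. \<forall>i j. Q i \<inter> im p1 \<inter> square x h \<noteq> {} --> Q j \<inter> im p2 \<inter> square x h \<noteq> {} --> \<bar>upper f i - upper f j\<bar> \<le> e"
proof -
 have cl: "\<And>i. Q i \<inter> W \<noteq> {} ==> x \<notin> closure (Q i)" using cp by (auto simp: crosscut_point_def)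
 have e2: "0 < e/2" using e by simp
 obtain h1 where h1: "h1 > 0" "\<And>i. Q i \<inter> im p1 \<inter> square x h1 \<noteq> {} ==>
  (\<exists>X. connected X \<and> X \<subseteq> im p1 \<and> Q i \<inter> X \<noteq> {} \<and> x \<in> closure X \<and>
   (\<forall>j. Q j \<inter> X \<noteq> {} --> \<bar>upper f i - upper f j\<bar> \<le> e/2))" using approach_piece[OF ap(1) cl e2] by blast
 obtain h2 where h2: "h2 > 0" "\<And>i. Q i \<inter> im p2 \<inter> square x h2 \<noteq> {} ==>
  (\<exists>X. connected X \<and> X \<subseteq> im p2 \<and> Q i \<inter> X \<noteq> {} \<and> x \<in> closure X \<and>
   (\<forall>j. Q j \<inter> X \<noteq> {} --> \<bar>upper f i - upper f j\<bar> \<le> e/2))" using approach_piece[OF ap(2) cl e2] by blast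
 have "\<bar>upper f i - upper f j\<bar> \<le> e"
  if ij: "Q i \<inter> im p1 \<inter> square x (min h1 h2) \<noteq> {}" "Q j \<inter> im p2 \<inter> square x (min h1 h2) \<noteq> {}" for i j
 proof -
  have "Q i \<inter> im p1 \<inter> square x h1 \<noteq> {}" "Q j \<inter> im p2 \<inter> square x h2 \<noteq> {}"
   using ij square_mono[of "min h1 h2" h1 x] square_mono[of "min h1 h2" h2 x] by auto
  then obtain X1 X2 where X: "connected X1" "X1 \<subseteq> im p1" "Q i \<inter> X1 \<noteq> {}" "x \<in> closure X1"
   "\<And>k. Q k \<inter> X1 \<noteq> {} ==> \<bar>upper f i - upper f k\<bar> \<le> e/2"
   "connected X2" "X2 \<subseteq> im p2" "Q j \<inter> X2 \<noteq> {}" "x \<in> closure X2"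
   "\<And>k. Q k \<inter> X2 \<noteq> {} ==> \<bar>upper f j - upper f k\<bar> \<le> e/2" using h1(2)[of i] h2(2)[of j] by metis
  obtain y1 y2 where y: "y1 \<in> Q i" "y1 \<in> X1" "y2 \<in> Q j" "y2 \<in> X2" using X by blast
  have W: "im p1 \<subseteq> W" "im p2 \<subseteq> W" "hausdorff1 (im p1 \<inter> S) = 0" "hausdorff1 (im p2 \<inter> S) = 0"
   using ap by (auto simp: approach_def)
  have "x \<notin> closure (Q i)" "x \<notin> closure (Q j)" using cl[of i] cl[of j] y X(2,7) W(1,2) by blast+
  then have "y1 \<noteq> x" "y2 \<noteq> x" using y closure_subset by blast+
  moreover have "hausdorff1 (X1 \<inter> S) = 0" "hausdorff1 (X2 \<inter> S) = 0" using X W by (auto intro: hausdorff1_null_mono)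
  ultimately have "\<bar>upper f i - upper f j\<bar> \<le> 2 * (e/2)" using X y W by (intro approach_values_agree[OF cp f, of X1 y1 _ _ X2 y2]) auto
  then show ?thesis by simp
 qed
 then show ?thesis using h1(1) h2(1) by (intro exI[of _ "min h1 h2"]) auto
qed

text \<open>The finitely many disks of diameter at least \<open>e/4\<close> met by \<open>X\<close>
  have closures away from \<open>x\<close>, so a disk met close enough to \<open>x\<close> is small.
  A generic radius makes \<open>X\<close> cross the square off the carpet, that is, inside a
  disk.\<close>

lemma small_disk_on_path:
 assumes con: "connected X" and X: "X \<subseteq> \<Omega>" "x \<in> closure X" "y \<in> X" "y \<noteq> x" "hausdorff1 (X \<inter> S) = 0"
  and cl: "\<And>i. Q i \<inter> X \<noteq> {} ==> x \<notin> closure (Q i)" and e: "0 < e"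
 shows "\<exists>i. Q i \<inter> X \<noteq> {} \<and> Q i \<subseteq> ball x e"
proof -
 let ?F = "{i. e/4 \<le> diameter (Q i)} \<inter> {i. Q i \<inter> X \<noteq> {}}"
 have fin: "finite ?F" using finite_large_disks[of "e/4"] e by auto
 have "open (- (\<Union>i\<in>?F. closure (Q i)))" using fin by (intro open_Compl closed_UN) auto
 moreover have "x \<in> - (\<Union>i\<in>?F. closure (Q i))" using cl by auto
 ultimately have "\<exists>h>0. square x h \<subseteq> - (\<Union>i\<in>?F. closure (Q i))" by (rule open_contains_square)
 then obtain h where h: "h > 0" "square x h \<subseteq> - (\<Union>i\<in>?F. closure (Q i))" by blast
 have yn: "0 < sup_norm (y - x)" using X(4) sup_norm_nonneg[of "y - x"] by (auto simp: less_le simp del: sup_norm_nonneg)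
 have "0 < (1::real)" "0 < min h (min (e/4) (sup_norm (y - x)))" using h e yn by auto
 \<comment> \<open>With the empty index set the sum is zero; the purpose is to pick a small generic
   radius.\<close>
 from square_with_small_sum[of "\<lambda>i. 0" "{}" x, OF _ _ _ AE_avoids_carpet_on_square[OF X(5), of x] this]
 obtain r where r: "0 < r" "r < min h (min (e/4) (sup_norm (y - x)))" "\<And>z. z \<in> X \<inter> S ==> sup_norm (z - x) \<noteq> r"
  by auto
 have "X \<inter> square x r \<noteq> {}" using X(2) centre_in_square[OF r(1), of x] open_Int_closure_eq_empty[OF open_square, of x r X] by blast
 then obtain a where a: "a \<in> X" "sup_norm (a - x) < r" by (auto simp: square_def)
 obtain z where z: "z \<in> X" "sup_norm (z - x) = r" using connected_meets_square[OF con a X(3), of] r(2) by auto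
 then obtain i where i: "z \<in> Q i" using r(3) not_in_carpet X(1) by blast
 have "z \<in> square x h" using z r by (simp add: square_def)
 then have "i \<notin> ?F" using h(2) i closure_subset[of "Q i"] by blast
 then have small: "diameter (Q i) < e/4" using i z(1) by auto
 have "Q i \<subseteq> ball x e"
 proof
  fix w assume w: "w \<in> Q i"
  have "dist w z \<le> diameter (Q i)" using diameter_bounded_bound[OF bounded_disk w i] .
  moreover have "dist z x \<le> 2 * (e/4)" using norm_le_sup_norm[of "z - x"] z r by (simp add: dist_norm)
  ultimately show "w \<in> ball x e" using small e dist_triangle[of w x z] by (simp add: dist_commute)
 qed
 then show ?thesis using i z by blast
qed

lemma approach_nontrivial:
 assumes cp: "crosscut_point x W" and ap: "approach f x W p"
 shows "disks_to Q (im p) x \<noteq> bot"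
proof -
 have "\<exists>i. Q i \<inter> im p \<noteq> {} \<and> Q i \<subseteq> ball x e" if "e > 0" for e
 proof -
  obtain y where "y \<in> im p" "y \<noteq> x" using ap by (auto simp: approach_def)
  then show ?thesis using ap cp that by (intro small_disk_on_path[of "im p" x y]) (auto simp: approach_def crosscut_point_def connected_im)
 qed
 then show ?thesis unfolding trivial_limit_def eventually_disks_to by auto
qed

text \<open>The limit is found along one sequence of disks on the given path. Uniform closeness of
  the disk values of any two approaching paths transfers it to all of them, so it does not depend on
  the path.\<close>

lemma approach_limit:
 assumes cp: "crosscut_point x W" and f: "disk_bounded f" "real_gradient (rosc f) f" "locally_square_summable f x"
  and ap: "approach f x W p"
 shows "\<exists>L. \<forall>p'. approach f x W p' --> ((upper f) \<longlongrightarrow> L) (disks_to Q (im p') x)"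
proof -
 have near: "\<exists>d>0. \<forall>i. Q i \<inter> im p' \<noteq> {} \<and> Q i \<subseteq> ball x d --> (\<forall>j. Q j \<inter> im p \<noteq> {} \<and> Q j \<subseteq> ball x d --> \<bar>upper f i - upper f j\<bar> \<le> e)"
  if ap': "approach f x W p'" and e: "e > 0" for p' e
 proof -
  obtain h where h: "h > 0" "\<And>i j. Q i \<inter> im p' \<inter> square x h \<noteq> {} ==> Q j \<inter> im p \<inter> square x h \<noteq> {} ==> \<bar>upper f i - upper f j\<bar> \<le> e"
   using approach_uniform[OF cp f ap' ap e] by blast
  have "\<bar>upper f i - upper f j\<bar> \<le> e" if "Q i \<inter> im p' \<noteq> {} \<and> Q i \<subseteq> ball x h" "Q j \<inter> im p \<noteq> {} \<and> Q j \<subseteq> ball x h" for i j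
   using that ball_subset_square[of x h] by (intro h(2)) blast+
  then show ?thesis using h(1) by blast
 qed
 have ex: "\<exists>i. Q i \<inter> im p \<noteq> {} \<and> Q i \<subseteq> ball x e" if "e > 0" for e
  using approach_nontrivial[OF cp ap] that unfolding trivial_limit_def eventually_disks_to by blast
 then have "\<forall>n. \<exists>i. Q i \<inter> im p \<noteq> {} \<and> Q i \<subseteq> ball x (1 / Suc n)" by simp
 then obtain i where i: "\<And>n. Q (i n) \<inter> im p \<noteq> {}" "\<And>n. Q (i n) \<subseteq> ball x (1 / Suc n)" by metis
 have i': "\<exists>m. \<forall>n\<ge>m. Q (i n) \<subseteq> ball x d" if d: "d > 0" for d
 proof -
  obtain m where m: "inverse (real (Suc m)) < d" using reals_Archimedean d by blast
  have "Q (i n) \<subseteq> ball x d" if "n \<ge> m" for n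
  proof -
   have "1 / real (Suc n) \<le> 1 / real (Suc m)" using that by (intro divide_left_mono) auto
   then have "ball x (1 / Suc n) \<subseteq> ball x d" using m by (intro subset_ball) (simp add: inverse_eq_divide)
   then show ?thesis using i(2) by blast
  qed
  then show ?thesis by blast
 qed
 have "Cauchy (\<lambda>n. upper f (i n))"
 proof (rule metric_CauchyI)
  fix e :: real assume e: "0 < e"
  obtain d where d: "d > 0" "\<And>k j. Q k \<inter> im p \<noteq> {} \<and> Q k \<subseteq> ball x d ==> Q j \<inter> im p \<noteq> {} \<and> Q j \<subseteq> ball x d ==> \<bar>upper f k - upper f j\<bar> \<le> e/2"
   using near[OF ap, of "e/2"] e by auto
  obtain m where m: "\<And>n. n \<ge> m ==> Q (i n) \<subseteq> ball x d" using i'[OF d(1)] by blast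
  have "dist (upper f (i a)) (upper f (i b)) < e" if "a \<ge> m" "b \<ge> m" for a b
   using d(2)[of "i a" "i b"] m i(1) that e by (simp add: dist_real_def)
  then show "\<exists>m. \<forall>a\<ge>m. \<forall>b\<ge>m. dist (upper f (i a)) (upper f (i b)) < e" by blast
 qed
 then obtain L where L: "(\<lambda>n. upper f (i n)) \<longlonglongrightarrow> L" using real_Cauchy_convergent convergent_def by blast
 have "((upper f) \<longlongrightarrow> L) (disks_to Q (im p') x)" if ap': "approach f x W p'" for p' unfolding tendsto_iff
 proof (intro allI impI)
  fix e :: real assume e: "0 < e"
  obtain d where d: "d > 0" "\<And>k j. Q k \<inter> im p' \<noteq> {} \<and> Q k \<subseteq> ball x d ==> Q j \<inter> im p \<noteq> {} \<and> Q j \<subseteq> ball x d ==> \<bar>upper f k - upper f j\<bar> \<le> e/2"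
   using near[OF ap', of "e/2"] e by auto
  obtain m where m: "\<And>n. n \<ge> m ==> Q (i n) \<subseteq> ball x d" using i'[OF d(1)] by blast
  have "dist (upper f k) L < e" if k: "Q k \<inter> im p' \<noteq> {} \<and> Q k \<subseteq> ball x d" for k
  proof -
   have "eventually (\<lambda>n. \<bar>upper f k - upper f (i n)\<bar> \<le> e/2) sequentially"
    unfolding eventually_sequentially using d(2)[OF k] m i(1) by blast
   moreover have "(\<lambda>n. \<bar>upper f k - upper f (i n)\<bar>) \<longlonglongrightarrow> \<bar>upper f k - L\<bar>" using L by (intro tendsto_intros)
   ultimately have "\<bar>upper f k - L\<bar> \<le> e/2" using tendsto_upperbound trivial_limit_sequentially by blast
   then show ?thesis using e by (simp add: dist_real_def)
  qed
  then show "eventually (\<lambda>k. dist (upper f k) L < e) (disks_to Q (im p') x)" unfolding eventually_disks_to using d(1) by blast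
 qed
 then show ?thesis by blast
qed

end

section \<open>Arc length\<close>

lemma arc_length_ge_sum:
 assumes "mono_on {..n} t" "t ` {..n} \<subseteq> {a..b}"
 shows "(\<Sum>k<n. ennreal (dist (g (t k)) (g (t (Suc k))))) \<le> arc_length g a b"
proof -
 have "(n, t) \<in> {(n, t). mono_on {..n} t \<and> t ` {..n} \<subseteq> {a..b}}" using assms by simp
 from SUP_upper[OF this, of "\<lambda>(n, t). \<Sum>k<n. ennreal (dist (g (t k)) (g (t (Suc k))))"]
 show ?thesis by (simp add: arc_length_def)
qed

lemma arc_length_le:
 assumes "\<And>(n::nat) t. mono_on {..n} t ==> t ` {..n} \<subseteq> {a..b} ==> (\<Sum>k<n. ennreal (dist (g (t k)) (g (t (Suc k))))) \<le> c"
 shows "arc_length g a b \<le> c" unfolding arc_length_def by (intro SUP_least) (use assms in auto)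

lemma arc_length_mono:
 assumes "a \<le> s" "t \<le> b" shows "arc_length g s t \<le> arc_length g a b"
proof (rule arc_length_le)
 fix n :: nat and u assume "mono_on {..n} u" "u ` {..n} \<subseteq> {s..t}"
 then show "(\<Sum>k<n. ennreal (dist (g (u k)) (g (u (Suc k))))) \<le> arc_length g a b" using assms by (intro arc_length_ge_sum) auto
qed

lemma dist_le_arc_length: "a \<le> b ==> ennreal (dist (g a) (g b)) \<le> arc_length g a b"
proof -
 assume ab: "a \<le> b"
 have "(\<Sum>k<1. ennreal (dist (g ((\<lambda>k. if k = 0 then a else b) k)) (g ((\<lambda>k. if k = 0 then a else b) (Suc k))))) \<le> arc_length g a b"
  by (rule arc_length_ge_sum) (use ab in \<open>auto simp: mono_on_def\<close>)
 then show ?thesis by simp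
qed

text \<open>Partitions of the two intervals are concatenated; the additional edge between them can
  only increase the sum.\<close>

lemma arc_length_superadd:
 assumes ab: "a \<le> b" "b \<le> c" shows "arc_length g a b + arc_length g b c \<le> arc_length g a c"
proof -
 let ?P = "\<lambda>a b. {(n::nat, t::nat => real). mono_on {..n} t \<and> t ` {..n} \<subseteq> {a..b}}"
 let ?f = "\<lambda>(n, t). \<Sum>k<n. ennreal (dist (g (t k)) (g (t (Suc k))))"
 have ne: "?P x y \<noteq> {}" if "x \<le> y" for x y
 proof -
  have "(0, \<lambda>k. x) \<in> ?P x y" using that by (auto simp: mono_on_def)
  then show ?thesis by blast
 qed
 have "?f p + ?f q \<le> arc_length g a c" if "p \<in> ?P a b" "q \<in> ?P b c" for p q
 proof -
  obtain m t where p: "p = (m, t)" by (cases p)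
  obtain n u where q: "q = (n, u)" by (cases q)
  have t: "\<And>i j. i \<le> j ==> j \<le> m ==> t i \<le> t j" "\<And>i. i \<le> m ==> a \<le> t i \<and> t i \<le> b"
   using that(1) unfolding p by (auto simp: mono_on_def)
  have u: "\<And>i j. i \<le> j ==> j \<le> n ==> u i \<le> u j" "\<And>i. i \<le> n ==> b \<le> u i \<and> u i \<le> c"
   using that(2) unfolding q by (auto simp: mono_on_def)
  define w where "w k = (if k \<le> m then t k else u (k - Suc m))" for k
  have "mono_on {..m + Suc n} w"
  proof (rule mono_onI)
   fix r s assume "r \<in> {..m + Suc n}" "s \<in> {..m + Suc n}" "r \<le> s"
   then show "w r \<le> w s" using t u by (cases "s \<le> m"; cases "r \<le> m") (auto simp: w_def intro: order_trans[of _ b])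
  qed
  moreover have "w ` {..m + Suc n} \<subseteq> {a..c}"
  proof
   fix y assume "y \<in> w ` {..m + Suc n}"
   then obtain k where k: "k \<le> m + Suc n" "y = w k" by auto
   moreover have "k - Suc m \<le> n" using k by simp
   ultimately show "y \<in> {a..c}" using t(2)[of k] u(2)[of "k - Suc m"] ab by (cases "k \<le> m") (simp_all add: w_def)
  qed
  ultimately have "(\<Sum>k<m + Suc n. ennreal (dist (g (w k)) (g (w (Suc k))))) \<le> arc_length g a c" by (rule arc_length_ge_sum)
  moreover have "?f p + ?f q \<le> (\<Sum>k<m + Suc n. ennreal (dist (g (w k)) (g (w (Suc k)))))"
  proof -
   define H where "H k = ennreal (dist (g (w k)) (g (w (Suc k))))" for k
   have f1: "(\<Sum>k<m. H k) = ?f p" unfolding p H_def prod.case by (intro sum.cong) (auto simp: w_def)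
   have f2: "(\<Sum>k<n. H (k + Suc m)) = ?f q" unfolding q H_def prod.case by (intro sum.cong) (auto simp: w_def)
   have split: "(\<Sum>k<m + Suc n. H k) = (\<Sum>k<m. H k) + (H m + (\<Sum>k<n. H (k + Suc m)))"
   proof (induction n)
    case (Suc n)
    then show ?case by (simp add: add.assoc add.commute[of m])
   qed simp
   show ?thesis unfolding f1[symmetric] f2[symmetric] H_def[symmetric] split by (intro add_left_mono) simp
  qed
  ultimately show ?thesis by (rule order_trans[rotated])
 qed
 then have "?f p + arc_length g b c \<le> arc_length g a c" if "p \<in> ?P a b" for p
  unfolding arc_length_def[of g b c] ennreal_SUP_add_right[OF ne[OF ab(2)]] using that by (intro SUP_least)
 then show ?thesis unfolding arc_length_def[of g a b] ennreal_SUP_add_left[OF ne[OF ab(1)], symmetric] by (intro SUP_least)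
qed

lemma sum_dist_two_values:
 fixes A :: "nat => real"
 assumes "\<And>i j. i \<le> j ==> j \<le> n ==> A i \<le> A j" "\<And>i. i \<le> n ==> A i = s \<or> A i = t" "s \<le> t"
 shows "(\<Sum>k<n. dist (g (A k)) (g (A (Suc k)))) = dist (g (A 0)) (g (A n))" using assms
proof (induction n)
 case (Suc n)
 have IH: "(\<Sum>k<n. dist (g (A k)) (g (A (Suc k)))) = dist (g (A 0)) (g (A n))" using Suc.prems by (intro Suc.IH) auto
 show ?case
 proof (cases "A n = A (Suc n)")
  case True then show ?thesis using IH by simp
 next
  case False
  then have "A n = s" using Suc.prems(1)[of n "Suc n"] Suc.prems(2)[of n] Suc.prems(2)[of "Suc n"] Suc.prems(3) by auto
  moreover have "A 0 \<le> A n" "A 0 = s \<or> A 0 = t" using Suc.prems(1)[of 0 n] Suc.prems(2)[of 0] by auto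
  ultimately have "A 0 = A n" using Suc.prems(3) by auto
  then show ?thesis using IH by simp
 qed
qed simp

text \<open>Clamp the partition to each of the intervals \<open>{a..s}\<close>,
  \<open>{s..t}\<close> and \<open>{t..b}\<close>. As no partition point lies strictly between
  \<open>s\<close> and \<open>t\<close>, the middle part jumps at most once and contributes no more
  than the chord.\<close>

lemma arc_length_gap:
 assumes st: "a \<le> s" "s \<le> t" "t \<le> b" and T: "mono_on {..n} T" "T ` {..n} \<subseteq> {a..b}"
  and gap: "\<And>k. k \<le> n ==> T k \<le> s \<or> t \<le> T k"
 shows "(\<Sum>k<n. ennreal (dist (g (T k)) (g (T (Suc k)))))
   \<le> arc_length g a s + ennreal (dist (g s) (g t)) + arc_length g t b"
proof -
 define x y z where "x k = min (T k) s" and "y k = max s (min (T k) t)" and "z k = max (T k) t" for k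
 have m: "T i \<le> T j" if "i \<le> j" "j \<le> n" for i j using T(1) that by (auto simp: mono_on_def)
 have r: "a \<le> T k" "T k \<le> b" if "k \<le> n" for k using T(2) that by auto
 have "dist (g (T k)) (g (T (Suc k))) \<le> dist (g (x k)) (g (x (Suc k))) + dist (g (y k)) (g (y (Suc k))) + dist (g (z k)) (g (z (Suc k)))"
  if k: "k < n" for k
 proof -
  have "T k \<le> T (Suc k)" using m k by simp
  then consider "T (Suc k) \<le> s" | "T k \<le> s" "t \<le> T (Suc k)" | "t \<le> T k" using gap[of k] gap[of "Suc k"] k by fastforce
  then show ?thesis
  proof cases
   case 1 then show ?thesis using \<open>T k \<le> T (Suc k)\<close> st by (simp add: x_def y_def z_def min_def max_def)
  next
   case 2
   then have "x k = T k" "x (Suc k) = s" "y k = s" "y (Suc k) = t" "z k = t" "z (Suc k) = T (Suc k)" using st by (auto simp: x_def y_def z_def)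
   then show ?thesis using dist_triangle[of "g (T k)" "g (T (Suc k))" "g s"] dist_triangle[of "g s" "g (T (Suc k))" "g t"] by simp
  next
   case 3 then show ?thesis using \<open>T k \<le> T (Suc k)\<close> st by (simp add: x_def y_def z_def min_def max_def)
  qed
 qed
 then have "(\<Sum>k<n. ennreal (dist (g (T k)) (g (T (Suc k)))))
   \<le> (\<Sum>k<n. ennreal (dist (g (x k)) (g (x (Suc k)))) + ennreal (dist (g (y k)) (g (y (Suc k)))) + ennreal (dist (g (z k)) (g (z (Suc k)))))"
  by (intro sum_mono) (simp add: ennreal_plus[symmetric] ennreal_leI del: ennreal_plus)
 also have "\<dots> = (\<Sum>k<n. ennreal (dist (g (x k)) (g (x (Suc k))))) + (\<Sum>k<n. ennreal (dist (g (y k)) (g (y (Suc k)))))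
   + (\<Sum>k<n. ennreal (dist (g (z k)) (g (z (Suc k)))))" by (simp only: sum.distrib)
 also have "\<dots> \<le> arc_length g a s + ennreal (dist (g s) (g t)) + arc_length g t b"
 proof (intro add_mono)
  show "(\<Sum>k<n. ennreal (dist (g (x k)) (g (x (Suc k))))) \<le> arc_length g a s"
   unfolding x_def using m r st by (intro arc_length_ge_sum mono_onI min.mono) auto
  show "(\<Sum>k<n. ennreal (dist (g (z k)) (g (z (Suc k))))) \<le> arc_length g t b"
   unfolding z_def using m r st by (intro arc_length_ge_sum mono_onI max.mono) auto
  have yv: "y k = s \<or> y k = t" if "k \<le> n" for k using gap[OF that] st by (auto simp: y_def)
  have ym: "y i \<le> y j" if "i \<le> j" "j \<le> n" for i j using m[OF that] by (auto simp: y_def)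
  have "(\<Sum>k<n. dist (g (y k)) (g (y (Suc k)))) = dist (g (y 0)) (g (y n))" using ym yv st(2) by (intro sum_dist_two_values[of n y s t]) auto
  also have "\<dots> \<le> dist (g s) (g t)" using yv[of 0] yv[of n] by (auto simp: dist_commute)
  finally show "(\<Sum>k<n. ennreal (dist (g (y k)) (g (y (Suc k))))) \<le> ennreal (dist (g s) (g t))" by (simp add: sum_ennreal ennreal_leI)
 qed
 finally show ?thesis .
qed

text \<open>A nearly optimal partition loses at most \<open>e/2\<close> of the total length. If
  \<open>v\<close> is closer to \<open>u\<close> than every partition point other than
  \<open>u\<close>, no partition point lies strictly between them, so the length between them
  exceeds the chord by at most \<open>e/2\<close>. The chord is short by continuity.\<close>

lemma arc_length_small:
 assumes g: "continuous_on {a..b} g" and fin: "arc_length g a b < \<infinity>" and u: "u \<in> {a..b}" and e: "0 < (e::real)"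
 shows "\<exists>d>0. \<forall>v\<in>{a..b}. \<bar>v - u\<bar> < d --> arc_length g (min u v) (max u v) \<le> ennreal e"
proof -
 define L where "L = enn2real (arc_length g a b)"
 have L: "arc_length g a b = ennreal L" using fin by (simp add: L_def less_top)
 have "\<exists>(n::nat) T. mono_on {..n} T \<and> T ` {..n} \<subseteq> {a..b} \<and>
   arc_length g a b \<le> (\<Sum>k<n. ennreal (dist (g (T k)) (g (T (Suc k))))) + ennreal (e/2)"
 proof (rule ccontr)
  assume no: "\<not> ?thesis"
  have "arc_length g a b \<le> ennreal (L - e/2)"
  proof (rule arc_length_le)
   fix n :: nat and T assume T: "mono_on {..n} T" "T ` {..n} \<subseteq> {a..b}"
   define s where "s = (\<Sum>k<n. dist (g (T k)) (g (T (Suc k))))"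
   have s: "(\<Sum>k<n. ennreal (dist (g (T k)) (g (T (Suc k))))) = ennreal s" "0 \<le> s" unfolding s_def by (auto simp: sum_nonneg)
   have "\<not> ennreal L \<le> ennreal s + ennreal (e/2)" using no T s L by metis
   then have "s + e/2 < L" using s(2) e by (simp add: ennreal_plus[symmetric] ennreal_le_iff2 del: ennreal_plus)
   then show "(\<Sum>k<n. ennreal (dist (g (T k)) (g (T (Suc k))))) \<le> ennreal (L - e/2)" unfolding s(1) by (intro ennreal_leI) simp
  qed
  moreover have "0 \<le> L" by (simp add: L_def)
  \<comment> \<open>\<open>ennreal\<close> cuts off a negative \<open>L - e/2\<close> at zero, which
    leaves the case \<open>L = 0\<close>; there the one-point partition is good enough.\<close>
  ultimately have "L \<le> L - e/2 \<or> L \<le> 0" unfolding L by (metis ennreal_le_iff2)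
  then have "L = 0" using e \<open>0 \<le> L\<close> by linarith
  then have "mono_on {..0::nat} (\<lambda>k. a) \<and> (\<lambda>k. a) ` {..0::nat} \<subseteq> {a..b} \<and>
    arc_length g a b \<le> (\<Sum>k<0::nat. ennreal (dist (g ((\<lambda>k. a) k)) (g ((\<lambda>k. a) (Suc k))))) + ennreal (e/2)"
   using u L by (auto simp: mono_on_def)
  then show False using no by blast
 qed
 then obtain n T where T: "mono_on {..n} T" "T ` {..n} \<subseteq> {a..b}"
   "arc_length g a b \<le> (\<Sum>k<n. ennreal (dist (g (T k)) (g (T (Suc k))))) + ennreal (e/2)" by blast
 obtain d1 where d1: "d1 > 0" "\<And>v. v \<in> {a..b} ==> dist v u < d1 ==> dist (g v) (g u) < e/2"
  using g u e unfolding continuous_on_iff by (meson half_gt_zero)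
 have "finite ((\<lambda>k. \<bar>T k - u\<bar>) ` {..n} - {0})" by simp
 then obtain d2 where d2: "d2 > 0" "\<And>k. k \<le> n ==> T k \<noteq> u ==> d2 \<le> \<bar>T k - u\<bar>"
 proof (cases "(\<lambda>k. \<bar>T k - u\<bar>) ` {..n} - {0} = {}")
  case True
  then show ?thesis using that[of 1] by fastforce
 next
  case False
  let ?M = "Min ((\<lambda>k. \<bar>T k - u\<bar>) ` {..n} - {0})"
  have "?M \<in> (\<lambda>k. \<bar>T k - u\<bar>) ` {..n} - {0}" using False by (intro Min_in) auto
  then have "0 < ?M" by auto
  moreover have "?M \<le> \<bar>T k - u\<bar>" if "k \<le> n" "T k \<noteq> u" for k using that by (intro Min_le) auto
  ultimately show ?thesis using that by blast
 qed
 have "arc_length g (min u v) (max u v) \<le> ennreal e" if v: "v \<in> {a..b}" "\<bar>v - u\<bar> < min d1 d2" for v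
 proof -
  define s t where "s = min u v" and "t = max u v"
  have st: "a \<le> s" "s \<le> t" "t \<le> b" using u v by (auto simp: s_def t_def)
  have gap: "T k \<le> s \<or> t \<le> T k" if "k \<le> n" for k
   using d2(2)[OF that] v(2) by (cases "T k = u") (auto simp: s_def t_def abs_if split: if_splits)
  have dst: "dist (g s) (g t) < e/2"
   using d1(2)[OF v(1)] v(2) by (auto simp: s_def t_def dist_real_def dist_commute min_def max_def split: if_splits)
  have f1: "arc_length g a s + arc_length g s t + arc_length g t b \<le> arc_length g a b"
   using arc_length_superadd[OF st(1,2), of g] arc_length_superadd[of a t b g] st by (meson add_right_mono order_trans)
  have "arc_length g a b \<le> arc_length g a s + ennreal (dist (g s) (g t)) + arc_length g t b + ennreal (e/2)"
   using T(3) arc_length_gap[OF st T(1,2) gap, of g] by (meson add_right_mono order_trans)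
  moreover obtain p q w where p: "arc_length g a s = ennreal p" "0 \<le> p" "arc_length g s t = ennreal q" "0 \<le> q"
   "arc_length g t b = ennreal w" "0 \<le> w"
  proof -
   have "arc_length g a s < top" "arc_length g s t < top" "arc_length g t b < top"
    using arc_length_mono[of a a s b g] arc_length_mono[of a s t b g] arc_length_mono[of a t b b g] fin st by (auto simp: order_le_less_trans)
   then show ?thesis using that by (cases "arc_length g a s"; cases "arc_length g s t"; cases "arc_length g t b") auto
  qed
  ultimately have "arc_length g a b \<le> ennreal (p + dist (g s) (g t) + w + e/2)" using e by (simp add: ennreal_plus)
  moreover have "ennreal (p + q + w) \<le> arc_length g a b" using f1 p by (simp add: ennreal_plus)
  ultimately have "ennreal (p + q + w) \<le> ennreal (p + dist (g s) (g t) + w + e/2)" by (rule order_trans[rotated])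
  then have "p + q + w \<le> p + dist (g s) (g t) + w + e/2" using p e by (subst (asm) ennreal_le_iff) auto
  then have "q \<le> dist (g s) (g t) + e/2" by simp
  then show ?thesis unfolding s_def[symmetric] t_def[symmetric] p using dst by (intro ennreal_leI) auto
 qed
 then show ?thesis using d1(1) d2(1) by (intro exI[of _ "min d1 d2"]) auto
qed

text \<open>
 The arc length function \<open>v\<close> is continuous, so it maps the compact set of times spent in a
 closed set to a compact set, on which the arc length parametrization is 1-Lipschitz.
\<close>

lemma line_integral_infinite_on:
 fixes g :: "real => complex"
 assumes g: "continuous_on {a..b} g" and ab: "a \<le> b" and I: "a \<in> I" "b \<in> I"
  and T: "closed T" "T \<subseteq> {a..b}" "\<And>t. t \<in> T ==> F (g t) = \<infinity>" and H: "hausdorff1 (g ` T) \<noteq> 0"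
 shows "line_integral (I, g) F = \<infinity>"
proof (cases "locally_rectifiable (I, g)")
 case True
 then have fin: "arc_length g a b < \<infinity>" using I ab by (auto simp: locally_rectifiable_def)
 define v where "v t = enn2real (arc_length g a t)" for t
 have vf: "arc_length g a t = ennreal (v t)" if "t \<in> {a..b}" for t using arc_length_mono[of a a t b g] that fin unfolding v_def
  by (auto intro!: ennreal_enn2real[symmetric] simp: order_le_less_trans)
 have v0: "0 \<le> v t" for t by (simp add: v_def)
 have vadd: "ennreal (dist (g s) (g t)) \<le> arc_length g s t \<and> arc_length g s t \<le> ennreal (v t - v s) \<and> v s \<le> v t"
  if st: "a \<le> s" "s \<le> t" "t \<le> b" for s t
 proof -
  have "ennreal (v s) + arc_length g s t \<le> ennreal (v t)" using arc_length_superadd[OF st(1,2), of g] vf[of s] vf[of t] st by simp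
  moreover obtain q where q: "arc_length g s t = ennreal q" "0 \<le> q"
  proof -
   have "arc_length g s t < top" using arc_length_mono[of a s t b g] fin st by (auto simp: order_le_less_trans)
   then show ?thesis using that by (cases "arc_length g s t") auto
  qed
  ultimately have "ennreal (v s + q) \<le> ennreal (v t)" using v0[of s] by (simp add: ennreal_plus[symmetric] del: ennreal_plus)
  then have "v s + q \<le> v t" using v0[of t] by (simp add: ennreal_le_iff)
  then show ?thesis using q dist_le_arc_length[OF st(2), of g] by (auto intro!: ennreal_leI)
 qed
 have lip: "dist (g s) (g t) \<le> \<bar>v s - v t\<bar>" if "s \<in> {a..b}" "t \<in> {a..b}" for s t
 proof -
  have *: "dist (g s) (g t) \<le> v t - v s" if "a \<le> s" "s \<le> t" "t \<le> b" for s t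
  proof -
   have "ennreal (dist (g s) (g t)) \<le> ennreal (v t - v s)" using vadd[OF that] by (meson order_trans)
   then show ?thesis using vadd[OF that] by (simp add: ennreal_le_iff)
  qed
  show ?thesis using *[of s t] *[of t s] that by (cases "s \<le> t") (auto simp: dist_commute)
 qed
 have vcont: "continuous_on {a..b} v" unfolding continuous_on_iff
 proof (intro ballI allI impI)
  fix u e :: real assume u: "u \<in> {a..b}" and e: "0 < e"
  obtain d where d: "d > 0" "\<And>w. w \<in> {a..b} ==> \<bar>w - u\<bar> < d ==> arc_length g (min u w) (max u w) \<le> ennreal (e/2)"
   using arc_length_small[OF g fin u, of "e/2"] e by auto
  \<comment> \<open>The subadditive half of additivity, obtained by inserting \<open>s\<close> into
    a partition of \<open>{a..t}\<close>; the superadditive half is in \<open>vadd\<close>.\<close>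
  have sub: "v t - v s \<le> e/2" if st: "a \<le> s" "s \<le> t" "t \<le> b" "arc_length g s t \<le> ennreal (e/2)" for s t
  proof -
   have "arc_length g a t \<le> arc_length g a s + ennreal (e/2)"
   proof (rule arc_length_le)
    fix n :: nat and p assume p: "mono_on {..n} p" "p ` {..n} \<subseteq> {a..t}"
    define x y where "x k = min (p k) s" and "y k = max (p k) s" for k :: nat
    have m: "p i \<le> p j" if "i \<le> j" "j \<le> n" for i j using p(1) that by (auto simp: mono_on_def)
    have r: "a \<le> p k" "p k \<le> t" if "k \<le> n" for k using p(2) that by auto
    have "dist (g (p k)) (g (p (Suc k))) \<le> dist (g (x k)) (g (x (Suc k))) + dist (g (y k)) (g (y (Suc k)))"
     if k: "k < n" for k
    proof -
     have "p k \<le> p (Suc k)" using m k by simp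
     then consider "p (Suc k) \<le> s" | "p k \<le> s" "s \<le> p (Suc k)" | "s \<le> p k" by fastforce
     then show ?thesis
     proof cases
      case 2
      then have "x k = p k" "x (Suc k) = s" "y k = s" "y (Suc k) = p (Suc k)" by (auto simp: x_def y_def)
      then show ?thesis using dist_triangle[of "g (p k)" "g (p (Suc k))" "g s"] by simp
     qed (use \<open>p k \<le> p (Suc k)\<close> in \<open>simp_all add: x_def y_def min_def max_def\<close>)
    qed
    then have "(\<Sum>k<n. ennreal (dist (g (p k)) (g (p (Suc k)))))
     \<le> (\<Sum>k<n. ennreal (dist (g (x k)) (g (x (Suc k)))) + ennreal (dist (g (y k)) (g (y (Suc k)))))"
     by (intro sum_mono) (simp add: ennreal_plus[symmetric] ennreal_leI del: ennreal_plus)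
    also have "\<dots> = (\<Sum>k<n. ennreal (dist (g (x k)) (g (x (Suc k))))) + (\<Sum>k<n. ennreal (dist (g (y k)) (g (y (Suc k)))))"
     by (simp only: sum.distrib)
    also have "\<dots> \<le> arc_length g a s + arc_length g s t"
    proof (intro add_mono)
     show "(\<Sum>k<n. ennreal (dist (g (x k)) (g (x (Suc k))))) \<le> arc_length g a s"
      unfolding x_def using m r st by (intro arc_length_ge_sum mono_onI min.mono) auto
     show "(\<Sum>k<n. ennreal (dist (g (y k)) (g (y (Suc k))))) \<le> arc_length g s t"
      unfolding y_def using m r st by (intro arc_length_ge_sum mono_onI max.mono) auto
    qed
    also have "\<dots> \<le> arc_length g a s + ennreal (e/2)" using st(4) by (rule add_left_mono)
    finally show "(\<Sum>k<n. ennreal (dist (g (p k)) (g (p (Suc k))))) \<le> arc_length g a s + ennreal (e/2)" .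
   qed
   then have "ennreal (v t) \<le> ennreal (v s) + ennreal (e/2)" using vf[of s] vf[of t] st(1-3) by simp
   also have "\<dots> = ennreal (v s + e/2)" using e v0[of s] by (intro ennreal_plus[symmetric]) auto
   finally have "ennreal (v t) \<le> ennreal (v s + e/2)" .
   then have "v t \<le> v s + e/2" using v0[of s] e by (subst (asm) ennreal_le_iff) auto
   then show ?thesis by simp
  qed
  have "dist (v w) (v u) < e" if w: "w \<in> {a..b}" "dist w u < d" for w
  proof (cases "u \<le> w")
   case True
   have "v w - v u \<le> e/2" using sub[of u w] d(2)[of w] w u True by (auto simp: dist_real_def min_def max_def)
   then show ?thesis using vadd[of u w] w u True e by (auto simp: dist_real_def)
  next
   case False
   have "v u - v w \<le> e/2" using sub[of w u] d(2)[of w] w u False by (auto simp: dist_real_def min_def max_def)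
   then show ?thesis using vadd[of w u] w u False e by (auto simp: dist_real_def)
  qed
  then show "\<exists>d>0. \<forall>w\<in>{a..b}. dist w u < d --> dist (v w) (v u) < e" using d(1) by blast
 qed
 define P where "P = arc_length_param g a b"
 \<comment> \<open>The choice operator may pick another time \<open>t'\<close>, but equal arc length
   puts it at the same point.\<close>
 have Pv: "P (v t) = g t" if t: "t \<in> {a..b}" for t
 proof -
  define t' where "t' = (SOME t'. t' \<in> {a..b} \<and> arc_length g a t' = ennreal (v t))"
  have "\<exists>t'. t' \<in> {a..b} \<and> arc_length g a t' = ennreal (v t)" using vf t by blast
  then have t': "t' \<in> {a..b}" "arc_length g a t' = ennreal (v t)" unfolding t'_def by (metis (mono_tags, lifting) someI_ex)+
  then have "v t' = v t" using v0 by (simp add: v_def)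
  then have "dist (g t') (g t) \<le> 0" using lip[OF t'(1) t] by simp
  then show ?thesis unfolding P_def arc_length_param_def t'_def[symmetric] by simp
 qed
 define N where "N = v ` T"
 have "compact T" using T(1,2) by (metis compact_Icc compact_Int_closed inf.absorb_iff2)
 then have "compact N" unfolding N_def by (intro compact_continuous_image continuous_on_subset[OF vcont T(2)])
 then have Nb: "N \<in> sets borel" by (intro borel_closed compact_imp_closed)
 have NL: "N \<subseteq> {0..v b}" using vadd T(2) v0 ab by (auto simp: N_def)
 have "P ` N = g ` T" unfolding N_def image_image using Pv T(2) by (intro image_cong) auto
 \<comment> \<open>Otherwise the image of \<open>N\<close> under a 1-Lipschitz map, which is the
   image of \<open>T\<close>, would have vanishing Hausdorff measure.\<close>
 have "N \<notin> null_sets lborel"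
 proof
  assume null: "N \<in> null_sets lborel"
  have "hausdorff1 (P ` N) = 0"
  proof (rule hausdorff1_lipschitz_image[OF null])
   show "N \<subseteq> {- (v b + 1)<..<v b + 1}" using NL v0[of b] by auto
   show "dist (P s) (P t) \<le> \<bar>s - t\<bar>" if "s \<in> N" "t \<in> N" for s t using that lip Pv T(2) by (auto simp: N_def subset_iff)
  qed
  then show False using H \<open>P ` N = g ` T\<close> by simp
 qed
 then have pos: "emeasure lborel N \<noteq> 0" using Nb by (auto simp: null_sets_def)
 have "\<infinity> = \<infinity> * emeasure lborel N" using pos by (simp add: ennreal_top_mult)
 also have "\<dots> = (\<integral>\<^sup>+l. \<infinity> * indicator N l \<partial>lborel)"
  using Nb by (intro nn_integral_cmult_indicator[symmetric]) simp
 also have "\<dots> \<le> (\<integral>\<^sup>+l \<in> {0..enn2real (arc_length g a b)}. F (P l) \<partial>lborel)"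
 proof (rule nn_integral_mono)
  fix l
  show "\<infinity> * indicator N l \<le> F (P l) * indicator {0..enn2real (arc_length g a b)} l"
  proof (cases "l \<in> N")
   case True
   then obtain t where "t \<in> T" "l = v t" by (auto simp: N_def)
   then have "F (P l) = \<infinity>" using T Pv by auto
   then show ?thesis using True NL by (auto simp: v_def)
  qed simp
 qed
 also have "\<dots> \<le> (SUP (a, b)\<in>{(a, b). a \<in> I \<and> b \<in> I \<and> a \<le> b}.
    \<integral>\<^sup>+l \<in> {0..enn2real (arc_length g a b)}. F (arc_length_param g a b l) \<partial>lborel)"
  unfolding P_def using I ab by (intro SUP_upper2[of "(a, b)"]) auto
 also have "\<dots> = line_integral (I, g) F" using True by (simp add: line_integral_def)
 finally show ?thesis by (simp add: top_unique)
qed (simp add: line_integral_def)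

section \<open>Null families of the classical modulus\<close>

lemma mod2_null_mono: "A \<subseteq> B ==> mod2 B = 0 ==> mod2 A = 0"
proof -
 assume AB: "A \<subseteq> B" and B: "mod2 B = 0"
 have "mod2 A \<le> mod2 B" unfolding mod2_def using AB by (intro INF_superset_mono) auto
 then show ?thesis using B by simp
qed

lemma mod2_zeroI:
 assumes "\<And>e::real. e > 0 ==> \<exists>F\<in>borel_measurable borel. (\<forall>p\<in>G. 1 \<le> line_integral p F) \<and> (\<integral>\<^sup>+ z. (F z)^2 \<partial>lborel) \<le> ennreal e"
 shows "mod2 G = 0"
proof -
 have "mod2 G \<le> 0 + ennreal e" if e: "e > 0" for e
 proof -
  obtain F where "F \<in> borel_measurable borel" "\<forall>p\<in>G. 1 \<le> line_integral p F" "(\<integral>\<^sup>+ z. (F z)^2 \<partial>lborel) \<le> ennreal e"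
   using assms[OF e] by blast
  then show ?thesis unfolding mod2_def by (intro INF_lower2[of F]) auto
 qed
 then have "mod2 G \<le> 0" by (rule ennreal_le_epsilon)
 then show ?thesis by simp
qed

lemma line_integral_mono:
 assumes "\<And>z. F z \<le> G z" shows "line_integral p F \<le> line_integral p G"
proof (cases "locally_rectifiable p")
 case True
 show ?thesis unfolding line_integral_def using True by (simp, intro SUP_mono', clarsimp) (intro nn_integral_mono mult_right_mono assms, simp)
qed (simp add: line_integral_def)

lemma mod2_null_Un:
 assumes "mod2 A = 0" "mod2 B = 0" shows "mod2 (A \<union> B) = 0"
proof (rule mod2_zeroI)
 fix e :: real assume e: "e > 0"
 then have e2: "e/2 > 0" by simp
 obtain F where F: "F \<in> borel_measurable borel" "\<And>p. p \<in> A ==> 1 \<le> line_integral p F" "(\<integral>\<^sup>+ z. (F z)^2 \<partial>lborel) < ennreal (e/2)"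
  using mod2_null_obtain[OF assms(1) e2] by metis
 obtain G where G: "G \<in> borel_measurable borel" "\<And>p. p \<in> B ==> 1 \<le> line_integral p G" "(\<integral>\<^sup>+ z. (G z)^2 \<partial>lborel) < ennreal (e/2)"
  using mod2_null_obtain[OF assms(2) e2] by metis
 note [measurable] = F(1) G(1)
 define k where "k z = max (F z) (G z)" for z
 have m: "k \<in> borel_measurable borel" unfolding k_def by measurable
 have "(\<integral>\<^sup>+ z. (k z)^2 \<partial>lborel) \<le> (\<integral>\<^sup>+ z. (F z)^2 + (G z)^2 \<partial>lborel)"
  by (intro nn_integral_mono) (auto simp: k_def max_def add_increasing add_increasing2)
 also have "\<dots> = (\<integral>\<^sup>+ z. (F z)^2 \<partial>lborel) + (\<integral>\<^sup>+ z. (G z)^2 \<partial>lborel)" by (intro nn_integral_add) auto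
 also have "\<dots> \<le> ennreal (e/2) + ennreal (e/2)" using F(3) G(3) by (intro add_mono) auto
 also have "\<dots> = ennreal e" using e by (simp add: ennreal_plus[symmetric] del: ennreal_plus)
 finally have "(\<integral>\<^sup>+ z. (k z)^2 \<partial>lborel) \<le> ennreal e" .
 moreover have "1 \<le> line_integral p k" if "p \<in> A \<union> B" for p
  using that F(2)[of p] G(2)[of p] line_integral_mono[of F k p] line_integral_mono[of G k p] by (auto simp: k_def intro: order_trans)
 ultimately show "\<exists>F\<in>borel_measurable borel. (\<forall>p\<in>A \<union> B. 1 \<le> line_integral p F) \<and> (\<integral>\<^sup>+ z. (F z)^2 \<partial>lborel) \<le> ennreal e"
  using m by blast
qed

lemma line_integral_sub:
 assumes "subcpath p' p" shows "line_integral p' F \<le> line_integral p F"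
proof (cases "locally_rectifiable p")
 case True
 then have "locally_rectifiable p'" using assms by (auto simp: locally_rectifiable_def subcpath_def)
 then show ?thesis unfolding line_integral_def using True assms by (simp add: subcpath_def) (intro SUP_subset_mono, auto)
qed (simp add: line_integral_def)

lemma mod2_null_superpaths:
 assumes "mod2 A = 0" shows "mod2 {p. \<exists>p'\<in>A. subcpath p' p} = 0"
proof (rule mod2_zeroI)
 fix e :: real assume e: "e > 0"
 obtain F where F: "F \<in> borel_measurable borel" "\<And>p. p \<in> A ==> 1 \<le> line_integral p F" "(\<integral>\<^sup>+ z. (F z)^2 \<partial>lborel) < ennreal e"
  using mod2_null_obtain[OF assms e] by metis
 have "1 \<le> line_integral p F" if "p' \<in> A" "subcpath p' p" for p p' using F(2)[OF that(1)] line_integral_sub[OF that(2)] by (rule order_trans)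
 then show "\<exists>F\<in>borel_measurable borel. (\<forall>p\<in>{p. \<exists>p'\<in>A. subcpath p' p}. 1 \<le> line_integral p F) \<and> (\<integral>\<^sup>+ z. (F z)^2 \<partial>lborel) \<le> ennreal e"
  using F(1,3) by (intro bexI[of _ F]) auto
qed

section \<open>Exceptional families of paths\<close>

context bounded_carpet
begin

text \<open>One predicate for both versions of the modulus. Once the closure properties of
  exceptional families are established, the versions are not distinguished again.\<close>

definition admissible :: "(nat => ennreal) => cpath set => bool" where
 "admissible \<rho> G \<longleftrightarrow> (case ver of
   Weak => \<exists>G0\<subseteq>G. mod2 G0 = 0 \<and> (\<forall>p\<in>G - G0. 1 \<le> meet_sum Q \<rho> (im p))
  | Strong => \<forall>p\<in>G. hausdorff1 (im p \<inter> S) = 0 --> 1 \<le> meet_sum Q \<rho> (im p))"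

abbreviation exceptional :: "cpath set => bool" where "exceptional G \<equiv> carpet_mod ver \<Omega> Q G = 0"

lemma admissible_Weak: "ver = Weak ==> admissible \<rho> G \<longleftrightarrow> (\<exists>G0\<subseteq>G. mod2 G0 = 0 \<and> (\<forall>p\<in>G - G0. 1 \<le> meet_sum Q \<rho> (im p)))"
 unfolding admissible_def by simp

lemma admissible_Strong: "ver = Strong ==> admissible \<rho> G \<longleftrightarrow> (\<forall>p\<in>G. hausdorff1 (im p \<inter> S) = 0 --> 1 \<le> meet_sum Q \<rho> (im p))"
 unfolding admissible_def by simp

lemma exceptional_iff: "exceptional G \<longleftrightarrow> (\<forall>e::real>0. \<exists>\<rho>. admissible \<rho> G \<and> (\<Sum>i. (\<rho> i)^2) < ennreal e)"
proof -
 have eq: "carpet_mod ver \<Omega> Q G = (INF \<rho>\<in>{\<rho>. admissible \<rho> G}. \<Sum>i. (\<rho> i)^2)"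
  unfolding admissible_def by (cases ver) (simp_all add: mod_weak_def mod_strong_def)
 show ?thesis
 proof
  assume z: "exceptional G"
  show "\<forall>e::real>0. \<exists>\<rho>. admissible \<rho> G \<and> (\<Sum>i. (\<rho> i)^2) < ennreal e"
  proof (intro allI impI)
   fix e :: real assume "e > 0"
   then have "(INF \<rho>\<in>{\<rho>. admissible \<rho> G}. \<Sum>i. (\<rho> i)^2) < ennreal e" using z eq by simp
   then show "\<exists>\<rho>. admissible \<rho> G \<and> (\<Sum>i. (\<rho> i)^2) < ennreal e" unfolding INF_less_iff by auto
  qed
 next
  assume r: "\<forall>e::real>0. \<exists>\<rho>. admissible \<rho> G \<and> (\<Sum>i. (\<rho> i)^2) < ennreal e"
  have "(INF \<rho>\<in>{\<rho>. admissible \<rho> G}. \<Sum>i. (\<rho> i)^2) \<le> 0 + ennreal e" if "e > 0" for e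
  proof -
   obtain \<rho> where "admissible \<rho> G" "(\<Sum>i. (\<rho> i)^2) < ennreal e" using r \<open>e > 0\<close> by blast
   then show ?thesis by (intro INF_lower2[of \<rho>]) auto
  qed
  then have "(INF \<rho>\<in>{\<rho>. admissible \<rho> G}. \<Sum>i. (\<rho> i)^2) \<le> 0" by (rule ennreal_le_epsilon)
  then show "exceptional G" using eq by simp
 qed
qed

lemma admissible_mono: "A \<subseteq> B ==> admissible \<rho> B ==> admissible \<rho> A"
proof (cases ver)
 case Weak
 assume "A \<subseteq> B" "admissible \<rho> B"
 then obtain H0 where G: "H0 \<subseteq> B" "mod2 H0 = 0" "\<forall>p\<in>B - H0. 1 \<le> meet_sum Q \<rho> (im p)"
  unfolding admissible_Weak[OF Weak] by blast
 have "mod2 (H0 \<inter> A) = 0" using G(2) by (rule mod2_null_mono[rotated]) auto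
 then show ?thesis using G \<open>A \<subseteq> B\<close> unfolding admissible_Weak[OF Weak] by (intro exI[of _ "H0 \<inter> A"]) blast
next
 case Strong
 assume "A \<subseteq> B" "admissible \<rho> B"
 then show ?thesis unfolding admissible_Strong[OF Strong] by blast
qed

lemma exceptional_mono: "A \<subseteq> B ==> exceptional B ==> exceptional A"
 unfolding exceptional_iff using admissible_mono by blast

lemma admissible_gradient_mono: "(\<And>i. \<rho> i \<le> \<rho>' i) ==> admissible \<rho> A ==> admissible \<rho>' A"
proof -
 assume le: "\<And>i. \<rho> i \<le> \<rho>' i" and a: "admissible \<rho> A"
 have "meet_sum Q \<rho> (im p) \<le> meet_sum Q \<rho>' (im p)" for p using le by (rule meet_sum_mono)
 note le = order_trans[OF _ this]
 show ?thesis
 proof (cases ver)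
  case Weak
  show ?thesis using a le unfolding admissible_Weak[OF Weak] by blast
 next
  case Strong
  show ?thesis using a le unfolding admissible_Strong[OF Strong] by blast
 qed
qed

lemma exceptional_Un: "exceptional A ==> exceptional B ==> exceptional (A \<union> B)"
proof -
 assume A: "exceptional A" and B: "exceptional B"
 show ?thesis unfolding exceptional_iff
 proof (intro allI impI)
  fix e :: real assume e: "e > 0"
  then have e2: "0 < e/3" by simp
  obtain \<rho> where \<rho>: "admissible \<rho> A" "(\<Sum>i. (\<rho> i)^2) < ennreal (e/3)" using A e2 unfolding exceptional_iff by blast
  obtain s where s: "admissible s B" "(\<Sum>i. (s i)^2) < ennreal (e/3)" using B e2 unfolding exceptional_iff by blast
  define T where "T i = max (\<rho> i) (s i)" for i
  have a: "admissible T A" "admissible T B"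
   using admissible_gradient_mono[OF _ \<rho>(1), of T] admissible_gradient_mono[OF _ s(1), of T] by (auto simp: T_def)
  have adm: "admissible T (A \<union> B)"
  proof (cases ver)
   case Weak
   obtain A0 B0 where "A0 \<subseteq> A" "mod2 A0 = 0" "\<forall>p\<in>A - A0. 1 \<le> meet_sum Q T (im p)"
     "B0 \<subseteq> B" "mod2 B0 = 0" "\<forall>p\<in>B - B0. 1 \<le> meet_sum Q T (im p)" using a unfolding admissible_Weak[OF Weak] by blast
   moreover from this have "mod2 (A0 \<union> B0) = 0" by (intro mod2_null_Un)
   ultimately have "A0 \<union> B0 \<subseteq> A \<union> B \<and> mod2 (A0 \<union> B0) = 0 \<and> (\<forall>p\<in>A \<union> B - (A0 \<union> B0). 1 \<le> meet_sum Q T (im p))"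
    by blast
   then show ?thesis unfolding admissible_Weak[OF Weak] by (rule exI)
  next
   case Strong
   show ?thesis using a unfolding admissible_Strong[OF Strong] by blast
  qed
  have "(\<Sum>i. (T i)^2) \<le> (\<Sum>i. (\<rho> i)^2 + (s i)^2)"
   by (intro suminf_le summableI) (auto simp: T_def max_def add_increasing add_increasing2)
  also have "\<dots> = (\<Sum>i. (\<rho> i)^2) + (\<Sum>i. (s i)^2)" by (simp add: suminf_add summableI)
  also have "\<dots> \<le> ennreal (e/3) + ennreal (e/3)" using \<rho>(2) s(2) by (intro add_mono) auto
  also have "\<dots> = ennreal (2*e/3)" using e by (simp add: ennreal_plus[symmetric] del: ennreal_plus)
  also have "\<dots> < ennreal e" using e by (intro ennreal_lessI) auto
  finally have "(\<Sum>i. (T i)^2) < ennreal e" .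
  with adm show "\<exists>\<rho>. admissible \<rho> (A \<union> B) \<and> (\<Sum>i. (\<rho> i)^2) < ennreal e" by blast
 qed
qed

text \<open>A longer path meets more disks, so weights admissible for a family remain admissible for
  all paths containing one of its members. Hence almost every path has no exceptional
  subpath.\<close>

lemma exceptional_superpaths: "exceptional A ==> exceptional {p. \<exists>p'\<in>A. subcpath p' p}"
proof -
 assume A: "exceptional A"
 have "admissible \<rho> {p. \<exists>p'\<in>A. subcpath p' p}" if adm: "admissible \<rho> A" for \<rho>
 proof (cases ver)
  case Weak
  obtain A0 where A0: "A0 \<subseteq> A" "mod2 A0 = 0" "\<forall>p\<in>A - A0. 1 \<le> meet_sum Q \<rho> (im p)"
   using adm unfolding admissible_Weak[OF Weak] by blast
  have "1 \<le> meet_sum Q \<rho> (im p)" if "p' \<in> A" "subcpath p' p" "\<nexists>p'. p' \<in> A0 \<and> subcpath p' p" for p p'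
  proof -
   have "1 \<le> meet_sum Q \<rho> (im p')" using A0(3) that by blast
   then show ?thesis using meet_sum_mono_set[OF im_sub[OF that(2)], of Q \<rho>] by (rule order_trans)
  qed
  then show ?thesis using A0(1) mod2_null_superpaths[OF A0(2)]
   unfolding admissible_Weak[OF Weak] by (intro exI[of _ "{p. \<exists>p'\<in>A0. subcpath p' p}"]) blast
 next
  case Strong
  have "1 \<le> meet_sum Q \<rho> (im p)" if "p' \<in> A" "subcpath p' p" "hausdorff1 (im p \<inter> S) = 0" for p p'
  proof -
   have "hausdorff1 (im p' \<inter> S) = 0" using im_sub[OF that(2)] by (intro hausdorff1_null_mono[OF that(3)]) blast
   then have "1 \<le> meet_sum Q \<rho> (im p')" using that(1) adm unfolding admissible_Strong[OF Strong] by blast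
   then show ?thesis using meet_sum_mono_set[OF im_sub[OF that(2)], of Q \<rho>] by (rule order_trans)
  qed
  then show ?thesis unfolding admissible_Strong[OF Strong] by blast
 qed
 then show ?thesis using A unfolding exceptional_iff by blast
qed

text \<open>Positive multiples of an infinite sum are infinite, so arbitrarily small multiples of
  \<rho> are admissible. The choice of \<open>c\<close> gives \<open>c^2 * s < e\<close>, with
  \<open>s + 1\<close> in place of \<open>s\<close> to keep the quotient meaningful.\<close>

lemma exceptional_infinite_sum:
 assumes "(\<Sum>i. (\<rho> i)^2) < \<infinity>" shows "exceptional {p. meet_sum Q \<rho> (im p) = \<infinity>}" unfolding exceptional_iff
proof (intro allI impI)
 fix e :: real assume e: "e > 0"
 obtain s where s: "(\<Sum>i. (\<rho> i)^2) = ennreal s" "0 \<le> s" using assms by (cases "\<Sum>i. (\<rho> i)^2") auto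
 define c where "c = sqrt (e / (2 * (s + 1)))"
 have c: "c > 0" "c^2 = e / (2 * (s + 1))" using e s by (auto simp: c_def)
 have "admissible (\<lambda>i. ennreal c * \<rho> i) {p. meet_sum Q \<rho> (im p) = \<infinity>}"
 proof -
  have "1 \<le> meet_sum Q (\<lambda>i. ennreal c * \<rho> i) (im p)" if "meet_sum Q \<rho> (im p) = \<infinity>" for p
   unfolding meet_sum_cmult using that c(1) by (simp add: ennreal_mult_top)
  moreover have "mod2 {} = 0" by (rule mod2_zeroI) (auto intro!: bexI[of _ "\<lambda>_. 0"])
  ultimately show ?thesis unfolding admissible_def by (cases ver) (simp_all, blast)
 qed
 moreover have "(\<Sum>i. (ennreal c * \<rho> i)^2) = ennreal (c^2) * (\<Sum>i. (\<rho> i)^2)"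
  using c(1) by (simp add: power_mult_distrib ennreal_power)
 moreover have "\<dots> < ennreal e"
 proof -
  have "c^2 * s = e * (s / (2 * (s + 1)))" unfolding c(2) by simp
  also have "\<dots> < e * 1" using e s(2) by (intro mult_strict_left_mono) auto
  finally have "c^2 * s < e" by simp
  then show ?thesis unfolding s(1) using s(2) e by (simp add: ennreal_mult[symmetric] ennreal_lessI)
 qed
 ultimately show "\<exists>\<rho>'. admissible \<rho>' {p. meet_sum Q \<rho> (im p) = \<infinity>} \<and> (\<Sum>i. (\<rho>' i)^2) < ennreal e" by metis
qed

text \<open>Rational points together with the attained end points give countably many compact pieces
  that exhaust the interval. Countability is what the union of null sets requires.\<close>

lemma interval_exhaustion:
 fixes I :: "real set"
 assumes "is_interval I" "bounded I"
 shows "\<exists>C. countable C \<and> C \<subseteq> I \<and> (\<forall>t\<in>I. \<exists>a\<in>C. \<exists>b\<in>C. a \<le> t \<and> t \<le> b)"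
proof (cases "I = {}")
 case False
 define C where "C = I \<inter> (\<rat> \<union> {Inf I, Sup I})"
 have bb: "bdd_below I" "bdd_above I" using assms(2) bounded_imp_bdd_below bounded_imp_bdd_above by auto
 have "\<exists>a\<in>C. a \<le> t" if t: "t \<in> I" for t
 proof (cases "Inf I = t")
  case True then show ?thesis using t by (auto simp: C_def)
 next
  case False
  then have "Inf I < t" using cInf_lower[OF t bb(1)] by simp
  then obtain u where u: "u \<in> I" "u < t" using cInf_less_iff[OF \<open>I \<noteq> {}\<close> bb(1)] by blast
  obtain q where q: "q \<in> \<rat>" "u < q" "q < t" using Rats_dense_in_real[OF u(2)] by blast
  then have "q \<in> I" using mem_is_interval_1_I[OF assms(1) u(1) t] by simp
  then show ?thesis using q by (intro bexI[of _ q]) (auto simp: C_def)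
 qed
 moreover have "\<exists>b\<in>C. t \<le> b" if t: "t \<in> I" for t
 proof (cases "Sup I = t")
  case True then show ?thesis using t by (auto simp: C_def)
 next
  case False
  then have "t < Sup I" using cSup_upper[OF t bb(2)] by simp
  then obtain u where u: "u \<in> I" "t < u" using less_cSup_iff[OF \<open>I \<noteq> {}\<close> bb(2)] by blast
  obtain q where q: "q \<in> \<rat>" "t < q" "q < u" using Rats_dense_in_real[OF u(2)] by blast
  then have "q \<in> I" using mem_is_interval_1_I[OF assms(1) t u(1)] by simp
  then show ?thesis using q by (intro bexI[of _ q]) (auto simp: C_def)
 qed
 moreover have "countable C" unfolding C_def by (simp add: countable_rat)
 moreover have "C \<subseteq> I" unfolding C_def by blast
 ultimately show ?thesis by (intro exI[of _ C]) blast
qed auto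

text \<open>In the strong version such paths are never tested. In the weak version the function that
  is infinite on the carpet has square integral zero, as the carpet has no area, while its integral
  along such a path is infinite.\<close>

lemma exceptional_hausdorff: "exceptional {p\<in>paths_in \<Omega>. hausdorff1 (im p \<inter> S) \<noteq> 0}"
proof (cases ver)
 case Strong
 have "admissible (\<lambda>i. 0) {p\<in>paths_in \<Omega>. hausdorff1 (im p \<inter> S) \<noteq> 0}" unfolding admissible_Strong[OF Strong] by blast
 then show ?thesis unfolding exceptional_iff by (intro allI impI exI[of _ "\<lambda>i. 0"]) simp
next
 case Weak
 let ?G = "{p\<in>paths_in \<Omega>. hausdorff1 (im p \<inter> S) \<noteq> 0}"
 define F :: "complex => ennreal" where "F z = \<infinity> * indicator S z" for z
 note [measurable] = carpet_sets
 have m: "F \<in> borel_measurable borel" unfolding F_def by measurable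
 have "(\<integral>\<^sup>+ z. (F z)^2 \<partial>lborel) = (\<integral>\<^sup>+ z. \<infinity> * indicator S z \<partial>lborel)"
  by (intro nn_integral_cong) (auto simp: F_def indicator_def power2_eq_square ennreal_top_mult)
 also have "\<dots> = \<infinity> * emeasure lborel S" by (rule nn_integral_cmult_indicator) simp
 also have "\<dots> = 0" using carpet_null by simp
 finally have i0: "(\<integral>\<^sup>+ z. (F z)^2 \<partial>lborel) = 0" .
 have "1 \<le> line_integral p F" if p: "p \<in> ?G" for p
 proof -
  obtain I g where gI: "p = (I, g)" by (cases p)
  have I: "is_interval I" "bounded I" "I \<noteq> {}" "continuous_on (closure I) g" "g ` I \<subseteq> \<Omega>" "hausdorff1 (g ` I \<inter> S) \<noteq> 0"
   using p by (auto simp: gI paths_in_def is_cpath_def im_def)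
  obtain C where C: "countable C" "C \<subseteq> I" "\<And>t. t \<in> I ==> \<exists>a\<in>C. \<exists>b\<in>C. a \<le> t \<and> t \<le> b"
   using interval_exhaustion[OF I(1,2)] by metis
  have Cne: "C \<times> C \<noteq> {}" using C(3) I(3) by blast
  have cC: "countable (C \<times> C)" using C(1) by simp
  define A where "A n = (case from_nat_into (C \<times> C) n of (a, b) => g ` {a..b} \<inter> S)" for n
  have "g ` I \<inter> S \<subseteq> (\<Union>n. A n)"
  proof
   fix y assume "y \<in> g ` I \<inter> S"
   then obtain t where t: "t \<in> I" "y = g t" "y \<in> S" by auto
   then obtain a b where ab: "(a, b) \<in> C \<times> C" "a \<le> t" "t \<le> b" using C(3) by blast
   obtain n where "from_nat_into (C \<times> C) n = (a, b)" using from_nat_into_surj[OF cC ab(1)] by blast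
   then have "y \<in> A n" using t ab by (auto simp: A_def)
   then show "y \<in> (\<Union>n. A n)" by blast
  qed
  then have "\<exists>n. hausdorff1 (A n) \<noteq> 0" using hausdorff1_null_UN[of A] hausdorff1_null_mono I(6) by blast
  then obtain n where n: "hausdorff1 (A n) \<noteq> 0" by blast
  obtain a b where ab: "from_nat_into (C \<times> C) n = (a, b)" by fastforce
  then have abC: "a \<in> I" "b \<in> I" using from_nat_into[OF Cne, of n] C(2) by auto
  have ne: "hausdorff1 (g ` {a..b} \<inter> S) \<noteq> 0" using n ab by (simp add: A_def)
  have le: "a \<le> b"
  proof (rule ccontr)
   assume "\<not> a \<le> b"
   then have "hausdorff1 (g ` {a..b} \<inter> S) = 0" unfolding hausdorff1_eq_0_iff by (auto intro!: exI[of _ "\<lambda>_. {}"])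
   then show False using ne by simp
  qed
  have sub: "{a..b} \<subseteq> I" using mem_is_interval_1_I[OF I(1) abC] by auto
  then have cont: "continuous_on {a..b} g" using I(4) closure_subset by (meson continuous_on_subset order_trans)
  \<comment> \<open>The complement of the open disks in place of the carpet makes the preimage
    closed; as the path stays in the domain, both have the same preimage.\<close>
  define T where "T = {a..b} \<inter> g -` (- (\<Union>i. Q i))"
  have "closed T" unfolding T_def using cont open_disk by (intro continuous_closed_preimage) auto
  moreover have "g ` T = g ` {a..b} \<inter> S" using sub I(5) by (auto simp: T_def carpet_def)
  moreover have "F (g t) = \<infinity>" if "t \<in> T" for t

  proof -
   have "g t \<in> \<Omega>" using that sub I(5) unfolding T_def by blast
   then have "g t \<in> S" using that by (auto simp: T_def carpet_def)
   then show ?thesis by (simp add: F_def)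
  qed
  ultimately have "line_integral (I, g) F = \<infinity>" using ne by (intro line_integral_infinite_on[OF cont le abC, of T]) (auto simp: T_def)
  then show ?thesis by (simp add: gI)
 qed
 then have "mod2 ?G = 0"
 proof (intro mod2_zeroI bexI[of _ F] conjI ballI)
  show "(\<integral>\<^sup>+ z. (F z)^2 \<partial>lborel) \<le> ennreal e" for e using i0 by simp
 qed (use m in auto)
 then have "admissible (\<lambda>i. 0) ?G" unfolding admissible_Weak[OF Weak] by blast
 then show ?thesis unfolding exceptional_iff by (intro allI impI exI[of _ "\<lambda>i. 0"]) simp
qed

section \<open>Oscillation as an upper gradient\<close>

lemma constant_or_nonconst:
 assumes "p \<in> paths_in \<Omega>" "subcpath p' p"
 shows "p' \<in> nonconst_paths_in \<Omega> \<or> (\<forall>x\<in>im p'. \<forall>y\<in>im p'. x = y)"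
proof (cases "snd p' constant_on fst p'")
 case True
 then show ?thesis by (auto simp: constant_on_def im_def)
next
 case False
 have "p' \<in> paths_in \<Omega>" using assms is_cpath_sub im_sub by (fastforce simp: paths_in_def)
 then show ?thesis using False by (simp add: nonconst_paths_in_def)
qed

text \<open>Paths with an exceptional subpath are exceptional, so the inequality passes to all
  subpaths of almost every path. Constant subpaths are outside the families considered, but on them
  the inequality is trivial.\<close>

lemma subpaths_gradient:
 assumes "real_gradient \<rho> f" and sm: "(\<Sum>i. (\<rho> i)^2) < \<infinity>"
 shows "\<exists>H0. exceptional H0 \<and> H0 \<subseteq> paths_in \<Omega> \<and> (\<forall>p\<in>paths_in \<Omega> - H0. meet_sum Q \<rho> (im p) < \<infinity> \<and> hausdorff1 (im p \<inter> S) = 0 \<and>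
   (\<forall>p'. subcpath p' p --> (\<forall>x\<in>im p' \<inter> S. \<forall>y\<in>im p' \<inter> S. ennreal \<bar>f x - f y\<bar> \<le> meet_sum Q \<rho> (im p'))))"
proof -
 obtain H1 where G: "exceptional H1"
  "\<And>p x y. p \<in> nonconst_paths_in \<Omega> - H1 ==> x \<in> im p \<inter> S ==> y \<in> im p \<inter> S ==> ennreal \<bar>f x - f y\<bar> \<le> meet_sum Q \<rho> (im p)"
  using assms unfolding real_gradient_def by blast
 define H0 where "H0 = paths_in \<Omega> \<inter> ({p. \<exists>p'\<in>H1. subcpath p' p} \<union> {p. meet_sum Q \<rho> (im p) = \<infinity>} \<union> {p\<in>paths_in \<Omega>. hausdorff1 (im p \<inter> S) \<noteq> 0})"
 have "exceptional ({p. \<exists>p'\<in>H1. subcpath p' p} \<union> {p. meet_sum Q \<rho> (im p) = \<infinity>} \<union> {p\<in>paths_in \<Omega>. hausdorff1 (im p \<inter> S) \<noteq> 0})"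
  by (intro exceptional_Un exceptional_superpaths G(1) exceptional_infinite_sum sm exceptional_hausdorff)
 then have "exceptional H0" by (rule exceptional_mono[rotated]) (auto simp: H0_def)
 moreover have "ennreal \<bar>f x - f y\<bar> \<le> meet_sum Q \<rho> (im p')"
  if "p \<in> paths_in \<Omega> - H0" "subcpath p' p" "x \<in> im p' \<inter> S" "y \<in> im p' \<inter> S" for p p' x y
 proof -
  have "p' \<notin> H1" using that by (auto simp: H0_def)
  have "p \<in> paths_in \<Omega>" using that(1) by blast
  from constant_or_nonconst[OF this that(2)] show ?thesis
  proof
   assume "p' \<in> nonconst_paths_in \<Omega>"
   then show ?thesis using \<open>p' \<notin> H1\<close> that(3,4) by (intro G(2)) blast+
  next
   assume "\<forall>x\<in>im p'. \<forall>y\<in>im p'. x = y"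
   then have "x = y" using that(3,4) by blast
   then show ?thesis by simp
  qed
 qed
 moreover have "meet_sum Q \<rho> (im p) < \<infinity> \<and> hausdorff1 (im p \<inter> S) = 0" if "p \<in> paths_in \<Omega> - H0" for p
  using that unfolding H0_def by (simp add: less_top)
 moreover have "H0 \<subseteq> paths_in \<Omega>" unfolding H0_def by blast
 ultimately show ?thesis by (intro exI[of _ H0]) blast
qed

text \<open>Almost every path has a finite sum of \<rho>, and then the covering argument for the
  values along the path replaces \<rho> by the oscillation. All competitors below enter the Sobolev
  space through this.\<close>

lemma oscillation_is_gradient:
 assumes "real_gradient \<rho> f" "(\<Sum>i. (\<rho> i)^2) < \<infinity>" "disk_bounded f" shows "real_gradient (rosc f) f"
proof -
 obtain H0 where G: "exceptional H0" "H0 \<subseteq> paths_in \<Omega>"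
  "\<And>p. p \<in> paths_in \<Omega> - H0 ==> meet_sum Q \<rho> (im p) < \<infinity>"
  "\<And>p p' x y. p \<in> paths_in \<Omega> - H0 ==> subcpath p' p ==> x \<in> im p' \<inter> S ==> y \<in> im p' \<inter> S ==>
    ennreal \<bar>f x - f y\<bar> \<le> meet_sum Q \<rho> (im p')" using subpaths_gradient[OF assms(1,2)] by blast
 have main: "ennreal \<bar>f x - f y\<bar> \<le> meet_sum Q (rosc f) (im p)"
  if p: "p \<in> paths_in \<Omega> - H0" and xy: "x \<in> im p \<inter> S" "y \<in> im p \<inter> S" for p x y
 proof -
  obtain I g where gI: "p = (I, g)" by (cases p)
  have I: "is_interval I" "continuous_on (closure I) g" "g ` I \<subseteq> \<Omega>" using p by (auto simp: gI paths_in_def is_cpath_def im_def)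
  have *: "ennreal \<bar>f (g a) - f (g b)\<bar> \<le> meet_sum Q (rosc f) (im p)"
   if ab: "a \<in> I" "b \<in> I" "a \<le> b" "g a \<in> S" "g b \<in> S" for a b
  proof -
   have sub: "{a..b} \<subseteq> I" using mem_is_interval_1_I[OF I(1) ab(1,2)] by auto
   then have cont: "continuous_on {a..b} g" using I(2) closure_subset by (meson continuous_on_subset order_trans)
   have sp: "subcpath ({s..t}, g) p" if "a \<le> s" "s \<le> t" "t \<le> b" for s t using sub that by (auto simp: subcpath_def gI is_interval_cc)
   have "ennreal \<bar>f (g a) - f (g b)\<bar> \<le> meet_sum Q (\<lambda>i. ennreal (upper f i - lower f i)) (g ` {a..b})"
   proof (rule oscillation_along_path[where \<rho> = \<rho>])
    show "ennreal \<bar>f (g s) - f (g t)\<bar> \<le> meet_sum Q \<rho> (g ` {s..t})"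
     if "a \<le> s" "s \<le> t" "t \<le> b" "\<And>i. g s \<notin> Q i" "\<And>i. g t \<notin> Q i" for s t
    proof -
     have "s \<in> I" "t \<in> I" using that(1-3) sub by auto
     then have "g s \<in> im ({s..t}, g) \<inter> S" "g t \<in> im ({s..t}, g) \<inter> S" using that I(3) by (auto simp: im_def carpet_def)
     then show ?thesis using G(4)[OF p sp[OF that(1-3)]] by (simp add: im_def)
    qed
    have "meet_sum Q \<rho> (g ` {a..b}) \<le> meet_sum Q \<rho> (im p)" using sub by (intro meet_sum_mono_set) (auto simp: gI im_def)
    then show "meet_sum Q \<rho> (g ` {a..b}) < \<infinity>" using G(3)[OF p] by (rule order_le_less_trans)
    show "g a \<notin> Q i" "g b \<notin> Q i" for i using ab disk_not_carpet by auto
   qed (use cont ab open_disk disk_closures_disjoint disk_boundedD[OF assms(3)] in auto)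
   also have "\<dots> \<le> meet_sum Q (rosc f) (im p)"
   proof -
    have "(\<lambda>i. ennreal (upper f i - lower f i)) = rosc f" by (simp add: rosc_def fun_eq_iff)
    then show ?thesis using sub by (simp only:) (intro meet_sum_mono_set, auto simp: gI im_def)
   qed
   finally show ?thesis .
  qed
  obtain a b where ab: "a \<in> I" "b \<in> I" "x = g a" "y = g b" using xy by (auto simp: gI im_def)
  show ?thesis
  proof (cases "a \<le> b")
   case True then show ?thesis using *[of a b] ab xy by auto
  next
   case False then show ?thesis using *[of b a] ab xy by (auto simp: abs_minus_commute)
  qed
 qed
 show ?thesis unfolding real_gradient_def using G(1,2) main by (intro exI[of _ H0]) (auto simp: nonconst_paths_in_def)
qed

end

section \<open>Exit and entry times, square summable sequences\<close>

lemma last_exit: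
 fixes g :: "real => complex"
 assumes cont: "continuous_on {a..b} g" and ab: "a \<le> b" and a: "g a \<in> closure U" and b: "g b \<notin> closure U" and op: "open U"
 shows "\<exists>s\<in>{a..b}. g s \<in> frontier U \<and> (\<forall>r\<in>{s..b}. g r \<notin> U)"
proof -
 define T where "T = {a..b} \<inter> g -` closure U"
 have T: "closed T" unfolding T_def using cont by (intro continuous_closed_preimage) auto
 have Tne: "T \<noteq> {}" "bdd_above T" using a ab by (auto simp: T_def bdd_above_def)
 define s where "s = Sup T"
 have s: "s \<in> T" unfolding s_def using Tne T by (intro closed_contains_Sup)
 have late: "g r \<notin> closure U" if "s < r" "r \<le> b" for r
 proof
  assume "g r \<in> closure U"
  then have "r \<in> T" using that s by (auto simp: T_def)
  then have "r \<le> s" unfolding s_def using Tne(2) by (rule cSup_upper)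
  then show False using that by simp
 qed
 have sb: "s < b" using s b by (cases "s = b") (auto simp: T_def)
 have "g s \<notin> U"
 proof
  assume "g s \<in> U"
  then obtain e where e: "s < e" "e \<le> b" "g e \<in> frontier U"
  proof (rule exit_point[of s b g U, rotated 2])
   show "continuous_on {s..b} g" using s by (intro continuous_on_subset[OF cont]) (auto simp: T_def)
   show "g b \<notin> U" using b closure_subset by blast
  qed (use sb op in auto)
  then have "g e \<in> closure U" by (simp add: frontier_def)
  then show False using late[OF e(1,2)] by simp
 qed
 then have "g s \<in> frontier U" using s op by (simp add: T_def frontier_def interior_open)
 moreover have "g r \<notin> U" if "r \<in> {s..b}" for r
  using that late[of r] \<open>g s \<notin> U\<close> closure_subset[of U] by (cases "r = s") auto
 ultimately show ?thesis using s unfolding T_def by blast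
qed

lemma first_entry:
 fixes g :: "real => complex"
 assumes cont: "continuous_on {a..b} g" and ab: "a \<le> b" and a: "g a \<notin> closure U" and b: "g b \<in> closure U" and op: "open U"
 shows "\<exists>s\<in>{a..b}. g s \<in> frontier U \<and> (\<forall>r\<in>{a..s}. g r \<notin> U)"
proof -
 have "continuous_on {-b..-a} (\<lambda>r. g (- r))" by (intro continuous_on_compose2[OF cont] continuous_intros) auto
 from last_exit[OF this _ _ _ op] ab a b obtain s where s: "s \<in> {-b..-a}" "g (- s) \<in> frontier U" "\<forall>r\<in>{s..-a}. g (- r) \<notin> U"
  by auto
 have "g r \<notin> U" if "r \<in> {a..-s}" for r using s(3)[rule_format, of "- r"] that by auto
 then show ?thesis using s(1,2) by (intro bexI[of _ "-s"]) auto
qed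

lemma suminf_ennreal_finite_iff:
 assumes "\<And>i. 0 \<le> a i" shows "(\<Sum>i. ennreal (a i)) < \<infinity> \<longleftrightarrow> summable a"
proof
 assume "(\<Sum>i. ennreal (a i)) < \<infinity>"
 then show "summable a" using assms by (intro summable_suminf_not_top) auto
next
 assume s: "summable a"
 have "(\<Sum>i. ennreal (a i)) = ennreal (suminf a)" using assms s by (intro suminf_ennreal2) auto
 then show "(\<Sum>i. ennreal (a i)) < \<infinity>" by simp
qed

lemma summable_square_add:
 fixes a b :: "nat => real"
 assumes "summable (\<lambda>i. (a i)^2)" "summable (\<lambda>i. (b i)^2)" shows "summable (\<lambda>i. (a i + b i)^2)"
proof (rule summable_comparison_test')
 show "summable (\<lambda>i. 2 * (a i)^2 + 2 * (b i)^2)" using assms by (intro summable_add summable_mult)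
 show "norm ((a i + b i)^2) \<le> 2 * (a i)^2 + 2 * (b i)^2" if "i \<ge> 0" for i
 proof -
  have "(a i + b i)^2 \<le> 2 * (a i)^2 + 2 * (b i)^2" using zero_le_power2[of "a i - b i"] unfolding power2_sum power2_diff by linarith
  then show ?thesis by simp
 qed
qed

lemma summable_square_le:
 fixes a b :: "nat => real"
 assumes "summable (\<lambda>i. (b i)^2)" "\<And>i. \<bar>a i\<bar> \<le> \<bar>b i\<bar>" shows "summable (\<lambda>i. (a i)^2)"
 using assms(2) by (intro summable_comparison_test'[OF assms(1), of 0]) (simp add: abs_le_square_iff[symmetric])

section \<open>Sobolev functions\<close>

context bounded_carpet
begin

definition gap :: "(complex => real) => nat => real" where "gap f i = upper f i - lower f i"

lemma rosc_gap: "rosc f i = ennreal (gap f i)" by (simp add: rosc_def gap_def)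

lemma gap_nonneg: "disk_bounded f ==> 0 \<le> gap f i" using disk_boundedD(5) by (simp add: gap_def)

lemma gap_leI:
 assumes "\<And>x y. x \<in> frontier (Q i) ==> y \<in> frontier (Q i) ==> f x - f y \<le> c" shows "gap f i \<le> c"
proof -
 have "upper f i \<le> c + lower f i"
 proof (rule upper_least)
  fix x assume x: "x \<in> frontier (Q i)"
  have "f x - c \<le> lower f i" by (rule lower_greatest) (use assms[OF x] in fastforce)
  then show "f x \<le> c + lower f i" by simp
 qed
 then show ?thesis by (simp add: gap_def)
qed

lemma gap_diff: "disk_bounded f ==> x \<in> frontier (Q i) ==> y \<in> frontier (Q i) ==> \<bar>f x - f y\<bar> \<le> gap f i"
 using disk_boundedD(3,4)[of f x i] disk_boundedD(3,4)[of f y i] by (auto simp: gap_def abs_le_iff)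

text \<open>The Sobolev space for real functions. Solutions are real, so the energy estimates can
  avoid extended arithmetic.\<close>

definition sob :: "(complex => real) => bool" where
 "sob f \<longleftrightarrow> disk_bounded f \<and> real_gradient (rosc f) f \<and> summable (\<lambda>i. (gap f i)^2) \<and>
   summable (\<lambda>i. (upper f i * diameter (Q i))^2)"

definition energy :: "(complex => real) => real" where "energy f = (\<Sum>i. (gap f i)^2)"

lemma rosc_square: "disk_bounded f ==> (rosc f i)^2 = ennreal ((gap f i)^2)"
 using gap_nonneg[of f i] by (simp add: rosc_gap ennreal_power)

lemma sobD:
 assumes "sob f"
 shows "disk_bounded f" "real_gradient (rosc f) f" "(\<Sum>i. (rosc f i)^2) < \<infinity>" "summable (\<lambda>i. (gap f i)^2)"
  "summable (\<lambda>i. (upper f i * diameter (Q i))^2)"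
proof -
 show d: "disk_bounded f" "real_gradient (rosc f) f" and s: "summable (\<lambda>i. (gap f i)^2)"
  "summable (\<lambda>i. (upper f i * diameter (Q i))^2)" using assms by (auto simp: sob_def)
 show "(\<Sum>i. (rosc f i)^2) < \<infinity>" using s by (simp only: rosc_square[OF d(1)]) (subst suminf_ennreal_finite_iff, auto)
qed

lemma sobolev_real: "sobolev ver \<Omega> Q (\<lambda>x. ereal (f x)) \<longleftrightarrow> sob f"
proof -
 have eq: "(e2ennreal \<bar>Msup Q (\<lambda>x. ereal (f x)) i\<bar>)^2 * ennreal ((diameter (Q i))^2) = ennreal ((upper f i * diameter (Q i))^2)"
  if "disk_bounded f" for i by (simp add: Msup_real[OF that] e2ennreal_ereal ennreal_power ennreal_mult[symmetric] power_mult_distrib)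
 have os: "(osc Q (\<lambda>x. ereal (f x)) i)^2 = ennreal ((gap f i)^2)" if "disk_bounded f" for i
  by (simp add: osc_real[OF that] rosc_square[OF that])
 have fin1: "(\<Sum>i. (e2ennreal \<bar>Msup Q (\<lambda>x. ereal (f x)) i\<bar>)^2 * ennreal ((diameter (Q i))^2)) < \<infinity> \<longleftrightarrow> summable (\<lambda>i. (upper f i * diameter (Q i))^2)"
  if "disk_bounded f" unfolding eq[OF that] by (rule suminf_ennreal_finite_iff) simp
 have fin2: "(\<Sum>i. (osc Q (\<lambda>x. ereal (f x)) i)^2) < \<infinity> \<longleftrightarrow> summable (\<lambda>i. (gap f i)^2)"
  if "disk_bounded f" unfolding os[OF that] by (rule suminf_ennreal_finite_iff) simp
 show ?thesis
 proof
  assume s: "sobolev ver \<Omega> Q (\<lambda>x. ereal (f x))"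
  then have d: "disk_bounded f" by (intro disk_bounded_of_finite) (auto simp: sobolev_def sobolev_loc_def)
  have "real_gradient (rosc f) f" using s unfolding sobolev_def sobolev_loc_def osc_real[OF d] upper_gradient_real by blast
  then show "sob f" using s d fin1[OF d] fin2[OF d] unfolding sob_def sobolev_def by blast
 next
  assume s: "sob f"
  then have d: "disk_bounded f" by (simp add: sob_def)
  have a: "(\<Sum>i. (e2ennreal \<bar>Msup Q (\<lambda>x. ereal (f x)) i\<bar>)^2 * ennreal ((diameter (Q i))^2)) < \<infinity>"
   and b: "(\<Sum>i. (osc Q (\<lambda>x. ereal (f x)) i)^2) < \<infinity>" using s fin1[OF d] fin2[OF d] by (auto simp: sob_def)
  have "upper_gradient ver \<Omega> Q (osc Q (\<lambda>x. ereal (f x))) (\<lambda>x. ereal (f x))"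
   unfolding osc_real[OF d] upper_gradient_real using s by (simp add: sob_def)
  moreover have "\<bar>Msup Q (\<lambda>x. ereal (f x)) i\<bar> \<noteq> \<infinity> \<and> \<bar>minf Q (\<lambda>x. ereal (f x)) i\<bar> \<noteq> \<infinity>" for i
   by (simp add: Msup_real[OF d] minf_real[OF d])
  ultimately show "sobolev ver \<Omega> Q (\<lambda>x. ereal (f x))" unfolding sobolev_def sobolev_loc_def
   using a b order_le_less_trans[OF meet_sum_le_suminf a] order_le_less_trans[OF meet_sum_le_suminf b] by blast
 qed
qed

lemma disk_meets_domain: "Q i \<inter> \<Omega> \<noteq> {}" using disk_nonempty[of i] disk_subset[of i] by blast

lemma energy_real: "sob f ==> dirichlet_energy Q \<Omega> (\<lambda>x. ereal (f x)) = ennreal (energy f)"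
proof -
 assume f: "sob f"
 have "dirichlet_energy Q \<Omega> (\<lambda>x. ereal (f x)) = (\<Sum>i. ennreal ((gap f i)^2))"
  by (simp add: dirichlet_energy_def meet_sum_def disk_meets_domain osc_real[OF sobD(1)[OF f]] rosc_square[OF sobD(1)[OF f]])
 also have "\<dots> = ennreal (energy f)" unfolding energy_def using sobD(4)[OF f] by (intro suminf_ennreal2) auto
 finally show ?thesis .
qed

lemma abs_upper_le:
 assumes f: "disk_bounded f" and x: "x \<in> frontier (Q i)" shows "\<bar>f x\<bar> \<le> \<bar>upper f i\<bar> + gap f i"
 using disk_boundedD(3,4)[OF f x] by (auto simp: gap_def)

text \<open>Any square summable gradient will do, since it can be replaced by the oscillation. The
  constant \<open>K\<close> is harmless because the squared diameters are summable in a bounded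
  domain.\<close>

lemma sob_of_gradient:
 assumes a: "sob a" and b: "sob b" and grad: "real_gradient \<rho> z" and fin: "(\<Sum>i. (\<rho> i)^2) < \<infinity>"
  and le: "\<And>x. x \<in> S ==> \<bar>z x\<bar> \<le> \<bar>a x\<bar> + \<bar>b x\<bar> + K"
  and gap: "\<And>i. rosc z i \<le> \<rho> i"
 shows "sob z"
proof -
 let ?B = "\<lambda>i. \<bar>upper a i\<bar> + gap a i + (\<bar>upper b i\<bar> + gap b i) + \<bar>K\<bar>"
 have zB: "\<bar>z x\<bar> \<le> ?B i" if x: "x \<in> frontier (Q i)" for x i
 proof -
  have "x \<in> S" using frontier_disk_subset[of i] x by blast
  then show ?thesis using le[of x] abs_upper_le[OF sobD(1)[OF a] x] abs_upper_le[OF sobD(1)[OF b] x] by linarith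
 qed
 have d: "disk_bounded z" by (rule disk_boundedI[where l = "\<lambda>i. - ?B i" and u = ?B]) (use zB in \<open>fastforce simp: abs_le_iff\<close>)
 have uB: "\<bar>upper z i\<bar> \<le> ?B i" for i
 proof -
  obtain x where x: "x \<in> frontier (Q i)" using frontier_disk_nonempty[of i] by blast
  have "upper z i \<le> ?B i" by (rule upper_least) (use zB in fastforce)
  moreover have "- ?B i \<le> upper z i" using zB[OF x] disk_boundedD(3)[OF d x] by linarith
  ultimately show ?thesis by linarith
 qed
 have "summable (\<lambda>i. (gap z i)^2)"
 proof -
  have "(\<Sum>i. ennreal ((gap z i)^2)) \<le> (\<Sum>i. (\<rho> i)^2)"
   unfolding rosc_square[OF d, symmetric] using gap by (intro suminf_le summableI power_mono) auto
  then have "(\<Sum>i. ennreal ((gap z i)^2)) < \<infinity>" using fin by (meson order_le_less_trans)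
  then show ?thesis by (subst (asm) suminf_ennreal_finite_iff) auto
 qed
 moreover have "summable (\<lambda>i. (upper z i * diameter (Q i))^2)"
 proof -
  obtain R where R: "R > 0" "\<Omega> \<subseteq> square 0 R" using domain_bound by blast
  have bS: "bounded (square 0 R)" by simp
  define D where "D = diameter (square 0 R)"
  have dD: "diameter (Q i) \<le> D" for i unfolding D_def using disk_subset[of i] R(2) by (intro diameter_subset) auto
  have d0: "0 \<le> diameter (Q i)" for i using diameter_disk_pos[of i] by simp
  have gd: "summable (\<lambda>i. (gap f i * diameter (Q i))^2)" if "sob f" for f
  proof (rule summable_square_le)
   have "summable (\<lambda>i. D^2 * (gap f i)^2)" using sobD(4)[OF that] by (rule summable_mult)
   then show "summable (\<lambda>i. (D * gap f i)^2)" by (simp add: power_mult_distrib)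
   show "\<bar>gap f i * diameter (Q i)\<bar> \<le> \<bar>D * gap f i\<bar>" for i
    using mult_right_mono[OF dD[of i], of "\<bar>gap f i\<bar>"] d0[of i] order_trans[OF d0[of i] dD[of i]] by (simp add: abs_mult mult_ac)
  qed
  have kd: "summable (\<lambda>i. (\<bar>K\<bar> * diameter (Q i))^2)"
  proof -
   obtain E where "(\<Sum>i. ennreal ((diameter (Q i))^2)) \<le> ennreal E" using sum_diameter_finite by blast
   then have "(\<Sum>i. ennreal ((diameter (Q i))^2)) < \<infinity>" using order_le_less_trans by fastforce
   then have "summable (\<lambda>i. (diameter (Q i))^2)" by (subst (asm) suminf_ennreal_finite_iff) auto
   then show ?thesis by (simp add: power_mult_distrib summable_mult)
  qed
  have ud: "summable (\<lambda>i. (\<bar>upper f i\<bar> * diameter (Q i))^2)" if "sob f" for f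
   using sobD(5)[OF that] by (simp add: power_mult_distrib)
  have "summable (\<lambda>i. (\<bar>upper a i\<bar> * diameter (Q i) + gap a i * diameter (Q i) + (\<bar>upper b i\<bar> * diameter (Q i) + gap b i * diameter (Q i)) + \<bar>K\<bar> * diameter (Q i))^2)"
   by (intro summable_square_add ud gd kd a b)
  then show ?thesis
  proof (rule summable_square_le)
   fix i
   have "\<bar>upper z i * diameter (Q i)\<bar> \<le> ?B i * diameter (Q i)" using uB[of i] d0[of i] by (simp add: abs_mult mult_right_mono)
   also have "\<dots> = \<bar>upper a i\<bar> * diameter (Q i) + gap a i * diameter (Q i) + (\<bar>upper b i\<bar> * diameter (Q i) + gap b i * diameter (Q i)) + \<bar>K\<bar> * diameter (Q i)"
    by (simp add: algebra_simps)
   finally show "\<bar>upper z i * diameter (Q i)\<bar> \<le> \<bar>\<bar>upper a i\<bar> * diameter (Q i) + gap a i * diameter (Q i) + (\<bar>upper b i\<bar> * diameter (Q i) + gap b i * diameter (Q i)) + \<bar>K\<bar> * diameter (Q i)\<bar>"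
    by simp
  qed
 qed
 ultimately show ?thesis unfolding sob_def using d oscillation_is_gradient[OF grad fin d] by blast
qed

text \<open>Meant for the maximum, the minimum, the mean and the lift of two functions. These are
  Lipschitz in the pair, so a multiple of the sum of the two oscillations is a gradient.\<close>

lemma sob_lipschitz:
 assumes a: "sob a" and b: "sob b" and C: "0 \<le> (C::real)"
  and lip: "\<And>x y. x \<in> S ==> y \<in> S ==> \<bar>z x - z y\<bar> \<le> C * (\<bar>a x - a y\<bar> + \<bar>b x - b y\<bar>)"
  and le: "\<And>x. x \<in> S ==> \<bar>z x\<bar> \<le> \<bar>a x\<bar> + \<bar>b x\<bar> + K"
 shows "sob z"
proof (rule sob_of_gradient[OF a b _ _ le])
 let ?\<rho> = "\<lambda>i. ennreal C * (rosc a i + rosc b i)"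
 note da = sobD(1)[OF a] note db = sobD(1)[OF b]
 have r: "?\<rho> i = ennreal (C * (gap a i + gap b i))" for i
  using C gap_nonneg[OF da, of i] gap_nonneg[OF db, of i] by (simp add: rosc_gap ennreal_mult ennreal_plus[symmetric] del: ennreal_plus)
 have "summable (\<lambda>i. C^2 * (gap a i + gap b i)^2)" using sobD(4)[OF a] sobD(4)[OF b] by (intro summable_mult summable_square_add)
 then have s: "summable (\<lambda>i. (C * (gap a i + gap b i))^2)" by (simp add: power_mult_distrib)
 have "(?\<rho> i)^2 = ennreal ((C * (gap a i + gap b i))^2)" for i
  unfolding r using C gap_nonneg[OF da, of i] gap_nonneg[OF db, of i] by (simp add: ennreal_power)
 then show "(\<Sum>i. (?\<rho> i)^2) < \<infinity>" using s by (simp only:) (subst suminf_ennreal_finite_iff, auto)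
 show "rosc z i \<le> ?\<rho> i" for i unfolding rosc_gap[of z] r
 proof (intro ennreal_leI gap_leI)
  fix x y assume xy: "x \<in> frontier (Q i)" "y \<in> frontier (Q i)"
  then have "x \<in> S" "y \<in> S" using frontier_disk_subset by auto
  then have "z x - z y \<le> C * (\<bar>a x - a y\<bar> + \<bar>b x - b y\<bar>)" using lip by fastforce
  also have "\<dots> \<le> C * (gap a i + gap b i)" using C gap_diff[OF da xy] gap_diff[OF db xy] by (intro mult_left_mono) auto
  finally show "z x - z y \<le> C * (gap a i + gap b i)" .
 qed
 obtain A where A: "A \<subseteq> paths_in \<Omega>" "exceptional A"
  "\<And>p x y. p \<in> nonconst_paths_in \<Omega> - A ==> x \<in> im p \<inter> S ==> y \<in> im p \<inter> S ==> ennreal \<bar>a x - a y\<bar> \<le> meet_sum Q (rosc a) (im p)"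
  using sobD(2)[OF a] unfolding real_gradient_def by blast
 obtain B where B: "B \<subseteq> paths_in \<Omega>" "exceptional B"
  "\<And>p x y. p \<in> nonconst_paths_in \<Omega> - B ==> x \<in> im p \<inter> S ==> y \<in> im p \<inter> S ==> ennreal \<bar>b x - b y\<bar> \<le> meet_sum Q (rosc b) (im p)"
  using sobD(2)[OF b] unfolding real_gradient_def by blast
 have "ennreal \<bar>z x - z y\<bar> \<le> meet_sum Q ?\<rho> (im p)"
  if g: "p \<in> nonconst_paths_in \<Omega> - (A \<union> B)" and xy: "x \<in> im p \<inter> S" "y \<in> im p \<inter> S" for p x y
 proof -
  have "ennreal \<bar>z x - z y\<bar> \<le> ennreal (C * (\<bar>a x - a y\<bar> + \<bar>b x - b y\<bar>))" using lip xy by (intro ennreal_leI) auto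
  also have "\<dots> = ennreal C * (ennreal \<bar>a x - a y\<bar> + ennreal \<bar>b x - b y\<bar>)" using C by (simp add: ennreal_mult)
  also have "\<dots> \<le> ennreal C * (meet_sum Q (rosc a) (im p) + meet_sum Q (rosc b) (im p))"
   by (intro mult_left_mono add_mono A(3) B(3) xy) (use g in auto)
  finally show ?thesis by (simp add: meet_sum_cmult meet_sum_add)
 qed
 then show "real_gradient ?\<rho> z"
  unfolding real_gradient_def using A(1) B(1) exceptional_Un[OF A(2) B(2)] by (intro exI[of _ "A \<union> B"]) simp
qed

section \<open>Good paths of Sobolev functions\<close>

lemma almost_every_iff: "almost_every_path ver \<Omega> Q G \<longleftrightarrow> exceptional (nonconst_paths_in \<Omega> - G)"
 by (simp add: almost_every_path_def)

lemma almost_every_Int: "almost_every_path ver \<Omega> Q G ==> almost_every_path ver \<Omega> Q H ==> almost_every_path ver \<Omega> Q (G \<inter> H)"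
proof -
 assume "almost_every_path ver \<Omega> Q G" "almost_every_path ver \<Omega> Q H"
 then have "exceptional ((nonconst_paths_in \<Omega> - G) \<union> (nonconst_paths_in \<Omega> - H))" unfolding almost_every_iff by (rule exceptional_Un)
 moreover have "(nonconst_paths_in \<Omega> - G) \<union> (nonconst_paths_in \<Omega> - H) = nonconst_paths_in \<Omega> - (G \<inter> H)" by blast
 ultimately show ?thesis unfolding almost_every_iff by simp
qed

text \<open>Between the last exit from \<open>Q i\<close> and the first entry into
  \<open>Q j\<close> the path meets neither disk. The oscillations on these two disks are therefore
  counted only once, which is why the bound carries no additional factor.\<close>

lemma disk_controlled_of_subpaths:
 assumes f: "disk_bounded f" and p: "is_cpath p" "im p \<subseteq> \<Omega>"
  and sub: "\<And>s t. s \<le> t ==> {s..t} \<subseteq> fst p ==> snd p s \<in> S ==> snd p t \<in> S ==>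
   ennreal \<bar>f (snd p s) - f (snd p t)\<bar> \<le> meet_sum Q (rosc f) (snd p ` {s..t})"
 shows "disk_controlled f p"
proof -
 define g where "g = snd p"
 have main: "ennreal \<bar>upper f i - upper f j\<bar> \<le> meet_sum Q (rosc f) (im p')"
  if sp: "subcpath p' p" and a: "a \<in> fst p'" "g a \<in> Q i" and b: "b \<in> fst p'" "g b \<in> Q j" and ab: "a \<le> b" for p' i j a b
 proof (cases "i = j")
  case False
  have ivl: "{a..b} \<subseteq> fst p'" using sp mem_is_interval_1_I[OF _ a(1) b(1)] by (auto simp: subcpath_def)
  then have ivl': "{a..b} \<subseteq> fst p" using sp by (auto simp: subcpath_def)
  have cont: "continuous_on {a..b} g" using p(1) ivl' closure_subset[of "fst p"] unfolding is_cpath_def g_def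
   by (meson continuous_on_subset order_trans)
  have bi: "g b \<notin> closure (Q i)" using closure_disk_unique[of "g b" i j] b(2) closure_subset[of "Q j"] False by blast
  obtain s where s: "s \<in> {a..b}" "g s \<in> frontier (Q i)" "\<And>r. r \<in> {s..b} ==> g r \<notin> Q i"
   using last_exit[OF cont ab _ bi open_disk] a(2) closure_subset[of "Q i"] by blast
  have sj: "g s \<notin> closure (Q j)" using closure_disk_unique[of "g s" i j] s(2) False by (auto simp: frontier_def)
  have "continuous_on {s..b} g" using s(1) by (intro continuous_on_subset[OF cont]) auto
  then obtain t where t: "t \<in> {s..b}" "g t \<in> frontier (Q j)" "\<And>r. r \<in> {s..t} ==> g r \<notin> Q j"
  proof -
   have "g b \<in> closure (Q j)" using b(2) closure_subset[of "Q j"] by blast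
   moreover have "s \<le> b" using s(1) by simp
   ultimately show thesis using first_entry[OF \<open>continuous_on {s..b} g\<close> _ sj _ open_disk] that by blast
  qed
  have st: "{s..t} \<subseteq> {a..b}" using s(1) t(1) by auto
  have S: "g s \<in> S" "g t \<in> S" using s(2) t(2) frontier_disk_subset by auto
  have 1: "ennreal \<bar>f (g s) - f (g t)\<bar> \<le> meet_sum Q (rosc f) (g ` {s..t})" unfolding g_def
  proof (rule sub)
   show "{s..t} \<subseteq> fst p" using st ivl' by blast
   show "s \<le> t" "snd p s \<in> S" "snd p t \<in> S" using t(1) S unfolding g_def by auto
  qed
  have "im p' = g ` fst p'" using sp by (simp add: im_def subcpath_def g_def)
  then have gi: "g ` {s..t} \<subseteq> im p'" using image_mono[OF order_trans[OF st ivl], of g] by simp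
  have "\<bar>upper f i - upper f j\<bar> \<le> \<bar>upper f i - f (g s)\<bar> + \<bar>f (g s) - f (g t)\<bar> + \<bar>upper f j - f (g t)\<bar>" by linarith
  then have "ennreal \<bar>upper f i - upper f j\<bar> \<le> ennreal \<bar>upper f i - f (g s)\<bar> + ennreal \<bar>f (g s) - f (g t)\<bar> + ennreal \<bar>upper f j - f (g t)\<bar>"
   by (simp add: ennreal_plus[symmetric] ennreal_leI del: ennreal_plus)
  also have "\<dots> \<le> rosc f i + meet_sum Q (rosc f) (g ` {s..t}) + rosc f j" by (intro add_mono 1 rosc_bound f s(2) t(2))
  also have "\<dots> = (\<Sum>k\<in>{i,j}. rosc f k) + meet_sum Q (rosc f) (g ` {s..t})" using False by (simp add: add_ac)
  also have "\<dots> \<le> meet_sum Q (rosc f) (im p')"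
  proof (rule meet_sum_split[OF _ _ _ gi])
   have "g a \<in> im p'" "g b \<in> im p'" using a b sp by (auto simp: im_def subcpath_def g_def)
   then show "Q k \<inter> im p' \<noteq> {}" if "k \<in> {i, j}" for k using that a b by blast
   show "Q k \<inter> g ` {s..t} = {}" if "k \<in> {i, j}" for k using that s(3) t by fastforce
  qed simp
  finally show ?thesis .
 qed simp
 show ?thesis unfolding disk_controlled_def
 proof (intro allI impI)
  fix p' i j assume sp: "subcpath p' p" and ij: "Q i \<inter> im p' \<noteq> {}" "Q j \<inter> im p' \<noteq> {}"
  obtain a where a: "a \<in> fst p'" "g a \<in> Q i" using ij(1) sp by (auto simp: im_def subcpath_def g_def)
  obtain b where b: "b \<in> fst p'" "g b \<in> Q j" using ij(2) sp by (auto simp: im_def subcpath_def g_def)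
  show "ennreal \<bar>upper f i - upper f j\<bar> \<le> meet_sum Q (rosc f) (im p')"
  proof (cases "a \<le> b")
   case True then show ?thesis by (rule main[OF sp a b])
  next
   case False
   then have "ennreal \<bar>upper f j - upper f i\<bar> \<le> meet_sum Q (rosc f) (im p')" by (intro main[OF sp b a]) simp
   then show ?thesis by (simp add: abs_minus_commute)
  qed
 qed
qed

abbreviation good where "good f \<equiv> good_paths \<Omega> Q (\<lambda>x. ereal (f x))"

lemma goodD:
 assumes f: "sob f" and p: "p \<in> good f"
 shows "p \<in> nonconst_paths_in \<Omega>" "hausdorff1 (im p \<inter> S) = 0" "meet_sum Q (rosc f) (im p) < \<infinity>" "disk_controlled f p"
proof -
 note d = sobD(1)[OF f]
 have t: "tame_path \<Omega> Q (\<lambda>x. ereal (f x)) p" using p by (simp add: good_paths_def)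
 show n: "p \<in> nonconst_paths_in \<Omega>" and "hausdorff1 (im p \<inter> S) = 0" using t by (auto simp: tame_path_def)
 show "meet_sum Q (rosc f) (im p) < \<infinity>" using t sobD(3)[OF f] unfolding tame_path_def osc_real[OF d] by blast
 show "disk_controlled f p"
 proof (rule disk_controlled_of_subpaths[OF d])
  show "is_cpath p" "im p \<subseteq> \<Omega>" using n by (auto simp: nonconst_paths_in_def paths_in_def)
  fix s t assume st: "s \<le> t" "{s..t} \<subseteq> fst p" "snd p s \<in> S" "snd p t \<in> S"
  have "subcpath ({s..t}, snd p) p" using st by (auto simp: subcpath_def is_interval_cc)
  moreover have "snd p s \<in> im ({s..t}, snd p) \<inter> S" "snd p t \<in> im ({s..t}, snd p) \<inter> S" using st by (auto simp: im_def)
  ultimately have "\<bar>ereal (f (snd p s)) - ereal (f (snd p t))\<bar> \<le> enn2ereal (meet_sum Q (rosc f) (im ({s..t}, snd p)))"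
   using p unfolding good_paths_def osc_real[OF d] by blast
  then show "ennreal \<bar>f (snd p s) - f (snd p t)\<bar> \<le> meet_sum Q (rosc f) (snd p ` {s..t})"
   unfolding abs_ereal_diff_le_iff by (simp add: im_def)
 qed
qed

text \<open>Consequently any family containing almost every path may be intersected with the good
  paths of finitely many functions.\<close>

lemma almost_every_good:
 assumes f: "sob f" shows "almost_every_path ver \<Omega> Q (good f)"
proof -
 note d = sobD(1)[OF f]
 obtain H0 where G: "exceptional H0" "H0 \<subseteq> paths_in \<Omega>"
  "\<And>c. c \<in> paths_in \<Omega> - H0 ==> meet_sum Q (rosc f) (im c) < \<infinity> \<and> hausdorff1 (im c \<inter> S) = 0"
  "\<And>c c' x y. c \<in> paths_in \<Omega> - H0 ==> subcpath c' c ==> x \<in> im c' \<inter> S ==> y \<in> im c' \<inter> S ==>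
    ennreal \<bar>f x - f y\<bar> \<le> meet_sum Q (rosc f) (im c')" using subpaths_gradient[OF sobD(2,3)[OF f]] by blast
 have "c \<in> good f" if c: "c \<in> nonconst_paths_in \<Omega>" "c \<notin> H0" for c
 proof -
  have p: "c \<in> paths_in \<Omega> - H0" using c by (simp add: nonconst_paths_in_def)
  have "tame_path \<Omega> Q (\<lambda>x. ereal (f x)) c" unfolding tame_path_def osc_real[OF d]
   using c(1) G(3)[OF p] order_le_less_trans[OF meet_sum_mono_set[OF im_sub]] by blast
  then show ?thesis unfolding good_paths_def osc_real[OF d] abs_ereal_diff_le_iff using G(4)[OF p] by blast
 qed
 then have "nonconst_paths_in \<Omega> - good f \<subseteq> H0" by blast
 then show ?thesis unfolding almost_every_iff using exceptional_mono G(1) by blast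
qed

text \<open>A disk of diameter \<open>d\<close> does not fit into a ball of radius
  \<open>d / 4\<close>.\<close>

lemma eventually_disks_avoid_finite:
 assumes "finite F" shows "eventually (\<lambda>i. i \<notin> F) (disks_to Q A x)"
proof -
 have "eventually (\<lambda>i. i \<noteq> k) (disks_to Q A x)" for k unfolding eventually_disks_to
 proof (intro exI[of _ "diameter (Q k) / 4"] conjI allI impI)
  show "0 < diameter (Q k) / 4" using diameter_disk_pos[of k] by simp
  fix i assume i: "Q i \<inter> A \<noteq> {} \<and> Q i \<subseteq> ball x (diameter (Q k) / 4)"
  show "i \<noteq> k"
  proof
   assume "i = k"
   then have "diameter (Q k) \<le> diameter (ball x (diameter (Q k) / 4))" using i by (intro diameter_subset) auto
   then show False using diameter_disk_pos[of k] by (simp add: diameter_ball)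
  qed
 qed
 then have "eventually (\<lambda>i. \<forall>k\<in>F. i \<noteq> k) (disks_to Q A x)" using assms by (intro eventually_ball_finite) auto
 then show ?thesis by (rule eventually_mono) auto
qed

text \<open>The terms of a finite sum are small outside finitely many indices. Suprema and infima
  over the disks met by such a path thus share their limits.\<close>

lemma gap_tendsto_0:
 assumes fin: "meet_sum Q (rosc f) A < \<infinity>" and d: "disk_bounded f"
 shows "((gap f) \<longlongrightarrow> 0) (disks_to Q A x)"
proof (rule tendstoI)
 fix e :: real assume e: "e > 0"
 obtain n where n: "meet_sum Q (\<lambda>i. if i < n then 0 else rosc f i) A < ennreal e" using meet_sum_tail[OF fin e] by blast
 have 1: "eventually (\<lambda>i. i \<notin> {..<n}) (disks_to Q A x)" by (rule eventually_disks_avoid_finite) simp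
 have 2: "eventually (\<lambda>i. Q i \<inter> A \<noteq> {}) (disks_to Q A x)" unfolding eventually_disks_to by (intro exI[of _ 1]) simp
 from 1 2 show "eventually (\<lambda>i. dist (gap f i) 0 < e) (disks_to Q A x)"
 proof eventually_elim
  case (elim i)
  have "(if i < n then 0 else rosc f i) < ennreal e"
   using meet_sum_ge_term[where Q = Q and A = A and i = i and \<rho> = "\<lambda>i. if i < n then 0 else rosc f i"] elim(2) n by (meson order_le_less_trans)
  then have "gap f i < e" using elim(1) gap_nonneg[OF d, of i] by (simp add: rosc_gap ennreal_less_iff)
  then show ?case using gap_nonneg[OF d, of i] by simp
 qed
qed

end

locale carpet_domain = bounded_carpet +
 fixes \<C> :: "complex set set"
 assumes finite_curves: "finite \<C>" and curves: "\<And>C. C \<in> \<C> ==> jordan_curve C" and disjoint_curves: "pairwise disjnt \<C>"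
  and frontier_domain: "frontier \<Omega> = \<Union>\<C>"
begin

lemma frontier_not_in_domain: "x \<in> frontier \<Omega> ==> x \<notin> \<Omega>"
 using open_domain by (simp add: frontier_def interior_open)

text \<open>The domain lies on one side \<open>U\<close> of the boundary curve through
  \<open>x\<close>. Below the scale \<open>R1\<close> squares meet no other boundary curve, so a
  subarc of a crosscut of \<open>U\<close> with both ends in the domain stays in the domain, and the
  region cut off only has to be intersected with it.\<close>

lemma crosscut_point_boundary:
 assumes x: "x \<in> frontier \<Omega>" shows "crosscut_point x \<Omega>"
proof -
 obtain G where G: "G \<in> \<C>" "x \<in> G" using x frontier_domain by blast
 have Gf: "G \<subseteq> frontier \<Omega>" using G(1) frontier_domain by blast
 have dis: "\<Omega> \<inter> G = {}" using Gf frontier_not_in_domain by blast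
 have x\<Omega>: "x \<notin> \<Omega>" using frontier_not_in_domain[OF x] .
 obtain y where y: "y \<in> \<Omega>" using disk_nonempty disk_subset by blast
 have in_out: "inside G \<union> outside G = - G" by (rule inside_Un_outside)
 obtain U where JS: "jordan_side G U" and yU: "y \<in> U"
 proof -
  have "y \<in> inside G \<or> y \<in> outside G" using y dis in_out by blast
  then show thesis using that curves[OF G(1)] unfolding jordan_side_def by blast
 qed
 have \<Omega>U: "\<Omega> \<subseteq> U" using jordan_sideD(8)[OF JS connected_domain dis y yU] .
 have "compact (\<Union>(\<C> - {G}))" using finite_curves curves jordan_sideD(1) unfolding jordan_side_def by (intro compact_Union) auto
 then have "open (- \<Union>(\<C> - {G}))" by (simp add: compact_imp_closed open_Compl)
 moreover have "x \<in> - \<Union>(\<C> - {G})" using disjoint_curves G unfolding pairwise_def disjnt_def by blast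
 ultimately obtain R1 where R1: "R1 > 0" "square x R1 \<subseteq> - \<Union>(\<C> - {G})" using open_contains_square by blast
 have sy: "0 < sup_norm (y - x)"
 proof -
  have "y \<noteq> x" using y x\<Omega> by blast
  then have "sup_norm (y - x) \<noteq> 0" by simp
  then show ?thesis using sup_norm_nonneg[of "y - x"] by linarith
 qed
 define R where "R = min R1 (sup_norm (y - x))"
 have R: "R > 0" using R1 sy by (simp add: R_def)
 have "\<exists>r0>0. \<forall>r. 0 < r --> r < r0 --> (\<exists>s s' N. crosscut_region \<Omega> x r r1 s s' N)" if r1: "0 < r1" "r1 < R" for r1
 proof -
  have "y \<in> U - square x r1" using yU r1(2) by (simp add: square_def R_def)
  then have far: "U - square x r1 \<noteq> {}" by blast
  define P where "P r = (\<exists>s s' N d. 0 \<le> s \<and> s < s' \<and> s' \<le> 4 * pi \<and>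
   square_path x r ` {s<..<s'} \<subseteq> U \<and> square_path x r s \<in> G \<and> square_path x r s' \<in> G \<and>
   0 < d \<and> (U \<union> G) \<inter> square x d \<subseteq> N \<and> N \<subseteq> (U \<union> G) \<inter> csquare x r1 \<and>
   (\<forall>X. connected X --> X \<subseteq> U \<union> G --> X \<inter> square_path x r ` {s..s'} = {} --> X \<inter> N \<noteq> {} --> X \<subseteq> N))" for r
  have "\<exists>r0>0. \<forall>r. 0 < r --> r < r0 --> P r" unfolding P_def by (rule square_crosscut[OF JS G(2) r1(1) far])
  then obtain r0 where r0: "r0 > 0" and cut: "\<And>r. 0 < r ==> r < r0 ==> P r" by blast
  show ?thesis
  proof (rule exI[of _ "min r0 r1"], intro conjI allI impI)
   show "0 < min r0 r1" using r0 r1 by simp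
   fix r assume r: "0 < r" "r < min r0 r1"
   obtain s s' N d where c: "0 \<le> s" "s < s'" "s' \<le> 4 * pi" "square_path x r ` {s<..<s'} \<subseteq> U" "square_path x r s \<in> G" "square_path x r s' \<in> G"
    "0 < d" "(U \<union> G) \<inter> square x d \<subseteq> N" "N \<subseteq> (U \<union> G) \<inter> csquare x r1"
    and X: "\<forall>X. connected X --> X \<subseteq> U \<union> G --> X \<inter> square_path x r ` {s..s'} = {} --> X \<inter> N \<noteq> {} --> X \<subseteq> N"
   proof -
    have "P r" using cut[of r] r by simp
    then show thesis unfolding P_def by (elim exE conjE) (rule that)
   qed
   have arcs: "square_path x r ` {t..t'} \<subseteq> \<Omega>"
    if t: "s \<le> t" "t \<le> t'" "t' \<le> s'" "square_path x r t \<in> \<Omega>" "square_path x r t' \<in> \<Omega>" for t t'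
   proof -
    have "t \<noteq> s" "t' \<noteq> s'" using t(4,5) c(5,6) dis by auto
    then have sub: "{t..t'} \<subseteq> {s<..<s'}" using t by auto
    have "square_path x r ` {t..t'} \<inter> G = {}" using image_mono[OF sub, of "square_path x r"] c(4) jordan_sideD(5)[OF JS] by blast
    moreover have "square_path x r ` {t..t'} \<subseteq> square x R1" using r r1 square_path_norm[of r x] by (auto simp: square_def R_def)
    ultimately have av: "square_path x r ` {t..t'} \<inter> frontier \<Omega> = {}" using R1(2) frontier_domain by blast
    have "connected (square_path x r ` {t..t'})" by (intro connected_continuous_image continuous_on_square_path) simp
    moreover have "square_path x r t \<in> square_path x r ` {t..t'}" using t(2) by (intro imageI) simp
    then have "square_path x r ` {t..t'} \<inter> \<Omega> \<noteq> {}" using t(4) by blast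
    ultimately show ?thesis using connected_Int_frontier[of "square_path x r ` {t..t'}" \<Omega>] av by blast
   qed
   have "crosscut_region \<Omega> x r r1 s s' (N \<inter> \<Omega>)" unfolding crosscut_region_def
   proof (intro conjI allI impI)
    show "N \<inter> \<Omega> \<subseteq> \<Omega> \<inter> csquare x r1" using c(9) by blast
    show "\<exists>d>0. \<Omega> \<inter> square x d \<subseteq> N \<inter> \<Omega>" using c(7,8) \<Omega>U by blast
    show "Y \<subseteq> N \<inter> \<Omega>" if "connected Y" "Y \<subseteq> \<Omega>" "Y \<inter> square_path x r ` {s..s'} = {}" "Y \<inter> (N \<inter> \<Omega>) \<noteq> {}" for Y
    proof -
     have "Y \<subseteq> U \<union> G" "Y \<inter> N \<noteq> {}" using that \<Omega>U by blast+
     then have "Y \<subseteq> N" using X that(1,3) by simp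
     then show ?thesis using that(2) by blast
    qed
   qed (use c arcs x\<Omega> in auto)
   then show "\<exists>s s' N. crosscut_region \<Omega> x r r1 s s' N" by blast
  qed
 qed
 moreover have "x \<notin> closure (Q i)" for i using closure_disk_subset x\<Omega> by blast
 ultimately show ?thesis unfolding crosscut_point_def using R by blast
qed

section \<open>Boundary values\<close>

lemma summable_near: "sob f ==> locally_square_summable f x"
 unfolding locally_square_summable_def using order_le_less_trans[OF meet_sum_le_suminf sobD(3)] by (intro exI[of _ 1]) simp

lemma good_path_approach:
 assumes f: "sob f" and x: "x \<in> frontier \<Omega>" and p: "p \<in> good f" "x \<in> closure (im p)"
 shows "approach f x \<Omega> p"
proof -
 have n: "is_cpath p" "im p \<subseteq> \<Omega>" using goodD(1)[OF f p(1)] by (auto simp: nonconst_paths_in_def paths_in_def)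
 have "meet_sum Q (rosc f) (im p') < \<infinity>" if "subcpath p' p" for p'
  using meet_sum_mono_set[OF im_sub[OF that]] goodD(3)[OF f p(1)] by (rule order_le_less_trans)
 then have "\<exists>h>0. \<forall>p'. subcpath p' p --> im p' \<subseteq> square x h --> meet_sum Q (rosc f) (im p') < \<infinity>"
  by (intro exI[of _ 1]) simp
 moreover have "\<exists>y\<in>im p. y \<noteq> x"
 proof -
  obtain t where "t \<in> fst p" using n(1) by (auto simp: is_cpath_def)
  then have "snd p t \<in> im p" by (simp add: im_def)
  then show ?thesis using n(2) frontier_not_in_domain[OF x] by (intro bexI[of _ "snd p t"]) auto
 qed
 ultimately show ?thesis unfolding approach_def using n goodD(2,4)[OF f p(1)] p(2) by blast
qed

text \<open>All good paths accessing \<open>x\<close> give the same limit, so the definite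
  description in the boundary value denotes it.\<close>

lemma boundary_limit:
 assumes f: "sob f" and x: "x \<in> boundary_accessible \<Omega> (good f)"
 shows "\<exists>L. boundary_value \<Omega> Q (\<lambda>x. ereal (f x)) x = ereal L \<and>
   (\<forall>p\<in>good f. x \<in> closure (im p) --> (upper f \<longlongrightarrow> L) (disks_to Q (im p) x) \<and> disks_to Q (im p) x \<noteq> bot)"
proof -
 obtain p0 where p0: "x \<in> frontier \<Omega>" "p0 \<in> good f" "open_cpath p0" "x \<in> closure (im p0)"
  using x by (auto simp: boundary_accessible_def)
 note cp = crosscut_point_boundary[OF p0(1)]
 obtain L where L: "\<And>p'. approach f x \<Omega> p' ==> (upper f \<longlongrightarrow> L) (disks_to Q (im p') x)"
  using approach_limit[OF cp sobD(1,2)[OF f] summable_near[OF f] good_path_approach[OF f p0(1,2,4)]] by blast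
 have lim: "(upper f \<longlongrightarrow> L) (disks_to Q (im p) x) \<and> disks_to Q (im p) x \<noteq> bot"
  if "p \<in> good f" "x \<in> closure (im p)" for p
  using L[OF good_path_approach[OF f p0(1) that]] approach_nontrivial[OF cp good_path_approach[OF f p0(1) that]] by blast
 have val: "Liminf (disks_to Q (im p) x) (Msup Q (\<lambda>x. ereal (f x))) = ereal L"
  if "p \<in> good f" "x \<in> closure (im p)" for p
 proof -
  have "Msup Q (\<lambda>x. ereal (f x)) = (\<lambda>i. ereal (upper f i))" using Msup_real[OF sobD(1)[OF f]] by (simp add: fun_eq_iff)
  then show ?thesis using lim[OF that] by (simp add: lim_imp_Liminf)
 qed
 have "boundary_access_value \<Omega> Q (\<lambda>x. ereal (f x)) x = ereal L" unfolding boundary_access_value_def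
 proof (rule the_equality)
  show "\<exists>p\<in>good f. open_cpath p \<and> x \<in> closure (im p) \<and> ereal L = Liminf (disks_to Q (im p) x) (Msup Q (\<lambda>x. ereal (f x)))"
   using p0 val by (intro bexI[of _ p0]) auto
  show "l = ereal L" if "\<exists>p\<in>good f. open_cpath p \<and> x \<in> closure (im p) \<and> l = Liminf (disks_to Q (im p) x) (Msup Q (\<lambda>x. ereal (f x)))" for l
   using that val by auto
 qed
 then show ?thesis using x lim unfolding boundary_value_def Let_def by auto
qed

text \<open>Boundary values as limits of both extrema over the disks along paths. In this form they
  pass to maxima, to minima and to functions squeezed between two others.\<close>

definition bval :: "(complex => real) => (complex => real) => bool" where
 "bval f \<alpha> \<longleftrightarrow> (\<exists>G\<subseteq>paths_in \<Omega>. almost_every_path ver \<Omega> Q G \<and> (\<forall>p\<in>G. \<forall>x\<in>frontier \<Omega>. open_cpath p --> x \<in> closure (im p) -->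
   disks_to Q (im p) x \<noteq> bot \<and> (upper f \<longlongrightarrow> \<alpha> x) (disks_to Q (im p) x) \<and> (lower f \<longlongrightarrow> \<alpha> x) (disks_to Q (im p) x)))"

lemma lower_limit:
 assumes f: "sob f" and p: "p \<in> good f" and L: "(upper f \<longlongrightarrow> L) (disks_to Q (im p) x)"
 shows "(lower f \<longlongrightarrow> L) (disks_to Q (im p) x)"
proof -
 have "((\<lambda>i. upper f i - gap f i) \<longlongrightarrow> L - 0) (disks_to Q (im p) x)"
  by (intro tendsto_diff L gap_tendsto_0[OF goodD(3)[OF f p] sobD(1)[OF f]])
 then show ?thesis by (simp add: gap_def)
qed

text \<open>On good paths the boundary value is a limit along a proper filter, so uniqueness of
  limits identifies the two descriptions; almost every path is good.\<close>

lemma bval_iff: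
 assumes f: "sob f"
 shows "bval f \<alpha> \<longleftrightarrow> (\<exists>G\<subseteq>paths_in \<Omega>. almost_every_path ver \<Omega> Q G \<and>
   (\<forall>x\<in>boundary_accessible \<Omega> G. boundary_value \<Omega> Q (\<lambda>x. ereal (f x)) x = ereal (\<alpha> x)))"
proof
 assume "bval f \<alpha>"
 then obtain G where G: "G \<subseteq> paths_in \<Omega>" "almost_every_path ver \<Omega> Q G"
  "\<And>p x. p \<in> G ==> x \<in> frontier \<Omega> ==> open_cpath p ==> x \<in> closure (im p) ==>
   disks_to Q (im p) x \<noteq> bot \<and> (upper f \<longlongrightarrow> \<alpha> x) (disks_to Q (im p) x)" unfolding bval_def by blast
 have "boundary_value \<Omega> Q (\<lambda>x. ereal (f x)) x = ereal (\<alpha> x)" if x: "x \<in> boundary_accessible \<Omega> (G \<inter> good f)" for x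
 proof -
  obtain p where p: "x \<in> frontier \<Omega>" "p \<in> G" "p \<in> good f" "open_cpath p" "x \<in> closure (im p)"
   using x by (auto simp: boundary_accessible_def)
  then have "x \<in> boundary_accessible \<Omega> (good f)" by (auto simp: boundary_accessible_def)
  then obtain L where L: "boundary_value \<Omega> Q (\<lambda>x. ereal (f x)) x = ereal L" "(upper f \<longlongrightarrow> L) (disks_to Q (im p) x)" "disks_to Q (im p) x \<noteq> bot"
   using boundary_limit[OF f] p by blast
  then have "L = \<alpha> x" using tendsto_unique[OF L(3,2)] G(3)[OF p(2,1,4,5)] by blast
  then show ?thesis using L(1) by simp
 qed
 then show "\<exists>G\<subseteq>paths_in \<Omega>. almost_every_path ver \<Omega> Q G \<and>
   (\<forall>x\<in>boundary_accessible \<Omega> G. boundary_value \<Omega> Q (\<lambda>x. ereal (f x)) x = ereal (\<alpha> x))"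
  using G(1) almost_every_Int[OF G(2) almost_every_good[OF f]] by (intro exI[of _ "G \<inter> good f"]) blast
next
 assume "\<exists>G\<subseteq>paths_in \<Omega>. almost_every_path ver \<Omega> Q G \<and>
   (\<forall>x\<in>boundary_accessible \<Omega> G. boundary_value \<Omega> Q (\<lambda>x. ereal (f x)) x = ereal (\<alpha> x))"
 then obtain G where G: "G \<subseteq> paths_in \<Omega>" "almost_every_path ver \<Omega> Q G"
  "\<And>x. x \<in> boundary_accessible \<Omega> G ==> boundary_value \<Omega> Q (\<lambda>x. ereal (f x)) x = ereal (\<alpha> x)" by blast
 have "disks_to Q (im p) x \<noteq> bot \<and> (upper f \<longlongrightarrow> \<alpha> x) (disks_to Q (im p) x) \<and> (lower f \<longlongrightarrow> \<alpha> x) (disks_to Q (im p) x)"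
  if p: "p \<in> G \<inter> good f" "x \<in> frontier \<Omega>" "open_cpath p" "x \<in> closure (im p)" for p x
 proof -
  have "x \<in> boundary_accessible \<Omega> (good f)" "x \<in> boundary_accessible \<Omega> G" using p by (auto simp: boundary_accessible_def)
  then obtain L where "boundary_value \<Omega> Q (\<lambda>x. ereal (f x)) x = ereal L" "(upper f \<longlongrightarrow> L) (disks_to Q (im p) x)" "disks_to Q (im p) x \<noteq> bot"
   using boundary_limit[OF f] p by blast
  moreover from this have "L = \<alpha> x" using G(3)[OF \<open>x \<in> boundary_accessible \<Omega> G\<close>] by simp
  ultimately show ?thesis using lower_limit[OF f, of p L x] p by auto
 qed
 then show "bval f \<alpha>" unfolding bval_def
  using G(1) almost_every_Int[OF G(2) almost_every_good[OF f]] by (intro exI[of _ "G \<inter> good f"]) blast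
qed

text \<open>On paths good for both functions the limits are taken along one common filter, so a
  statement about limits of numbers suffices.\<close>

lemma bval_combine:
 assumes a: "bval a \<alpha>" and b: "bval b \<beta>" and G: "almost_every_path ver \<Omega> Q G"
  and step: "\<And>x F. x \<in> boundary_accessible \<Omega> G ==> F \<noteq> bot ==> (upper a \<longlongrightarrow> \<alpha> x) F ==> (lower a \<longlongrightarrow> \<alpha> x) F ==>
    (upper b \<longlongrightarrow> \<beta> x) F ==> (lower b \<longlongrightarrow> \<beta> x) F ==> (upper z \<longlongrightarrow> d x) F \<and> (lower z \<longlongrightarrow> d x) F"
 shows "bval z d"
proof -
 obtain A where A: "A \<subseteq> paths_in \<Omega>" "almost_every_path ver \<Omega> Q A"
  "\<And>p x. p \<in> A ==> x \<in> frontier \<Omega> ==> open_cpath p ==> x \<in> closure (im p) ==>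
   disks_to Q (im p) x \<noteq> bot \<and> (upper a \<longlongrightarrow> \<alpha> x) (disks_to Q (im p) x) \<and> (lower a \<longlongrightarrow> \<alpha> x) (disks_to Q (im p) x)"
  using a unfolding bval_def by blast
 obtain B where B: "B \<subseteq> paths_in \<Omega>" "almost_every_path ver \<Omega> Q B"
  "\<And>p x. p \<in> B ==> x \<in> frontier \<Omega> ==> open_cpath p ==> x \<in> closure (im p) ==>
   disks_to Q (im p) x \<noteq> bot \<and> (upper b \<longlongrightarrow> \<beta> x) (disks_to Q (im p) x) \<and> (lower b \<longlongrightarrow> \<beta> x) (disks_to Q (im p) x)"
  using b unfolding bval_def by blast
 have "disks_to Q (im p) x \<noteq> bot \<and> (upper z \<longlongrightarrow> d x) (disks_to Q (im p) x) \<and> (lower z \<longlongrightarrow> d x) (disks_to Q (im p) x)"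
  if p: "p \<in> A \<inter> B \<inter> G" "x \<in> frontier \<Omega>" "open_cpath p" "x \<in> closure (im p)" for p x
 proof -
  have "x \<in> boundary_accessible \<Omega> G" using p unfolding boundary_accessible_def by blast
  then show ?thesis using A(3)[of p x] B(3)[of p x] p step[of x "disks_to Q (im p) x"] by blast
 qed
 then show ?thesis unfolding bval_def
  using A(1) almost_every_Int[OF almost_every_Int[OF A(2) B(2)] G] by (intro exI[of _ "A \<inter> B \<inter> G"]) blast
qed

section \<open>Maxima and minima of Sobolev functions\<close>

lemma upper_mono: "disk_bounded g ==> (\<And>x. x \<in> S ==> f x \<le> g x) ==> upper f i \<le> upper g i"
 using frontier_disk_subset disk_boundedD(3) by (intro upper_least) (meson order_trans subsetD)

lemma lower_mono: "disk_bounded f ==> (\<And>x. x \<in> S ==> f x \<le> g x) ==> lower f i \<le> lower g i"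
 using frontier_disk_subset disk_boundedD(4) by (intro lower_greatest) (meson order_trans subsetD)

lemma almost_every_paths: "almost_every_path ver \<Omega> Q (paths_in \<Omega>)"
proof -
 have "nonconst_paths_in \<Omega> - paths_in \<Omega> \<subseteq> {p. meet_sum Q (\<lambda>i. 0) (im p) = \<infinity>}" by (auto simp: nonconst_paths_in_def)
 then show ?thesis unfolding almost_every_iff using exceptional_mono exceptional_infinite_sum[of "\<lambda>i. 0"] by fastforce
qed

lemma bval_between:
 assumes a: "sob a" "bval a \<alpha>" and b: "sob b" "bval b \<alpha>" and z: "disk_bounded z"
  and az: "\<And>x. x \<in> S ==> a x \<le> z x" and zb: "\<And>x. x \<in> S ==> z x \<le> b x"
 shows "bval z \<alpha>"
proof (rule bval_combine[OF a(2) b(2) almost_every_paths], intro conjI)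
 fix x and F :: "nat filter"
 assume h: "(upper a \<longlongrightarrow> \<alpha> x) F" "(lower a \<longlongrightarrow> \<alpha> x) F" "(upper b \<longlongrightarrow> \<alpha> x) F" "(lower b \<longlongrightarrow> \<alpha> x) F"
 note da = sobD(1)[OF a(1)] note db = sobD(1)[OF b(1)]
 show "(upper z \<longlongrightarrow> \<alpha> x) F"
  by (rule tendsto_sandwich[OF _ _ h(1) h(3)]) (auto intro!: always_eventually upper_mono z db az zb)
 show "(lower z \<longlongrightarrow> \<alpha> x) F"
  by (rule tendsto_sandwich[OF _ _ h(2) h(4)]) (auto intro!: always_eventually lower_mono z da az zb)
qed

lemma upper_max: assumes u: "disk_bounded u" "disk_bounded v" shows "upper (\<lambda>x. max (u x) (v x)) i = max (upper u i) (upper v i)"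
  "max (lower u i) (lower v i) \<le> lower (\<lambda>x. max (u x) (v x)) i"
  "lower (\<lambda>x. min (u x) (v x)) i = min (lower u i) (lower v i)"
  "upper (\<lambda>x. min (u x) (v x)) i \<le> min (upper u i) (upper v i)"
  "disk_bounded (\<lambda>x. max (u x) (v x))" "disk_bounded (\<lambda>x. min (u x) (v x))"
proof -
 note U = disk_boundedD[OF u(1)] and V = disk_boundedD[OF u(2)]
 show M: "disk_bounded (\<lambda>x. max (u x) (v x))"
  by (rule disk_boundedI[where l = "lower u" and u = "\<lambda>i. max (upper u i) (upper v i)"]) (meson U(3,4) V(3) max.coboundedI1 max.mono)
 show m: "disk_bounded (\<lambda>x. min (u x) (v x))"
  by (rule disk_boundedI[where u = "upper u" and l = "\<lambda>i. min (lower u i) (lower v i)"]) (meson U(3,4) V(4) min.coboundedI1 min.mono)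
 show "upper (\<lambda>x. max (u x) (v x)) i = max (upper u i) (upper v i)"
 proof (rule antisym)
  show "upper (\<lambda>x. max (u x) (v x)) i \<le> max (upper u i) (upper v i)" by (rule upper_least) (meson U(3) V(3) max.mono)
  show "max (upper u i) (upper v i) \<le> upper (\<lambda>x. max (u x) (v x)) i" by (intro max.boundedI upper_mono M) auto
 qed
 show "lower (\<lambda>x. min (u x) (v x)) i = min (lower u i) (lower v i)"
 proof (rule antisym)
  show "min (lower u i) (lower v i) \<le> lower (\<lambda>x. min (u x) (v x)) i" by (rule lower_greatest) (meson U(4) V(4) min.mono)
  show "lower (\<lambda>x. min (u x) (v x)) i \<le> min (lower u i) (lower v i)" by (intro min.boundedI lower_mono m) auto
 qed
 show "max (lower u i) (lower v i) \<le> lower (\<lambda>x. max (u x) (v x)) i" by (rule lower_greatest) (meson U(4) V(4) max.mono)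
 show "upper (\<lambda>x. min (u x) (v x)) i \<le> min (upper u i) (upper v i)" by (rule upper_least) (meson U(3) V(3) min.mono)
qed

text \<open>The numbers \<open>p\<close> and \<open>q\<close> have the same sum as \<open>a\<close>
  and \<open>b\<close>, and neither exceeds the larger of these. Two numbers of given sum have the
  smaller sum of squares the closer they are together; here this is the inequality
  \<open>a * b \<le> p * q\<close>.\<close>

lemma gap_max_min:
 assumes u: "disk_bounded u" "disk_bounded v"
 shows "(gap (\<lambda>x. max (u x) (v x)) i)^2 + (gap (\<lambda>x. min (u x) (v x)) i)^2 \<le> (gap u i)^2 + (gap v i)^2"
proof -
 note mm = upper_max(1-4)[OF u, of i] upper_max(5,6)[OF u]
 define a where "a = gap u i" define b where "b = gap v i"
 define p where "p = max (upper u i) (upper v i) - max (lower u i) (lower v i)"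
 define q where "q = min (upper u i) (upper v i) - min (lower u i) (lower v i)"
 have lu: "lower u i \<le> upper u i" "lower v i \<le> upper v i" using disk_boundedD(5) u by auto
 have ab: "0 \<le> a" "0 \<le> b" using lu by (auto simp: a_def b_def gap_def)
 have pq: "p + q = a + b" "p \<le> max a b" "q \<le> max a b" "0 \<le> p" "0 \<le> q" using lu unfolding p_def q_def a_def b_def gap_def by linarith+
 have "p^2 + q^2 \<le> a^2 + b^2"
 proof -
  have "0 \<le> (max a b - p) * (max a b - q)" using pq by simp
  moreover have "(a - p) * (a - q) = a^2 - a * (p + q) + p * q" "(b - p) * (b - q) = b^2 - b * (p + q) + p * q"
   by (simp_all add: power2_eq_square algebra_simps)
  ultimately have "a * b \<le> p * q" unfolding pq(1) by (auto simp: max_def power2_eq_square algebra_simps split: if_splits)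
  moreover have "(p + q)^2 = (a + b)^2" using pq(1) by simp
  ultimately show ?thesis by (simp add: power2_sum)
 qed
 moreover have "gap (\<lambda>x. max (u x) (v x)) i \<le> p" "gap (\<lambda>x. min (u x) (v x)) i \<le> q"
  using mm unfolding gap_def p_def q_def by linarith+
 then have "(gap (\<lambda>x. max (u x) (v x)) i)^2 \<le> p^2" "(gap (\<lambda>x. min (u x) (v x)) i)^2 \<le> q^2"
  using gap_nonneg mm(5,6) by (auto intro!: power_mono)
 ultimately show ?thesis unfolding a_def b_def by linarith
qed

lemma sob_max: "sob u ==> sob v ==> sob (\<lambda>x. max (u x) (v x))"
 by (rule sob_lipschitz[of u v 1 _ 0]) (auto simp: max_def)

lemma sob_min: "sob u ==> sob v ==> sob (\<lambda>x. min (u x) (v x))"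
 by (rule sob_lipschitz[of u v 1 _ 0]) (auto simp: min_def)

text \<open>At the boundary points accessible by \<open>G\<close> the larger data win the maximum
  and the smaller ones the minimum.\<close>

lemma bval_max_min:
 assumes u: "sob u" "bval u \<alpha>" and v: "sob v" "bval v \<beta>" and G: "almost_every_path ver \<Omega> Q G"
  and le: "\<And>x. x \<in> boundary_accessible \<Omega> G ==> \<beta> x \<le> \<alpha> x"
 shows "bval (\<lambda>x. max (u x) (v x)) \<alpha>" "bval (\<lambda>x. min (u x) (v x)) \<beta>"
proof -
 note mm = upper_max[OF sobD(1)[OF u(1)] sobD(1)[OF v(1)]]
 show "bval (\<lambda>x. max (u x) (v x)) \<alpha>"
 proof (rule bval_combine[OF u(2) v(2) G], intro conjI)
  fix x and F :: "nat filter"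
  assume x: "x \<in> boundary_accessible \<Omega> G" and h: "(upper u \<longlongrightarrow> \<alpha> x) F" "(lower u \<longlongrightarrow> \<alpha> x) F" "(upper v \<longlongrightarrow> \<beta> x) F" "(lower v \<longlongrightarrow> \<beta> x) F"
  have e: "max (\<alpha> x) (\<beta> x) = \<alpha> x" using le[OF x] by simp
  have 1: "((\<lambda>i. max (upper u i) (upper v i)) \<longlongrightarrow> \<alpha> x) F" using tendsto_max[OF h(1,3)] unfolding e .
  have 2: "((\<lambda>i. max (lower u i) (lower v i)) \<longlongrightarrow> \<alpha> x) F" using tendsto_max[OF h(2,4)] unfolding e .
  show "(upper (\<lambda>x. max (u x) (v x)) \<longlongrightarrow> \<alpha> x) F" using 1 unfolding mm(1)[symmetric] .
  show "(lower (\<lambda>x. max (u x) (v x)) \<longlongrightarrow> \<alpha> x) F"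
  proof (rule tendsto_sandwich[OF _ _ 2 1])
   show "eventually (\<lambda>i. lower (\<lambda>x. max (u x) (v x)) i \<le> max (upper u i) (upper v i)) F"
    unfolding mm(1)[symmetric] using disk_boundedD(5)[OF mm(5)] by (intro always_eventually) simp
  qed (use mm(2) in auto)
 qed
 show "bval (\<lambda>x. min (u x) (v x)) \<beta>"
 proof (rule bval_combine[OF u(2) v(2) G], intro conjI)
  fix x and F :: "nat filter"
  assume x: "x \<in> boundary_accessible \<Omega> G" and h: "(upper u \<longlongrightarrow> \<alpha> x) F" "(lower u \<longlongrightarrow> \<alpha> x) F" "(upper v \<longlongrightarrow> \<beta> x) F" "(lower v \<longlongrightarrow> \<beta> x) F"
  have e: "min (\<alpha> x) (\<beta> x) = \<beta> x" using le[OF x] by simp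
  have 1: "((\<lambda>i. min (upper u i) (upper v i)) \<longlongrightarrow> \<beta> x) F" using tendsto_min[OF h(1,3)] unfolding e .
  have 2: "((\<lambda>i. min (lower u i) (lower v i)) \<longlongrightarrow> \<beta> x) F" using tendsto_min[OF h(2,4)] unfolding e .
  show "(lower (\<lambda>x. min (u x) (v x)) \<longlongrightarrow> \<beta> x) F" using 2 unfolding mm(3)[symmetric] .
  show "(upper (\<lambda>x. min (u x) (v x)) \<longlongrightarrow> \<beta> x) F"
  proof (rule tendsto_sandwich[OF _ _ 2 1])
   show "eventually (\<lambda>i. min (lower u i) (lower v i) \<le> upper (\<lambda>x. min (u x) (v x)) i) F"
    unfolding mm(3)[symmetric] using disk_boundedD(5)[OF mm(6)] by (intro always_eventually) simp
  qed (use mm(4) in auto)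
 qed
qed

end

lemma AE_real_obtain:
 assumes "AE x in lborel. P x" "a < (b::real)" obtains x where "a < x" "x < b" "P x"
proof -
 have "\<exists>x. a < x \<and> x < b \<and> P x"
 proof (rule ccontr)
  assume n: "\<not> ?thesis"
  from assms(1) have "AE x in lborel. x \<notin> {a<..<b}" by (rule eventually_mono) (use n in auto)
  then have "{a<..<b} \<in> null_sets lborel" by (subst (asm) AE_iff_null_sets[symmetric]) auto
  then show False using assms(2) by (simp add: null_sets_def)
 qed
 then show ?thesis using that by blast
qed

context carpet_domain
begin

section \<open>Minimizers and the exclusion of shifts\<close>

definition minimizer :: "(complex => real) => (complex => real) => bool" where
 "minimizer u \<alpha> \<longleftrightarrow> sob u \<and> bval u \<alpha> \<and> (\<forall>z. sob z --> bval z \<alpha> --> energy u \<le> energy z)"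

lemma energy_mono:
 assumes u: "sob u" and v: "sob v" and le: "\<And>i. gap u i \<le> gap v i"
 shows "energy u \<le> energy v"
 unfolding energy_def using sobD(4)[OF u] sobD(4)[OF v] le gap_nonneg[OF sobD(1)[OF u]] by (intro suminf_le power_mono) auto

lemma energy_strict_mono:
 assumes u: "sob u" and v: "sob v" and le: "\<And>i. gap u i \<le> gap v i" and j: "gap u j < gap v j"
 shows "energy u < energy v"
proof -
 have "0 < (\<Sum>i. (gap v i)^2 - (gap u i)^2)"
 proof (rule suminf_pos2[where i = j])
  show "summable (\<lambda>i. (gap v i)^2 - (gap u i)^2)" using sobD(4)[OF u] sobD(4)[OF v] by (rule summable_diff[rotated])
  show "0 \<le> (gap v i)^2 - (gap u i)^2" for i using le[of i] gap_nonneg[OF sobD(1)[OF u], of i] by (simp add: power_mono)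
  show "0 < (gap v j)^2 - (gap u j)^2" using j gap_nonneg[OF sobD(1)[OF u], of j] by (simp add: power_strict_mono)
 qed
 also have "\<dots> = energy v - energy u" unfolding energy_def using sobD(4)[OF u] sobD(4)[OF v] by (intro suminf_diff[symmetric])
 finally show ?thesis by simp
qed

text \<open>Maximum and minimum together have at most the energy of \<open>u\<close> and
  \<open>v\<close>. The minimum competes with \<open>v\<close> and so has at least its energy, which
  leaves at most the energy of \<open>u\<close> for the maximum.\<close>

lemma energy_max_le:
 assumes u: "minimizer u \<alpha>" and v: "minimizer v \<beta>" and G: "almost_every_path ver \<Omega> Q G"
  and le: "\<And>x. x \<in> boundary_accessible \<Omega> G ==> \<beta> x \<le> \<alpha> x"
 shows "energy (\<lambda>x. max (u x) (v x)) \<le> energy u"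
proof -
 have su: "sob u" "bval u \<alpha>" and sv: "sob v" "bval v \<beta>" using u v by (auto simp: minimizer_def)
 note sM = sob_max[OF su(1) sv(1)] note sm = sob_min[OF su(1) sv(1)]
 have "energy v \<le> energy (\<lambda>x. min (u x) (v x))" using v sm bval_max_min(2)[OF su sv G le] by (simp add: minimizer_def)
 moreover have "energy (\<lambda>x. max (u x) (v x)) + energy (\<lambda>x. min (u x) (v x)) \<le> energy u + energy v" unfolding energy_def
  using sobD(4)[OF su(1)] sobD(4)[OF sv(1)] sobD(4)[OF sM] sobD(4)[OF sm] gap_max_min[OF sobD(1)[OF su(1)] sobD(1)[OF sv(1)]]
  by (simp add: suminf_add) (intro suminf_le summable_add, auto)
 ultimately show ?thesis by linarith
qed

text \<open>The mean of \<open>u\<close> and \<open>w\<close> lies between them and is a competitor.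
  By the parallelogram identity its energy is below that of \<open>u\<close> by at least a quarter
  of the sum of the squared differences of oscillations.\<close>

lemma gap_eq_of_minimizer:
 assumes u: "minimizer u \<alpha>" and w: "sob w" "bval w \<alpha>" "energy w \<le> energy u" and uw: "\<And>x. x \<in> S ==> u x \<le> w x"
 shows "gap u i = gap w i"
proof -
 have su: "sob u" "bval u \<alpha>" using u by (auto simp: minimizer_def)
 let ?h = "\<lambda>x. (u x + w x) / 2"
 have sh: "sob ?h"
 proof (rule sob_lipschitz[OF su(1) w(1), of 1 _ 0])
  have half: "\<bar>(p + q) / 2\<bar> \<le> \<bar>p\<bar> + \<bar>q\<bar>" for p q :: real
  proof -
   have "\<bar>(p + q) / 2\<bar> \<le> \<bar>p + q\<bar>" by simp
   then show ?thesis using abs_triangle_ineq[of p q] by (rule order_trans)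
  qed
  have eq: "?h x - ?h y = ((u x - u y) + (w x - w y)) / 2" for x y by (simp add: field_simps)
  show "\<bar>?h x - ?h y\<bar> \<le> 1 * (\<bar>u x - u y\<bar> + \<bar>w x - w y\<bar>)" for x y unfolding eq mult_1_left by (rule half)
  show "\<bar>?h x\<bar> \<le> \<bar>u x\<bar> + \<bar>w x\<bar> + 0" for x using half[of "u x" "w x"] by simp
 qed simp
 have bh: "bval ?h \<alpha>" by (rule bval_between[OF su w(1,2) sobD(1)[OF sh]]) (use uw in force)+
 have gh: "gap ?h k \<le> (gap u k + gap w k) / 2" for k
  by (intro gap_leI) (use gap_diff[OF sobD(1)[OF su(1)], of _ k] gap_diff[OF sobD(1)[OF w(1)], of _ k] in \<open>fastforce simp: abs_le_iff field_simps\<close>)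
 have sd: "summable (\<lambda>k. (gap u k - gap w k)^2)"
  using summable_square_add[of "gap u" "\<lambda>k. - gap w k"] sobD(4)[OF su(1)] sobD(4)[OF w(1)] by simp
 have "energy u \<le> energy ?h" using u sh bh by (simp add: minimizer_def)
 also have "\<dots> \<le> (\<Sum>k. ((gap u k)^2 + (gap w k)^2) / 2 - (gap u k - gap w k)^2 / 4)" unfolding energy_def
 proof (intro suminf_le)
  fix k
  have "(gap ?h k)^2 \<le> ((gap u k + gap w k) / 2)^2" using gh[of k] gap_nonneg[OF sobD(1)[OF sh]] by (intro power_mono)
  also have "\<dots> = ((gap u k)^2 + (gap w k)^2) / 2 - (gap u k - gap w k)^2 / 4" by (simp add: power2_eq_square field_simps)
  finally show "(gap ?h k)^2 \<le> ((gap u k)^2 + (gap w k)^2) / 2 - (gap u k - gap w k)^2 / 4" .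
 next
  show "summable (\<lambda>k. (gap ?h k)^2)" using sobD(4)[OF sh] .
  show "summable (\<lambda>k. ((gap u k)^2 + (gap w k)^2) / 2 - (gap u k - gap w k)^2 / 4)"
   using sobD(4)[OF su(1)] sobD(4)[OF w(1)] sd by (intro summable_diff summable_divide summable_add)
 qed
 also have "\<dots> = (energy u + energy w) / 2 - (\<Sum>k. (gap u k - gap w k)^2) / 4"
 proof -
  note s1 = sobD(4)[OF su(1)] and s2 = sobD(4)[OF w(1)]
  have "(\<Sum>k. ((gap u k)^2 + (gap w k)^2) / 2 - (gap u k - gap w k)^2 / 4) =
   (\<Sum>k. ((gap u k)^2 + (gap w k)^2) / 2) - (\<Sum>k. (gap u k - gap w k)^2 / 4)"
   using s1 s2 sd by (intro suminf_diff[symmetric] summable_divide summable_add)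
  also have "(\<Sum>k. ((gap u k)^2 + (gap w k)^2) / 2) = (\<Sum>k. (gap u k)^2 + (gap w k)^2) / 2" using s1 s2 by (intro suminf_divide summable_add)
  also have "(\<Sum>k. (gap u k)^2 + (gap w k)^2) = energy u + energy w" unfolding energy_def using s1 s2 by (intro suminf_add[symmetric])
  also have "(\<Sum>k. (gap u k - gap w k)^2 / 4) = (\<Sum>k. (gap u k - gap w k)^2) / 4" using sd by (intro suminf_divide)
  finally show ?thesis .
 qed
 finally have fin: "energy u \<le> (energy u + energy w) / 2 - (\<Sum>k. (gap u k - gap w k)^2) / 4" .
 have "D \<le> 0" if "e \<le> (e + e') / 2 - D / 4" "e' \<le> e" for e e' D :: real using that by (simp add: field_simps)
 from this[OF fin w(3)] have "(\<Sum>k. (gap u k - gap w k)^2) \<le> 0" .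
 then have "(\<Sum>k. (gap u k - gap w k)^2) = 0" using suminf_nonneg[OF sd] by fastforce
 then have "\<forall>k. (gap u k - gap w k)^2 = 0" using suminf_eq_zero_iff[OF sd] by auto
 then show ?thesis by simp
qed

text \<open>\<open>F a b\<close> moves \<open>a\<close> towards \<open>b\<close>, with factor
  \<open>L\<close> below \<open>C - L\<close> and not at all above \<open>C\<close>. The cap 1 on
  the distance and the bound \<open>s * (1 + L) \<le> 1\<close> make the correction vary no faster
  than \<open>a\<close>, so that \<open>F\<close> is monotone and extrema of the lifted function are
  controlled by those of \<open>u\<close> and \<open>w\<close>. Staying between \<open>a\<close> and
  \<open>b\<close> preserves boundary values, and the Lipschitz bound gives membership in the
  Sobolev space.\<close>

lemma lift_mono:
 fixes a a' b b' L C s :: real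
 defines "F \<equiv> \<lambda>a b. a + s * (min (b - a) 1 * max 0 (min L (C - a)))"
 assumes L: "0 \<le> L" and s: "0 \<le> s" "s * (1 + L) \<le> 1"
 shows "a \<le> a' ==> a' \<le> b' ==> b \<le> b' ==> F a b \<le> F a' b'"
  and "a \<le> b ==> a \<le> F a b \<and> F a b \<le> b"
  and "a \<le> b ==> a' \<le> b' ==> \<bar>F a b - F a' b'\<bar> \<le> 2 * (\<bar>a - a'\<bar> + \<bar>b - b'\<bar>)"
proof -
 define G where "G a = max 0 (min L (C - a))" for a
 define p where "p a b = min (b - a) (1::real)" for a b
 have F: "F a b = a + s * (p a b * G a)" for a b by (simp add: F_def p_def G_def)
 have G: "0 \<le> G a" "G a \<le> L" for a using L by (auto simp: G_def)
 have Gd: "G a' \<le> G a" "G a - G a' \<le> a' - a" if "a \<le> a'" for a a' using that L by (auto simp: G_def)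
 have Gl: "\<bar>G a - G a'\<bar> \<le> \<bar>a - a'\<bar>" for a a' using L by (auto simp: G_def)
 have p: "p a b \<le> 1" "p a b \<le> b - a" "a \<le> b ==> 0 \<le> p a b" for a b by (auto simp: p_def)
 have pl: "\<bar>p a b - p a' b'\<bar> \<le> \<bar>a - a'\<bar> + \<bar>b - b'\<bar>" for a a' b b' by (auto simp: p_def)
 have "s + s * L \<le> 1" using s(2) by (simp add: distrib_left)
 then have sL: "s * L \<le> 1" "s \<le> 1" using s(1) mult_nonneg_nonneg[OF s(1) L] by linarith+
 { assume h: "a \<le> a'" "a' \<le> b'" "b \<le> b'"
  have "p a b * G a \<le> p a b' * G a" using h(3) G(1)[of a] by (intro mult_right_mono) (auto simp: p_def)
  moreover have "p a b' * G a - p a' b' * G a' \<le> (1 + L) * (a' - a)"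
  proof -
   have "p a b' * G a - p a' b' * G a' = p a b' * (G a - G a') + (p a b' - p a' b') * G a'" by (simp add: algebra_simps)
   also have "\<dots> \<le> 1 * (a' - a) + (a' - a) * L"
   proof (intro add_mono mult_mono)
    show "p a b' - p a' b' \<le> a' - a" using h by (auto simp: p_def)
    show "0 \<le> a' - a" "0 \<le> G a - G a'" using h Gd[OF h(1)] by auto
    show "G a - G a' \<le> a' - a" using Gd[OF h(1)] by simp
   qed (use p G in auto)
   finally show ?thesis by (simp add: algebra_simps)
  qed
  ultimately have "p a b * G a - p a' b' * G a' \<le> (1 + L) * (a' - a)" by linarith
  then have "s * (p a b * G a - p a' b' * G a') \<le> s * ((1 + L) * (a' - a))" using s(1) by (rule mult_left_mono)
  also have "\<dots> = (s * (1 + L)) * (a' - a)" by simp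
  also have "\<dots> \<le> 1 * (a' - a)" using s h by (intro mult_right_mono) auto
  finally show "F a b \<le> F a' b'" by (simp add: F algebra_simps) }
 { assume h: "a \<le> b"
  have "0 \<le> s * (p a b * G a)" using s p(3)[OF h] G(1)[of a] by (intro mult_nonneg_nonneg)
  moreover have "s * (p a b * G a) \<le> b - a"
  proof -
   have "s * (p a b * G a) = (s * G a) * p a b" by simp
   also have "\<dots> \<le> (s * L) * p a b" using s(1) G(2)[of a] p(3)[OF h] by (intro mult_right_mono mult_left_mono)
   also have "\<dots> \<le> 1 * p a b" using sL p(3)[OF h] by (intro mult_right_mono)
   finally show ?thesis using p(2)[of a b] by simp
  qed
  ultimately show "a \<le> F a b \<and> F a b \<le> b" by (simp add: F) }
 { assume h: "a \<le> b" "a' \<le> b'"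
  have "p a b * G a - p a' b' * G a' = p a b * (G a - G a') + (p a b - p a' b') * G a'" by (simp add: algebra_simps)
  then have "\<bar>p a b * G a - p a' b' * G a'\<bar> \<le> \<bar>p a b\<bar> * \<bar>G a - G a'\<bar> + \<bar>p a b - p a' b'\<bar> * \<bar>G a'\<bar>"
   using abs_triangle_ineq by (simp add: abs_mult[symmetric])
  also have "\<dots> \<le> 1 * \<bar>a - a'\<bar> + (\<bar>a - a'\<bar> + \<bar>b - b'\<bar>) * L"
   using p(1,3) h G Gl pl by (intro add_mono mult_mono) auto
  also have "\<dots> \<le> (1 + L) * (\<bar>a - a'\<bar> + \<bar>b - b'\<bar>)" using L by (simp add: algebra_simps)
  finally have "s * \<bar>p a b * G a - p a' b' * G a'\<bar> \<le> s * ((1 + L) * (\<bar>a - a'\<bar> + \<bar>b - b'\<bar>))" using s(1) by (rule mult_left_mono)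
  also have "\<dots> = (s * (1 + L)) * (\<bar>a - a'\<bar> + \<bar>b - b'\<bar>)" by simp
  also have "\<dots> \<le> 1 * (\<bar>a - a'\<bar> + \<bar>b - b'\<bar>)" using s by (intro mult_right_mono) auto
  finally have 1: "\<bar>s * (p a b * G a - p a' b' * G a')\<bar> \<le> \<bar>a - a'\<bar> + \<bar>b - b'\<bar>" using s(1) by (simp add: abs_mult)
  have "F a b - F a' b' = (a - a') + s * (p a b * G a - p a' b' * G a')" by (simp add: F algebra_simps)
  then have "\<bar>F a b - F a' b'\<bar> \<le> \<bar>a - a'\<bar> + \<bar>s * (p a b * G a - p a' b' * G a')\<bar>" by (metis abs_triangle_ineq)
  also have "\<dots> \<le> \<bar>a - a'\<bar> + (\<bar>a - a'\<bar> + \<bar>b - b'\<bar>)" using 1 by (rule add_left_mono)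
  also have "\<dots> \<le> 2 * (\<bar>a - a'\<bar> + \<bar>b - b'\<bar>)" by simp
  finally show "\<bar>F a b - F a' b'\<bar> \<le> 2 * (\<bar>a - a'\<bar> + \<bar>b - b'\<bar>)" . }
qed

text \<open>On each disk both extrema of \<open>w\<close> arise from those of \<open>u\<close> by
  the same shift \<open>d i\<close>. Lifting then changes the oscillation only through the factor
  depending on the level, which is at least as large at the infimum as at the supremum. So no
  oscillation grows, and that of \<open>Q j\<close> strictly falls if its shift is not zero.\<close>

lemma shift_or_gap_zero:
 assumes u: "minimizer u \<alpha>" and w: "sob w" "bval w \<alpha>" "energy w \<le> energy u" and uw: "\<And>x. x \<in> S ==> u x \<le> w x"
  and gj: "gap u j \<noteq> 0"
 shows "upper w j = upper u j"
proof (rule ccontr)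
 assume ne: "upper w j \<noteq> upper u j"
 have su: "sob u" "bval u \<alpha>" using u by (auto simp: minimizer_def)
 note du = sobD(1)[OF su(1)] note dw = sobD(1)[OF w(1)]
 have geq: "gap u i = gap w i" for i by (rule gap_eq_of_minimizer[OF u w uw])
 define d where "d i = upper w i - upper u i" for i
 have d0: "0 \<le> d i" for i using upper_mono[OF dw, of u i] uw by (simp add: d_def)
 have low: "lower w i = lower u i + d i" for i using geq[of i] by (simp add: gap_def d_def)
 have dj: "d j > 0" using d0[of j] ne by (simp add: d_def)
 \<comment> \<open>The window of levels from \<open>C - L\<close> to \<open>C\<close> runs exactly
   from \<open>lower u j\<close> to \<open>upper u j\<close>, so on this disk the two level factors
   differ by the full \<open>L\<close>.\<close>
 define L where "L = gap u j"
 have L: "L > 0" using gj gap_nonneg[OF du, of j] by (simp add: L_def)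
 define C where "C = upper u j"
 define s where "s = 1 / (1 + L)"
 have s: "0 < s" "s * (1 + L) \<le> 1" using L by (auto simp: s_def)
 define F where "F a b = a + s * (min (b - a) 1 * max 0 (min L (C - a)))" for a b
 note F = lift_mono[where C = C, OF less_imp_le[OF L] less_imp_le[OF s(1)] s(2), folded F_def]
 define z where "z x = F (u x) (w x)" for x
 have uz: "u x \<le> z x" "z x \<le> w x" if "x \<in> S" for x using F(2)[OF uw[OF that]] by (auto simp: z_def)
 have sz: "sob z"
 proof (rule sob_lipschitz[OF su(1) w(1), of 2 _ 0])
  show "\<bar>z x - z y\<bar> \<le> 2 * (\<bar>u x - u y\<bar> + \<bar>w x - w y\<bar>)" if "x \<in> S" "y \<in> S" for x y
   unfolding z_def using F(3)[OF uw[OF that(1)] uw[OF that(2)]] .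
  show "\<bar>z x\<bar> \<le> \<bar>u x\<bar> + \<bar>w x\<bar> + 0" if "x \<in> S" for x using uz[OF that] by linarith
 qed simp
 have bz: "bval z \<alpha>" by (rule bval_between[OF su w(1,2) sobD(1)[OF sz] uz])
 have gz: "gap z i \<le> F (upper u i) (upper w i) - F (lower u i) (lower w i)" for i
 proof (rule gap_leI)
  fix x y assume xy: "x \<in> frontier (Q i)" "y \<in> frontier (Q i)"
  have xS: "x \<in> S" "y \<in> S" using xy frontier_disk_subset by auto
  have "z x \<le> F (upper u i) (upper w i)" unfolding z_def
   using disk_boundedD(3)[OF du xy(1)] disk_boundedD(3)[OF dw xy(1)] d0[of i] by (intro F(1)) (auto simp: d_def)
  moreover have "F (lower u i) (lower w i) \<le> z y" unfolding z_def
   using disk_boundedD(4)[OF du xy(2)] disk_boundedD(4)[OF dw xy(2)] uw[OF xS(2)] by (intro F(1))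
  ultimately show "z x - z y \<le> F (upper u i) (upper w i) - F (lower u i) (lower w i)" by linarith
 qed
 have Fd: "F (upper u i) (upper w i) - F (lower u i) (lower w i) =
   gap u i - s * min (d i) 1 * (max 0 (min L (C - lower u i)) - max 0 (min L (C - upper u i)))" for i
  unfolding F_def low by (simp add: d_def gap_def algebra_simps)
 have "gap z i \<le> gap u i" for i
 proof -
  have "0 \<le> s * min (d i) 1 * (max 0 (min L (C - lower u i)) - max 0 (min L (C - upper u i)))"
   using s(1) d0[of i] disk_boundedD(5)[OF du, of i] by (intro mult_nonneg_nonneg) auto
  then show ?thesis using gz[of i] Fd[of i] by linarith
 qed
 moreover have "gap z j < gap u j"
 proof -
  have "C - lower u j = L" "C - upper u j = 0" by (simp_all add: C_def L_def gap_def)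
  then have "max 0 (min L (C - lower u j)) - max 0 (min L (C - upper u j)) = L" using L by simp
  moreover have "0 < s * min (d j) 1 * L" using s(1) dj L by simp
  ultimately show ?thesis using gz[of j] Fd[of j] by simp
 qed
 ultimately have "energy z < energy u" by (rule energy_strict_mono[OF sz su(1)])
 moreover have "energy u \<le> energy z" using u sz bz by (simp add: minimizer_def)
 ultimately show False by simp
qed

lemma AE_finite_line:
 assumes f: "(\<Sum>i. (\<rho> i)^2) < \<infinity>"
 shows "AE X in lborel. \<forall>s t. line b X ` {s..t} \<subseteq> \<Omega> --> s \<le> t --> meet_sum Q \<rho> (line b X ` {s..t}) < \<infinity>"
 using AE_line_not_exceptional[OF exceptional_infinite_sum[OF f], of b]
proof eventually_elim
 case (elim X)
 show ?case
 proof (intro allI impI)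
  fix s t assume st: "line b X ` {s..t} \<subseteq> \<Omega>" "s \<le> t"
  have "({s..t}, line b X) \<in> paths_in \<Omega>" using st by (auto simp: paths_in_def is_cpath_def im_def continuous_on_line is_interval_cc)
  then have "({s..t}, line b X) \<notin> {p. meet_sum Q \<rho> (im p) = \<infinity>}" using elim by blast
  then show "meet_sum Q \<rho> (line b X ` {s..t}) < \<infinity>" by (simp add: im_def less_top)
 qed
qed

lemma vertical_exit:
 assumes "Complex X y0 \<in> \<Omega>"
 shows "\<exists>y1>y0. line True X ` {y0..<y1} \<subseteq> \<Omega> \<and> line True X y1 \<in> frontier \<Omega>"
proof -
 obtain R where R: "R > 0" "\<Omega> \<subseteq> square 0 R" using domain_bound by blast
 define T where "T = {y0..} \<inter> line True X -` (- \<Omega>)"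
 have cl: "closed T" unfolding T_def using open_domain by (intro continuous_closed_preimage continuous_on_line) auto
 have "line True X (max y0 R) \<notin> square 0 R" by (auto simp: line_def square_def sup_norm_def)
 then have "max y0 R \<in> T" using R by (auto simp: T_def)
 then have "T \<noteq> {}" by blast
 moreover have "bdd_below T" by (rule bdd_belowI[of _ y0]) (simp add: T_def)
 ultimately have T: "T \<noteq> {}" "bdd_below T" by blast+
 define y1 where "y1 = Inf T"
 have y1: "y1 \<in> T" unfolding y1_def using T cl by (intro closed_contains_Inf)
 have "y1 \<noteq> y0" using y1 assms by (auto simp: T_def line_def)
 then have lt: "y0 < y1" using y1 by (simp add: T_def)
 have sub: "line True X ` {y0..<y1} \<subseteq> \<Omega>"
 proof
  fix p assume "p \<in> line True X ` {y0..<y1}"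
  then obtain y where y: "y0 \<le> y" "y < y1" "p = line True X y" by auto
  have "y \<notin> T" using y(2) cInf_lower[OF _ T(2), of y] unfolding y1_def by fastforce
  then show "p \<in> \<Omega>" using y by (auto simp: T_def)
 qed
 have "line True X y1 \<in> closure \<Omega>"
 proof -
  have "y1 \<in> closure {y0..<y1}" using lt by simp
  then have "line True X y1 \<in> line True X ` closure {y0..<y1}" by blast
  also have "\<dots> \<subseteq> closure (line True X ` {y0..<y1})" by (intro image_closure_subset continuous_on_line closure_subset) auto
  also have "\<dots> \<subseteq> closure \<Omega>" using sub by (rule closure_mono)
  finally show ?thesis .
 qed
 then have "line True X y1 \<in> frontier \<Omega>" using y1 open_domain by (simp add: T_def frontier_def interior_open)
 then show ?thesis using lt sub by blast
qed

text \<open>A disk with a shift \<open>T\<close> has no oscillation, so \<open>u\<close> and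
  \<open>w\<close> are constants \<open>c\<close> and \<open>c + T\<close> on its circle. On a
  generic line from there, the first disk with oscillation would have no shift and would still see
  values close to both constants, which forces an oscillation of at least \<open>T / 2\<close>.
  Finitely many disks have that much. Off their closures the two constants spread over a connected
  set and reach the boundary, where they would have to coincide.\<close>

lemma shift_zero:
 assumes u: "minimizer u \<alpha>" and w: "sob w" "bval w \<alpha>" "energy w \<le> energy u" and uw: "\<And>x. x \<in> S ==> u x \<le> w x"
 shows "upper w j = upper u j"
proof (rule ccontr)
 assume ne: "upper w j \<noteq> upper u j"
 have su: "sob u" "bval u \<alpha>" using u by (auto simp: minimizer_def)
 note du = sobD(1)[OF su(1)] note dw = sobD(1)[OF w(1)]
 have geq: "gap u i = gap w i" for i by (rule gap_eq_of_minimizer[OF u w uw])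
 then have roeq: "rosc w = rosc u" by (simp add: fun_eq_iff rosc_gap)
 have sh: "upper w i = upper u i" if "gap u i \<noteq> 0" for i by (rule shift_or_gap_zero[OF u w uw that])
 define T where "T = upper w j - upper u j"
 define c where "c = upper u j"
 have T: "T > 0" using ne upper_mono[OF dw, of u j] uw by (simp add: T_def)
 have gj: "gap u j = 0" using sh ne by blast
 define Bad where "Bad = {k. T / 2 \<le> gap u k}"
 have fB: "finite Bad"
 proof -
  have "(\<lambda>k. (gap u k)^2) \<longlonglongrightarrow> 0" using sobD(4)[OF su(1)] by (rule summable_LIMSEQ_zero)
  then have "eventually (\<lambda>k. (gap u k)^2 < (T/2)^2) sequentially" using order_tendstoD(2)[of "\<lambda>k. (gap u k)^2" 0 sequentially "(T/2)^2"] T by simp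
  then obtain n where n: "\<And>k. k \<ge> n ==> (gap u k)^2 < (T/2)^2" by (auto simp: eventually_sequentially)
  have "Bad \<subseteq> {..<n}"
  proof
   fix k assume "k \<in> Bad"
   then have "(T/2)^2 \<le> (gap u k)^2" using T unfolding Bad_def by (intro power_mono) auto
   then show "k \<in> {..<n}" using n[of k] by (cases "k < n") auto
  qed
  then show ?thesis by (rule finite_subset) simp
 qed
 \<comment> \<open>The closures removed are finitely many disjoint compact sets with connected
   complements, so the domain stays connected.\<close>
 define V where "V = \<Omega> - (\<Union>k\<in>Bad. closure (Q k))"
 have oV: "open V" unfolding V_def using open_domain fB by (intro open_Diff closed_UN) auto
 have cV: "connected V" unfolding V_def
 proof (rule connected_complement_finite_Union[OF fB open_domain connected_domain])
  show "compact (closure (Q k)) \<and> connected (- closure (Q k)) \<and> closure (Q k) \<subseteq> \<Omega>" for k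
   using compact_closure_disk closure_disk_subset jordan_sideD(4)[OF disk_sides(2)] by blast
 qed (rule disk_closures_disjoint)
 have nB: "k \<notin> Bad" if "Q k \<inter> V \<noteq> {}" for k using that closure_subset[of "Q k"] unfolding V_def by blast
 define state where "state k \<longleftrightarrow> gap u k = 0 \<and> upper u k = c \<and> upper w k = c + T" for k
 have sj: "state j" using gj by (simp add: state_def c_def T_def)
 define generic where "generic b X \<longleftrightarrow> good_line u b X \<and> good_line w b X \<and>
  (\<forall>s t. line b X ` {s..t} \<subseteq> \<Omega> --> s \<le> t --> meet_sum Q (rosc u) (line b X ` {s..t}) < \<infinity>)" for b X
 have AEg: "AE X in lborel. generic b X" for b
  using AE_good_line[OF sobD(2)[OF su(1)], of b] AE_good_line[OF sobD(2)[OF w(1)], of b] AE_finite_line[OF sobD(3)[OF su(1)], of b]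
  unfolding generic_def by eventually_elim simp
 \<comment> \<open>The state of a point in place of a disk, so that it can be carried along a line
   through points of the carpet.\<close>
 define pst where "pst z \<longleftrightarrow> disk_value u z = c \<and> disk_value w z = c + T \<and> (\<forall>i. z \<in> Q i --> gap u i = 0)" for z
 have pst_disk: "pst z \<longleftrightarrow> state k" if "z \<in> Q k" for z k
  using that disk_unique[of z] by (auto simp: pst_def state_def disk_value_disk)
 have propagate: "pst (line b X r)"
  if gen: "generic b X" and st: "s \<le> t" "line b X ` {s..t} \<subseteq> V" and a: "a \<in> {s..t}" "pst (line b X a)" and r: "r \<in> {s..t}"
  for b X s t a r
 proof -
  let ?L = "line b X ` {s..t}"
  have LO: "?L \<subseteq> \<Omega>" using st(2) by (auto simp: V_def)
  have gl: "good_line u b X" "good_line w b X" "meet_sum Q (rosc u) ?L < \<infinity>" using gen st(1) LO by (auto simp: generic_def)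
  have zero: "gap u k0 = 0" if k0: "Q k0 \<inter> ?L \<noteq> {}" for k0
  proof (rule ccontr)
   assume gk0: "gap u k0 \<noteq> 0"
   have T12: "T / 12 > 0" using T by simp
   obtain n where n: "meet_sum Q (\<lambda>i. if i < n then 0 else rosc u i) ?L < ennreal (T / 12)" using meet_sum_tail[OF gl(3) T12] by blast
   \<comment> \<open>The disks with oscillation that are too heavy for the tail, and
     \<open>k0\<close>, which keeps \<open>K\<close> from being empty.\<close>
   define F where "F = {k. k < n \<and> gap u k \<noteq> 0} \<union> {k0}"
   have fF: "finite F" by (simp add: F_def)
   have gF: "gap u k \<noteq> 0" if "k \<in> F" for k using that gk0 by (auto simp: F_def)
   define K where "K = {s..t} \<inter> line b X -` (\<Union>k\<in>F. closure (Q k))"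
   have "closed K" unfolding K_def using fF by (intro continuous_closed_preimage continuous_on_line closed_UN) auto
   then have cK: "compact K" unfolding K_def by (metis Int_lower1 bounded_closed_interval bounded_subset compact_eq_bounded_closed)
   have "K \<noteq> {}" using k0 closure_subset[of "Q k0"] by (auto simp: K_def F_def)
   \<comment> \<open>The time in \<open>K\<close> nearest to \<open>a\<close>. The segment between
     the two meets no disk of \<open>F\<close>, so its sum is below \<open>T / 12\<close>.\<close>
   obtain e where e: "e \<in> K" and emin: "\<And>y. y \<in> K ==> \<bar>e - a\<bar> \<le> \<bar>y - a\<bar>"
   proof -
    have "continuous_on K (\<lambda>y. \<bar>y - a\<bar>)" by (intro continuous_intros)
    then show thesis using continuous_attains_inf[OF cK \<open>K \<noteq> {}\<close>, of "\<lambda>y. \<bar>y - a\<bar>"] that by blast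
   qed
   obtain k where k: "k \<in> F" "line b X e \<in> closure (Q k)" using e by (auto simp: K_def)
   define J where "J = {min a e..max a e}"
   have Jst: "J \<subseteq> {s..t}" using a(1) e by (auto simp: J_def K_def)
   have Jfree: "y \<notin> K" if "y \<in> J" "y \<noteq> e" for y
   proof
    assume "y \<in> K"
    then have "\<bar>e - a\<bar> \<le> \<bar>y - a\<bar>" by (rule emin)
    then show False using that by (auto simp: J_def min_def max_def split: if_splits)
   qed
   have notin: "line b X y \<notin> Q k'" if "y \<in> J" "k' \<in> F" for y k'
   proof
    assume y: "line b X y \<in> Q k'"
    have ak: "line b X a \<notin> Q k'" using a(2) gF[OF that(2)] by (auto simp: pst_def)
    have con: "connected (line b X ` J)" unfolding J_def by (intro connected_continuous_image continuous_on_line) simp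
    have "line b X a \<in> line b X ` J" by (intro imageI) (simp add: J_def)
    then have ns: "\<not> line b X ` J \<subseteq> Q k'" using ak by blast
    have me: "line b X ` J \<inter> Q k' \<noteq> {}" using y that(1) by blast
    obtain p where p: "p \<in> line b X ` J" "p \<in> frontier (Q k')" using connected_meets_frontier[OF con me ns] by blast
    then obtain q where q: "q \<in> J" "line b X q \<in> frontier (Q k')" by blast
    have "q \<in> K" using q Jst that(2) by (auto simp: K_def frontier_def)
    then have "q = e" using Jfree q(1) by blast
    then have eF: "line b X e \<in> frontier (Q k')" using q by simp
    have "y \<in> K" using y Jst that closure_subset[of "Q k'"] by (auto simp: K_def)
    then have "y = e" using Jfree that(1) by blast
    then show False using y eF frontier_not_in_disk by blast
   qed
   have eJ: "e \<in> J" "a \<in> J" by (auto simp: J_def)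
   have ef: "line b X e \<in> frontier (Q k)" using k notin[OF eJ(1) k(1)] by (simp add: closure_disk)
   then have eS: "line b X e \<in> S" using frontier_disk_subset by blast
   have small: "meet_sum Q (rosc u) (line b X ` J) < ennreal (T / 12)"
   proof -
    have "meet_sum Q (rosc u) (line b X ` J) \<le> meet_sum Q (\<lambda>i. if i < n then 0 else rosc u i) (line b X ` J)" unfolding meet_sum_def
    proof (intro suminf_le summableI)
     fix i
     show "(if Q i \<inter> line b X ` J \<noteq> {} then rosc u i else 0) \<le> (if Q i \<inter> line b X ` J \<noteq> {} then if i < n then 0 else rosc u i else 0)"
      using notin[of _ i] by (cases "gap u i = 0") (auto simp: F_def rosc_gap)
    qed
    also have "\<dots> \<le> meet_sum Q (\<lambda>i. if i < n then 0 else rosc u i) ?L" using Jst by (intro meet_sum_mono_set) auto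
    finally show ?thesis using n by simp
   qed
   \<comment> \<open>Three sums below \<open>T / 12\<close> move each value by less than
     \<open>T / 4\<close>; at the point reached, \<open>u\<close> and \<open>w\<close> still differ
     by more than \<open>T / 2\<close>.\<close>
   have dv: "\<bar>disk_value f (line b X a) - disk_value f (line b X e)\<bar> < T / 4"
    if f: "disk_bounded f" "good_line f b X" "rosc f = rosc u" for f
   proof -
    have "ennreal \<bar>disk_value f (line b X a) - disk_value f (line b X e)\<bar> \<le> 3 * meet_sum Q (rosc f) (line b X ` J)" unfolding J_def
    proof (rule good_line_disk_value[OF f(1,2)])
     show "line b X ` {min a e..max a e} \<subseteq> \<Omega>" using Jst LO unfolding J_def by blast
    qed auto
    also have "\<dots> < 3 * ennreal (T / 12)" unfolding f(3) using small by (intro ennreal_mult_strict_left_mono) auto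
    also have "\<dots> = ennreal (T / 4)" using T by (simp add: ennreal_mult[symmetric] flip: ennreal_numeral)
    finally show ?thesis by (subst (asm) ennreal_less_iff) auto
   qed
   have "\<bar>c - u (line b X e)\<bar> < T/4" "\<bar>c + T - w (line b X e)\<bar> < T/4"
    using dv[OF du gl(1)] dv[OF dw gl(2) roeq] a(2) disk_value_carpet[OF eS] by (auto simp: pst_def)
   moreover have "w (line b X e) \<le> upper u k" using disk_boundedD(3)[OF dw ef] sh[OF gF[OF k(1)]] by simp
   moreover have "lower u k \<le> u (line b X e)" using disk_boundedD(4)[OF du ef] .
   ultimately have "T / 2 \<le> gap u k" unfolding gap_def by linarith
   then have "k \<in> Bad" by (simp add: Bad_def)
   then have "line b X e \<notin> V" using k(2) by (auto simp: V_def)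
   moreover have "e \<in> {s..t}" using e by (simp add: K_def)
   ultimately show False using st(2) by blast
  qed
  \<comment> \<open>With no oscillation left on the segment, both disk values are constant along
    it.\<close>
  have z0: "meet_sum Q (rosc u) ?L = 0"
  proof -
   have "(if Q i \<inter> ?L \<noteq> {} then rosc u i else 0) = 0" for i using zero[of i] by (simp add: rosc_gap)
   then show ?thesis unfolding meet_sum_def by (simp only: suminf_zero)
  qed
  have "disk_value f (line b X r) = disk_value f (line b X a)" if "disk_bounded f" "good_line f b X" "rosc f = rosc u" for f
  proof -
   have "ennreal \<bar>disk_value f (line b X r) - disk_value f (line b X a)\<bar> \<le> 3 * meet_sum Q (rosc f) ?L"
    using that st(1) LO r a(1) by (intro good_line_disk_value)
   then have "ennreal \<bar>disk_value f (line b X r) - disk_value f (line b X a)\<bar> = 0" unfolding that(3) z0 by simp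
   then show ?thesis by (simp add: ennreal_eq_0_iff)
  qed
  from this[OF du gl(1)] this[OF dw gl(2) roeq] show ?thesis using a(2) zero r unfolding pst_def by (metis (no_types, lifting) disjoint_iff imageI)
 qed
 have local_state: "state k'"
  if sq: "square z0 d \<subseteq> V" and k: "Q k \<inter> square z0 d \<noteq> {}" "state k" and k': "Q k' \<inter> square z0 d \<noteq> {}" for z0 d k k'
 proof -
  obtain z1 where z1: "z1 \<in> Q k \<inter> square z0 d" using k(1) by blast
  obtain z2 where z2: "z2 \<in> Q k' \<inter> square z0 d" using k' by blast
  obtain r1 where r1: "r1 > 0" "square z1 r1 \<subseteq> Q k \<inter> square z0 d" using open_contains_square[of "Q k \<inter> square z0 d" z1] z1 open_Int[OF open_disk[of k] open_square[of z0 d]] by blast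
  obtain r2 where r2: "r2 > 0" "square z2 r2 \<subseteq> Q k' \<inter> square z0 d" using open_contains_square[of "Q k' \<inter> square z0 d" z2] z2 open_Int[OF open_disk[of k'] open_square[of z0 d]] by blast
  \<comment> \<open>A route with one corner: a generic vertical line through the first disk and a
    generic horizontal line through the second, meeting at \<open>Complex X Y\<close> inside the
    same square.\<close>
  obtain X where X: "Re z1 - r1 < X" "X < Re z1 + r1" "generic True X" using AE_real_obtain[OF AEg[of True], of "Re z1 - r1" "Re z1 + r1"] r1 by auto
  obtain Y where Y: "Im z2 - r2 < Y" "Y < Im z2 + r2" "generic False Y" using AE_real_obtain[OF AEg[of False], of "Im z2 - r2" "Im z2 + r2"] r2 by auto
  have p1: "Complex X (Im z1) \<in> Q k \<inter> square z0 d" using r1 X by (intro subsetD[OF r1(2)]) (simp add: square_def sup_norm_def abs_less_iff)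
  have p2: "Complex (Re z2) Y \<in> Q k' \<inter> square z0 d" using r2 Y by (intro subsetD[OF r2(2)]) (simp add: square_def sup_norm_def abs_less_iff)
  have seg1: "line True X ` {min (Im z1) Y..max (Im z1) Y} \<subseteq> V"
  proof -
   have "line True X y \<in> square z0 d" if "y \<in> {min (Im z1) Y..max (Im z1) Y}" for y
    using p1 p2 that by (auto simp: line_def square_def sup_norm_def abs_less_iff min_def max_def split: if_splits)
   then show ?thesis using sq by blast
  qed
  have seg2: "line False Y ` {min (Re z2) X..max (Re z2) X} \<subseteq> V"
  proof -
   have "line False Y y \<in> square z0 d" if "y \<in> {min (Re z2) X..max (Re z2) X}" for y
    using p1 p2 that by (auto simp: line_def square_def sup_norm_def abs_less_iff min_def max_def split: if_splits)
   then show ?thesis using sq by blast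
  qed
  have "pst (line True X (Im z1))" using pst_disk[of "Complex X (Im z1)" k] p1 k(2) by (simp add: line_def)
  then have "pst (line True X Y)" by (rule propagate[OF X(3) _ seg1, rotated 2]) auto
  then have "pst (line False Y X)" by (simp add: line_def)
  then have "pst (line False Y (Re z2))" by (rule propagate[OF Y(3) _ seg2, rotated 2]) auto
  then show ?thesis using pst_disk[of "Complex (Re z2) Y" k'] p2 by (simp add: line_def)
 qed
 \<comment> \<open>A locally constant property on the connected set \<open>V\<close>. Any two
   overlapping squares share a disk, by density of the disks, and this makes neighbouring points
   agree.\<close>
 define N where "N z \<longleftrightarrow> (\<exists>d>0. square z d \<subseteq> V \<and> (\<forall>k. Q k \<inter> square z d \<noteq> {} --> state k))" for z
 have Nloc: "\<exists>U. open U \<and> z \<in> U \<and> (\<forall>y\<in>U. N z \<longleftrightarrow> N y)" if z: "z \<in> V" for z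
 proof -
  obtain d where d: "d > 0" "square z d \<subseteq> V" using open_contains_square[OF oV z] by blast
  have some: "N y ==> \<forall>k. Q k \<inter> square z d \<noteq> {} --> state k" if y: "y \<in> square z d" for y
  proof -
   assume "N y"
   then obtain \<epsilon> where \<epsilon>: "\<epsilon> > 0" "square y \<epsilon> \<subseteq> V" "\<And>k. Q k \<inter> square y \<epsilon> \<noteq> {} ==> state k" by (auto simp: N_def)
   have W: "open (square y \<epsilon> \<inter> square z d)" "square y \<epsilon> \<inter> square z d \<subseteq> \<Omega>" "square y \<epsilon> \<inter> square z d \<noteq> {}"
    using \<epsilon> y centre_in_square[OF \<epsilon>(1), of y] by (auto simp: V_def)
   obtain k where "Q k \<inter> (square y \<epsilon> \<inter> square z d) \<noteq> {}" using disk_dense[OF W] by blast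
   then have "state k" "Q k \<inter> square z d \<noteq> {}" using \<epsilon>(3)[of k] by blast+
   then show "\<forall>k. Q k \<inter> square z d \<noteq> {} --> state k" using local_state[OF d(2)] by blast
  qed
  have all: "N y" if y: "y \<in> square z d" and st: "\<forall>k. Q k \<inter> square z d \<noteq> {} --> state k" for y
  proof -
   obtain \<epsilon> where "\<epsilon> > 0" "square y \<epsilon> \<subseteq> square z d" using open_contains_square[of "square z d" y] y by auto
   then show ?thesis unfolding N_def using d(2) st by blast
  qed
  have "N z \<longleftrightarrow> N y" if "y \<in> square z d" for y
   using some[OF that] all[OF that] some[OF centre_in_square[OF d(1)]] all[OF centre_in_square[OF d(1)]] by blast
  then show ?thesis using centre_in_square[OF d(1)] by (intro exI[of _ "square z d"]) auto
 qed
 have Nconst: "N a \<longleftrightarrow> N b" if "a \<in> V" "b \<in> V" for a b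
 proof (rule connected_equivalence_relation[OF cV that])
  fix a assume "a \<in> V"
  then obtain U where U: "open U" "a \<in> U" "\<forall>y\<in>U. N a \<longleftrightarrow> N y" using Nloc by blast
  then show "\<exists>T. openin (top_of_set V) T \<and> a \<in> T \<and> (\<forall>x\<in>T. N a \<longleftrightarrow> N x)"
   using \<open>a \<in> V\<close> openin_open_Int[OF U(1), of V] by (intro exI[of _ "V \<inter> U"]) blast
 qed auto
 have jV: "Q j \<subseteq> V"
 proof -
  have jB: "j \<notin> Bad" using gj T by (simp add: Bad_def)
  then have "Q j \<inter> closure (Q k) = {}" if "k \<in> Bad" for k using disk_closures_disjoint[of j k] closure_subset[of "Q j"] that by blast
  then show ?thesis using disk_subset[of j] by (auto simp: V_def)
 qed
 obtain zj where zj: "zj \<in> Q j" using disk_nonempty[of j] by blast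
 have "N zj"
 proof -
  obtain \<epsilon> where \<epsilon>: "\<epsilon> > 0" "square zj \<epsilon> \<subseteq> Q j" using open_contains_square[OF open_disk zj] by blast
  have "state k" if "Q k \<inter> square zj \<epsilon> \<noteq> {}" for k
  proof -
   have "k = j" using that \<epsilon>(2) disk_disjoint[of k j] by blast
   then show ?thesis using sj by simp
  qed
  then show ?thesis unfolding N_def using \<epsilon> jV by blast
 qed
 then have NV: "N z" if "z \<in> V" for z using Nconst[of zj z] zj jV that by blast
 have all_state: "state k" if "k \<notin> Bad" for k
 proof -
  obtain z where z: "z \<in> Q k" using disk_nonempty[of k] by blast
  have "closure (Q k) \<inter> closure (Q m) = {}" if "m \<in> Bad" for m using disk_closures_disjoint[of k m] that \<open>k \<notin> Bad\<close> by blast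
  then have "z \<in> V" using z disk_subset[of k] closure_subset[of "Q k"] by (auto simp: V_def)
  then obtain d where d: "d > 0" "\<forall>m. Q m \<inter> square z d \<noteq> {} --> state m" using NV[OF \<open>z \<in> V\<close>] unfolding N_def by blast
  then show ?thesis using z centre_in_square[OF d(1), of z] by blast
 qed
 \<comment> \<open>It remains to leave \<open>Q j\<close> along a generic vertical line up to the
   boundary: on this path the suprema of \<open>u\<close> and of \<open>w\<close> converge to the
   same boundary value.\<close>
 obtain A where A: "almost_every_path ver \<Omega> Q A"
  "\<And>g x. g \<in> A ==> x \<in> frontier \<Omega> ==> open_cpath g ==> x \<in> closure (im g) ==>
   disks_to Q (im g) x \<noteq> bot \<and> (upper u \<longlongrightarrow> \<alpha> x) (disks_to Q (im g) x)" using su(2) unfolding bval_def by blast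
 obtain B where B: "almost_every_path ver \<Omega> Q B"
  "\<And>g x. g \<in> B ==> x \<in> frontier \<Omega> ==> open_cpath g ==> x \<in> closure (im g) ==>
   (upper w \<longlongrightarrow> \<alpha> x) (disks_to Q (im g) x)" using w(2) unfolding bval_def by blast
 have "exceptional (nonconst_paths_in \<Omega> - (A \<inter> B))" using almost_every_Int[OF A(1) B(1)] unfolding almost_every_iff .
 note ae = AE_line_not_exceptional[OF this, of True]
 obtain r1 where r1: "r1 > 0" "square zj r1 \<subseteq> Q j" using open_contains_square[OF open_disk zj] by blast
 obtain X where X: "Re zj - r1 < X" "X < Re zj + r1" "\<forall>I. (I, line True X) \<in> paths_in \<Omega> --> (I, line True X) \<notin> nonconst_paths_in \<Omega> - (A \<inter> B)"
  using AE_real_obtain[OF ae, of "Re zj - r1" "Re zj + r1"] r1 by auto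
 have "Complex X (Im zj) \<in> square zj r1" using X r1 by (simp add: square_def sup_norm_def abs_less_iff)
 then have "Complex X (Im zj) \<in> \<Omega>" using r1(2) disk_subset by blast
 then obtain y1 where y1: "y1 > Im zj" "line True X ` {Im zj..<y1} \<subseteq> \<Omega>" "line True X y1 \<in> frontier \<Omega>" using vertical_exit by blast
 define g where "g = ({Im zj<..<y1}, line True X)"
 have "im g \<subseteq> \<Omega>" using y1(2) by (auto simp: g_def im_def)
 then have pth: "g \<in> paths_in \<Omega>" using y1(1) by (auto simp: paths_in_def g_def is_cpath_def continuous_on_line is_interval_oo)
 have "\<not> snd g constant_on fst g"
 proof
  assume cst: "snd g constant_on fst g"
  define p where "p = Im zj + (y1 - Im zj) / 3"
  define q where "q = Im zj + 2 * (y1 - Im zj) / 3"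
  have "Im zj < p" "p < q" "q < y1" using y1(1) unfolding p_def q_def by (simp_all add: field_simps)
  then have "p \<in> fst g" "q \<in> fst g" "p \<noteq> q" unfolding g_def by auto
  then have "line True X p = line True X q" using cst by (auto simp: constant_on_def g_def)
  then show False using \<open>p \<noteq> q\<close> by (simp add: line_def)
 qed
 then have "g \<in> nonconst_paths_in \<Omega>" using pth by (simp add: nonconst_paths_in_def)
 then have gAB: "g \<in> A \<inter> B" using X(3) pth by (auto simp: g_def)
 have op: "open_cpath g" by (simp add: open_cpath_def g_def)
 have xcl: "line True X y1 \<in> closure (im g)"
 proof -
  have "y1 \<in> closure {Im zj<..<y1}" using y1(1) by simp
  then have "line True X y1 \<in> line True X ` closure {Im zj<..<y1}" by blast
  also have "\<dots> \<subseteq> closure (line True X ` {Im zj<..<y1})" by (intro image_closure_subset continuous_on_line closure_subset) auto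
  finally show ?thesis by (simp add: g_def im_def)
 qed
 let ?F = "disks_to Q (im g) (line True X y1)"
 have F: "?F \<noteq> bot" "(upper u \<longlongrightarrow> \<alpha> (line True X y1)) ?F" "(upper w \<longlongrightarrow> \<alpha> (line True X y1)) ?F"
  using A(2)[of g "line True X y1"] B(2)[of g "line True X y1"] gAB y1(3) op xcl by blast+
 have ev: "eventually state ?F" using eventually_disks_avoid_finite[OF fB] by (rule eventually_mono) (rule all_state)
 have "(upper u \<longlongrightarrow> c) ?F" by (rule tendsto_eventually) (use ev in \<open>rule eventually_mono, simp add: state_def\<close>)
 moreover have "(upper w \<longlongrightarrow> c + T) ?F" by (rule tendsto_eventually) (use ev in \<open>rule eventually_mono, simp add: state_def\<close>)
 ultimately have "c = \<alpha> (line True X y1)" "c + T = \<alpha> (line True X y1)" using tendsto_unique[OF F(1)] F(2,3) by auto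
 then show False using T by simp
qed

text \<open>The maximum has no shift against \<open>u\<close>, which compares the suprema; equality
  of the oscillations then compares the infima.\<close>

lemma disk_comparison:
 assumes u: "minimizer u \<alpha>" and v: "minimizer v \<beta>" and G: "almost_every_path ver \<Omega> Q G"
  and le: "\<And>x. x \<in> boundary_accessible \<Omega> G ==> \<beta> x \<le> \<alpha> x"
 shows "upper v i \<le> upper u i \<and> lower v i \<le> lower u i"
proof -
 let ?w = "\<lambda>x. max (u x) (v x)"
 have su: "sob u" "bval u \<alpha>" and sv: "sob v" "bval v \<beta>" using u v by (auto simp: minimizer_def)
 note mm = upper_max[OF sobD(1)[OF su(1)] sobD(1)[OF sv(1)]]
 have sw: "sob ?w" "bval ?w \<alpha>" "energy ?w \<le> energy u"
  using sob_max[OF su(1) sv(1)] bval_max_min(1)[OF su sv G le] energy_max_le[OF u v G le] by auto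
 have "upper ?w i = upper u i" by (rule shift_zero[OF u sw]) simp
 moreover have "gap u i = gap ?w i" by (rule gap_eq_of_minimizer[OF u sw]) simp
 ultimately have "max (upper u i) (upper v i) = upper u i" "lower ?w i = lower u i" using mm(1)[of i] by (auto simp: gap_def)
 then show ?thesis using mm(2)[of i] by auto
qed

text \<open>The competitor is itself a minimizer, and comparison with equal data applies in both
  directions.\<close>

lemma minimizer_unique_on_disks:
 assumes u: "minimizer u \<alpha>" and z: "sob z" "bval z \<alpha>" "energy z \<le> energy u"
 shows "upper z i = upper u i" "lower z i = lower u i"
proof -
 have mz: "minimizer z \<alpha>" using u z unfolding minimizer_def by (meson order_trans)
 from disk_comparison[OF u mz almost_every_paths, of i] disk_comparison[OF mz u almost_every_paths, of i]
 show "upper z i = upper u i" "lower z i = lower u i" by auto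
qed

end

text \<open>A Cauchy criterion for filters: the supremum of all eventual lower bounds is the
  limit.\<close>

lemma real_filter_limit:
 fixes f :: "'a => real"
 assumes F: "F \<noteq> bot" and c: "\<And>e. e > 0 ==> \<exists>c. eventually (\<lambda>i. \<bar>f i - c\<bar> \<le> e) F"
 shows "\<exists>L. (f \<longlongrightarrow> L) F"
proof -
 define A where "A = {a. eventually (\<lambda>i. a \<le> f i) F}"
 have up: "a \<le> c + e" if a: "a \<in> A" and e: "eventually (\<lambda>i. \<bar>f i - c\<bar> \<le> e) F" for a c e
 proof -
  have "eventually (\<lambda>i. a \<le> f i \<and> \<bar>f i - c\<bar> \<le> e) F" using a e unfolding A_def by (auto intro: eventually_conj)
  then obtain i where "a \<le> f i" "\<bar>f i - c\<bar> \<le> e" using F eventually_happens by blast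
  then show ?thesis by linarith
 qed
 have mem: "c - e \<in> A" if "eventually (\<lambda>i. \<bar>f i - c\<bar> \<le> e) F" for c e
  unfolding A_def mem_Collect_eq using that by (rule eventually_mono) linarith
 obtain c1 where c1: "eventually (\<lambda>i. \<bar>f i - c1\<bar> \<le> 1) F" using c[of 1] by auto
 have bdd: "bdd_above A" using up[OF _ c1] by (rule bdd_aboveI)
 have ne: "A \<noteq> {}" using mem[OF c1] by blast
 have "(f \<longlongrightarrow> Sup A) F"
 proof (rule tendstoI)
  fix e :: real assume e: "e > 0"
  then obtain d where d: "eventually (\<lambda>i. \<bar>f i - d\<bar> \<le> e / 3) F" using c[of "e/3"] by auto
  have "d - e / 3 \<le> Sup A" using mem[OF d] bdd by (rule cSup_upper)
  moreover have "Sup A \<le> d + e / 3" using ne up[OF _ d] by (rule cSup_least)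
  ultimately have "\<bar>d - Sup A\<bar> \<le> e / 3" by linarith
  then have close: "dist d (Sup A) \<le> e / 3" by (simp add: dist_real_def)
  from d show "eventually (\<lambda>i. dist (f i) (Sup A) < e) F"
  proof eventually_elim
   case (elim i)
   then have "dist (f i) d \<le> e / 3" by (simp add: dist_real_def)
   then show ?case using dist_triangle[of "f i" "Sup A" d] close e by linarith
  qed
 qed
 then show ?thesis by blast
qed

context carpet_domain
begin

section \<open>Regularity of minimizers\<close>

text \<open>A point on the circle of a disk is accessed from outside that disk, so the disk is taken
  out.\<close>

definition access_domain :: "complex => complex set" where
 "access_domain x = \<Omega> - \<Union>{Q i | i. x \<in> frontier (Q i)}"

lemma access_domain_disk: "x \<in> frontier (Q i) ==> access_domain x = \<Omega> - Q i"
 using frontier_disk_unique by (auto simp: access_domain_def)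

lemma access_domain_other: "(\<And>i. x \<notin> frontier (Q i)) ==> access_domain x = \<Omega>" by (auto simp: access_domain_def)

lemma crosscut_point_access: "x \<in> S ==> crosscut_point x (access_domain x)"
 using crosscut_point_interior[of x] crosscut_point_disk[of x] access_domain_disk[of x] access_domain_other[of x] by metis

lemma carpet_access_domain: "S \<subseteq> access_domain x" using carpet_subset disk_not_carpet by (auto simp: access_domain_def)

text \<open>The finitely many large disks whose closures miss \<open>x\<close> stay away from it, so
  disks met near \<open>x\<close> are small. If \<open>x\<close> is on a circle, density is applied
  outside the closure of its disk, because that disk does not shrink to \<open>x\<close>.\<close>

lemma disks_near_nontrivial:
 assumes x: "x \<in> S" shows "disks_to Q UNIV x \<noteq> bot"
proof -
 have "\<exists>i. Q i \<subseteq> ball x e" if e: "e > 0" for e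
 proof -
  define B where "B = {i. e / 2 \<le> diameter (Q i) \<and> x \<notin> closure (Q i)}"
  have "finite {i. e / 2 \<le> diameter (Q i)}" using e by (intro finite_large_disks) simp
  then have fB: "finite B" by (rule rev_finite_subset) (auto simp: B_def)
  have "open (\<Omega> - (\<Union>i\<in>B. closure (Q i)))" using fB open_domain by (intro open_Diff closed_UN) auto
  moreover have "x \<in> \<Omega> - (\<Union>i\<in>B. closure (Q i))" using x carpet_subset by (auto simp: B_def)
  ultimately obtain d0 where d0: "d0 > 0" "ball x d0 \<subseteq> \<Omega> - (\<Union>i\<in>B. closure (Q i))" by (meson open_contains_ball)
  define d where "d = min d0 (e/2)"
  have d: "d > 0" using d0 e by (simp add: d_def)
  have "\<exists>i. Q i \<inter> ball x d \<noteq> {} \<and> x \<notin> closure (Q i)"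
  proof (cases "\<exists>k. x \<in> frontier (Q k)")
   case True
   then obtain k where k: "x \<in> frontier (Q k)" by blast
   then have "x \<in> closure (- closure (Q k))" using jordan_sideD(6)[OF disk_sides(2)[of k]] by blast
   then have "(- closure (Q k)) \<inter> ball x d \<noteq> {}" using d by (simp add: closure_iff_nhds_not_empty) (metis Int_commute centre_in_ball open_ball subset_refl)
   moreover have "ball x d \<subseteq> \<Omega>" using d0 by (auto simp: d_def)
   ultimately obtain i where i: "Q i \<inter> (ball x d - closure (Q k)) \<noteq> {}"
    using disk_dense[of "ball x d - closure (Q k)"] by (auto simp: open_Diff)
   have "i \<noteq> k" using i closure_subset[of "Q k"] by blast
   then have "x \<notin> closure (Q i)" using k closure_disk_unique[of x i k] by (auto simp: frontier_def)
   then show ?thesis using i by blast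
  next
   case False
   have "ball x d \<subseteq> \<Omega>" using d0 by (auto simp: d_def)
   then obtain i where "Q i \<inter> ball x d \<noteq> {}" using disk_dense[of "ball x d"] d by auto
   then show ?thesis using False x disk_not_carpet closure_disk by blast
  qed
  then obtain i where i: "Q i \<inter> ball x d \<noteq> {}" "x \<notin> closure (Q i)" by blast
  have "ball x d \<subseteq> ball x d0" by (simp add: d_def subset_ball)
  then have "i \<notin> B" using i(1) d0(2) closure_subset[of "Q i"] by blast
  then have di: "diameter (Q i) < e / 2" using i(2) by (simp add: B_def)
  obtain p where p: "p \<in> Q i" "dist x p < d" using i(1) by auto
  have "Q i \<subseteq> ball x e"
  proof
   fix q assume "q \<in> Q i"
   then have "dist p q \<le> diameter (Q i)" using p bounded_disk by (intro diameter_bounded_bound)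
   then have "dist x q < e" using dist_triangle[of x q p] p(2) di by (auto simp: d_def)
   then show "q \<in> ball x e" by simp
  qed
  then show ?thesis by blast
 qed
 then show ?thesis unfolding trivial_limit_def eventually_disks_to using disk_nonempty by auto
qed

lemma disks_to_mono: "disks_to Q A x \<le> disks_to Q UNIV x" unfolding filter_leD le_filter_def eventually_disks_to by blast

text \<open>Clamping \<open>u\<close> to \<open>{T1..T2}\<close> inside \<open>N\<close> raises no
  oscillation: a circle with points inside and outside \<open>N\<close> carries a value in the
  window by \<open>disks\<close>. Paths entering or leaving \<open>N\<close> satisfy a gradient
  inequality by \<open>cross\<close>. As \<open>N\<close> lies in a compact part of the domain,
  boundary values do not change. The clamped function is a competitor of no larger energy, so its
  extrema on the disks are those of \<open>u\<close>.\<close>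

lemma truncated_minimizer:
 assumes u: "minimizer u \<alpha>" and T: "T1 \<le> (T2::real)"
  and N: "N \<subseteq> csquare x r1" "csquare x r1 \<subseteq> \<Omega>"
  and disks: "\<And>i. frontier (Q i) \<subseteq> N \<or> frontier (Q i) \<inter> N = {} \<or> (\<exists>y\<in>frontier (Q i). T1 \<le> u y \<and> u y \<le> T2)"
  and cross: "\<And>q y y'. q \<in> paths_in \<Omega> ==> y \<in> im q \<inter> S ==> y' \<in> im q \<inter> S ==> y \<in> N ==> y' \<notin> N ==>
    (\<exists>p\<in>im q. \<exists>c. T1 \<le> c \<and> c \<le> T2 \<and> ((p \<in> S \<and> u p = c) \<or> (\<exists>i. p \<in> frontier (Q i) \<and> Q i \<inter> im q \<noteq> {} \<and> \<bar>u p - c\<bar> \<le> gap u i)))"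
  and i: "frontier (Q i) \<subseteq> N"
 shows "T1 \<le> lower u i" "upper u i \<le> T2"
proof -
 have su: "sob u" "bval u \<alpha>" using u by (auto simp: minimizer_def)
 note du = sobD(1)[OF su(1)]
 define cl where "cl v = max T1 (min T2 v)" for v
 define z where "z y = (if y \<in> N then cl (u y) else u y)" for y
 have cl: "T1 \<le> cl v" "cl v \<le> T2" for v using T by (auto simp: cl_def)
 have cl1: "\<bar>cl v - cl v'\<bar> \<le> \<bar>v - v'\<bar>" for v v' by (auto simp: cl_def)
 have cl2: "\<bar>cl v - c\<bar> \<le> \<bar>v - c\<bar>" if "T1 \<le> c" "c \<le> T2" for v c using that by (auto simp: cl_def)
 have gz: "gap z k \<le> gap u k" for k
 proof (rule gap_leI)
  fix a b assume ab: "a \<in> frontier (Q k)" "b \<in> frontier (Q k)"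
  note D = disk_boundedD(3,4)[OF du]
  consider "frontier (Q k) \<subseteq> N" | "frontier (Q k) \<inter> N = {}" | y where "y \<in> frontier (Q k)" "T1 \<le> u y" "u y \<le> T2"
   using disks[of k] by blast
  then show "z a - z b \<le> gap u k"
  proof cases
   case 1
   then have "z a = cl (u a)" "z b = cl (u b)" using ab by (auto simp: z_def)
   then show ?thesis using cl1[of "u a" "u b"] gap_diff[OF du ab] by linarith
  next
   case 2
   then have "z a = u a" "z b = u b" using ab by (auto simp: z_def)
   then show ?thesis using gap_diff[OF du ab] by linarith
  next
   case 3
   have "lower u k \<le> u y" "u y \<le> upper u k" using D 3 by auto
   then have "z a \<le> upper u k" "lower u k \<le> z b" using D(1)[OF ab(1)] D(2)[OF ab(2)] 3 by (auto simp: z_def cl_def)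
   then show ?thesis by (simp add: gap_def)
  qed
 qed
 obtain H0 where G: "exceptional H0" "H0 \<subseteq> paths_in \<Omega>"
  "\<And>q q' x y. q \<in> paths_in \<Omega> - H0 ==> subcpath q' q ==> x \<in> im q' \<inter> S ==> y \<in> im q' \<inter> S ==>
    ennreal \<bar>u x - u y\<bar> \<le> meet_sum Q (rosc u) (im q')" using subpaths_gradient[OF sobD(2,3)[OF su(1)]] by blast
 \<comment> \<open>Both ends are compared with the crossing point \<open>p\<close>, and
   \<open>p\<close> twice with the level \<open>c\<close> in the window, which gives four sums. The
   level is not moved by clamping.\<close>
 have half: "ennreal \<bar>z y - z y'\<bar> \<le> 4 * meet_sum Q (rosc u) (im q)"
  if g: "q \<in> paths_in \<Omega> - H0" and y: "y \<in> im q \<inter> S" "y' \<in> im q \<inter> S" and N': "y \<in> N" "y' \<notin> N" for q y y'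
 proof -
  define M where "M = meet_sum Q (rosc u) (im q)"
  have "is_interval (fst q)" "fst q \<noteq> {}" using g by (auto simp: paths_in_def is_cpath_def)
  then have "subcpath q q" by (simp add: subcpath_def)
  then have le: "ennreal \<bar>u a - u b\<bar> \<le> M" if "a \<in> im q \<inter> S" "b \<in> im q \<inter> S" for a b
   using G(3)[OF g _ that] unfolding M_def by blast
  obtain p c where p: "p \<in> im q" "T1 \<le> c" "c \<le> T2"
   and alt: "(p \<in> S \<and> u p = c) \<or> (\<exists>i. p \<in> frontier (Q i) \<and> Q i \<inter> im q \<noteq> {} \<and> \<bar>u p - c\<bar> \<le> gap u i)"
   using cross[OF _ y N'] g by blast
  have pS: "p \<in> im q \<inter> S" using alt p(1) frontier_disk_subset by blast
  have pc: "ennreal \<bar>u p - c\<bar> \<le> M"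
  proof (cases "u p = c")
   case False
   then obtain i where i: "Q i \<inter> im q \<noteq> {}" "\<bar>u p - c\<bar> \<le> gap u i" using alt by blast
   then have "ennreal \<bar>u p - c\<bar> \<le> rosc u i" unfolding rosc_gap by (intro ennreal_leI)
   also have "\<dots> \<le> M" unfolding M_def using i(1) by (rule meet_sum_ge_term)
   finally show ?thesis .
  qed simp
  have "\<bar>z y - z y'\<bar> \<le> \<bar>cl (u y) - c\<bar> + \<bar>c - u y'\<bar>" using N' by (simp add: z_def)
  also have "\<dots> \<le> \<bar>u y - u p\<bar> + \<bar>u p - c\<bar> + (\<bar>u p - c\<bar> + \<bar>u p - u y'\<bar>)" using cl2[OF p(2,3), of "u y"] by linarith
  finally have "ennreal \<bar>z y - z y'\<bar> \<le> ennreal \<bar>u y - u p\<bar> + ennreal \<bar>u p - c\<bar> + (ennreal \<bar>u p - c\<bar> + ennreal \<bar>u p - u y'\<bar>)"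
   by (simp add: ennreal_plus[symmetric] ennreal_leI del: ennreal_plus)
  also have "\<dots> \<le> M + M + (M + M)" by (intro add_mono pc le y pS)
  also have "\<dots> = (1 + 1 + (1 + 1)) * M" by (simp only: distrib_right mult_1_left)
  also have "(1 + 1 + (1 + 1) :: ennreal) = 4" by simp
  finally show ?thesis unfolding M_def .
 qed
 have grad: "ennreal \<bar>z y - z y'\<bar> \<le> meet_sum Q (\<lambda>i. 4 * rosc u i) (im q)"
  if g: "q \<in> paths_in \<Omega> - H0" and y: "y \<in> im q \<inter> S" "y' \<in> im q \<inter> S" for q y y'
 proof (cases "y \<in> N \<longleftrightarrow> y' \<in> N")
  case True
  have "is_interval (fst q)" "fst q \<noteq> {}" using g by (auto simp: paths_in_def is_cpath_def)
  then have "subcpath q q" by (simp add: subcpath_def)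
  have "\<bar>z y - z y'\<bar> \<le> \<bar>u y - u y'\<bar>" using True cl1 by (auto simp: z_def)
  then have "ennreal \<bar>z y - z y'\<bar> \<le> ennreal \<bar>u y - u y'\<bar>" by (rule ennreal_leI)
  also have "\<dots> \<le> meet_sum Q (rosc u) (im q)" by (rule G(3)[OF g \<open>subcpath q q\<close> y])
  also have "\<dots> = 1 * meet_sum Q (rosc u) (im q)" by simp
  also have "\<dots> \<le> 4 * meet_sum Q (rosc u) (im q)" by (intro mult_right_mono) auto
  finally show ?thesis by (simp add: meet_sum_cmult)
 next
  case False
  then show ?thesis using half[OF g y] half[OF g y(2,1)] by (auto simp: meet_sum_cmult abs_minus_commute)
 qed
 have "real_gradient (\<lambda>i. 4 * rosc u i) z"
  unfolding real_gradient_def using G(1,2) grad by (intro exI[of _ H0]) (auto simp: nonconst_paths_in_def)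
 moreover have "(\<Sum>i. (4 * rosc u i)^2) < \<infinity>"
 proof -
  have "(\<Sum>i. (4 * rosc u i)^2) = 4^2 * (\<Sum>i. (rosc u i)^2)" by (simp only: power_mult_distrib ennreal_suminf_cmult)
  then show ?thesis using sobD(3)[OF su(1)] by (simp add: ennreal_mult_less_top power2_eq_square)
 qed
 ultimately have sz: "sob z"
 proof (rule sob_of_gradient[OF su(1) su(1), of _ _ "\<bar>T1\<bar> + \<bar>T2\<bar>"])
  show "\<bar>z y\<bar> \<le> \<bar>u y\<bar> + \<bar>u y\<bar> + (\<bar>T1\<bar> + \<bar>T2\<bar>)" for y using cl[of "u y"] by (auto simp: z_def)
  show "rosc z k \<le> 4 * rosc u k" for k
  proof -
   have "rosc z k \<le> 1 * rosc u k" unfolding rosc_gap using gz by (simp add: ennreal_leI)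
   also have "\<dots> \<le> 4 * rosc u k" by (intro mult_right_mono) auto
   finally show ?thesis .
  qed
 qed
 have ez: "energy z \<le> energy u" by (rule energy_mono[OF sz su(1) gz])
 have bz: "bval z \<alpha>"
 proof -
  have same: "eventually (\<lambda>k. upper u k = upper z k \<and> lower u k = lower z k) (disks_to Q A y)" if y: "y \<in> frontier \<Omega>" for y A
  proof -
   have "y \<in> - csquare x r1" using N(2) frontier_not_in_domain[OF y] by blast
   moreover have "open (- csquare x r1)" by (intro open_Compl compact_imp_closed) simp
   ultimately obtain e where e: "e > 0" "cball y e \<subseteq> - csquare x r1" by (meson open_contains_cball)
   have "upper u k = upper z k \<and> lower u k = lower z k" if "Q k \<subseteq> ball y e" for k
   proof -
    have "closure (Q k) \<subseteq> cball y e" using that ball_subset_cball by (intro closure_minimal) auto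
    then have "z p = u p" if "p \<in> frontier (Q k)" for p using that e N(1) by (auto simp: z_def frontier_def)
    then show ?thesis by (simp add: upper_def lower_def)
   qed
   then show ?thesis unfolding eventually_disks_to using e(1) by blast
  qed
  obtain A where A: "A \<subseteq> paths_in \<Omega>" "almost_every_path ver \<Omega> Q A"
   "\<And>q x. q \<in> A ==> x \<in> frontier \<Omega> ==> open_cpath q ==> x \<in> closure (im q) ==>
    disks_to Q (im q) x \<noteq> bot \<and> (upper u \<longlongrightarrow> \<alpha> x) (disks_to Q (im q) x) \<and> (lower u \<longlongrightarrow> \<alpha> x) (disks_to Q (im q) x)"
   using su(2) unfolding bval_def by blast
  have "disks_to Q (im q) x \<noteq> bot \<and> (upper z \<longlongrightarrow> \<alpha> x) (disks_to Q (im q) x) \<and> (lower z \<longlongrightarrow> \<alpha> x) (disks_to Q (im q) x)"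
   if q: "q \<in> A" "x \<in> frontier \<Omega>" "open_cpath q" "x \<in> closure (im q)" for q x
  proof -
   have ev: "eventually (\<lambda>k. upper u k = upper z k) (disks_to Q (im q) x)" "eventually (\<lambda>k. lower u k = lower z k) (disks_to Q (im q) x)"
    using same[OF q(2), of "im q"] by (auto elim: eventually_mono)
   show ?thesis using A(3)[OF q] Lim_transform_eventually[OF _ ev(1)] Lim_transform_eventually[OF _ ev(2)] by blast
  qed
  then show ?thesis unfolding bval_def using A(1,2) by blast
 qed
 note eq = minimizer_unique_on_disks[OF u sz bz ez, of i]
 have zi: "T1 \<le> z p" "z p \<le> T2" if "p \<in> frontier (Q i)" for p using that i cl by (auto simp: z_def)
 show "T1 \<le> lower u i" unfolding eq(2)[symmetric] by (rule lower_greatest) (rule zi)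
 show "upper u i \<le> T2" unfolding eq(1)[symmetric] by (rule upper_least) (rule zi)
qed

text \<open>On a crosscut around \<open>x\<close> with small sum all values are within
  \<open>e\<close> of a constant \<open>c\<close>. Truncating to this window in the region cut off
  shows that disks close to \<open>x\<close> have their values in it.\<close>

lemma minimizer_limit:
 assumes u: "minimizer u \<alpha>" and x: "x \<in> S"
 shows "\<exists>L. (upper u \<longlongrightarrow> L) (disks_to Q UNIV x)"
proof (rule real_filter_limit[OF disks_near_nontrivial[OF x]])
 fix e :: real assume e: "e > 0"
 have su: "sob u" using u by (auto simp: minimizer_def)
 note du = sobD(1)[OF su]
 let ?W = "access_domain x"
 have x\<Omega>: "x \<in> \<Omega>" using x carpet_subset by blast
 obtain R0 where R0: "R0 > 0" "square x R0 \<subseteq> \<Omega>" using open_contains_square[OF open_domain x\<Omega>] by blast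
 have cp: "crosscut_point x ?W" by (rule crosscut_point_access[OF x])
 have W\<Omega>: "?W \<subseteq> \<Omega>" by (auto simp: access_domain_def)
 obtain R where R: "R > 0" "\<And>r1. 0 < r1 ==> r1 < R ==> \<exists>r0>0. \<forall>r. 0 < r --> r < r0 --> (\<exists>s s' N. crosscut_region ?W x r r1 s s' N)"
  using cp unfolding crosscut_point_def by blast
 define r1 where "r1 = min R R0 / 2"
 have r1: "0 < r1" "r1 < R" "r1 < R0" using R(1) R0(1) by (auto simp: r1_def)
 obtain r0 where r0: "r0 > 0" "\<And>r. 0 < r ==> r < r0 ==> \<exists>s s' N. crosscut_region ?W x r r1 s s' N" using R(2)[OF r1(1,2)] by blast
 have cs: "csquare x r1 \<subseteq> \<Omega>" using R0(2) r1(3) by (force simp: csquare_def square_def)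
 define I where "I = {i. Q i \<inter> ?W \<noteq> {}}"
 have clI: "x \<notin> closure (Q i)" if "i \<in> I" for i using cp that unfolding crosscut_point_def I_def by blast
 have sumI: "(\<Sum>i. if i \<in> I then ennreal ((gap u i)^2) else 0) < \<infinity>"
 proof -
  have "(\<Sum>i. if i \<in> I then ennreal ((gap u i)^2) else 0) \<le> (\<Sum>i. ennreal ((gap u i)^2))" by (intro suminf_le summableI) auto
  also have "\<dots> < \<infinity>" using sobD(4)[OF su] by (subst suminf_ennreal_finite_iff) auto
  finally show ?thesis .
 qed
 have e27: "e / 27 > 0" "0 < r0" using e r0 by auto
 obtain r where r: "0 < r" "r < r0" "good_square u x r"
  "(\<Sum>i. if i \<in> I \<and> Q i \<inter> {z. sup_norm (z - x) = r} \<noteq> {} then ennreal (gap u i) else 0) < ennreal (e / 27)"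
  using square_with_small_sum[OF gap_nonneg[OF du] sumI clI AE_good_square[OF sobD(2)[OF su], of x] e27] by blast
 obtain s s' N where "crosscut_region ?W x r r1 s s' N" using r0(2)[OF r(1,2)] by blast
 then have C: "0 \<le> s" "s \<le> s'" "s' \<le> 4 * pi" "N \<subseteq> ?W \<inter> csquare x r1" "\<exists>d>0. ?W \<inter> square x d \<subseteq> N"
  and X: "\<And>X. connected X ==> X \<subseteq> ?W ==> X \<inter> square_path x r ` {s..s'} = {} ==> X \<inter> N \<noteq> {} ==> X \<subseteq> N"
  and arc: "square_path x r s \<in> ?W ==> square_path x r s' \<in> ?W ==> square_path x r ` {s..s'} \<subseteq> ?W"
  and ends: "square_path x r s \<in> ?W" "square_path x r s' \<in> ?W" "\<And>i. \<not> Q i \<subseteq> ?W ==> square_path x r s \<in> frontier (Q i)"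
  using x\<Omega> unfolding crosscut_region_def by simp_all
 define A where "A = square_path x r ` {s..s'}"
 have AW: "A \<subseteq> ?W" unfolding A_def by (rule arc[OF ends(1,2)])
 define c where "c = disk_value u (square_path x r s)"
 have arcval: "\<bar>disk_value u q - c\<bar> \<le> e" if q: "q \<in> A" for q
 proof -
  obtain t where t: "s \<le> t" "t \<le> s'" "q = square_path x r t" using q by (auto simp: A_def)
  have sub: "square_path x r ` {s..t} \<subseteq> A" unfolding A_def using t by (intro image_mono) auto
  have "ennreal \<bar>disk_value u (square_path x r s) - disk_value u (square_path x r t)\<bar> \<le> 27 * meet_sum Q (rosc u) (square_path x r ` {s..t})"
   using t C(1,3) sub AW W\<Omega> by (intro good_square_arc[OF du r(3,1)]) auto
  also have "\<dots> \<le> 27 * (\<Sum>i. if i \<in> I \<and> Q i \<inter> {z. sup_norm (z - x) = r} \<noteq> {} then ennreal (gap u i) else 0)"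
   unfolding meet_sum_def
  proof (intro mult_left_mono suminf_le summableI)
   fix i
   show "(if Q i \<inter> square_path x r ` {s..t} \<noteq> {} then rosc u i else 0)
    \<le> (if i \<in> I \<and> Q i \<inter> {z. sup_norm (z - x) = r} \<noteq> {} then ennreal (gap u i) else 0)"
   proof (cases "Q i \<inter> square_path x r ` {s..t} = {}")
    case False
    then obtain y where y: "y \<in> Q i" "y \<in> square_path x r ` {s..t}" by blast
    have "y \<in> ?W" using y(2) sub AW by blast
    moreover have "sup_norm (y - x) = r" using y(2) square_path_norm[of r x] r(1) by auto
    ultimately have "i \<in> I \<and> Q i \<inter> {z. sup_norm (z - x) = r} \<noteq> {}" using y(1) unfolding I_def by blast
    then show ?thesis by (simp add: rosc_gap)
   qed simp
  qed simp
  also have "\<dots> \<le> 27 * ennreal (e / 27)" using r(4) by (intro mult_left_mono) auto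
  also have "\<dots> = ennreal e" using e by (simp add: ennreal_mult[symmetric] flip: ennreal_numeral)
  finally show ?thesis using e unfolding c_def t(3) by (subst (asm) ennreal_le_iff) (auto simp: abs_minus_commute)
 qed
 have conF: "connected (frontier (Q i))" for i using jordan_sideD(2)[OF disk_sides(1)] .
 have FW: "frontier (Q i) \<subseteq> ?W" for i using frontier_disk_subset carpet_access_domain by blast
 \<comment> \<open>A circle avoiding the arc is connected and lies in the access domain, so the
   crosscut does not split it.\<close>
 have disks: "frontier (Q i) \<subseteq> N \<or> frontier (Q i) \<inter> N = {} \<or> (\<exists>y\<in>frontier (Q i). c - e \<le> u y \<and> u y \<le> c + e)" for i
 proof (cases "frontier (Q i) \<inter> A = {}")
  case True
  then show ?thesis using X[OF conF FW] unfolding A_def by blast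
 next
  case False
  then obtain y where y: "y \<in> frontier (Q i)" "y \<in> A" by blast
  then have "y \<in> S" using frontier_disk_subset by blast
  then have "\<bar>u y - c\<bar> \<le> e" using arcval[OF y(2)] by (simp add: disk_value_carpet)
  then show ?thesis using y(1) by (intro disjI2 bexI[of _ y]) auto
 qed
 \<comment> \<open>A path with points inside and outside \<open>N\<close> either meets the arc or
   passes through the disk having \<open>x\<close> on its circle. In the second case the arc starts
   on that same circle, so the window is reached up to one oscillation of a disk that the path
   meets.\<close>
 have cross: "\<exists>p\<in>im g. \<exists>d. c - e \<le> d \<and> d \<le> c + e \<and> ((p \<in> S \<and> u p = d) \<or> (\<exists>i. p \<in> frontier (Q i) \<and> Q i \<inter> im g \<noteq> {} \<and> \<bar>u p - d\<bar> \<le> gap u i))"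
  if g: "g \<in> paths_in \<Omega>" and y: "y \<in> im g \<inter> S" "y' \<in> im g \<inter> S" "y \<in> N" "y' \<notin> N" for g y y'
 proof -
  have con: "connected (im g)" using g connected_im by (simp add: paths_in_def)
  have hit: "\<exists>p. p \<in> im g \<and> p \<in> frontier (Q i)" if "Q i \<inter> im g \<noteq> {}" for i
  proof -
   have "im g \<inter> Q i \<noteq> {}" "\<not> im g \<subseteq> Q i" using that y(1) disk_not_carpet by blast+
   then show ?thesis using connected_meets_frontier[OF con] by blast
  qed
  show ?thesis
  proof (cases "im g \<inter> A = {}")
   case False
   then obtain q where q: "q \<in> im g" "q \<in> A" by blast
   have vq: "\<bar>disk_value u q - c\<bar> \<le> e" by (rule arcval[OF q(2)])
   show ?thesis
   proof (cases "q \<in> S")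
    case True
    then show ?thesis using vq q(1) by (intro bexI[of _ q] exI[of _ "u q"]) (auto simp: disk_value_carpet)
   next
    case False
    then obtain i where i: "q \<in> Q i" using q(2) AW W\<Omega> not_in_carpet by blast
    then obtain p where p: "p \<in> im g" "p \<in> frontier (Q i)" using hit[of i] q(1) by blast
    have "\<bar>u p - upper u i\<bar> \<le> gap u i" using disk_boundedD(3,4)[OF du p(2)] by (simp add: gap_def)
    moreover have "\<bar>upper u i - c\<bar> \<le> e" using vq i by (simp add: disk_value_disk)
    moreover have "Q i \<inter> im g \<noteq> {}" using i q(1) by blast
    ultimately show ?thesis using p by (intro bexI[of _ p] exI[of _ "upper u i"] conjI disjI2 exI[of _ i]) auto
   qed
  next
   case True
   have "\<not> im g \<subseteq> ?W"
   proof
    assume "im g \<subseteq> ?W"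
    then have "im g \<subseteq> N" using X[OF con] True y(1,3) unfolding A_def by blast
    then show False using y(2,4) by blast
   qed
   then obtain w where w: "w \<in> im g" "w \<notin> ?W" by blast
   have "w \<in> \<Omega>" using w(1) g by (auto simp: paths_in_def)
   then obtain i where i: "w \<in> Q i" "x \<in> frontier (Q i)" using w(2) unfolding access_domain_def by blast
   then have me: "Q i \<inter> im g \<noteq> {}" using w(1) by blast
   obtain p where p: "p \<in> im g" "p \<in> frontier (Q i)" using hit[OF me] by blast
   define q where "q = square_path x r s"
   have "\<not> Q i \<subseteq> ?W" using i(1) w(2) by blast
   then have qf: "q \<in> frontier (Q i)" unfolding q_def by (rule ends(3))
   have qA: "q \<in> A" unfolding q_def A_def using C(2) by (intro imageI) simp
   have "q \<in> S" using qf frontier_disk_subset by blast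
   then have "\<bar>u q - c\<bar> \<le> e" using arcval[OF qA] by (simp add: disk_value_carpet)
   then show ?thesis using gap_diff[OF du p(2) qf] p me by (intro bexI[of _ p] exI[of _ "u q"] conjI disjI2 exI[of _ i]) auto
  qed
 qed
 have c2: "c - e \<le> c + e" using e by simp
 have NC: "N \<subseteq> csquare x r1" using C(4) by blast
 obtain d where d: "d > 0" "?W \<inter> square x d \<subseteq> N" using C(5) by blast
 \<comment> \<open>Half the radius, so that the closures of these disks still lie in the square
   whose trace is contained in \<open>N\<close>.\<close>
 have "\<bar>upper u i - c\<bar> \<le> e" if i: "Q i \<subseteq> ball x (d/2)" for i
 proof -
  have "closure (Q i) \<subseteq> cball x (d/2)" using i ball_subset_cball by (intro closure_minimal) auto
  also have "\<dots> \<subseteq> ball x d" using d(1) by auto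
  also have "\<dots> \<subseteq> square x d" by (rule ball_subset_square)
  finally have "frontier (Q i) \<subseteq> N" using FW[of i] d(2) by (auto simp: frontier_def)
  then have fN: "frontier (Q i) \<subseteq> N" .
  have "c - e \<le> lower u i" by (rule truncated_minimizer(1)[OF u c2 NC cs disks _ fN]) (rule cross; assumption)
  moreover have "upper u i \<le> c + e" by (rule truncated_minimizer(2)[OF u c2 NC cs disks _ fN]) (rule cross; assumption)
  ultimately show ?thesis using disk_boundedD(5)[OF du, of i] by linarith
 qed
 then have "eventually (\<lambda>i. \<bar>upper u i - c\<bar> \<le> e) (disks_to Q UNIV x)"
  unfolding eventually_disks_to using d(1) by (intro exI[of _ "d/2"]) auto
 then show "\<exists>c. eventually (\<lambda>i. \<bar>upper u i - c\<bar> \<le> e) (disks_to Q UNIV x)" by blast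
qed

end

lemma meet_sum_Un: "meet_sum Q \<rho> (A \<union> B) \<le> meet_sum Q \<rho> A + meet_sum Q \<rho> B"
proof -
 have "meet_sum Q \<rho> (A \<union> B) \<le> (\<Sum>i. (if Q i \<inter> A \<noteq> {} then \<rho> i else 0) + (if Q i \<inter> B \<noteq> {} then \<rho> i else 0))"
  unfolding meet_sum_def by (intro suminf_le summableI) (auto simp: Int_Un_distrib)
 then show ?thesis by (simp add: meet_sum_def suminf_add[symmetric] summableI)
qed

lemma meet_sum_finite_UN:
 assumes "finite D" "\<And>x. x \<in> D ==> meet_sum Q \<rho> (A x) < \<infinity>" shows "meet_sum Q \<rho> (\<Union>x\<in>D. A x) < \<infinity>"
 using assms
proof (induction D rule: finite_induct)
 case empty
 then show ?case by (simp add: meet_sum_def)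
next
 case (insert a D)
 have "meet_sum Q \<rho> (A a \<union> (\<Union>x\<in>D. A x)) \<le> meet_sum Q \<rho> (A a) + meet_sum Q \<rho> (\<Union>x\<in>D. A x)" by (rule meet_sum_Un)
 also have "\<dots> < \<infinity>" using insert.IH insert.prems by (simp add: less_top)
 finally show ?case by simp
qed

context carpet_domain
begin

section \<open>Values of normalized functions\<close>

text \<open>Square summability near \<open>x\<close> makes the oscillation vanish along all disks
  shrinking to \<open>x\<close>, not only along those met by one path.\<close>

lemma gap_tendsto_0_near:
 assumes s: "locally_square_summable f x" and d: "disk_bounded f"
 shows "(gap f \<longlongrightarrow> 0) (disks_to Q UNIV x)"
proof (rule tendstoI)
 fix e :: real assume e: "e > 0"
 obtain h where h: "h > 0" "meet_sum Q (\<lambda>i. (rosc f i)^2) (square x h) < \<infinity>" using s unfolding locally_square_summable_def by blast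
 have e2: "e^2 > 0" using e by simp
 obtain n where n: "meet_sum Q (\<lambda>i. if i < n then 0 else (rosc f i)^2) (square x h) < ennreal (e^2)" using meet_sum_tail[OF h(2) e2] by blast
 have 1: "eventually (\<lambda>i. i \<notin> {..<n}) (disks_to Q UNIV x)" by (rule eventually_disks_avoid_finite) simp
 have 2: "eventually (\<lambda>i. Q i \<subseteq> ball x h) (disks_to Q UNIV x)" unfolding eventually_disks_to using h(1) by blast
 from 1 2 show "eventually (\<lambda>i. dist (gap f i) 0 < e) (disks_to Q UNIV x)"
 proof eventually_elim
  case (elim i)
  have "Q i \<inter> square x h \<noteq> {}" using elim(2) ball_subset_square[of x h] disk_nonempty[of i] by blast
  from meet_sum_ge_term[where \<rho> = "\<lambda>i. if i < n then 0 else (rosc f i)^2" and Q = Q and A = "square x h" and i = i, OF this] n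
  have "(if i < n then 0 else (rosc f i)^2) < ennreal (e^2)" by (rule order_le_less_trans)
  then have "(gap f i)^2 < e^2" using elim(1) by (simp add: rosc_square[OF d] ennreal_less_iff)
  then have "gap f i < e" using e by (simp add: power_less_imp_less_base)
  then show ?case using gap_nonneg[OF d, of i] by simp
 qed
qed

text \<open>A function in the local Sobolev space may take infinite values off the circles. Its
  normalized version is determined by its suprema and oscillations on the disks, and these it shares
  with a real function.\<close>

definition represents :: "(complex => ereal) => (complex => real) => bool" where
 "represents g f \<longleftrightarrow> disk_bounded f \<and> real_gradient (rosc f) f \<and> (\<forall>x\<in>\<Omega>. locally_square_summable f x) \<and>
   (\<forall>i. Msup Q g i = ereal (upper f i)) \<and> osc Q g = rosc f"

lemma sobolev_loc_represented:
 assumes g: "sobolev_loc ver \<Omega> Q g" shows "represents g (\<lambda>x. real_of_ereal (g x))"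
proof -
 let ?f = "\<lambda>x. real_of_ereal (g x)"
 have fin: "\<bar>Msup Q g i\<bar> \<noteq> \<infinity>" "\<bar>minf Q g i\<bar> \<noteq> \<infinity>" for i using g by (auto simp: sobolev_loc_def)
 have eq: "ereal (?f x) = g x" if x: "x \<in> frontier (Q i)" for x i
 proof -
  have "minf Q g i \<le> g x" "g x \<le> Msup Q g i" using x by (auto simp: minf_def Msup_def INF_lower SUP_upper)
  then have "\<bar>g x\<bar> \<noteq> \<infinity>" using fin[of i] by auto
  then show ?thesis by (simp add: ereal_real)
 qed
 have M: "Msup Q (\<lambda>x. ereal (?f x)) i = Msup Q g i" for i unfolding Msup_def using eq by (intro SUP_cong) auto
 have m: "minf Q (\<lambda>x. ereal (?f x)) i = minf Q g i" for i unfolding minf_def using eq by (intro INF_cong) auto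
 have d: "disk_bounded ?f"
 proof (rule disk_bounded_of_finite)
  show "\<bar>Msup Q (\<lambda>x. ereal (?f x)) i\<bar> \<noteq> \<infinity>" for i unfolding M by (rule fin(1))
  show "\<bar>minf Q (\<lambda>x. ereal (?f x)) i\<bar> \<noteq> \<infinity>" for i unfolding m by (rule fin(2))
 qed
 have o: "osc Q g = rosc ?f" unfolding osc_real[OF d, symmetric] by (simp add: osc_def M m fun_eq_iff)
 have "real_gradient (rosc ?f) ?f"
 proof -
  obtain H0 where G: "H0 \<subseteq> paths_in \<Omega>" "exceptional H0" "\<forall>p\<in>nonconst_paths_in \<Omega> - H0. \<forall>x\<in>im p \<inter> S. \<forall>y\<in>im p \<inter> S.
      \<bar>g x\<bar> \<noteq> \<infinity> \<and> \<bar>g y\<bar> \<noteq> \<infinity> \<and> \<bar>g x - g y\<bar> \<le> enn2ereal (meet_sum Q (rosc ?f) (im p))"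
   using g unfolding sobolev_loc_def upper_gradient_def o by blast
  have "ennreal \<bar>?f x - ?f y\<bar> \<le> meet_sum Q (rosc ?f) (im p)"
   if "p \<in> nonconst_paths_in \<Omega> - H0" "x \<in> im p \<inter> S" "y \<in> im p \<inter> S" for p x y
  proof -
   have "\<bar>g x\<bar> \<noteq> \<infinity>" "\<bar>g y\<bar> \<noteq> \<infinity>" "\<bar>g x - g y\<bar> \<le> enn2ereal (meet_sum Q (rosc ?f) (im p))" using bspec[OF bspec[OF bspec[OF G(3) that(1)] that(2)] that(3)] by simp_all
   then have "\<bar>ereal (?f x) - ereal (?f y)\<bar> \<le> enn2ereal (meet_sum Q (rosc ?f) (im p))" by (simp add: ereal_real)
   then show ?thesis unfolding abs_ereal_diff_le_iff .
  qed
  then show ?thesis unfolding real_gradient_def using G(1,2) by (intro exI[of _ H0]) blast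
 qed
 moreover have "locally_square_summable ?f x" if x: "x \<in> \<Omega>" for x
 proof -
  obtain r where r: "r > 0" "cball x r \<subseteq> \<Omega>" using open_domain x open_contains_cball by blast
  then have "compactly_in (ball x r) \<Omega>" by (simp add: compactly_in_def)
  then have "meet_sum Q (\<lambda>i. (rosc ?f i)^2) (ball x r) < \<infinity>" using g r(1) unfolding sobolev_loc_def o by blast
  moreover have "square x (r/2) \<subseteq> ball x r" using square_subset_ball[of x "r/2"] by simp
  ultimately have "meet_sum Q (\<lambda>i. (rosc ?f i)^2) (square x (r/2)) < \<infinity>" using meet_sum_mono_set order_le_less_trans by blast
  then show ?thesis unfolding locally_square_summable_def using r(1) by (intro exI[of _ "r/2"]) simp
 qed
 moreover have "Msup Q g i = ereal (upper ?f i)" for i unfolding M[symmetric] by (rule Msup_real[OF d])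
 ultimately show ?thesis unfolding represents_def using d o by blast
qed

lemma good_hatD:
 assumes r: "represents g f" and p: "p \<in> good_paths_hat \<Omega> Q g"
 shows "p \<in> nonconst_paths_in \<Omega>" "hausdorff1 (im p \<inter> S) = 0"
  "subcpath p' p ==> compactly_in (im p') \<Omega> ==> meet_sum Q (rosc f) (im p') < \<infinity>" "disk_controlled f p"
proof -
 have o: "osc Q g = rosc f" and M: "\<And>i. Msup Q g i = ereal (upper f i)" using r by (auto simp: represents_def)
 have t: "tame_path \<Omega> Q g p" using p by (simp add: good_paths_hat_def)
 show "p \<in> nonconst_paths_in \<Omega>" "hausdorff1 (im p \<inter> S) = 0" using t by (auto simp: tame_path_def)
 show "subcpath p' p ==> compactly_in (im p') \<Omega> ==> meet_sum Q (rosc f) (im p') < \<infinity>" using t unfolding tame_path_def o by blast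
 have "\<forall>p' i1 i2. subcpath p' p \<and> Q i1 \<inter> im p' \<noteq> {} \<and> Q i2 \<inter> im p' \<noteq> {} -->
      \<bar>ereal (upper f i1) - ereal (upper f i2)\<bar> \<le> enn2ereal (meet_sum Q (rosc f) (im p'))"
  using p unfolding good_paths_hat_def o M by blast
 then show "disk_controlled f p" unfolding disk_controlled_def abs_ereal_diff_le_iff by blast
qed

text \<open>Subpaths in a small square around \<open>x\<close> are compactly contained in the
  domain, which turns the finiteness condition of a good path into the local one of
  \<open>approach\<close>.\<close>

lemma accessing_path_approach:
 assumes r: "represents g f" and c0: "c0 \<in> good_paths_hat \<Omega> Q g" and acc: "accesses \<Omega> Q c0 c x" and x: "x \<in> S"
 shows "approach f x (access_domain x) c"
proof -
 note G = good_hatD[OF r c0]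
 have p0: "is_cpath c0" "im c0 \<subseteq> \<Omega>" "\<not> snd c0 constant_on fst c0" using G(1) by (auto simp: nonconst_paths_in_def paths_in_def)
 have sub0: "subcpath c0 c0" using p0(1) by (simp add: subcpath_def is_cpath_def)
 have facts: "subcpath c c0 \<and> im c \<subseteq> access_domain x \<and> x \<in> closure (im c) \<and> (\<exists>y\<in>im c. y \<noteq> x)"
 proof (cases "x \<in> im c0 \<inter> carpet_interior \<Omega> Q")
  case True
  then have e: "c = c0" using acc by (simp add: accesses_def)
  have "access_domain x = \<Omega>" using True by (intro access_domain_other) (auto simp: carpet_interior_def)
  moreover have "x \<in> closure (im c0)" using True closure_subset by blast
  moreover have "\<exists>y\<in>im c0. y \<noteq> x" using p0(3) by (auto simp: constant_on_def im_def)
  ultimately show ?thesis using e sub0 p0(2) by simp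
 next
  case False
  then have a: "subcpath c c0" "x \<in> closure (im c) - im c" "\<And>i. x \<in> frontier (Q i) ==> im c \<inter> Q i = {}"
   using acc unfolding accesses_def by auto
  have "im c \<subseteq> access_domain x" using im_sub[OF a(1)] p0(2) a(3) unfolding access_domain_def by blast
  moreover have "\<exists>y\<in>im c. y \<noteq> x"
  proof -
   have "im c \<noteq> {}" using a(1) by (simp add: subcpath_def im_def)
   then show ?thesis using a(2) by (metis DiffD2 all_not_in_conv)
  qed
  ultimately show ?thesis using a(1,2) by simp
 qed
 then have sub: "subcpath c c0" by blast
 have x\<Omega>: "x \<in> \<Omega>" using x carpet_subset by blast
 obtain h where h: "h > 0" "cball x h \<subseteq> \<Omega>" using open_domain x\<Omega> open_contains_cball by blast
 have fin: "meet_sum Q (rosc f) (im c') < \<infinity>" if c': "subcpath c' c" "im c' \<subseteq> square x (h/2)" for c'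
 proof (rule G(3))
  show "subcpath c' c0" by (rule subcpath_trans[OF c'(1) sub])
  have "im c' \<subseteq> cball x h" using order_trans[OF c'(2) square_subset_ball[of x "h/2"]] ball_subset_cball[of x h] by (simp add: order_trans)
  then have "closure (im c') \<subseteq> cball x h" by (intro closure_minimal) auto
  moreover have "bounded (im c')" using \<open>im c' \<subseteq> cball x h\<close> by (rule bounded_subset[OF bounded_cball])
  ultimately show "compactly_in (im c') \<Omega>" unfolding compactly_in_def using h(2) by auto
 qed
 have "hausdorff1 (im c \<inter> S) = 0" using im_sub[OF sub] by (intro hausdorff1_null_mono[OF G(2)]) blast
 moreover have "disk_controlled f c" using G(4) subcpath_trans[OF _ sub] unfolding disk_controlled_def by blast
 moreover have "\<exists>h>0. \<forall>c'. subcpath c' c --> im c' \<subseteq> square x h --> meet_sum Q (rosc f) (im c') < \<infinity>"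
  using h(1) fin by (intro exI[of _ "h/2"]) simp
 ultimately show ?thesis unfolding approach_def using facts is_cpath_sub[OF p0(1) sub] by blast
qed

text \<open>All accessing paths share one limit, so the definite description in the access value
  denotes it.\<close>

lemma access_value_limit:
 assumes r: "represents g f" and p0: "p0 \<in> good_paths_hat \<Omega> Q g" and acc: "accesses \<Omega> Q p0 p x" and x: "x \<in> S"
 shows "\<exists>L. access_value \<Omega> Q g x = ereal L \<and> (upper f \<longlongrightarrow> L) (disks_to Q (im p) x) \<and> disks_to Q (im p) x \<noteq> bot"
proof -
 note cp = crosscut_point_access[OF x]
 have fr: "disk_bounded f" "real_gradient (rosc f) f" "locally_square_summable f x" and M: "Msup Q g = (\<lambda>i. ereal (upper f i))"
  using r x carpet_subset by (auto simp: represents_def fun_eq_iff)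
 obtain L where L: "\<And>p'. approach f x (access_domain x) p' ==> (upper f \<longlongrightarrow> L) (disks_to Q (im p') x)"
  using approach_limit[OF cp fr accessing_path_approach[OF r p0 acc x]] by blast
 have lim: "(upper f \<longlongrightarrow> L) (disks_to Q (im p') x)" "disks_to Q (im p') x \<noteq> bot"
  if "p1 \<in> good_paths_hat \<Omega> Q g" "accesses \<Omega> Q p1 p' x" for p1 p'
  using L[OF accessing_path_approach[OF r that x]] approach_nontrivial[OF cp accessing_path_approach[OF r that x]] by blast+
 have val: "Liminf (disks_to Q (im p') x) (Msup Q g) = ereal L"
  if "p1 \<in> good_paths_hat \<Omega> Q g" "accesses \<Omega> Q p1 p' x" for p1 p' unfolding M using lim[OF that] by (intro lim_imp_Liminf) auto
 have "access_value \<Omega> Q g x = ereal L" unfolding access_value_def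
 proof (rule the_equality)
  show "\<exists>p0\<in>good_paths_hat \<Omega> Q g. \<exists>p. accesses \<Omega> Q p0 p x \<and> ereal L = Liminf (disks_to Q (im p) x) (Msup Q g)"
   using p0 acc val[OF p0 acc] by (intro bexI[of _ p0] exI[of _ p]) simp_all
  show "l = ereal L" if "\<exists>p0\<in>good_paths_hat \<Omega> Q g. \<exists>p. accesses \<Omega> Q p0 p x \<and> l = Liminf (disks_to Q (im p) x) (Msup Q g)" for l
   using that val by auto
 qed
 then show ?thesis using lim[OF p0 acc] by blast
qed

lemma meet_sum_compact_finite:
 assumes "\<forall>x\<in>\<Omega>. locally_square_summable f x" "compact K" "K \<subseteq> \<Omega>"
 shows "meet_sum Q (\<lambda>i. (rosc f i)^2) K < \<infinity>"
proof -
 have "\<exists>h. h > 0 \<and> meet_sum Q (\<lambda>i. (rosc f i)^2) (square x h) < \<infinity>" if "x \<in> K" for x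
  using assms(1,3) that unfolding locally_square_summable_def by blast
 then obtain h where h: "\<And>x. x \<in> K ==> h x > 0" "\<And>x. x \<in> K ==> meet_sum Q (\<lambda>i. (rosc f i)^2) (square x (h x)) < \<infinity>"
  by metis
 have "K \<subseteq> (\<Union>x\<in>K. square x (h x))" using centre_in_square[OF h(1)] by blast
 then obtain D where D: "D \<subseteq> K" "finite D" "K \<subseteq> (\<Union>x\<in>D. square x (h x))"
  using compactE_image[OF assms(2), of K "\<lambda>x. square x (h x)"] by auto
 have "meet_sum Q (\<lambda>i. (rosc f i)^2) (\<Union>x\<in>D. square x (h x)) < \<infinity>" using D(1,2) h(2) by (intro meet_sum_finite_UN) auto
 then show ?thesis using meet_sum_mono_set[OF D(3)] order_le_less_trans by blast
qed

text \<open>The energy is finite only on compact sets. The weights are cut down to the disks meeting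
  a compact set, for countably many compact sets that absorb every segment in the domain.\<close>

lemma AE_locally_finite_line:
 assumes f: "\<forall>x\<in>\<Omega>. locally_square_summable f x"
 shows "AE X in lborel. \<forall>s t. line b X ` {s..t} \<subseteq> \<Omega> --> s \<le> t --> meet_sum Q (rosc f) (line b X ` {s..t}) < \<infinity>"
proof -
 obtain C :: "nat => complex set" where C: "\<And>n. compact (C n)" "\<And>n. C n \<subseteq> \<Omega>" "\<And>K. compact K ==> K \<subseteq> \<Omega> ==> \<exists>n. K \<subseteq> C n"
  using open_Union_compact_subsets[OF open_domain] by (metis order_refl)
 define \<rho> where "\<rho> n i = (if Q i \<inter> C n \<noteq> {} then rosc f i else 0)" for n i
 have "(\<Sum>i. (\<rho> n i)^2) < \<infinity>" for n
 proof -
  have "(\<Sum>i. (\<rho> n i)^2) = meet_sum Q (\<lambda>i. (rosc f i)^2) (C n)"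
   unfolding meet_sum_def \<rho>_def by (intro arg_cong[of _ _ suminf] ext) simp
  then show ?thesis using meet_sum_compact_finite[OF f C(1,2)] by simp
 qed
 then have "AE X in lborel. \<forall>n. \<forall>s t. line b X ` {s..t} \<subseteq> \<Omega> --> s \<le> t --> meet_sum Q (\<rho> n) (line b X ` {s..t}) < \<infinity>"
  unfolding AE_all_countable by (intro allI AE_finite_line)
 then show ?thesis
 proof eventually_elim
  case (elim X)
  show ?case
  proof (intro allI impI)
   fix s t assume st: "line b X ` {s..t} \<subseteq> \<Omega>" "s \<le> t"
   have "compact (line b X ` {s..t})" by (intro compact_continuous_image continuous_on_line) simp
   then obtain n where n: "line b X ` {s..t} \<subseteq> C n" using C(3) st(1) by blast
   have "meet_sum Q (rosc f) (line b X ` {s..t}) = meet_sum Q (\<rho> n) (line b X ` {s..t})"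
    unfolding meet_sum_def \<rho>_def using n by (intro arg_cong[of _ _ suminf] ext) auto
   then show "meet_sum Q (rosc f) (line b X ` {s..t}) < \<infinity>" using elim st by simp
  qed
 qed
qed

text \<open>Those of the first \<open>n\<close> disks that are met have closures away from the
  initial point, and a short initial piece avoids them.\<close>

lemma short_segment_small:
 assumes fin: "meet_sum Q \<rho> (line b X ` {s..t}) < \<infinity>" and st: "s < t" and e: "0 < (e::real)"
  and cl: "\<And>k. Q k \<inter> line b X ` {s..t} \<noteq> {} ==> line b X s \<notin> closure (Q k)"
 shows "\<exists>r>s. r \<le> t \<and> meet_sum Q \<rho> (line b X ` {s..r}) < ennreal e"
proof -
 obtain n where n: "meet_sum Q (\<lambda>i. if i < n then 0 else \<rho> i) (line b X ` {s..t}) < ennreal e" using meet_sum_tail[OF fin e] by blast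
 define F where "F = {k. k < n \<and> Q k \<inter> line b X ` {s..t} \<noteq> {}}"
 have "open (- (\<Union>k\<in>F. closure (Q k)))" by (intro open_Compl closed_UN) (auto simp: F_def)
 moreover have "line b X s \<in> - (\<Union>k\<in>F. closure (Q k))" using cl by (auto simp: F_def)
 ultimately obtain h where h: "h > 0" "ball (line b X s) h \<subseteq> - (\<Union>k\<in>F. closure (Q k))" by (meson open_contains_ball)
 define r where "r = min t (s + h / 2)"
 have r: "s < r" "r \<le> t" using st h(1) by (auto simp: r_def)
 have "line b X ` {s..r} \<subseteq> ball (line b X s) h" using h(1) by (auto simp: dist_line r_def)
 then have av: "line b X ` {s..r} \<inter> Q k = {}" if "k \<in> F" for k using h(2) that closure_subset[of "Q k"] by blast
 have sub: "line b X ` {s..r} \<subseteq> line b X ` {s..t}" using r by (intro image_mono) auto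
 have "meet_sum Q \<rho> (line b X ` {s..r}) \<le> meet_sum Q (\<lambda>i. if i < n then 0 else \<rho> i) (line b X ` {s..r})" unfolding meet_sum_def
 proof (intro suminf_le summableI)
  fix i
  show "(if Q i \<inter> line b X ` {s..r} \<noteq> {} then \<rho> i else 0) \<le> (if Q i \<inter> line b X ` {s..r} \<noteq> {} then if i < n then 0 else \<rho> i else 0)"
  proof (cases "i < n \<and> Q i \<inter> line b X ` {s..r} \<noteq> {}")
   case True
   then have "i \<in> F" using sub unfolding F_def by blast
   then show ?thesis using av True by blast
  qed auto
 qed
 also have "\<dots> \<le> meet_sum Q (\<lambda>i. if i < n then 0 else \<rho> i) (line b X ` {s..t})" by (rule meet_sum_mono_set[OF sub])
 finally show ?thesis using n r by (intro exI[of _ r]) auto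
qed

text \<open>On a generic vertical line the last exit from \<open>Q i\<close> is accessible along the
  segment beyond it. Sums over short initial pieces are small, so the disk values there tend to
  \<open>f x\<close> itself. One such point on each circle ties the disk values of a function to
  those of its normalized version.\<close>

lemma accessible_frontier_point:
 assumes r: "represents g f"
 shows "\<exists>x\<in>frontier (Q i). x \<in> accessible_points \<Omega> Q (good_paths_hat \<Omega> Q g) \<and> access_value \<Omega> Q g x = ereal (f x)"
proof -
 have fr: "disk_bounded f" "real_gradient (rosc f) f" "\<forall>x\<in>\<Omega>. locally_square_summable f x" and M: "\<And>i. Msup Q g i = ereal (upper f i)" and o: "osc Q g = rosc f"
  using r by (auto simp: represents_def)
 obtain z where z: "z \<in> Q i" using disk_nonempty[of i] by blast
 obtain \<delta> where \<delta>: "\<delta> > 0" "square z \<delta> \<subseteq> Q i" using open_contains_square[OF open_disk z] by blast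
 have ae: "AE X in lborel. good_line f True X \<and> hausdorff1 (range (line True X) \<inter> S) = 0 \<and>
   (\<forall>s t. line True X ` {s..t} \<subseteq> \<Omega> --> s \<le> t --> meet_sum Q (rosc f) (line True X ` {s..t}) < \<infinity>)"
  using AE_good_line[OF fr(2), of True] AE_line_carpet_null[of True] AE_locally_finite_line[OF fr(3), of True] by eventually_elim simp
 have lt: "Re z - \<delta> < Re z + \<delta>" using \<delta>(1) by simp
 obtain X where X: "Re z - \<delta> < X" "X < Re z + \<delta>" "good_line f True X" "hausdorff1 (range (line True X) \<inter> S) = 0"
   and Xfin: "\<forall>s t. line True X ` {s..t} \<subseteq> \<Omega> --> s \<le> t --> meet_sum Q (rosc f) (line True X ` {s..t}) < \<infinity>"
  by (rule AE_real_obtain[OF ae lt]) (elim conjE, rule that)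
 let ?l = "line True X"
 define y0 where "y0 = Im z"
 have "Complex X y0 \<in> square z \<delta>" using X(1,2) \<delta>(1) by (simp add: square_def sup_norm_def abs_less_iff y0_def)
 then have z0: "?l y0 \<in> Q i" using \<delta>(2) by (auto simp: line_def)
 then obtain y1 where y1: "y1 > y0" "?l ` {y0..<y1} \<subseteq> \<Omega>" "?l y1 \<in> frontier \<Omega>" using vertical_exit[of X y0] disk_subset[of i] by (auto simp: line_def)
 have "?l y1 \<in> - closure (Q i)" using frontier_not_in_domain[OF y1(3)] closure_disk_subset by blast
 then obtain d where d: "d > 0" "ball (?l y1) d \<subseteq> - closure (Q i)" by (meson closed_closure open_Compl open_contains_ball)
 define b where "b = max y0 (y1 - d / 2)"
 have b: "y0 \<le> b" "b < y1" using y1 d by (auto simp: b_def)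
 have "dist (?l y1) (?l b) < d" using d(1) y1(1) by (auto simp: dist_line b_def)
 then have bi: "?l b \<notin> closure (Q i)" using d(2) by auto
 have "?l y0 \<in> closure (Q i)" using z0 closure_subset by blast
 \<comment> \<open>The last exit, so that the segment beyond it avoids \<open>Q i\<close>, as access
   requires.\<close>
 then obtain s where s: "s \<in> {y0..b}" "?l s \<in> frontier (Q i)" "\<And>r. r \<in> {s..b} ==> ?l r \<notin> Q i"
  using last_exit[OF continuous_on_line b(1) _ bi open_disk] by blast
 have sb: "s < b" using s bi by (cases "s = b") (auto simp: frontier_def)
 define x where "x = ?l s"
 have xS: "x \<in> S" using s(2) frontier_disk_subset by (auto simp: x_def)
 have "{s..b} \<subseteq> {y0..<y1}" using s(1) b by auto
 then have seg: "?l ` {s..b} \<subseteq> \<Omega>" using image_mono[of "{s..b}" "{y0..<y1}" ?l] y1(2) by blast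
 have clx: "x \<notin> closure (Q k)" if k: "Q k \<inter> ?l ` {s..b} \<noteq> {}" for k
 proof
  assume "x \<in> closure (Q k)"
  then have "k = i" using s(2) closure_disk_unique[of x k i] by (auto simp: x_def frontier_def)
  then show False using k s(3) by blast
 qed
 have fin: "meet_sum Q (rosc f) (?l ` {s..b}) < \<infinity>" using Xfin seg sb by simp
 \<comment> \<open>The closed segment is the good path, its interior the accessing open
   subpath.\<close>
 define c0 where "c0 = ({s..b}, ?l)"
 define c where "c = ({s<..<b}, ?l)"
 have nc: "c0 \<in> nonconst_paths_in \<Omega>" unfolding c0_def by (rule line_path[OF sb seg])
 have hat: "c0 \<in> good_paths_hat \<Omega> Q g"
 proof -
  have h0: "hausdorff1 (im c0 \<inter> S) = 0" by (rule hausdorff1_null_mono[OF X(4)]) (auto simp: c0_def im_def)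
  have fin0: "meet_sum Q (rosc f) (im c0) < \<infinity>" using fin by (simp add: c0_def im_def)
  have "tame_path \<Omega> Q g c0" unfolding tame_path_def o using nc h0 fin0 order_le_less_trans[OF meet_sum_mono_set[OF im_sub]] by blast
  moreover have "disk_controlled f c0"
  proof (rule disk_controlled_of_subpaths[OF fr(1)])
   show "is_cpath c0" "im c0 \<subseteq> \<Omega>" using nc by (auto simp: nonconst_paths_in_def paths_in_def)
   fix s' t' assume h: "s' \<le> t'" "{s'..t'} \<subseteq> fst c0" "snd c0 s' \<in> S" "snd c0 t' \<in> S"
   have "?l ` {s'..t'} \<subseteq> \<Omega>" using h(2) seg by (auto simp: c0_def)
   then show "ennreal \<bar>f (snd c0 s') - f (snd c0 t')\<bar> \<le> meet_sum Q (rosc f) (snd c0 ` {s'..t'})"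
    using X(3) h(1,3,4) unfolding good_line_def c0_def by auto
  qed
  ultimately show ?thesis unfolding good_paths_hat_def disk_controlled_def o M abs_ereal_diff_le_iff by blast
 qed
 have sp: "subcpath c c0" using sb by (auto simp: c_def c0_def subcpath_def is_interval_oo)
 have xim: "x \<notin> im c"
 proof
  assume "x \<in> im c"
  then obtain t where "s < t" "?l s = ?l t" by (auto simp: c_def im_def x_def)
  then show False by (simp add: line_def)
 qed
 have xcl: "x \<in> closure (im c)"
 proof -
  have "s \<in> closure {s<..<b}" using sb by simp
  then have "?l s \<in> ?l ` closure {s<..<b}" by blast
  also have "\<dots> \<subseteq> closure (?l ` {s<..<b})" by (intro image_closure_subset continuous_on_line closure_subset) auto
  finally show ?thesis by (simp add: c_def im_def x_def)
 qed
 have "x \<notin> carpet_interior \<Omega> Q" using s(2) by (auto simp: carpet_interior_def x_def)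
 moreover have "im c \<inter> Q k = {}" if "x \<in> frontier (Q k)" for k
 proof -
  have "im c \<subseteq> ?l ` {s..b}" by (auto simp: c_def im_def)
  moreover have "x \<in> closure (Q k)" using that by (simp add: frontier_def)
  ultimately show ?thesis using clx[of k] by blast
 qed
 ultimately have acc: "accesses \<Omega> Q c0 c x" unfolding accesses_def using sp xim xcl by (auto simp: open_cpath_def c_def)
 obtain L where L: "access_value \<Omega> Q g x = ereal L" "(upper f \<longlongrightarrow> L) (disks_to Q (im c) x)" "disks_to Q (im c) x \<noteq> bot"
  using access_value_limit[OF r hat acc xS] by blast
 have "\<bar>L - f x\<bar> \<le> 2 * e" if e: "e > 0" for e
 proof -
  obtain t where t: "t > s" "t \<le> b" "meet_sum Q (rosc f) (?l ` {s..t}) < ennreal e"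
   using short_segment_small[OF fin sb e] clx unfolding x_def by blast
  \<comment> \<open>One term for passing from the supremum on \<open>Q k\<close> to a point of its
    circle on the segment, one for passing from there to \<open>x\<close>.\<close>
  have "eventually (\<lambda>k. \<bar>upper f k - f x\<bar> \<le> 2 * e) (disks_to Q (im c) x)" unfolding eventually_disks_to
  proof (intro exI[of _ "t - s"] conjI allI impI)
   show "0 < t - s" using t by simp
   fix k assume k: "Q k \<inter> im c \<noteq> {} \<and> Q k \<subseteq> ball x (t - s)"
   then obtain q where q: "s < q" "q < b" "?l q \<in> Q k" by (auto simp: c_def im_def)
   have "?l q \<in> ball x (t - s)" using k q(3) by blast
   then have "q < t" using q(1) by (simp add: x_def dist_line)
   then have sub: "?l ` {s..q} \<subseteq> ?l ` {s..t}" by (intro image_mono) auto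
   have con: "connected (?l ` {s..q})" by (intro connected_continuous_image continuous_on_line) simp
   have qi: "?l q \<in> ?l ` {s..q}" "?l s \<in> ?l ` {s..q}" using q(1) by auto
   have me: "?l ` {s..q} \<inter> Q k \<noteq> {}" using qi(1) q(3) by blast
   have "\<not> ?l ` {s..q} \<subseteq> Q k" using qi(2) xS disk_not_carpet unfolding x_def by blast
   then obtain p where p: "p \<in> ?l ` {s..q}" "p \<in> frontier (Q k)" using connected_meets_frontier[OF con me] by blast
   have pS: "p \<in> ?l ` {s..t} \<inter> S" "x \<in> ?l ` {s..t} \<inter> S" using p sub qi(2) xS frontier_disk_subset unfolding x_def by blast+
   have st\<Omega>: "?l ` {s..t} \<subseteq> \<Omega>" using seg t by (auto simp: image_subset_iff)
   have a1: "ennreal \<bar>upper f k - f p\<bar> \<le> meet_sum Q (rosc f) (?l ` {s..t})"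
   proof -
    have "Q k \<inter> ?l ` {s..t} \<noteq> {}" using me sub by blast
    then show ?thesis using rosc_bound[OF fr(1) p(2)] meet_sum_ge_term[where \<rho> = "rosc f" and Q = Q] order_trans by blast
   qed
   have a2: "ennreal \<bar>f p - f x\<bar> \<le> meet_sum Q (rosc f) (?l ` {s..t})"
    using X(3) t(1) st\<Omega> pS unfolding good_line_def by (meson less_imp_le)
   have "\<bar>upper f k - f p\<bar> < e" "\<bar>f p - f x\<bar> < e"
    using order_le_less_trans[OF a1 t(3)] order_le_less_trans[OF a2 t(3)] by (simp_all add: ennreal_less_iff)
   then show "\<bar>upper f k - f x\<bar> \<le> 2 * e" by linarith
  qed
  moreover have "((\<lambda>k. \<bar>upper f k - f x\<bar>) \<longlongrightarrow> \<bar>L - f x\<bar>) (disks_to Q (im c) x)" by (intro tendsto_intros L(2))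
  ultimately show ?thesis using tendsto_upperbound L(3) by blast
 qed
 have "\<bar>L - f x\<bar> \<le> 0 + e" if "e > 0" for e
 proof -
  have "\<bar>L - f x\<bar> \<le> 2 * (e / 2)" using that by (intro \<open>\<And>e. e > 0 ==> \<bar>L - f x\<bar> \<le> 2 * e\<close>) simp
  then show ?thesis by simp
 qed
 then have "\<bar>L - f x\<bar> \<le> 0" by (rule field_le_epsilon)
 then have "L = f x" by simp
 then show ?thesis using L(1) s(2) xS hat acc unfolding accessible_points_def x_def by blast
qed

text \<open>On each circle \<open>u\<close> agrees at some point with a function \<open>f\<close>
  representing the one it normalizes, so the suprema of both on a disk differ by at most the two
  oscillations, which vanish near every carpet point. Access values of \<open>f\<close> are
  therefore the limits \<open>L\<close> of the disk values of \<open>u\<close>. As \<open>L\<close>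
  is continuous on the carpet, the lower limits in the normalized version return \<open>L\<close>
  again.\<close>

lemma normalized_values:
 assumes u: "minimizer u \<alpha>" and norm: "normalized ver \<Omega> Q (\<lambda>x. ereal (u x))" and x: "x \<in> S"
 shows "(upper u \<longlongrightarrow> u x) (disks_to Q UNIV x)"
proof -
 have su: "sob u" using u by (simp add: minimizer_def)
 note du = sobD(1)[OF su]
 obtain g where g: "sobolev_loc ver \<Omega> Q g" "\<And>x. x \<in> S ==> ereal (u x) = normalized_version \<Omega> Q g x"
  using norm unfolding normalized_def by blast
 obtain f where r: "represents g f" using sobolev_loc_represented[OF g(1)] by blast
 have df: "disk_bounded f" and lf: "\<And>x. x \<in> \<Omega> ==> locally_square_summable f x" using r by (auto simp: represents_def)
 define A where "A = accessible_points \<Omega> Q (good_paths_hat \<Omega> Q g)"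
 have AS: "A \<subseteq> S" by (auto simp: A_def accessible_points_def)
 have uA: "ereal (u y) = access_value \<Omega> Q g y" if "y \<in> A" for y
  using g(2)[of y] AS that unfolding normalized_version_def Let_def A_def by auto
 have close: "\<bar>upper f i - upper u i\<bar> \<le> gap f i + gap u i" for i
 proof -
  obtain p where p: "p \<in> frontier (Q i)" "p \<in> A" "access_value \<Omega> Q g p = ereal (f p)"
   using accessible_frontier_point[OF r, of i] unfolding A_def by blast
  have "u p = f p" using uA[OF p(2)] p(3) by simp
  then show ?thesis using disk_boundedD(3,4)[OF du p(1)] disk_boundedD(3,4)[OF df p(1)] by (simp add: gap_def)
 qed
 have "\<exists>L. \<forall>y\<in>S. (upper u \<longlongrightarrow> L y) (disks_to Q UNIV y)" using minimizer_limit[OF u] by metis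
 then obtain L where L: "\<And>y. y \<in> S ==> (upper u \<longlongrightarrow> L y) (disks_to Q UNIV y)" by blast
 have acc: "access_value \<Omega> Q g y = ereal (L y)" if y: "y \<in> A" for y
 proof -
  have yS: "y \<in> S" "y \<in> \<Omega>" using y AS carpet_subset by auto
  obtain c0 c where c: "c0 \<in> good_paths_hat \<Omega> Q g" "accesses \<Omega> Q c0 c y" using y by (auto simp: A_def accessible_points_def)
  obtain l where l: "access_value \<Omega> Q g y = ereal l" "(upper f \<longlongrightarrow> l) (disks_to Q (im c) y)" "disks_to Q (im c) y \<noteq> bot"
   using access_value_limit[OF r c yS(1)] by blast
  let ?F = "disks_to Q (im c) y"
  have g0: "((\<lambda>i. gap f i + gap u i) \<longlongrightarrow> 0) ?F"
   using tendsto_add[OF tendsto_mono[OF disks_to_mono gap_tendsto_0_near[OF lf[OF yS(2)] df]]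
     tendsto_mono[OF disks_to_mono gap_tendsto_0_near[OF summable_near[OF su] du]]] by simp
  have "((\<lambda>i. upper f i - upper u i) \<longlongrightarrow> 0) ?F" by (rule Lim_null_comparison[OF always_eventually g0]) (use close in simp)
  from tendsto_diff[OF l(2) this] have "(upper u \<longlongrightarrow> l) ?F" by simp
  moreover have "(upper u \<longlongrightarrow> L y) ?F" by (rule tendsto_mono[OF disks_to_mono L[OF yS(1)]])
  ultimately have "l = L y" using tendsto_unique[OF l(3)] by blast
  then show ?thesis using l(1) by simp
 qed
 \<comment> \<open>A value \<open>L y\<close> with \<open>y\<close> near \<open>x\<close> is a limit
   over disks that finally lie in a fixed ball around \<open>x\<close>, where the disk values are
   close to \<open>L x\<close>.\<close>
 have cont: "((\<lambda>y. ereal (L y)) \<longlongrightarrow> ereal (L x)) (at x within B)" if B: "B \<subseteq> S" for B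
 proof -
  have "(L \<longlongrightarrow> L x) (at x within B)" unfolding tendsto_iff
  proof (intro allI impI)
   fix e :: real assume e: "e > 0"
   have "eventually (\<lambda>i. dist (upper u i) (L x) < e/2) (disks_to Q UNIV x)" using L[OF x] e by (intro tendstoD) auto
   then obtain d where d: "d > 0" "\<And>i. Q i \<subseteq> ball x d ==> dist (upper u i) (L x) < e/2" unfolding eventually_disks_to using disk_nonempty by auto
   have "dist (L y) (L x) < e" if y: "y \<in> B" "dist y x < d" for y
   proof -
    have yS: "y \<in> S" using y B by blast
    have "eventually (\<lambda>i. Q i \<subseteq> ball x d) (disks_to Q UNIV y)" unfolding eventually_disks_to
    proof (intro exI[of _ "d - dist y x"] conjI allI impI)
     show "0 < d - dist y x" using y by simp
     fix i assume i: "Q i \<inter> UNIV \<noteq> {} \<and> Q i \<subseteq> ball y (d - dist y x)"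
     have "ball y (d - dist y x) \<subseteq> ball x d"
     proof
      fix p assume "p \<in> ball y (d - dist y x)"
      then show "p \<in> ball x d" using dist_triangle[of x p y] by (simp add: dist_commute)
     qed
     then show "Q i \<subseteq> ball x d" using i by blast
    qed
    then have "eventually (\<lambda>i. dist (upper u i) (L x) \<le> e/2) (disks_to Q UNIV y)"
     by (rule eventually_mono) (use d(2) in \<open>simp add: less_imp_le\<close>)
    moreover have "((\<lambda>i. dist (upper u i) (L x)) \<longlongrightarrow> dist (L y) (L x)) (disks_to Q UNIV y)" by (intro tendsto_intros L yS)
    ultimately have "dist (L y) (L x) \<le> e/2" using tendsto_upperbound disks_near_nontrivial[OF yS] by blast
    then show ?thesis using e by linarith
   qed
   then show "eventually (\<lambda>y. dist (L y) (L x) < e) (at x within B)" unfolding eventually_at using d(1) by blast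
  qed
  then show ?thesis by simp
 qed
 have lim: "Liminf (at x within B) (access_value \<Omega> Q g) = ereal (L x)"
  if B: "B \<subseteq> A" and eq: "ereal (u x) = Liminf (at x within B) (access_value \<Omega> Q g)" for B
 proof -
  \<comment> \<open>The lower limit along the trivial filter is infinite, whereas \<open>u x\<close>
    is real.\<close>
  have nb: "at x within B \<noteq> bot"
  proof
   assume "at x within B = bot"
   then have "Liminf (at x within B) (access_value \<Omega> Q g) = \<infinity>" by (simp add: top_ereal_def)
   then show False using eq by simp
  qed
  have BS: "B \<subseteq> S" using B AS by blast
  have "eventually (\<lambda>y. ereal (L y) = access_value \<Omega> Q g y) (at x within B)"
   unfolding eventually_at using acc B by (intro exI[of _ 1]) auto
  from Lim_transform_eventually[OF cont[OF BS] this] have "(access_value \<Omega> Q g \<longlongrightarrow> ereal (L x)) (at x within B)" .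
  then show ?thesis using nb by (intro lim_imp_Liminf)
 qed
 have "u x = L x"
 proof (cases "x \<in> A")
  case True
  then show ?thesis using uA[OF True] acc[OF True] by simp
 next
  case False
  have n: "ereal (u x) = normalized_version \<Omega> Q g x" by (rule g(2)[OF x])
  show ?thesis
  proof (cases "\<exists>i. x \<in> frontier (Q i)")
   case True
   let ?B = "A \<inter> frontier (Q (THE i. x \<in> frontier (Q i)))"
   have e: "ereal (u x) = Liminf (at x within ?B) (access_value \<Omega> Q g)"
    using n False True unfolding normalized_version_def Let_def A_def by simp
   have "ereal (u x) = ereal (L x)" using lim[OF _ e] e by simp
   then show ?thesis by simp
  next
   case no: False
   have e: "ereal (u x) = Liminf (at x within A) (access_value \<Omega> Q g)"
    using n False no unfolding normalized_version_def Let_def A_def by simp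
   have "ereal (u x) = ereal (L x)" using lim[OF _ e] e by simp
   then show ?thesis by simp
  qed
 qed
 then show ?thesis using L[OF x] by simp
qed

text \<open>The boundary values of \<open>f\<close> are given by \<alpha> at every boundary point,
  so having the boundary values of \<open>f\<close> is the same as \<open>bval\<close> with
  \<alpha>.\<close>

lemma solution_minimizer:
 assumes sol: "dirichlet_solution ver \<Omega> Q \<alpha> (\<lambda>x. ereal (u x))"
 shows "minimizer u \<alpha>" "normalized ver \<Omega> Q (\<lambda>x. ereal (u x))"
proof -
 obtain f where f: "boundary_data_of ver \<Omega> Q f \<alpha>" "normalized ver \<Omega> Q (\<lambda>x. ereal (u x))" "sobolev ver \<Omega> Q (\<lambda>x. ereal (u x))"
  "has_boundary_values_of ver \<Omega> Q (\<lambda>x. ereal (u x)) f"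
  "\<And>g. sobolev ver \<Omega> Q g ==> has_boundary_values_of ver \<Omega> Q g f ==>
      dirichlet_energy Q \<Omega> (\<lambda>x. ereal (u x)) \<le> dirichlet_energy Q \<Omega> g"
  using sol unfolding dirichlet_solution_def by blast
 show "normalized ver \<Omega> Q (\<lambda>x. ereal (u x))" by (rule f(2))
 have su: "sob u" using f(3) by (simp add: sobolev_real)
 have fb: "boundary_value \<Omega> Q f x = ereal (\<alpha> x)" if "x \<in> boundary_accessible \<Omega> G" for x G
  using f(1) that by (auto simp: boundary_data_of_def boundary_accessible_def)
 have iff: "has_boundary_values_of ver \<Omega> Q (\<lambda>x. ereal (z x)) f \<longleftrightarrow> bval z \<alpha>" if "sob z" for z
  unfolding bval_iff[OF that] has_boundary_values_of_def using fb by auto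
 have "energy u \<le> energy z" if z: "sob z" "bval z \<alpha>" for z
 proof -
  have "dirichlet_energy Q \<Omega> (\<lambda>x. ereal (u x)) \<le> dirichlet_energy Q \<Omega> (\<lambda>x. ereal (z x))"
   using z iff[OF z(1)] by (intro f(5)) (simp_all add: sobolev_real)
  moreover have "0 \<le> energy z" unfolding energy_def using sobD(4)[OF z(1)] by (intro suminf_nonneg) auto
  ultimately show ?thesis unfolding energy_real[OF su] energy_real[OF z(1)] by (simp add: ennreal_le_iff)
 qed
 then show "minimizer u \<alpha>" using su f(4) iff[OF su] by (simp add: minimizer_def)
qed

text \<open>At each carpet point both solutions are limits of their suprema over the same shrinking
  disks, so the comparison on disks passes to the limit.\<close>

lemma solution_comparison:
 assumes u: "dirichlet_solution ver \<Omega> Q \<alpha> (\<lambda>x. ereal (u x))" and v: "dirichlet_solution ver \<Omega> Q \<beta> (\<lambda>x. ereal (v x))"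
  and G: "almost_every_path ver \<Omega> Q G" and le: "\<And>x. x \<in> boundary_accessible \<Omega> G ==> \<beta> x \<le> \<alpha> x" and x: "x \<in> S"
 shows "v x \<le> u x"
proof (rule tendsto_le[OF disks_near_nontrivial[OF x]])
 note U = solution_minimizer[OF u] and V = solution_minimizer[OF v]
 show "(upper u \<longlongrightarrow> u x) (disks_to Q UNIV x)" by (rule normalized_values[OF U x])
 show "(upper v \<longlongrightarrow> v x) (disks_to Q UNIV x)" by (rule normalized_values[OF V x])
 show "eventually (\<lambda>i. upper v i \<le> upper u i) (disks_to Q UNIV x)"
  using disk_comparison[OF U(1) V(1) G le] by (intro always_eventually) blast
qed

end

theorem theorem2p66:
  fixes \<Omega> :: "complex set" and Q :: "nat \<Rightarrow> complex set" and ver :: carpet_version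
    and \<C> :: "complex set set" and \<alpha> \<beta> :: "complex \<Rightarrow> real" and u v :: "complex \<Rightarrow> real"
    and G0 :: "cpath set"
  assumes carpet: "relative_carpet \<Omega> Q"
    and bdd: "bounded \<Omega>"
    and boundary: "finite \<C>" "\<And>C. C \<in> \<C> \<Longrightarrow> jordan_curve C" "pairwise disjnt \<C>"
      "frontier \<Omega> = \<Union>\<C>"
    and u: "dirichlet_solution ver \<Omega> Q \<alpha> (\<lambda>x. ereal (u x))"
    and v: "dirichlet_solution ver \<Omega> Q \<beta> (\<lambda>x. ereal (v x))"
    and G0: "G0 \<subseteq> paths_in \<Omega>" "almost_every_path ver \<Omega> Q G0"
    and le: "\<And>x. x \<in> boundary_accessible \<Omega> G0 \<Longrightarrow> \<alpha> x \<ge> \<beta> x"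
  shows "\<forall>x\<in>carpet \<Omega> Q. u x \<ge> v x"
proof -
  interpret carpet_domain \<Omega> Q ver \<C> by unfold_locales (rule carpet bdd boundary | assumption)+
  show ?thesis using solution_comparison[OF u v G0(2) le] by blast
qed

end
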